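(* Let $\gamma>0$, $a>0$, $p>4$ and assume that $0<c<c_0$. Let $$m_l=\inf_{S(c)\cap A_{k_0}}F .$$ Then any minimizing sequence for $m_l$ has, up to translations, a subsequence converging strongly in $X$ (that is, if $(u_n)\subset S(c)\cap A_{k_0}$ and $F(u_n)\to m_l$, there exist $x_n\in\mathbb{R}^2$ such that $(u_n(\cdot-x_n))$ has a subsequence converging strongly in $X$). In particular the infimum $m_l$ is achieved. Also, any minimizer of $F$ on $S(c)\cap A_{k_0}$ is a critical point of $F$ on $S(c)$.
   Context: All functions are real-valued on $\mathbb{R}^2$. $X=\{u\in H^1(\mathbb{R}^2): \int_{\mathbb{R}^2}\log(1+|x|)u^2(x)\,dx<\infty\}$ is the Hilbert space with norm $\|u\|_X^2=\int_{\mathbb{R}^2}(|\nabla u|^2+u^2)\,dx+\int_{\mathbb{R}^2}\log(1+|x|)u^2(x)\,dx$. For $c>0$, $S(c)=\{u\in X:\int_{\mathbb{R}^2}u^2\,dx=c\}$. The functional $F:X\to\mathbb{R}$ (of class $C^1$) is $$F(u)=\tfrac12A(u)+\tfrac{\gamma}{4}V(u)-\tfrac{a}{p}C(u),$$ where $A(u)=\int_{\mathbb{R}^2}|\nabla u|^2dx$, $V(u)=\iint_{\mathbb{R}^2\times\mathbb{R}^2}|u(x)|^2|u(y)|^2\log(|x-y|)\,dx\,dy$, $C(u)=\int_{\mathbb{R}^2}|u|^p\,dx$. A critical point of $F$ on $S(c)$ is $u\in S(c)$ with $dF(u)[\psi]=0$ for all $\psi\in X$ such that $\int_{\mathbb{R}^2}u\psi\,dx=0$.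 Put $$k_0=\frac{p-2}{p-4}\,\frac{\gamma c^2}{4},\qquad A_{k_0}=\{u\in X: A(u)\le k_0\}.$$ $K_{GN}$ is the best (smallest) constant in the Gagliardo–Nirenberg inequality $\|u\|_p^p\le K_{GN}\|\nabla u\|_2^{p-2}\|u\|_2^{2}$ for $u\in H^1(\mathbb{R}^2)$, and $$c_0=2\left[\frac{p(p-4)^{\frac{p-4}{2}}}{(p-2)^{\frac p2}}\,\frac{1}{a\,\gamma^{\frac{p-4}{2}}K_{GN}}\right]^{\frac1{p-3}}.$$ *)

theory Defs
  imports "HOL-Analysis.Analysis"
begin

text \<open>
  Elements of the function spaces below are represented by Borel measurable functions
  (every class modulo null sets has such a representative), so that, for instance,
  \<open>X_norm\<close> is a norm only after identifying functions that agree almost everywhere.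
\<close>

type_synonym plane = "real^2"

definition partial :: "2 \<Rightarrow> (plane \<Rightarrow> real) \<Rightarrow> plane \<Rightarrow> real" where
  "partial i f x = frechet_derivative f (at x) (axis i 1)"

primrec Ck :: "nat \<Rightarrow> (plane \<Rightarrow> real) \<Rightarrow> bool" where
  "Ck 0 f \<longleftrightarrow> continuous_on UNIV f"
| "Ck (Suc k) f \<longleftrightarrow> (\<forall>x. f differentiable at x) \<and> (\<forall>i. Ck k (partial i f))"

definition test_function :: "(plane \<Rightarrow> real) \<Rightarrow> bool" where
  "test_function \<phi> \<longleftrightarrow> (\<forall>k. Ck k \<phi>) \<and> compact (closure {x. \<phi> x \<noteq> 0})"

definition locally_integrable :: "(plane \<Rightarrow> 'b::euclidean_space) \<Rightarrow> bool" where
  "locally_integrable f \<longleftrightarrow> (\<forall>K. compact K \<longrightarrow> set_integrable lborel K f)"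

definition has_weak_gradient :: "(plane \<Rightarrow> real) \<Rightarrow> (plane \<Rightarrow> plane) \<Rightarrow> bool" where
  "has_weak_gradient u G \<longleftrightarrow>
     locally_integrable u \<and> locally_integrable G \<and>
     (\<forall>\<phi> i. test_function \<phi> \<longrightarrow>
        (LINT x|lborel. u x * partial i \<phi> x) = - (LINT x|lborel. G x $ i * \<phi> x))"

text \<open>Unique up to a null set whenever a weak gradient exists.\<close>

definition weak_gradient :: "(plane \<Rightarrow> real) \<Rightarrow> plane \<Rightarrow> plane" where
  "weak_gradient u = (SOME G. has_weak_gradient u G)"

definition H1 :: "(plane \<Rightarrow> real) set" where
  "H1 = {u. u \<in> borel_measurable borel \<and> integrable lborel (\<lambda>x. (u x)\<^sup>2) \<and>
            (\<exists>G. has_weak_gradient u G \<and> integrable lborel (\<lambda>x. (norm (G x))\<^sup>2))}"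

definition X_space :: "(plane \<Rightarrow> real) set" where
  "X_space = {u \<in> H1. integrable lborel (\<lambda>x. ln (1 + norm x) * (u x)\<^sup>2)}"

definition X_norm :: "(plane \<Rightarrow> real) \<Rightarrow> real" where
  "X_norm u = sqrt ((LINT x|lborel. (norm (weak_gradient u x))\<^sup>2 + (u x)\<^sup>2)
                    + (LINT x|lborel. ln (1 + norm x) * (u x)\<^sup>2))"

definition mass_sphere :: "real \<Rightarrow> (plane \<Rightarrow> real) set" where
  "mass_sphere c = {u \<in> X_space. (LINT x|lborel. (u x)\<^sup>2) = c}"

definition A_fun :: "(plane \<Rightarrow> real) \<Rightarrow> real" where
  "A_fun u = (LINT x|lborel. (norm (weak_gradient u x))\<^sup>2)"

definition V_fun :: "(plane \<Rightarrow> real) \<Rightarrow> real" where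
  "V_fun u = (LINT (x, y)|(lborel \<Otimes>\<^sub>M lborel). \<bar>u x\<bar>\<^sup>2 * \<bar>u y\<bar>\<^sup>2 * ln (norm (x - y)))"

definition C_fun :: "real \<Rightarrow> (plane \<Rightarrow> real) \<Rightarrow> real" where
  "C_fun p u = (LINT x|lborel. \<bar>u x\<bar> powr p)"

definition F_fun :: "real \<Rightarrow> real \<Rightarrow> real \<Rightarrow> (plane \<Rightarrow> real) \<Rightarrow> real" where
  "F_fun \<gamma> a p u = 1/2 * A_fun u + \<gamma>/4 * V_fun u - a/p * C_fun p u"

text \<open>Frechet differentiability, at \<open>u\<close>, of a functional on the normed space \<open>X_space\<close>.\<close>

definition has_X_derivative ::
    "((plane \<Rightarrow> real) \<Rightarrow> real) \<Rightarrow> ((plane \<Rightarrow> real) \<Rightarrow> real) \<Rightarrow> (plane \<Rightarrow> real) \<Rightarrow> bool" where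
  "has_X_derivative \<Phi> L u \<longleftrightarrow>
     (\<forall>f\<in>X_space. \<forall>g\<in>X_space. L (\<lambda>x. f x + g x) = L f + L g) \<and>
     (\<forall>r. \<forall>f\<in>X_space. L (\<lambda>x. r * f x) = r * L f) \<and>
     (\<exists>B. \<forall>f\<in>X_space. \<bar>L f\<bar> \<le> B * X_norm f) \<and>
     (\<forall>\<epsilon>>0. \<exists>\<delta>>0. \<forall>h\<in>X_space. X_norm h < \<delta> \<longrightarrow>
        \<bar>\<Phi> (\<lambda>x. u x + h x) - \<Phi> u - L h\<bar> \<le> \<epsilon> * X_norm h)"

definition critical_point_on_sphere ::
    "((plane \<Rightarrow> real) \<Rightarrow> real) \<Rightarrow> real \<Rightarrow> (plane \<Rightarrow> real) \<Rightarrow> bool" where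
  "critical_point_on_sphere \<Phi> c u \<longleftrightarrow> u \<in> mass_sphere c \<and>
     (\<exists>L. has_X_derivative \<Phi> L u \<and>
        (\<forall>\<psi>\<in>X_space. (LINT x|lborel. u x * \<psi> x) = 0 \<longrightarrow> L \<psi> = 0))"

definition k0 :: "real \<Rightarrow> real \<Rightarrow> real \<Rightarrow> real" where
  "k0 \<gamma> p c = (p - 2) / (p - 4) * (\<gamma> * c\<^sup>2 / 4)"

definition A_sublevel :: "real \<Rightarrow> (plane \<Rightarrow> real) set" where
  "A_sublevel k = {u \<in> X_space. A_fun u \<le> k}"

text \<open>The set of admissible constants is closed, so its infimum is the smallest one.\<close>

definition K_GN :: "real \<Rightarrow> real" where
  "K_GN p = Inf {K. \<forall>u\<in>H1. (LINT x|lborel. \<bar>u x\<bar> powr p)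
      \<le> K * sqrt (LINT x|lborel. (norm (weak_gradient u x))\<^sup>2) powr (p - 2)
          * (sqrt (LINT x|lborel. (u x)\<^sup>2))\<^sup>2}"

definition c0 :: "real \<Rightarrow> real \<Rightarrow> real \<Rightarrow> real" where
  "c0 \<gamma> a p = 2 * (p * (p - 4) powr ((p - 4) / 2) / (p - 2) powr (p / 2)
                  * (1 / (a * \<gamma> powr ((p - 4) / 2) * K_GN p))) powr (1 / (p - 3))"

definition m_l :: "real \<Rightarrow> real \<Rightarrow> real \<Rightarrow> real \<Rightarrow> real" where
  "m_l \<gamma> a p c = (INF u \<in> mass_sphere c \<inter> A_sublevel (k0 \<gamma> p c). F_fun \<gamma> a p u)"

end

theory Submission
  imports Defs "HOL-Complex_Analysis.Great_Picard"
begin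

text \<open>
  Write \<open>V = V_far - V_near\<close>, where the kernels \<open>ln (1 + |x - y|)\<close> and \<open>ln (1 + 1 / |x - y|)\<close>
  replace \<open>ln |x - y|\<close>. On \<open>S(c)\<close> with \<open>A(u) \<le> k0\<close> the Gagliardo--Nirenberg inequality bounds
  \<open>V_near\<close> and the power term, so \<open>F\<close> is bounded below and a minimizing sequence has bounded
  \<open>V_far\<close>. A bound on \<open>V_far\<close> does two things. It prevents the mass from spreading: if most pairs of
  points were far apart, \<open>V_far\<close> would be large (\<open>mass_concentration\<close>), so after a translation a fixed
  ball carries a fixed part of the mass. Seen from that ball, \<open>ln (1 + |x - y|)\<close> is comparable to
  \<open>ln (1 + |x|)\<close>, so the translated sequence is bounded in \<open>X\<close> (\<open>weight_le_V_far\<close>), and bounded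
  sequences of \<open>X\<close> have subsequences that converge in \<open>L\<^sup>2\<close> (\<open>X_compact_embedding\<close>).

  Under \<open>L\<^sup>2\<close> convergence with bounded energy \<open>V_near\<close> and the power term converge
  (\<open>V_near_diff_le\<close>, \<open>C_fun_diff_le\<close>), while \<open>A\<close> and \<open>V_far\<close> are lower semicontinuous (\<open>A_fun_lsc\<close>
  and Fatou). The limit is therefore a minimizer, and no energy is lost: \<open>A\<close> and \<open>V_far\<close> converge
  along the sequence. Convergence of \<open>A\<close> improves \<open>L\<^sup>2\<close> convergence to \<open>H\<^sup>1\<close> convergence by the
  parallelogram identity, and convergence of \<open>V_far\<close> gives convergence of the logarithmic weight by
  Pratt's version of dominated convergence (\<open>weighted_convergence\<close>).

  The smallness of \<open>c\<close> enters only through the boundary \<open>A(u) = k0\<close>. For the mass preserving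
  dilations \<open>t u(t x)\<close> the derivative of \<open>F\<close> at \<open>t = 1\<close> equals
  \<open>A(u) - \<gamma> c\<^sup>2 / 4 - a (p - 2) / p C(u)\<close>, and \<open>c < c0\<close> says exactly that the Gagliardo--Nirenberg bound
  for \<open>C(u)\<close> makes this positive when \<open>A(u) = k0\<close> (\<open>K_GN_smallness\<close>). Shrinking \<open>t\<close> then lowers \<open>F\<close>
  inside the constraint set, so a minimizer has \<open>A(u) < k0\<close>. It may be varied freely on the sphere, and
  the first variation vanishes (\<open>first_variation_bound\<close>).

  The Sobolev theory is derived from the definition of the weak gradient by mollification with smooth
  bumps. Translations satisfy \<open>\<parallel>u(\<cdot> + h) - u\<parallel> \<le> (|h\<^sub>1| + |h\<^sub>2|) \<parallel>\<nabla>u\<parallel>\<close> in \<open>L\<^sup>2\<close>, which yields the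
  compactness, and Gagliardo's argument with integrals along the coordinate lines, applied to powers of a
  mollified function, yields the Gagliardo--Nirenberg inequality.
\<close>

section \<open>Square integrable functions\<close>

definition L2 :: "'a measure \<Rightarrow> ('a \<Rightarrow> real) set" where
  "L2 M = {f \<in> borel_measurable M. integrable M (\<lambda>x. (f x)\<^sup>2)}"

definition nrm2 :: "'a measure \<Rightarrow> ('a \<Rightarrow> real) \<Rightarrow> real" where
  "nrm2 M f = sqrt (LINT x|M. (f x)\<^sup>2)"

lemma L2_meas: "f \<in> L2 M \<Longrightarrow> f \<in> borel_measurable M"
  and L2_int: "f \<in> L2 M \<Longrightarrow> integrable M (\<lambda>x. (f x)\<^sup>2)"
  by (auto simp: L2_def)

lemma nrm2_nonneg[simp]: "0 \<le> nrm2 M f"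
  by (simp add: nrm2_def)

lemma nrm2_sq: "(nrm2 M f)\<^sup>2 = (LINT x|M. (f x)\<^sup>2)"
  by (simp add: nrm2_def)

lemma L2_bounded_by:
  assumes "f \<in> borel_measurable M" "integrable M g" "\<And>x. x \<in> space M \<Longrightarrow> (f x)\<^sup>2 \<le> g x"
  shows "f \<in> L2 M"
  unfolding L2_def
proof safe
  show "f \<in> borel_measurable M" by fact
  show "integrable M (\<lambda>x. (f x)\<^sup>2)"
    by (rule Bochner_Integration.integrable_bound[OF assms(2)])
       (use assms in \<open>auto intro!: AE_I2 order_trans[OF _ abs_ge_self]\<close>)
qed

lemma L2_mult_integrable:
  assumes "f \<in> L2 M" "g \<in> L2 M"
  shows "integrable M (\<lambda>x. f x * g x)"
proof (rule Bochner_Integration.integrable_bound)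
  show "integrable M (\<lambda>x. (f x)\<^sup>2 + (g x)\<^sup>2)"
    using assms by (auto simp: L2_def)
  show "(\<lambda>x. f x * g x) \<in> borel_measurable M"
    using assms by (auto simp: L2_def)
  have "\<bar>a * b\<bar> \<le> \<bar>a\<^sup>2 + b\<^sup>2\<bar>" for a b :: real
  proof -
    have "2 * (\<bar>a\<bar> * \<bar>b\<bar>) \<le> \<bar>a\<bar>\<^sup>2 + \<bar>b\<bar>\<^sup>2" using sum_squares_bound[of "\<bar>a\<bar>" "\<bar>b\<bar>"] by simp
    moreover have "0 \<le> \<bar>a\<bar> * \<bar>b\<bar>" by simp
    ultimately have "\<bar>a\<bar> * \<bar>b\<bar> \<le> \<bar>a\<bar>\<^sup>2 + \<bar>b\<bar>\<^sup>2" by linarith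
    then show ?thesis by (simp add: abs_mult)
  qed
  then show "AE x in M. norm (f x * g x) \<le> norm ((f x)\<^sup>2 + (g x)\<^sup>2)"
    by simp
qed

lemma L2_add[intro]:
  assumes "f \<in> L2 M" "g \<in> L2 M"
  shows "(\<lambda>x. f x + g x) \<in> L2 M"
proof -
  have "integrable M (\<lambda>x. (f x)\<^sup>2 + (g x)\<^sup>2 + 2 * (f x * g x))"
    using assms L2_mult_integrable[OF assms] by (auto simp: L2_def)
  then show ?thesis using assms by (auto simp: L2_def power2_sum mult.assoc)
qed

lemma L2_cmult[intro]: "f \<in> L2 M \<Longrightarrow> (\<lambda>x. r * f x) \<in> L2 M" for r :: real
  by (auto simp: L2_def power_mult_distrib)

lemma L2_minus[intro]: "f \<in> L2 M \<Longrightarrow> (\<lambda>x. - f x) \<in> L2 M"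
  by (auto simp: L2_def)

lemma L2_diff[intro]:
  assumes "f \<in> L2 M" "g \<in> L2 M"
  shows "(\<lambda>x. f x - g x) \<in> L2 M"
  using L2_add[OF assms(1) L2_minus[OF assms(2)]] by simp

lemma L2_abs[intro]: "f \<in> L2 M \<Longrightarrow> (\<lambda>x. \<bar>f x\<bar>) \<in> L2 M"
  by (auto simp: L2_def)

lemma nrm2_abs[simp]: "nrm2 M (\<lambda>x. \<bar>f x\<bar>) = nrm2 M f"
  by (simp add: nrm2_def)

lemma nrm2_cmult: "nrm2 M (\<lambda>x. r * f x) = \<bar>r\<bar> * nrm2 M f"
  by (simp add: nrm2_def power_mult_distrib real_sqrt_mult)

lemma nrm2_minus[simp]: "nrm2 M (\<lambda>x. - f x) = nrm2 M f"
  by (simp add: nrm2_def)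

lemma nrm2_minus_commute: "nrm2 M (\<lambda>x. f x - g x) = nrm2 M (\<lambda>x. g x - f x)"
  by (simp add: nrm2_def power2_commute)

lemma nrm2_cong: "(\<And>x. x \<in> space M \<Longrightarrow> f x = g x) \<Longrightarrow> nrm2 M f = nrm2 M g"
  unfolding nrm2_def by (metis (mono_tags, lifting) Bochner_Integration.integral_cong)

lemma nn_integral_L2: 
  "f \<in> L2 M \<Longrightarrow> (\<integral>\<^sup>+x. ennreal ((f x)\<^sup>2) \<partial>M) = ennreal ((nrm2 M f)\<^sup>2)"
  unfolding nrm2_sq by (subst nn_integral_eq_integral) (auto simp: L2_def)

lemma L2_nn_integralI:
  assumes "f \<in> borel_measurable M" "(\<integral>\<^sup>+x. ennreal ((f x)\<^sup>2) \<partial>M) \<le> ennreal (B\<^sup>2)" "0 \<le> B"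
  shows "f \<in> L2 M" "nrm2 M f \<le> B"
proof -
  have "integrable M (\<lambda>x. (f x)\<^sup>2)"
    by (rule integrableI_bounded) (use assms in \<open>auto intro: le_less_trans\<close>)
  then show *: "f \<in> L2 M" using assms by (auto simp: L2_def)
  have "(nrm2 M f)\<^sup>2 \<le> B\<^sup>2"
    using assms(2) unfolding nn_integral_L2[OF *] by (simp add: ennreal_le_iff)
  then show "nrm2 M f \<le> B" using assms(3) by (rule power2_le_imp_le)
qed

lemma Cauchy_Schwarz_abs:
  assumes "f \<in> L2 M" "g \<in> L2 M"
  shows "(LINT x|M. \<bar>f x\<bar> * \<bar>g x\<bar>) \<le> nrm2 M f * nrm2 M g"
proof -
  have [measurable]: "f \<in> borel_measurable M" "g \<in> borel_measurable M"
    using assms by (auto simp: L2_def)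
  have i: "integrable M (\<lambda>x. \<bar>f x\<bar> * \<bar>g x\<bar>)"
    using L2_mult_integrable[OF L2_abs L2_abs] assms by blast
  have "ennreal ((LINT x|M. \<bar>f x\<bar> * \<bar>g x\<bar>)\<^sup>2) = (\<integral>\<^sup>+x. ennreal \<bar>f x\<bar> * ennreal \<bar>g x\<bar> \<partial>M)\<^sup>2"
    using i by (simp add: nn_integral_eq_integral ennreal_power ennreal_mult[symmetric])
  also have "\<dots> \<le> (\<integral>\<^sup>+x. ennreal \<bar>f x\<bar> ^ 2 \<partial>M) * (\<integral>\<^sup>+x. ennreal \<bar>g x\<bar> ^ 2 \<partial>M)"
    by (rule Cauchy_Schwarz_nn_integral) auto
  also have "\<dots> = ennreal ((nrm2 M f)\<^sup>2) * ennreal ((nrm2 M g)\<^sup>2)"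
    using nn_integral_L2[OF assms(1)] nn_integral_L2[OF assms(2)] by (simp add: ennreal_power)
  also have "\<dots> = ennreal ((nrm2 M f * nrm2 M g)\<^sup>2)"
    by (simp add: ennreal_mult[symmetric] power_mult_distrib)
  finally have "(LINT x|M. \<bar>f x\<bar> * \<bar>g x\<bar>)\<^sup>2 \<le> (nrm2 M f * nrm2 M g)\<^sup>2"
    by (simp add: ennreal_le_iff)
  then show ?thesis by (rule power2_le_imp_le) simp
qed

lemma Cauchy_Schwarz_L2:
  assumes "f \<in> L2 M" "g \<in> L2 M"
  shows "\<bar>LINT x|M. f x * g x\<bar> \<le> nrm2 M f * nrm2 M g"
proof -
  have "\<bar>LINT x|M. f x * g x\<bar> \<le> (LINT x|M. \<bar>f x * g x\<bar>)"
    by (rule integral_abs_bound)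
  then show ?thesis using Cauchy_Schwarz_abs[OF assms] by (simp add: abs_mult)
qed

lemma nrm2_triangle:
  assumes "f \<in> L2 M" "g \<in> L2 M"
  shows "nrm2 M (\<lambda>x. f x + g x) \<le> nrm2 M f + nrm2 M g"
proof -
  have "(nrm2 M (\<lambda>x. f x + g x))\<^sup>2 = (nrm2 M f)\<^sup>2 + (nrm2 M g)\<^sup>2 + 2 * (LINT x|M. f x * g x)"
    unfolding nrm2_sq using L2_mult_integrable[OF assms] L2_int[OF assms(1)] L2_int[OF assms(2)]
    by (simp add: power2_sum mult.assoc)
  also have "\<dots> \<le> (nrm2 M f + nrm2 M g)\<^sup>2"
    using Cauchy_Schwarz_L2[OF assms] by (simp add: power2_sum)
  finally show ?thesis by (rule power2_le_imp_le) simp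
qed

lemma nrm2_triangle_diff:
  assumes "f \<in> L2 M" "g \<in> L2 M" "h \<in> L2 M"
  shows "nrm2 M (\<lambda>x. f x - h x) \<le> nrm2 M (\<lambda>x. f x - g x) + nrm2 M (\<lambda>x. g x - h x)"
  using nrm2_triangle[OF L2_diff[OF assms(1,2)] L2_diff[OF assms(2,3)]] by simp

lemma nrm2_diff_bound:
  assumes "f \<in> L2 M" "g \<in> L2 M"
  shows "\<bar>nrm2 M f - nrm2 M g\<bar> \<le> nrm2 M (\<lambda>x. f x - g x)"
  using nrm2_triangle[OF L2_diff[OF assms] assms(2)] nrm2_triangle[OF L2_diff[OF assms(2,1)] assms(1)]
    nrm2_minus_commute[of M f g] by auto

lemma L2_tendsto_nrm2:
  assumes "\<And>n. f n \<in> L2 M" "g \<in> L2 M" "(\<lambda>n. nrm2 M (\<lambda>x. f n x - g x)) \<longlonglongrightarrow> 0"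
  shows "(\<lambda>n. nrm2 M (f n)) \<longlonglongrightarrow> nrm2 M g"
proof (rule LIM_zero_cancel, rule Lim_null_comparison[OF _ assms(3)])
  show "\<forall>\<^sub>F n in sequentially. norm (nrm2 M (f n) - nrm2 M g) \<le> nrm2 M (\<lambda>x. f n x - g x)"
    using nrm2_diff_bound[OF assms(1,2)] by simp
qed

lemma L2_tendsto_inner:
  assumes "\<And>n. f n \<in> L2 M" "g \<in> L2 M" "h \<in> L2 M" "(\<lambda>n. nrm2 M (\<lambda>x. f n x - g x)) \<longlonglongrightarrow> 0"
  shows "(\<lambda>n. LINT x|M. f n x * h x) \<longlonglongrightarrow> (LINT x|M. g x * h x)"
proof (rule LIM_zero_cancel, rule Lim_null_comparison)
  show "(\<lambda>n. nrm2 M (\<lambda>x. f n x - g x) * nrm2 M h) \<longlonglongrightarrow> 0"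
    using tendsto_mult_left_zero[OF assms(4)] .
  have "(LINT x|M. f n x * h x) - (LINT x|M. g x * h x) = (LINT x|M. (f n x - g x) * h x)" for n
    using L2_mult_integrable[OF assms(1,3)] L2_mult_integrable[OF assms(2,3)]
    by (simp add: left_diff_distrib)
  then show "\<forall>\<^sub>F n in sequentially. norm ((LINT x|M. f n x * h x) - (LINT x|M. g x * h x))
     \<le> nrm2 M (\<lambda>x. f n x - g x) * nrm2 M h"
    using Cauchy_Schwarz_L2[OF L2_diff[OF assms(1,2)] assms(3)] by simp
qed

text \<open>
  The map \<open>a \<mapsto> a |a|\<close> sends \<open>L\<^sup>2\<close> to \<open>L\<^sup>1\<close>, and the next two inequalities compare distances before and
  after it in both directions. In this way results about \<open>L\<^sup>1\<close> (subsequences converging almost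
  everywhere, continuity of translations) carry over to \<open>L\<^sup>2\<close>.
\<close>

lemma sq_diff_le_signed:
  fixes a b :: real
  shows "(a - b)\<^sup>2 \<le> 2 * \<bar>a * \<bar>a\<bar> - b * \<bar>b\<bar>\<bar>"
proof (cases "0 \<le> a * b")
  case True
  then have *: "(0 \<le> a \<and> 0 \<le> b) \<or> (a \<le> 0 \<and> b \<le> 0)" by (auto simp: zero_le_mult_iff)
  then have "a * \<bar>a\<bar> - b * \<bar>b\<bar> = (a - b) * (\<bar>a\<bar> + \<bar>b\<bar>)"
    by (auto simp: algebra_simps)
  then have "\<bar>a * \<bar>a\<bar> - b * \<bar>b\<bar>\<bar> = \<bar>a - b\<bar> * (\<bar>a\<bar> + \<bar>b\<bar>)"
    by (simp add: abs_mult)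
  moreover have "\<bar>a - b\<bar> * \<bar>a - b\<bar> \<le> \<bar>a - b\<bar> * (\<bar>a\<bar> + \<bar>b\<bar>)"
    by (intro mult_left_mono) auto
  moreover have "0 \<le> \<bar>a - b\<bar> * (\<bar>a\<bar> + \<bar>b\<bar>)" by simp
  moreover have "(a-b)\<^sup>2 = \<bar>a - b\<bar> * \<bar>a - b\<bar>" by (simp add: power2_eq_square)
  ultimately show ?thesis by linarith
next
  case False
  then have *: "(0 < a \<and> b < 0) \<or> (a < 0 \<and> 0 < b)" by (auto simp: zero_le_mult_iff not_le)
  have "(a - b)\<^sup>2 \<le> 2 * (a\<^sup>2 + b\<^sup>2)"
    using zero_le_power2[of "a + b"] by (simp add: power2_sum power2_diff)
  moreover have "\<bar>a * \<bar>a\<bar> - b * \<bar>b\<bar>\<bar> = a\<^sup>2 + b\<^sup>2"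
    using * by (auto simp: power2_eq_square abs_if algebra_simps mult_less_0_iff not_less)
      (smt (verit, best) mult_pos_pos mult_neg_neg)+
  ultimately show ?thesis by simp
qed

lemma signed_sq_diff_le:
  fixes a b :: real
  shows "\<bar>a * \<bar>a\<bar> - b * \<bar>b\<bar>\<bar> \<le> \<bar>a - b\<bar> * (\<bar>a\<bar> + \<bar>b\<bar>)"
proof -
  have "a * \<bar>a\<bar> - b * \<bar>b\<bar> = (a - b) * \<bar>a\<bar> + b * (\<bar>a\<bar> - \<bar>b\<bar>)" by (simp add: algebra_simps)
  also have "\<bar>\<dots>\<bar> \<le> \<bar>a - b\<bar> * \<bar>a\<bar> + \<bar>b\<bar> * \<bar>\<bar>a\<bar> - \<bar>b\<bar>\<bar>"
    by (rule order_trans[OF abs_triangle_ineq]) (simp add: abs_mult)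
  also have "\<dots> \<le> \<bar>a - b\<bar> * \<bar>a\<bar> + \<bar>b\<bar> * \<bar>a - b\<bar>"
    by (intro add_mono mult_left_mono) auto
  finally show ?thesis by (simp add: algebra_simps)
qed

lemma L2_AE_subseq:
  assumes "\<And>n. f n \<in> L2 M" "g \<in> L2 M" "(\<lambda>n. nrm2 M (\<lambda>x. f n x - g x)) \<longlonglongrightarrow> 0"
  obtains r where "strict_mono (r :: nat \<Rightarrow> nat)" "AE x in M. (\<lambda>n. f (r n) x) \<longlonglongrightarrow> g x"
proof -
  have "\<exists>r::nat\<Rightarrow>nat. strict_mono r \<and> (AE x in M. (\<lambda>n. (f (r n) x - g x)\<^sup>2) \<longlonglongrightarrow> 0)"
  proof (rule tendsto_L1_AE_subseq[where u = "\<lambda>n x. (f n x - g x)\<^sup>2"])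
    show "integrable M (\<lambda>x. (f n x - g x)\<^sup>2)" for n
      using L2_int[OF L2_diff[OF assms(1,2)]] .
    show "(\<lambda>n. LINT x|M. norm ((f n x - g x)\<^sup>2)) \<longlonglongrightarrow> 0"
      using tendsto_power[OF assms(3), of 2] by (simp add: nrm2_sq)
  qed
  then obtain r where r: "strict_mono (r::nat\<Rightarrow>nat)" "AE x in M. (\<lambda>n. (f (r n) x - g x)\<^sup>2) \<longlonglongrightarrow> 0"
    by blast
  from r(2) have "AE x in M. (\<lambda>n. f (r n) x) \<longlonglongrightarrow> g x"
  proof eventually_elim
    case (elim x)
    then have "(\<lambda>n. sqrt ((f (r n) x - g x)\<^sup>2)) \<longlonglongrightarrow> sqrt 0" by (rule tendsto_real_sqrt)
    then show ?case by (simp add: tendsto_rabs_zero_iff LIM_zero_iff)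
  qed
  with r(1) show ?thesis by (rule that)
qed

lemma L2_Fatou:
  assumes "\<And>n. f n \<in> L2 M" "g \<in> borel_measurable M" "AE x in M. (\<lambda>n. f n x) \<longlonglongrightarrow> g x"
    "\<forall>\<^sub>F n in sequentially. nrm2 M (f n) \<le> B" "0 \<le> B"
  shows "g \<in> L2 M" "nrm2 M g \<le> B"
proof -
  have [measurable]: "f n \<in> borel_measurable M" for n using assms(1) by (auto simp: L2_def)
  have "(\<integral>\<^sup>+x. ennreal ((g x)\<^sup>2) \<partial>M) = (\<integral>\<^sup>+x. liminf (\<lambda>n. ennreal ((f n x)\<^sup>2)) \<partial>M)"
  proof (rule nn_integral_cong_AE)
    show "AE x in M. ennreal ((g x)\<^sup>2) = liminf (\<lambda>n. ennreal ((f n x)\<^sup>2))"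
      using assms(3)
    proof eventually_elim
      case (elim x)
      then have "(\<lambda>n. ennreal ((f n x)\<^sup>2)) \<longlonglongrightarrow> ennreal ((g x)\<^sup>2)"
        by (intro tendsto_intros) auto
      then show ?case by (rule lim_imp_Liminf[OF trivial_limit_sequentially, symmetric])
    qed
  qed
  also have "\<dots> \<le> liminf (\<lambda>n. \<integral>\<^sup>+x. ennreal ((f n x)\<^sup>2) \<partial>M)"
    by (rule nn_integral_liminf) auto
  also have "\<dots> \<le> liminf (\<lambda>n. ennreal (B\<^sup>2))"
  proof (rule Liminf_mono)
    show "\<forall>\<^sub>F n in sequentially. (\<integral>\<^sup>+x. ennreal ((f n x)\<^sup>2) \<partial>M) \<le> ennreal (B\<^sup>2)"
      using assms(4) by eventually_elim (simp add: nn_integral_L2[OF assms(1)] ennreal_leI power_mono)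
  qed
  also have "\<dots> = ennreal (B\<^sup>2)" by (simp add: Liminf_const)
  finally have "(\<integral>\<^sup>+x. ennreal ((g x)\<^sup>2) \<partial>M) \<le> ennreal (B\<^sup>2)" .
  from L2_nn_integralI[OF assms(2) this assms(5)]
  show "g \<in> L2 M" "nrm2 M g \<le> B" .
qed

text \<open>
  The signed squares form a Cauchy sequence in \<open>L\<^sup>1\<close>, so a subsequence converges almost everywhere;
  Fatou's lemma shows that its pointwise limit is the limit in \<open>L\<^sup>2\<close>.
\<close>

lemma L2_complete:
  assumes f: "\<And>n. f n \<in> L2 M"
    and C: "\<And>e. e > 0 \<Longrightarrow> \<exists>N. \<forall>i\<ge>N. \<forall>j\<ge>N. nrm2 M (\<lambda>x. f i x - f j x) < e"
  obtains g where "g \<in> L2 M" "(\<lambda>n. nrm2 M (\<lambda>x. f n x - g x)) \<longlonglongrightarrow> 0"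
proof -
  have [measurable]: "f n \<in> borel_measurable M" for n using f by (auto simp: L2_def)
  obtain N1 where N1: "\<And>i j. i \<ge> N1 \<Longrightarrow> j \<ge> N1 \<Longrightarrow> nrm2 M (\<lambda>x. f i x - f j x) < 1"
    using C[of 1] by auto
  define B where "B = nrm2 M (f N1) + 1"
  have B: "nrm2 M (f i) \<le> B" if "i \<ge> N1" for i
    using N1[OF that order.refl] nrm2_diff_bound[OF f f, of i N1] by (simp add: B_def)
  have Bp: "B > 0" unfolding B_def using nrm2_nonneg[of M "f N1"] by linarith
  define s where "s = (\<lambda>n x. f n x * \<bar>f n x\<bar>)"
  have si: "integrable M (s n)" for n
    unfolding s_def by (rule L2_mult_integrable[OF f L2_abs[OF f]])
  obtain r where r: "strict_mono r" "AE x in M. Cauchy (\<lambda>i. s (r i) x)"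
  proof (rule cauchy_L1_AE_cauchy_subseq[of M s])
    fix e :: real assume e: "e > 0"
    obtain N where N: "\<And>i j. i \<ge> N \<Longrightarrow> j \<ge> N \<Longrightarrow> nrm2 M (\<lambda>x. f i x - f j x) < e / (2 * B)"
      using C[of "e / (2 * B)"] e Bp by auto
    have "(LINT x|M. norm (s i x - s j x)) < e" if ij: "i \<ge> max N N1" "j \<ge> max N N1" for i j
    proof -
      have L: "(\<lambda>x. \<bar>f i x\<bar> + \<bar>f j x\<bar>) \<in> L2 M" "(\<lambda>x. f i x - f j x) \<in> L2 M"
        by (rule L2_add[OF L2_abs[OF f] L2_abs[OF f]], rule L2_diff[OF f f])
      have "(LINT x|M. norm (s i x - s j x)) \<le> (LINT x|M. \<bar>f i x - f j x\<bar> * \<bar>\<bar>f i x\<bar> + \<bar>f j x\<bar>\<bar>)"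
      proof (rule integral_mono)
        show "integrable M (\<lambda>x. norm (s i x - s j x))" using si by auto
        show "integrable M (\<lambda>x. \<bar>f i x - f j x\<bar> * \<bar>\<bar>f i x\<bar> + \<bar>f j x\<bar>\<bar>)"
          by (rule L2_mult_integrable[OF L2_abs[OF L(2)] L2_abs[OF L(1)]])
        show "norm (s i x - s j x) \<le> \<bar>f i x - f j x\<bar> * \<bar>\<bar>f i x\<bar> + \<bar>f j x\<bar>\<bar>" for x
          using signed_sq_diff_le[of "f i x" "f j x"] by (simp add: s_def)
      qed
      also have "\<dots> \<le> nrm2 M (\<lambda>x. f i x - f j x) * nrm2 M (\<lambda>x. \<bar>f i x\<bar> + \<bar>f j x\<bar>)"
        by (rule Cauchy_Schwarz_abs[OF L(2,1)])
      also have "\<dots> \<le> nrm2 M (\<lambda>x. f i x - f j x) * (2 * B)"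
      proof (rule mult_left_mono)
        show "nrm2 M (\<lambda>x. \<bar>f i x\<bar> + \<bar>f j x\<bar>) \<le> 2 * B"
          using nrm2_triangle[OF L2_abs[OF f[of i]] L2_abs[OF f[of j]]] B[of i] B[of j] ij by simp
      qed simp
      also have "\<dots> < e / (2 * B) * (2 * B)"
        by (rule mult_strict_right_mono) (use N ij Bp in auto)
      also have "\<dots> = e" using Bp by simp
      finally show ?thesis .
    qed
    then show "\<exists>N. \<forall>i\<ge>N. \<forall>j\<ge>N. (LINT x|M. norm (s i x - s j x)) < e" by blast
  qed (use si in auto)
  have ae: "AE x in M. Cauchy (\<lambda>i. f (r i) x)"
    using r(2)
  proof eventually_elim
    case (elim x)
    show ?case
    proof (rule metric_CauchyI)
      fix e :: real assume e: "e > 0"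
      obtain N where N: "\<And>i j. i \<ge> N \<Longrightarrow> j \<ge> N \<Longrightarrow> dist (s (r i) x) (s (r j) x) < e\<^sup>2 / 2"
        using metric_CauchyD[OF elim, of "e\<^sup>2/2"] e by auto
      have "dist (f (r i) x) (f (r j) x) < e" if "i \<ge> N" "j \<ge> N" for i j
      proof -
        have "(f (r i) x - f (r j) x)\<^sup>2 < e\<^sup>2"
          using sq_diff_le_signed[of "f (r i) x" "f (r j) x"] N[OF that]
          by (simp add: s_def dist_real_def)
        then have "\<bar>f (r i) x - f (r j) x\<bar> < \<bar>e\<bar>" by (simp add: abs_square_less_1 power2_less_imp_less real_less_rsqrt abs_le_square_iff not_le[symmetric])
        then show ?thesis using e by (simp add: dist_real_def)
      qed
      then show "\<exists>N. \<forall>m\<ge>N. \<forall>n\<ge>N. dist (f (r m) x) (f (r n) x) < e" by blast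
    qed
  qed
  define g where "g = (\<lambda>x. lim (\<lambda>i. f (r i) x))"
  have gm[measurable]: "g \<in> borel_measurable M"
    unfolding g_def by (rule borel_measurable_lim_metric) auto
  have lim: "AE x in M. (\<lambda>i. f (r i) x) \<longlonglongrightarrow> g x"
    using ae by eventually_elim (simp add: g_def Cauchy_convergent_iff convergent_LIMSEQ_iff)
  have ge: "r n \<ge> n" for n by (rule seq_suble[OF r(1)])
  have gL: "g \<in> L2 M"
  proof (rule L2_Fatou(1)[OF _ gm lim])
    show "\<forall>\<^sub>F n in sequentially. nrm2 M (f (r n)) \<le> B"
      using eventually_ge_at_top[of N1]
    proof eventually_elim
      case (elim k)
      show ?case using B[of "r k"] ge[of k] elim by simp
    qed
  qed (use f Bp in auto)
  have "(\<lambda>n. nrm2 M (\<lambda>x. f n x - g x)) \<longlonglongrightarrow> 0"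
  proof (rule LIMSEQ_I)
    fix e :: real assume e: "e > 0"
    obtain N where N: "\<And>i j. i \<ge> N \<Longrightarrow> j \<ge> N \<Longrightarrow> nrm2 M (\<lambda>x. f i x - f j x) < e / 2"
      using C[of "e/2"] e by auto
    have "norm (nrm2 M (\<lambda>x. f n x - g x) - 0) < e" if n: "n \<ge> N" for n
    proof -
      have "nrm2 M (\<lambda>x. f n x - g x) \<le> e/2"
      proof (rule L2_Fatou(2)[where f = "\<lambda>k x. f n x - f (r k) x"])
        show "AE x in M. (\<lambda>k. f n x - f (r k) x) \<longlonglongrightarrow> f n x - g x"
          using lim by eventually_elim (intro tendsto_intros)
        show "\<forall>\<^sub>F k in sequentially. nrm2 M (\<lambda>x. f n x - f (r k) x) \<le> e / 2"
          using eventually_ge_at_top[of N]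
        proof eventually_elim
          case (elim k)
          have "N \<le> r k" using ge[of k] elim by simp
          from N[OF n this] show ?case by simp
        qed
      qed (use f e in auto)
      then show ?thesis using e by simp
    qed
    then show "\<exists>N. \<forall>n\<ge>N. norm (nrm2 M (\<lambda>x. f n x - g x) - 0) < e" by blast
  qed
  with gL show ?thesis by (rule that)
qed

text \<open>
  Averaging does not increase \<open>L\<^sup>2\<close> norms (Jensen and Tonelli). The average is taken over the
  mollifying measure when functions are convolved, and over a segment when a difference is written as the
  integral of a derivative.
\<close>

lemma nn_integral_square_average_le:
  assumes "sigma_finite_measure N" "emeasure M (space M) = 1"
    and w[measurable]: "(\<lambda>(x, z). w x z) \<in> borel_measurable (N \<Otimes>\<^sub>M M)"
    and B: "AE z in M. (\<integral>\<^sup>+x. ennreal ((w x z)\<^sup>2) \<partial>N) \<le> B"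
  shows "(\<integral>\<^sup>+x. ennreal ((LINT z|M. w x z)\<^sup>2) \<partial>N) \<le> B"
proof -
  interpret N: sigma_finite_measure N by fact
  interpret M: finite_measure M by (rule finite_measureI) (simp add: assms)
  interpret NM: pair_sigma_finite N M by unfold_locales
  have "(\<integral>\<^sup>+x. ennreal ((LINT z|M. w x z)\<^sup>2) \<partial>N) \<le> (\<integral>\<^sup>+x. \<integral>\<^sup>+z. ennreal ((w x z)\<^sup>2) \<partial>M \<partial>N)"
  proof (rule nn_integral_mono)
    fix x assume x: "x \<in> space N"
    have [measurable]: "w x \<in> borel_measurable M"
      using measurable_Pair2[OF w x] by simp
    show "ennreal ((LINT z|M. w x z)\<^sup>2) \<le> (\<integral>\<^sup>+z. ennreal ((w x z)\<^sup>2) \<partial>M)"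
    proof (cases "integrable M (\<lambda>z. (w x z)\<^sup>2)")
      case True
      have L: "w x \<in> L2 M" "(\<lambda>_. 1) \<in> L2 M"
        using True by (auto simp: L2_def)
      have "measure M (space M) = 1" using assms(2) by (simp add: measure_def)
      then have "nrm2 M (\<lambda>_. 1) = 1" by (simp add: nrm2_def)
      then have "\<bar>LINT z|M. w x z\<bar> \<le> nrm2 M (w x)"
        using Cauchy_Schwarz_L2[OF L] by simp
      then have "(LINT z|M. w x z)\<^sup>2 \<le> (nrm2 M (w x))\<^sup>2"
        by (metis abs_ge_zero power2_abs power_mono)
      then show ?thesis unfolding nn_integral_L2[OF L(1)] by (rule ennreal_leI)
    next
      case False
      then have "(\<integral>\<^sup>+z. ennreal ((w x z)\<^sup>2) \<partial>M) = \<infinity>"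
        by (auto simp: integrable_iff_bounded not_less top_unique)
      then show ?thesis by simp
    qed
  qed
  also have "\<dots> = (\<integral>\<^sup>+z. \<integral>\<^sup>+x. ennreal ((w x z)\<^sup>2) \<partial>N \<partial>M)"
    by (rule NM.Fubini'[symmetric]) auto
  also have "\<dots> \<le> (\<integral>\<^sup>+z. B \<partial>M)"
    by (rule nn_integral_mono_AE[OF B])
  also have "\<dots> = B" by (simp add: assms)
  finally show ?thesis .
qed

section \<open>Affine changes of variables\<close>

lemma lborel_integral_affine:
  fixes f :: "'a::euclidean_space \<Rightarrow> real" and s :: real
  assumes "f \<in> borel_measurable borel" "s \<noteq> 0"
  shows "(LINT x|lborel. f (s *\<^sub>R x + b)) = (LINT x|lborel. f x) / \<bar>s\<bar> ^ DIM('a)"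
proof -
  have "(LINT x|lborel. f x) = (LINT x|density (distr lborel borel (\<lambda>x. b + s *\<^sub>R x)) (\<lambda>_. ennreal (\<bar>s\<bar> ^ DIM('a))). f x)"
    using lborel_affine[OF assms(2), of b] by simp
  also have "\<dots> = \<bar>s\<bar> ^ DIM('a) * (LINT x|lborel. f (s *\<^sub>R x + b))"
    using assms(1) by (subst integral_density) (auto simp: integral_distr add.commute)
  finally show ?thesis using assms(2) by simp
qed

lemma lborel_integrable_affine:
  fixes f :: "'a::euclidean_space \<Rightarrow> real" and s :: real
  assumes "f \<in> borel_measurable borel" "s \<noteq> 0"
  shows "integrable lborel (\<lambda>x. f (s *\<^sub>R x + b)) \<longleftrightarrow> integrable lborel f"
proof -
  have "integrable lborel f \<longleftrightarrow> integrable (density (distr lborel borel (\<lambda>x. b + s *\<^sub>R x)) (\<lambda>_. ennreal (\<bar>s\<bar> ^ DIM('a)))) f"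
    using lborel_affine[OF assms(2), of b] by simp
  also have "\<dots> \<longleftrightarrow> integrable lborel (\<lambda>x. f (s *\<^sub>R x + b))"
    using assms by (subst integrable_density) (auto simp: integrable_distr_eq add.commute)
  finally show ?thesis by simp
qed

lemma nn_integral_lborel_affine:
  fixes f :: "'a::euclidean_space \<Rightarrow> ennreal" and s :: real
  assumes "f \<in> borel_measurable borel" "s \<noteq> 0"
  shows "(\<integral>\<^sup>+x. f x \<partial>lborel) = ennreal (\<bar>s\<bar> ^ DIM('a)) * (\<integral>\<^sup>+x. f (s *\<^sub>R x + b) \<partial>lborel)"
proof -
  have "(\<integral>\<^sup>+x. f x \<partial>lborel) = (\<integral>\<^sup>+x. f x \<partial>density (distr lborel borel (\<lambda>x. b + s *\<^sub>R x)) (\<lambda>_. ennreal (\<bar>s\<bar> ^ DIM('a))))"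
    using lborel_affine[OF assms(2), of b] by simp
  also have "\<dots> = (\<integral>\<^sup>+x. ennreal (\<bar>s\<bar> ^ DIM('a)) * f (b + s *\<^sub>R x) \<partial>lborel)"
    using assms(1) by (subst nn_integral_density) (auto simp: nn_integral_distr)
  also have "\<dots> = ennreal (\<bar>s\<bar> ^ DIM('a)) * (\<integral>\<^sup>+x. f (b + s *\<^sub>R x) \<partial>lborel)"
    using assms(1) by (intro nn_integral_cmult) auto
  finally show ?thesis by (simp add: add.commute)
qed

section \<open>Smooth bump functions\<close>

text \<open>
  The counterpart of \<open>Ck\<close> for functions of one variable.
\<close>

primrec Dk :: "nat \<Rightarrow> (real \<Rightarrow> real) \<Rightarrow> bool" where
  "Dk 0 f \<longleftrightarrow> continuous_on UNIV f"
| "Dk (Suc k) f \<longleftrightarrow> (\<exists>f'. (\<forall>x. (f has_real_derivative f' x) (at x)) \<and> Dk k f')"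

lemma Dk_add: "Dk k f \<Longrightarrow> Dk k g \<Longrightarrow> Dk k (\<lambda>x. f x + g x)"
proof (induction k arbitrary: f g)
  case (Suc k)
  then obtain f' g' where "\<forall>x. (f has_real_derivative f' x) (at x)" "Dk k f'"
    "\<forall>x. (g has_real_derivative g' x) (at x)" "Dk k g'" by auto
  with Suc.IH[of f' g'] show ?case
    by (auto intro!: exI[of _ "\<lambda>x. f' x + g' x"] DERIV_add)
qed (auto intro: continuous_intros)

lemma Dk_cmult: "Dk k f \<Longrightarrow> Dk k (\<lambda>x. c * f x)"
proof (induction k arbitrary: f)
  case (Suc k)
  then obtain f' where "\<forall>x. (f has_real_derivative f' x) (at x)" "Dk k f'" by auto
  with Suc.IH[of f'] show ?case
    by (auto intro!: exI[of _ "\<lambda>x. c * f' x"] DERIV_cmult)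
qed (auto intro: continuous_intros)

text \<open>
  The derivative of each of these functions is a linear combination of two others; this is why all of
  them, in particular \<open>exp (- 1 / t)\<close>, are smooth across \<open>0\<close>.
\<close>

definition flat :: "nat \<Rightarrow> real \<Rightarrow> real" where
  "flat m t = (if t > 0 then (1 / t) ^ m * exp (- (1 / t)) else 0)"

lemma flat_tendsto_0: "(flat m \<longlongrightarrow> 0) (at 0)"
proof -
  have "((\<lambda>t::real. (1/t) ^ m * exp (- (1/t))) \<longlongrightarrow> 0) (at_right 0)"
  proof -
    have "((\<lambda>x::real. x ^ m * exp (- x)) \<longlongrightarrow> 0) at_top"
      using tendsto_power_div_exp_0[of m] by (simp add: exp_minus field_simps)
    from filterlim_compose[OF this filterlim_inverse_at_top_right]
    show ?thesis by (simp add: inverse_eq_divide)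
  qed
  then have r: "(flat m \<longlongrightarrow> 0) (at_right 0)"
    by (rule Lim_transform_eventually) (auto simp: flat_def eventually_at_filter)
  have l: "(flat m \<longlongrightarrow> 0) (at_left 0)"
    by (rule Lim_transform_eventually[OF tendsto_const]) (auto simp: flat_def eventually_at_filter)
  show ?thesis using r l by (simp add: filterlim_split_at_real)
qed

lemma flat_deriv: "(flat m has_real_derivative (flat (m + 2) t - real m * flat (m + 1) t)) (at t)"
proof -
  consider "t > 0" | "t < 0" | "t = 0" by linarith
  then show ?thesis
  proof cases
    case 1
    have "((\<lambda>t. (1 / t) ^ m * exp (- (1 / t))) has_real_derivative
        (real m * (1 / t) ^ (m - 1) * (- (1 / t)\<^sup>2)) * exp (- (1 / t)) + (1 / t) ^ m * (exp (- (1 / t)) * (1 / t)\<^sup>2)) (at t)"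
      using 1 by (auto intro!: derivative_eq_intros simp: power2_eq_square)
    moreover have "(real m * (1 / t) ^ (m - 1) * (- (1 / t)\<^sup>2)) * exp (- (1 / t)) + (1 / t) ^ m * (exp (- (1 / t)) * (1 / t)\<^sup>2)
        = flat (m + 2) t - real m * flat (m + 1) t"
      using 1 by (cases m) (simp_all add: flat_def power2_eq_square)
    ultimately have "((\<lambda>t. (1 / t) ^ m * exp (- (1 / t))) has_real_derivative (flat (m + 2) t - real m * flat (m + 1) t)) (at t)"
      by simp
    then show ?thesis
      by (rule DERIV_cong_ev[THEN iffD1, rotated 3])
         (use 1 in \<open>auto simp: flat_def intro!: eventually_mono[OF eventually_nhds_in_open[of "{0<..}" t]]\<close>)
  next
    case 2
    have "((\<lambda>t. 0) has_real_derivative 0) (at t)" by simp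
    then have "(flat m has_real_derivative 0) (at t)"
      by (rule DERIV_cong_ev[THEN iffD1, rotated 3])
         (use 2 in \<open>auto simp: flat_def intro!: eventually_mono[OF eventually_nhds_in_open[of "{..<0}" t]]\<close>)
    then show ?thesis using 2 by (simp add: flat_def)
  next
    case 3
    have "(\<lambda>h. (flat m (0 + h) - flat m 0) / h) \<midarrow>0\<rightarrow> 0"
      by (rule Lim_transform_eventually[OF flat_tendsto_0[of "Suc m"]])
         (auto simp: flat_def eventually_at_filter)
    then show ?thesis using 3 by (simp add: DERIV_def flat_def)
  qed
qed

lemma Dk_flat: "Dk k (flat m)"
proof (induction k arbitrary: m)
  case 0
  show ?case by (simp add: continuous_on_eq_continuous_at) (meson flat_deriv DERIV_isCont)
next
  case (Suc k)
  have "Dk k (\<lambda>t. flat (m + 2) t + (- real m) * flat (m + 1) t)"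
    by (intro Dk_add Dk_cmult Suc)
  then show ?case using flat_deriv by (auto intro!: exI[of _ "\<lambda>t. flat (m + 2) t - real m * flat (m + 1) t"])
qed

lemma partial_eqI: "(f has_derivative D) (at x) \<Longrightarrow> partial i f x = D (axis i 1)"
  unfolding partial_def using frechet_derivative_at by metis

lemma Ck_imp_continuous: "Ck k f \<Longrightarrow> continuous_on UNIV f"
  by (cases k) (auto simp: continuous_on_eq_continuous_at differentiable_imp_continuous_within)

lemma Ck_SucD: "Ck (Suc k) f \<Longrightarrow> Ck k f"
proof (induction k arbitrary: f)
  case 0
  then show ?case by (simp add: continuous_on_eq_continuous_at differentiable_imp_continuous_within)
next
  case (Suc k)
  have "Ck k (partial i f)" for i
  proof (rule Suc.IH)
    show "Ck (Suc k) (partial i f)" using Suc.prems by simp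
  qed
  then show ?case using Suc.prems by simp
qed

lemma Ck_const[simp]: "Ck k (\<lambda>x. c)"
proof (induction k arbitrary: c)
  case (Suc k)
  have "partial i (\<lambda>x. c) = (\<lambda>x. 0)" for i
    by (rule ext, rule partial_eqI[where D = "\<lambda>_. 0", simplified]) auto
  with Suc[of 0] show ?case by simp
qed auto

lemma Ck_add: "Ck k f \<Longrightarrow> Ck k g \<Longrightarrow> Ck k (\<lambda>x. f x + g x)"
proof (induction k arbitrary: f g)
  case (Suc k)
  have "partial i (\<lambda>x. f x + g x) = (\<lambda>x. partial i f x + partial i g x)" for i
  proof
    fix x
    show "partial i (\<lambda>x. f x + g x) x = partial i f x + partial i g x"
      unfolding partial_def[of i f] partial_def[of i g]
      using Suc.prems by (intro partial_eqI[where D = "\<lambda>h. frechet_derivative f (at x) h + frechet_derivative g (at x) h"])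
        (auto intro!: has_derivative_add simp: frechet_derivative_works[symmetric])
  qed
  with Suc show ?case by auto
qed (auto intro: continuous_intros)

lemma partial_mult:
  assumes "f differentiable at x" "g differentiable at x"
  shows "partial i (\<lambda>x. f x * g x) x = f x * partial i g x + partial i f x * g x"
  unfolding partial_def[of i f] partial_def[of i g]
  using assms by (intro partial_eqI[where D = "\<lambda>h. f x * frechet_derivative g (at x) h + frechet_derivative f (at x) h * g x"])
    (auto intro!: has_derivative_mult simp: frechet_derivative_works[symmetric])

lemma Ck_mult: "Ck k f \<Longrightarrow> Ck k g \<Longrightarrow> Ck k (\<lambda>x. f x * g x)"
proof (induction k arbitrary: f g)
  case (Suc k)
  have *: "partial i (\<lambda>x. f x * g x) = (\<lambda>x. f x * partial i g x + partial i f x * g x)" for i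
    using Suc.prems by (intro ext partial_mult) auto
  have "Ck k (\<lambda>x. f x * partial i g x + partial i f x * g x)" for i
    using Suc.prems Ck_SucD[OF Suc.prems(1)] Ck_SucD[OF Suc.prems(2)]
    by (intro Ck_add Suc.IH) auto
  then show ?case using Suc.prems by (auto simp: * differentiable_mult)
qed (auto intro: continuous_intros)

lemma Ck_coord: "Dk k f \<Longrightarrow> Ck k (\<lambda>x. f (s * x $ i + b))"
proof (induction k arbitrary: f)
  case 0
  then show ?case
    by (auto intro!: continuous_on_compose2[of UNIV f UNIV] continuous_intros)
next
  case (Suc k)
  then obtain f' where f': "\<And>x. (f has_real_derivative f' x) (at x)" "Dk k f'" by auto
  have d: "((\<lambda>x. f (s * x $ i + b)) has_derivative (\<lambda>h. f' (s * x $ i + b) * (s * h $ i))) (at x)" for x :: plane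
  proof -
    have "((\<lambda>x::plane. s * x $ i + b) has_derivative (\<lambda>h. s * h $ i)) (at x)"
      by (rule has_derivative_add_const[OF has_derivative_mult_right[OF bounded_linear_imp_has_derivative[OF bounded_linear_vec_nth]]])
    from has_derivative_compose[OF this f'(1)[unfolded has_field_derivative_def]]
    show ?thesis by simp
  qed
  have p: "partial j (\<lambda>x. f (s * x $ i + b)) = (\<lambda>x. f' (s * x $ i + b) * (s * axis j 1 $ i))" for j
    by (rule ext, rule partial_eqI[OF d])
  show ?case
    unfolding Ck.simps p using d Ck_mult[OF Suc.IH[OF f'(2)] Ck_const] by (auto simp: differentiable_def)
qed

lemma has_derivative_affine:
  assumes "f differentiable at (s *\<^sub>R x + b)"
  shows "((\<lambda>x. f (s *\<^sub>R x + b)) has_derivative (\<lambda>h. frechet_derivative f (at (s *\<^sub>R x + b)) (s *\<^sub>R h))) (at x)"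
proof -
  have "((\<lambda>x. s *\<^sub>R x + b) has_derivative (\<lambda>h. s *\<^sub>R h)) (at x)"
    by (auto intro!: derivative_eq_intros)
  moreover have "(f has_derivative frechet_derivative f (at (s *\<^sub>R x + b))) (at (s *\<^sub>R x + b))"
    using assms by (simp add: frechet_derivative_works[symmetric])
  ultimately show ?thesis by (rule has_derivative_compose)
qed

lemma partial_affine:
  assumes "f differentiable at (s *\<^sub>R x + b)"
  shows "partial j (\<lambda>x. f (s *\<^sub>R x + b)) x = s * partial j f (s *\<^sub>R x + b)"
proof -
  have "linear (frechet_derivative f (at (s *\<^sub>R x + b)))"
    using assms by (intro linear_frechet_derivative) auto
  then show ?thesis
    unfolding partial_eqI[OF has_derivative_affine[OF assms]] by (simp add: partial_def linear_scale)
qed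

lemma Ck_affine: "Ck k f \<Longrightarrow> Ck k (\<lambda>x. f (s *\<^sub>R x + b))"
proof (induction k arbitrary: f)
  case 0
  then show ?case
    by (auto intro!: continuous_on_compose2[of UNIV f UNIV] continuous_intros)
next
  case (Suc k)
  have f: "f differentiable at y" for y using Suc.prems by simp
  have p: "partial j (\<lambda>x. f (s *\<^sub>R x + b)) = (\<lambda>x. s * partial j f (s *\<^sub>R x + b))" for j
    by (intro ext partial_affine f)
  have "(\<lambda>x. f (s *\<^sub>R x + b)) differentiable at x" for x
    using has_derivative_affine[OF f] unfolding differentiable_def by blast
  then show ?case
    unfolding Ck.simps p using Ck_mult[OF Ck_const Suc.IH] Suc.prems by auto
qed

text \<open>
  As \<open>m\<close> grows these functions increase to the indicator of the open box between \<open>a\<close> and \<open>b\<close>; with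
  \<open>m = 1\<close> and a small box they serve as mollifiers.
\<close>

definition bump :: "real \<Rightarrow> plane \<Rightarrow> plane \<Rightarrow> plane \<Rightarrow> real" where
  "bump m a b y = flat 0 (m * (y $ 1 - a $ 1)) * flat 0 (m * (b $ 1 - y $ 1)) *
     (flat 0 (m * (y $ 2 - a $ 2)) * flat 0 (m * (b $ 2 - y $ 2)))"

lemma flat0_bounds: "0 \<le> flat 0 t" "flat 0 t \<le> 1" "flat 0 t > 0 \<longleftrightarrow> t > 0"
  by (auto simp: flat_def)

lemma bump_nonneg: "0 \<le> bump m a b y"
  by (auto simp: bump_def flat0_bounds)

lemma bump_le_1: "bump m a b y \<le> 1"
  unfolding bump_def by (intro mult_le_one mult_nonneg_nonneg flat0_bounds)

lemma bump_eq_0: "m > 0 \<Longrightarrow> y \<notin> box a b \<Longrightarrow> bump m a b y = 0"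
  by (auto simp: bump_def flat_def mem_box_cart forall_2 zero_less_mult_iff)

lemma bump_pos: "m > 0 \<Longrightarrow> y \<in> box a b \<Longrightarrow> 0 < bump m a b y"
  by (auto simp: bump_def flat_def mem_box_cart forall_2)

lemma bump_tendsto: "(\<lambda>n. bump (real (Suc n)) a b y) \<longlonglongrightarrow> indicator (box a b) y"
proof (cases "y \<in> box a b")
  case True
  have f: "(\<lambda>n. flat 0 (real (Suc n) * t)) \<longlonglongrightarrow> 1" if "t > 0" for t
  proof -
    have "(\<lambda>n. 1 / t * inverse (real (Suc n))) \<longlonglongrightarrow> 1 / t * 0"
      by (rule tendsto_mult[OF tendsto_const LIMSEQ_inverse_real_of_nat])
    then have "(\<lambda>n. exp (- (1 / t * inverse (real (Suc n))))) \<longlonglongrightarrow> exp (- (1 / t * 0))"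
      by (intro tendsto_exp tendsto_minus)
    then show ?thesis using that by (simp add: flat_def divide_simps mult.commute)
  qed
  have "(\<lambda>n. bump (real (Suc n)) a b y) \<longlonglongrightarrow> 1 * 1 * (1 * 1)"
    unfolding bump_def using True by (intro tendsto_mult f) (auto simp: mem_box_cart)
  then show ?thesis using True by simp
next
  case False
  then show ?thesis by (simp add: bump_eq_0)
qed

lemma Ck_bump: "Ck k (bump m a b)"
proof -
  have 1: "Ck k (\<lambda>y. flat 0 (m * (y $ i - a $ i)))" for i
    using Ck_coord[OF Dk_flat[of k 0], of m i "- m * a $ i"] by (simp add: algebra_simps)
  have 2: "Ck k (\<lambda>y. flat 0 (m * (b $ i - y $ i)))" for i
    using Ck_coord[OF Dk_flat[of k 0], of "-m" i "m * b $ i"] by (simp add: algebra_simps)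
  show ?thesis unfolding bump_def[abs_def] by (intro Ck_mult 1 2)
qed

lemma test_functionI:
  assumes "\<And>k. Ck k f" "compact K" "\<And>x. x \<notin> K \<Longrightarrow> f x = 0"
  shows "test_function f"
proof -
  have "closure {x. f x \<noteq> 0} \<subseteq> K"
    using assms by (intro closure_minimal compact_imp_closed) auto
  then have "compact (closure {x. f x \<noteq> 0})"
    using assms(2) by (metis closed_closure compact_Int_closed inf.absorb_iff2)
  with assms(1) show ?thesis by (simp add: test_function_def)
qed

lemma test_function_bump: "m > 0 \<Longrightarrow> test_function (bump m a b)"
  by (rule test_functionI[where K = "cbox a b"])
     (use box_subset_cbox in \<open>auto intro: Ck_bump bump_eq_0\<close>)

lemma test_functionE:
  assumes "test_function f"
  obtains K where "compact K" "\<And>x. x \<notin> K \<Longrightarrow> f x = 0"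
  using assms that[of "closure {x. f x \<noteq> 0}"] closure_subset[of "{x. f x \<noteq> 0}"]
  unfolding test_function_def by blast

lemma test_function_cmult:
  assumes "test_function f" shows "test_function (\<lambda>x. c * f x)"
proof -
  obtain K where K: "compact K" "\<And>x. x \<notin> K \<Longrightarrow> f x = 0" using test_functionE[OF assms] by blast
  show ?thesis
    using assms K by (intro test_functionI[OF _ K(1)] Ck_mult Ck_const) (auto simp: test_function_def)
qed

lemma test_function_mult:
  assumes "test_function f" "test_function g" shows "test_function (\<lambda>x. f x * g x)"
proof -
  obtain K where K: "compact K" "\<And>x. x \<notin> K \<Longrightarrow> f x = 0" using test_functionE[OF assms(1)] by blast
  show ?thesis
    using assms K by (intro test_functionI[OF _ K(1)] Ck_mult Ck_const) (auto simp: test_function_def)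
qed

lemma test_function_differentiable: "test_function f \<Longrightarrow> f differentiable at x"
  unfolding test_function_def by (metis Ck.simps(2))

lemma test_function_affine:
  assumes "test_function f" "s \<noteq> 0" shows "test_function (\<lambda>x. f (s *\<^sub>R x + b))"
proof -
  obtain K where K: "compact K" "\<And>x. x \<notin> K \<Longrightarrow> f x = 0" using test_functionE[OF assms(1)] by blast
  show ?thesis
  proof (rule test_functionI)
    show "compact ((\<lambda>y. (1/s) *\<^sub>R (y - b)) ` K)"
      by (intro compact_continuous_image continuous_intros K)
    fix x assume "x \<notin> (\<lambda>y. (1/s) *\<^sub>R (y - b)) ` K"
    then have "s *\<^sub>R x + b \<notin> K"
      using assms(2) by (auto simp: image_iff dest!: bspec[where x = "s *\<^sub>R x + b"])
    then show "f (s *\<^sub>R x + b) = 0" by (rule K(2))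
  next
    show "Ck k (\<lambda>x. f (s *\<^sub>R x + b))" for k
      using assms(1) by (intro Ck_affine) (simp add: test_function_def)
  qed
qed

lemma test_function_partial:
  assumes "test_function f" shows "test_function (partial i f)"
proof -
  obtain K where K: "compact K" "\<And>x. x \<notin> K \<Longrightarrow> f x = 0" using test_functionE[OF assms] by blast
  show ?thesis
  proof (rule test_functionI[OF _ K(1)])
    show "Ck k (partial i f)" for k using assms unfolding test_function_def by (metis Ck.simps(2))
    fix x assume x: "x \<notin> K"
    have "eventually (\<lambda>y. y \<in> - K) (nhds x)"
      using x K(1) by (intro eventually_nhds_in_open) (auto intro: compact_imp_closed)
    then have ev: "eventually (\<lambda>y. f y = 0) (nhds x)" by eventually_elim (use K in auto)
    have "((\<lambda>_. 0) has_derivative (\<lambda>_. 0)) (at x)" by simp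
    then have "(f has_derivative (\<lambda>_. 0)) (at x)"
      by (rule has_derivative_transform_eventually)
         (use ev K(2)[OF x] in \<open>auto simp: eventually_at_filter elim: eventually_mono\<close>)
    from partial_eqI[OF this] show "partial i f x = 0" by simp
  qed
qed

lemma test_function_continuous: "test_function f \<Longrightarrow> continuous_on UNIV f"
  unfolding test_function_def using Ck_imp_continuous by blast

lemma test_function_borel[measurable_dest]: "test_function f \<Longrightarrow> f \<in> borel_measurable borel"
  by (rule borel_measurable_continuous_onI[OF test_function_continuous])

lemma test_function_bounded:
  assumes "test_function f" obtains B where "B > 0" "\<And>x. \<bar>f x\<bar> \<le> B"
proof -
  obtain K where K: "compact K" "\<And>x. x \<notin> K \<Longrightarrow> f x = 0" using test_functionE[OF assms] by blast
  have "compact (f ` K)"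
    by (rule compact_continuous_image[OF continuous_on_subset[OF test_function_continuous[OF assms]] K(1)]) auto
  then obtain B where "\<forall>y\<in>f ` K. norm y \<le> B"
    using compact_imp_bounded[of "f ` K"] unfolding bounded_iff by blast
  then have B: "\<And>x. x \<in> K \<Longrightarrow> \<bar>f x\<bar> \<le> B" by auto
  show ?thesis
  proof (rule that[of "\<bar>B\<bar> + 1"])
    show "\<bar>f x\<bar> \<le> \<bar>B\<bar> + 1" for x
      using B[of x] K(2)[of x] by (cases "x \<in> K") auto
  qed auto
qed

section \<open>Locally integrable functions and the fundamental lemma\<close>

lemma locally_integrable_borel:
  assumes "locally_integrable g" shows "g \<in> borel_measurable borel"
proof -
  have "(\<lambda>x. indicator (cball 0 (real n)) x *\<^sub>R g x) \<in> borel_measurable borel" for n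
  proof -
    have "integrable lborel (\<lambda>x. indicator (cball 0 (real n)) x *\<^sub>R g x)"
      using assms unfolding locally_integrable_def set_integrable_def by simp
    from borel_measurable_integrable[OF this] show ?thesis by simp
  qed
  moreover have "(\<lambda>n. indicator (cball 0 (real n)) x *\<^sub>R g x) \<longlonglongrightarrow> g x" for x
  proof (rule tendsto_eventually)
    obtain N where N: "norm x \<le> real N" using real_arch_simple[of "norm x"] by auto
    show "\<forall>\<^sub>F n in sequentially. indicator (cball 0 (real n)) x *\<^sub>R g x = g x"
      using eventually_ge_at_top[of N]
    proof eventually_elim
      case (elim n)
      then have "x \<in> cball 0 (real n)" using N by simp
      then show ?case by simp
    qed
  qed
  ultimately show ?thesis by (rule borel_measurable_LIMSEQ_metric)
qed

lemma locally_integrable_nth: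
  fixes G :: "plane \<Rightarrow> plane"
  assumes "locally_integrable G" shows "locally_integrable (\<lambda>x. G x $ i)"
  unfolding locally_integrable_def set_integrable_def
proof safe
  fix K :: "plane set" assume "compact K"
  then have "integrable lborel (\<lambda>x. indicator K x *\<^sub>R G x)"
    using assms by (simp add: locally_integrable_def set_integrable_def)
  from integrable_bounded_linear[OF bounded_linear_vec_nth[of i] this]
  show "integrable lborel (\<lambda>x. indicator K x *\<^sub>R G x $ i)" by simp
qed

lemma emeasure_compact_finite: "compact K \<Longrightarrow> emeasure lborel K < \<infinity>"
  for K :: "'a::euclidean_space set"
  using emeasure_bounded_finite compact_imp_bounded by blast

lemma indicator_L2:
  fixes K :: "'a::euclidean_space set"
  assumes "compact K" shows "indicator K \<in> L2 lborel"
proof -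
  have "(indicator K x :: real)\<^sup>2 = indicator K x" for x by (simp add: indicator_def)
  then show ?thesis
    using emeasure_compact_finite[OF assms] compact_imp_closed[OF assms]
    by (simp add: L2_def)
qed

lemma L2_locally_integrable:
  assumes "f \<in> L2 lborel" shows "locally_integrable f"
  unfolding locally_integrable_def set_integrable_def
  using L2_mult_integrable[OF indicator_L2 assms] by auto

lemma locally_integrable_mult_test:
  assumes g: "locally_integrable (g :: plane \<Rightarrow> real)" and f: "test_function f"
  shows "integrable lborel (\<lambda>x. g x * f x)"
proof -
  obtain K where K: "compact K" "\<And>x. x \<notin> K \<Longrightarrow> f x = 0" using test_functionE[OF f] by blast
  obtain B where B: "B > 0" "\<And>x. \<bar>f x\<bar> \<le> B" using test_function_bounded[OF f] by blast
  have i: "integrable lborel (\<lambda>x. B * (indicator K x *\<^sub>R g x))"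
    using g K(1) by (auto simp: locally_integrable_def set_integrable_def)
  show ?thesis
  proof (rule Bochner_Integration.integrable_bound[OF i])
    show "(\<lambda>x. g x * f x) \<in> borel_measurable lborel"
      using locally_integrable_borel[OF g] test_function_borel[OF f] by simp
    show "AE x in lborel. norm (g x * f x) \<le> norm (B * (indicator K x *\<^sub>R g x))"
    proof (rule AE_I2)
      fix x
      show "norm (g x * f x) \<le> norm (B * (indicator K x *\<^sub>R g x))"
        using K(2)[of x] B mult_right_mono[OF B(2)[of x], of "\<bar>g x\<bar>"]
        by (cases "x \<in> K") (auto simp: abs_mult mult.commute)
    qed
  qed
qed

lemma test_function_L2: assumes f: "test_function f" shows "f \<in> L2 lborel"
proof -
  have "locally_integrable f"
    unfolding locally_integrable_def set_integrable_def
  proof safe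
    fix K :: "plane set" assume K: "compact K"
    have "continuous_on K f" by (rule continuous_on_subset[OF test_function_continuous[OF f]]) simp
    from borel_integrable_compact[OF K this]
    show "integrable lborel (\<lambda>x. indicator K x *\<^sub>R f x)"
      by (simp add: indicator_def of_bool_def if_distrib cong: if_cong)
  qed
  from locally_integrable_mult_test[OF this f] show ?thesis
    using test_function_borel[OF f] by (auto simp: L2_def power2_eq_square)
qed

text \<open>
  The measures with densities the positive and the negative part of \<open>g\<close> agree on boxes, hence are equal.
\<close>

lemma integral_boxes_zero_imp_AE_zero:
  assumes g: "locally_integrable (g :: plane \<Rightarrow> real)"
    and z: "\<And>a b. (LINT x|lborel. g x * indicator (box a b) x) = 0"
  shows "AE x in lborel. g x = 0"
proof -
  have [measurable]: "g \<in> borel_measurable borel" by (rule locally_integrable_borel[OF g])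
  have gi: "integrable lborel (\<lambda>x. g x * indicator (box a b) x)" for a b
  proof (rule Bochner_Integration.integrable_bound)
    show "integrable lborel (\<lambda>x. indicator (cbox a b) x *\<^sub>R g x)"
      using g by (auto simp: locally_integrable_def set_integrable_def)
    show "AE x in lborel. norm (g x * indicator (box a b) x) \<le> norm (indicator (cbox a b) x *\<^sub>R g x)"
      using box_subset_cbox[of a b] by (auto simp: indicator_def)
  qed auto
  define M1 where "M1 = density lborel (\<lambda>x. ennreal (g x))"
  define M2 where "M2 = density lborel (\<lambda>x. ennreal (- g x))"
  have e1: "emeasure M1 (box a b) = (\<integral>\<^sup>+x. ennreal (g x * indicator (box a b) x) \<partial>lborel)" for a b
    unfolding M1_def by (subst emeasure_density) (auto intro!: nn_integral_cong simp: indicator_def)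
  have e2: "emeasure M2 (box a b) = (\<integral>\<^sup>+x. ennreal (- (g x * indicator (box a b) x)) \<partial>lborel)" for a b
    unfolding M2_def by (subst emeasure_density) (auto intro!: nn_integral_cong simp: indicator_def)
  have fin: "emeasure M1 (box a b) \<noteq> \<infinity>" "emeasure M2 (box a b) \<noteq> \<infinity>" for a b
    unfolding e1 e2 using real_integrable_def[of lborel "\<lambda>x. g x * indicator (box a b) x"] gi[of a b]
    by auto
  have eq: "emeasure M1 (box a b) = emeasure M2 (box a b)" for a b
  proof -
    have "enn2real (emeasure M1 (box a b)) = enn2real (emeasure M2 (box a b))"
      using z[of a b] real_lebesgue_integral_def[OF gi[of a b]] unfolding e1 e2 by simp
    then show ?thesis using fin[of a b]
      by (metis ennreal_enn2real_if infinity_ennreal_def)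
  qed
  have "M1 = M2"
  proof (rule measure_eqI_generator_eq)
    let ?E = "range (\<lambda>(a, b). box a b::plane set)"
    show "Int_stable ?E" by (auto simp: Int_stable_def box_Int_box)
    show "?E \<subseteq> Pow UNIV" "sets M1 = sigma_sets UNIV ?E" "sets M2 = sigma_sets UNIV ?E"
      by (simp_all add: borel_eq_box M1_def M2_def)
    let ?A = "\<lambda>n::nat. box (- (real n *\<^sub>R One)) (real n *\<^sub>R One) :: plane set"
    show "range ?A \<subseteq> ?E" "(\<Union>i. ?A i) = UNIV"
      unfolding UN_box_eq_UNIV by auto
    show "emeasure M1 (?A i) \<noteq> \<infinity>" for i by (rule fin)
    show "emeasure M1 X = emeasure M2 X" if "X \<in> ?E" for X using that eq by auto
  qed
  then have "AE x in lborel. ennreal (g x) = ennreal (- g x)"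
    unfolding M1_def M2_def by (subst (asm) sigma_finite_measure.density_unique_iff[OF sigma_finite_lborel]) auto
  then show ?thesis
  proof eventually_elim
    case (elim x)
    then show ?case by (cases "g x" "0::real" rule: linorder_cases) (auto simp: ennreal_neg)
  qed
qed

text \<open>
  Bumps are test functions and converge boundedly to the indicator of a box, so the integral of \<open>g\<close> over
  every box vanishes.
\<close>

lemma fundamental_lemma:
  assumes g: "locally_integrable (g :: plane \<Rightarrow> real)"
    and z: "\<And>\<phi>. test_function \<phi> \<Longrightarrow> (LINT x|lborel. g x * \<phi> x) = 0"
  shows "AE x in lborel. g x = 0"
proof (rule integral_boxes_zero_imp_AE_zero[OF g])
  fix a b :: plane
  have [measurable]: "g \<in> borel_measurable borel" by (rule locally_integrable_borel[OF g])
  have m: "bump m a b \<in> borel_measurable borel" for m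
    by (rule borel_measurable_continuous_onI[OF Ck_imp_continuous[OF Ck_bump[of 0]]])
  have "(\<lambda>n. LINT x|lborel. g x * bump (real (Suc n)) a b x) \<longlonglongrightarrow> (LINT x|lborel. g x * indicator (box a b) x)"
  proof (rule integral_dominated_convergence)
    show "integrable lborel (\<lambda>x. norm (indicator (cbox a b) x *\<^sub>R g x))"
      using g by (auto simp: locally_integrable_def set_integrable_def)
    show "AE x in lborel. norm (g x * bump (real (Suc n)) a b x) \<le> norm (indicator (cbox a b) x *\<^sub>R g x)" for n
    proof (rule AE_I2)
      fix x
      show "norm (g x * bump (real (Suc n)) a b x) \<le> norm (indicator (cbox a b) x *\<^sub>R g x)"
        using box_subset_cbox[of a b] bump_le_1[of "real (Suc n)" a b x] bump_nonneg[of "real (Suc n)" a b x] bump_eq_0[of "real (Suc n)" x a b]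
        by (cases "x \<in> box a b") (auto simp: abs_mult mult_left_le subset_iff)
    qed
    show "AE x in lborel. (\<lambda>n. g x * bump (real (Suc n)) a b x) \<longlonglongrightarrow> g x * indicator (box a b) x"
      by (intro AE_I2 tendsto_mult tendsto_const bump_tendsto)
  qed (use m in auto)
  moreover have "(LINT x|lborel. g x * bump (real (Suc n)) a b x) = 0" for n
    by (rule z[OF test_function_bump]) simp
  ultimately show "(LINT x|lborel. g x * indicator (box a b) x) = 0"
    by (simp add: LIMSEQ_const_iff)
qed

lemma weak_gradient_unique:
  assumes "has_weak_gradient u G" "has_weak_gradient u H"
  shows "AE x in lborel. G x = H x"
proof -
  have c: "AE x in lborel. G x $ i = H x $ i" for i
  proof -
    have "locally_integrable (\<lambda>x. G x $ i)" "locally_integrable (\<lambda>x. H x $ i)"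
      using assms by (auto simp: has_weak_gradient_def intro: locally_integrable_nth)
    note l = this
    have "AE x in lborel. G x $ i - H x $ i = 0"
    proof (rule fundamental_lemma)
      show "locally_integrable (\<lambda>x. G x $ i - H x $ i)"
        using l by (auto simp: locally_integrable_def intro!: set_integral_diff)
      fix \<phi> assume t: "test_function \<phi>"
      show "(LINT x|lborel. (G x $ i - H x $ i) * \<phi> x) = 0"
        using locally_integrable_mult_test[OF l(1) t] locally_integrable_mult_test[OF l(2) t] assms t
        by (auto simp: left_diff_distrib has_weak_gradient_def)
    qed
    then show ?thesis by simp
  qed
  show ?thesis using c[of 1] c[of 2] by eventually_elim (simp add: vec_eq_iff forall_2)
qed

section \<open>Weak derivatives in \<open>L\<^sup>2\<close>\<close>

abbreviation nrm :: "(plane \<Rightarrow> real) \<Rightarrow> real" where "nrm \<equiv> nrm2 lborel"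
abbreviation L2p :: "(plane \<Rightarrow> real) set" where "L2p \<equiv> L2 lborel"

definition wpart :: "2 \<Rightarrow> (plane \<Rightarrow> real) \<Rightarrow> plane \<Rightarrow> real" where
  "wpart i u = (\<lambda>x. weak_gradient u x $ i)"

lemma norm2_plane: "(norm (x::plane))\<^sup>2 = (x $ 1)\<^sup>2 + (x $ 2)\<^sup>2"
  by (simp add: norm_vec_def L2_set_def sum_2)

lemma L2_cong_AE: "f \<in> L2 M \<Longrightarrow> g \<in> borel_measurable M \<Longrightarrow> AE x in M. f x = g x \<Longrightarrow> g \<in> L2 M"
  unfolding L2_def
  by (auto intro: integrable_cong_AE_imp[where g = "\<lambda>x. (f x)\<^sup>2"] elim: AE_mp)

lemma nrm2_cong_AE: "f \<in> borel_measurable M \<Longrightarrow> g \<in> borel_measurable M \<Longrightarrow> AE x in M. f x = g x \<Longrightarrow> nrm2 M f = nrm2 M g"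
  unfolding nrm2_def by (subst integral_cong_AE[where g = "\<lambda>x. (g x)\<^sup>2"]) auto

lemma has_weak_gradientI:
  fixes g :: "2 \<Rightarrow> plane \<Rightarrow> real"
  assumes u: "u \<in> L2p" and g: "\<And>i. g i \<in> L2p"
    and w: "\<And>i \<phi>. test_function \<phi> \<Longrightarrow> (LINT x|lborel. u x * partial i \<phi> x) = - (LINT x|lborel. g i x * \<phi> x)"
  shows "has_weak_gradient u (\<lambda>x. \<Sum>i\<in>UNIV. g i x *\<^sub>R axis i 1)"
  unfolding has_weak_gradient_def
proof (intro conjI allI impI)
  show "locally_integrable u" by (rule L2_locally_integrable[OF u])
  show "locally_integrable (\<lambda>x. \<Sum>i\<in>UNIV. g i x *\<^sub>R axis i (1::real))"
    unfolding locally_integrable_def set_integrable_def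
  proof safe
    fix K :: "plane set" assume "compact K"
    then have "integrable lborel (\<lambda>x. indicator K x *\<^sub>R g i x)" for i
      using L2_locally_integrable[OF g] by (auto simp: locally_integrable_def set_integrable_def)
    then have "integrable lborel (\<lambda>x. \<Sum>i\<in>UNIV. (indicator K x *\<^sub>R g i x) *\<^sub>R axis i (1::real))"
      by (intro Bochner_Integration.integrable_sum integrable_scaleR_left)
    then show "integrable lborel (\<lambda>x. indicator K x *\<^sub>R (\<Sum>i\<in>UNIV. g i x *\<^sub>R axis i (1::real)))"
      by (simp add: scaleR_sum_right)
  qed
  fix \<phi> i assume t: "test_function \<phi>"
  have "(\<Sum>j\<in>UNIV. g j x *\<^sub>R axis j (1::real)) $ i = g i x" for x
    by (simp add: axis_def if_distrib cong: if_cong)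
  then show "(LINT x|lborel. u x * partial i \<phi> x) = - (LINT x|lborel. (\<Sum>i\<in>UNIV. g i x *\<^sub>R axis i 1) $ i * \<phi> x)"
    using w[OF t, of i] by simp
qed

text \<open>
  The weak gradient is chosen by description from the class of all weak gradients. This lemma is the way
  to compute it: partial derivatives found in any manner agree with it almost everywhere.
\<close>

lemma H1I:
  fixes g :: "2 \<Rightarrow> plane \<Rightarrow> real"
  assumes u: "u \<in> L2p" and g: "\<And>i. g i \<in> L2p"
    and w: "\<And>i \<phi>. test_function \<phi> \<Longrightarrow> (LINT x|lborel. u x * partial i \<phi> x) = - (LINT x|lborel. g i x * \<phi> x)"
  shows "u \<in> H1" "AE x in lborel. wpart i u x = g i x"
proof -
  let ?G = "\<lambda>x. \<Sum>i\<in>UNIV. g i x *\<^sub>R axis i (1::real) :: plane"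
  have c: "?G x $ i = g i x" for x i
    by (simp add: axis_def if_distrib cong: if_cong)
  have h: "has_weak_gradient u ?G" by (rule has_weak_gradientI[OF assms])
  have "(norm (?G x))\<^sup>2 = (g 1 x)\<^sup>2 + (g 2 x)\<^sup>2" for x
    unfolding norm2_plane c ..
  then have "integrable lborel (\<lambda>x. (norm (?G x))\<^sup>2)"
    using L2_int[OF g[of 1]] L2_int[OF g[of 2]] by simp
  then show "u \<in> H1" using u h by (auto simp: H1_def L2_def)
  have "has_weak_gradient u (weak_gradient u)"
    unfolding weak_gradient_def using h by (rule someI[of "has_weak_gradient u"])
  from weak_gradient_unique[OF this h] show "AE x in lborel. wpart i u x = g i x"
  proof eventually_elim
    case (elim x)
    then show ?case unfolding wpart_def using c by simp
  qed
qed

lemma H1_L2: "u \<in> H1 \<Longrightarrow> u \<in> L2p"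
  by (auto simp: H1_def L2_def)

lemma H1_has_weak_gradient: "u \<in> H1 \<Longrightarrow> has_weak_gradient u (weak_gradient u)"
  unfolding weak_gradient_def by (auto simp: H1_def intro: someI[of "has_weak_gradient u"])

lemma wpart_borel: "u \<in> H1 \<Longrightarrow> wpart i u \<in> borel_measurable borel"
  using H1_has_weak_gradient[of u] locally_integrable_borel[OF locally_integrable_nth, of "weak_gradient u" i]
  by (auto simp: wpart_def has_weak_gradient_def)

lemma wpart_L2: assumes "u \<in> H1" shows "wpart i u \<in> L2p"
proof -
  obtain G where G: "has_weak_gradient u G" "integrable lborel (\<lambda>x. (norm (G x))\<^sup>2)"
    using assms by (auto simp: H1_def)
  have [measurable]: "(\<lambda>x. G x $ i) \<in> borel_measurable borel" for i
    using G(1) locally_integrable_borel[OF locally_integrable_nth, of G i] by (auto simp: has_weak_gradient_def)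
  have "(\<lambda>x. G x $ i) \<in> L2p"
  proof (rule L2_bounded_by[OF _ G(2)])
    show "(G x $ i)\<^sup>2 \<le> (norm (G x))\<^sup>2" for x
      using component_le_norm_cart[of "G x" i] by (metis abs_ge_zero power2_abs power_mono)
  qed simp
  then show ?thesis
  proof (rule L2_cong_AE)
    show "wpart i u \<in> borel_measurable lborel" using wpart_borel[OF assms] by simp
    show "AE x in lborel. G x $ i = wpart i u x"
      using weak_gradient_unique[OF G(1) H1_has_weak_gradient[OF assms]]
      by eventually_elim (simp add: wpart_def)
  qed
qed

lemma wpart_test: "u \<in> H1 \<Longrightarrow> test_function \<phi> \<Longrightarrow> (LINT x|lborel. u x * partial i \<phi> x) = - (LINT x|lborel. wpart i u x * \<phi> x)"
  using H1_has_weak_gradient[of u] by (auto simp: has_weak_gradient_def wpart_def)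

lemma A_fun_eq: assumes "u \<in> H1" shows "A_fun u = (nrm (wpart 1 u))\<^sup>2 + (nrm (wpart 2 u))\<^sup>2"
  unfolding A_fun_def norm2_plane nrm2_sq
  using L2_int[OF wpart_L2[OF assms, of 1]] L2_int[OF wpart_L2[OF assms, of 2]] by (simp add: wpart_def)

lemma grad_sq_integrable: assumes "u \<in> H1" shows "integrable lborel (\<lambda>x. (norm (weak_gradient u x))\<^sup>2)"
  unfolding norm2_plane
  using L2_int[OF wpart_L2[OF assms, of 1]] L2_int[OF wpart_L2[OF assms, of 2]] by (simp add: wpart_def)

lemma A_fun_nonneg[simp]: "0 \<le> A_fun u"
  by (simp add: A_fun_def)

lemma L2_mult_test_integrable:
  assumes "u \<in> L2p" "test_function \<phi>" shows "integrable lborel (\<lambda>x. u x * \<phi> x)"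
  by (rule L2_mult_integrable[OF assms(1) test_function_L2[OF assms(2)]])

lemma H1_add:
  assumes "u \<in> H1" "v \<in> H1"
  shows "(\<lambda>x. u x + v x) \<in> H1" "AE x in lborel. wpart i (\<lambda>x. u x + v x) x = wpart i u x + wpart i v x"
proof -
  have "(LINT x|lborel. (u x + v x) * partial i \<phi> x) = - (LINT x|lborel. (wpart i u x + wpart i v x) * \<phi> x)"
    if t: "test_function \<phi>" for \<phi> and i :: 2
    using wpart_test[OF assms(1) t, of i] wpart_test[OF assms(2) t, of i]
      L2_mult_test_integrable[OF H1_L2[OF assms(1)] test_function_partial[OF t]]
      L2_mult_test_integrable[OF H1_L2[OF assms(2)] test_function_partial[OF t]]
      L2_mult_test_integrable[OF wpart_L2[OF assms(1)] t] L2_mult_test_integrable[OF wpart_L2[OF assms(2)] t]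
    by (simp add: distrib_right)
  note * = H1I[where u = "\<lambda>x. u x + v x" and g = "\<lambda>i x. wpart i u x + wpart i v x", OF L2_add[OF H1_L2 H1_L2] L2_add[OF wpart_L2 wpart_L2] this, OF assms assms]
  from * show "(\<lambda>x. u x + v x) \<in> H1" "AE x in lborel. wpart i (\<lambda>x. u x + v x) x = wpart i u x + wpart i v x" by auto
qed

lemma H1_cmult:
  assumes "u \<in> H1"
  shows "(\<lambda>x. c * u x) \<in> H1" "AE x in lborel. wpart i (\<lambda>x. c * u x) x = c * wpart i u x"
proof -
  have "(LINT x|lborel. (c * u x) * partial i \<phi> x) = - (LINT x|lborel. (c * wpart i u x) * \<phi> x)"
    if t: "test_function \<phi>" for \<phi> and i :: 2
    using wpart_test[OF assms(1) t, of i] by (simp add: mult.assoc)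
  note * = H1I[where u = "\<lambda>x. c * u x" and g = "\<lambda>i x. c * wpart i u x", OF L2_cmult[OF H1_L2] L2_cmult[OF wpart_L2] this, OF assms assms]
  from * show "(\<lambda>x. c * u x) \<in> H1" "AE x in lborel. wpart i (\<lambda>x. c * u x) x = c * wpart i u x" by auto
qed

lemma H1_diff:
  assumes "u \<in> H1" "v \<in> H1"
  shows "(\<lambda>x. u x - v x) \<in> H1" "AE x in lborel. wpart i (\<lambda>x. u x - v x) x = wpart i u x - wpart i v x"
proof -
  note m = H1_cmult[OF assms(2), where c = "-1"]
  note a = H1_add[OF assms(1) m(1)]
  show "(\<lambda>x. u x - v x) \<in> H1" using a(1) by simp
  show "AE x in lborel. wpart i (\<lambda>x. u x - v x) x = wpart i u x - wpart i v x"
    using a(2)[of i] m(2)[of i] by eventually_elim simp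
qed

lemma L2_affine:
  assumes "f \<in> L2p" "s \<noteq> 0"
  shows "(\<lambda>x. f (s *\<^sub>R x + b)) \<in> L2p" "nrm (\<lambda>x. f (s *\<^sub>R x + b)) = nrm f / \<bar>s\<bar>"
proof -
  have [measurable]: "f \<in> borel_measurable borel" using assms(1) by (simp add: L2_def)
  have m: "(\<lambda>x. (f x)\<^sup>2) \<in> borel_measurable borel" by measurable
  show "(\<lambda>x. f (s *\<^sub>R x + b)) \<in> L2p"
    using lborel_integrable_affine[OF m assms(2), of b] assms(1) by (auto simp: L2_def)
  show "nrm (\<lambda>x. f (s *\<^sub>R x + b)) = nrm f / \<bar>s\<bar>"
    unfolding nrm2_def lborel_integral_affine[OF m assms(2), of b]
    by (simp add: real_sqrt_divide)
qed

lemma H1_affine: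
  assumes "u \<in> H1" "s \<noteq> 0"
  shows "(\<lambda>x. u (s *\<^sub>R x + b)) \<in> H1"
    "AE x in lborel. wpart i (\<lambda>x. u (s *\<^sub>R x + b)) x = s * wpart i u (s *\<^sub>R x + b)"
proof -
  have "(LINT x|lborel. u (s *\<^sub>R x + b) * partial i \<phi> x) = - (LINT x|lborel. (s * wpart i u (s *\<^sub>R x + b)) * \<phi> x)"
    if t: "test_function \<phi>" for \<phi> and i :: 2
  proof -
    define \<psi> where "\<psi> = (\<lambda>x. \<phi> ((1/s) *\<^sub>R x + (- (1/s) *\<^sub>R b)))"
    have tp: "test_function \<psi>" unfolding \<psi>_def using assms(2) by (intro test_function_affine[OF t]) simp
    have e: "\<psi> (s *\<^sub>R x + b) = \<phi> x" for x using assms(2) by (simp add: \<psi>_def algebra_simps)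
    have pe: "partial i \<psi> (s *\<^sub>R x + b) = (1/s) * partial i \<phi> x" for x
      unfolding \<psi>_def using assms(2) by (subst partial_affine[OF test_function_differentiable[OF t]]) (simp add: algebra_simps)
    have [measurable]: "u \<in> borel_measurable borel" "wpart i u \<in> borel_measurable borel"
      "\<psi> \<in> borel_measurable borel" "partial i \<psi> \<in> borel_measurable borel"
      using H1_L2[OF assms(1)] wpart_borel[OF assms(1)] test_function_borel[OF tp] test_function_borel[OF test_function_partial[OF tp]]
      by (auto simp: L2_def)
    have "(LINT x|lborel. u (s *\<^sub>R x + b) * ((1/s) * partial i \<phi> x)) = (LINT x|lborel. u x * partial i \<psi> x) / \<bar>s\<bar> ^ DIM(plane)"
      unfolding pe[symmetric] by (rule lborel_integral_affine[where f = "\<lambda>x. u x * partial i \<psi> x", OF _ assms(2)]) measurable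
    also have "\<dots> = - ((LINT x|lborel. wpart i u x * \<psi> x) / \<bar>s\<bar> ^ DIM(plane))"
      by (simp add: wpart_test[OF assms(1) tp])
    also have "(LINT x|lborel. wpart i u x * \<psi> x) / \<bar>s\<bar> ^ DIM(plane) = (LINT x|lborel. wpart i u (s *\<^sub>R x + b) * \<phi> x)"
      unfolding e[symmetric] by (rule lborel_integral_affine[where f = "\<lambda>x. wpart i u x * \<psi> x", OF _ assms(2), symmetric]) measurable
    finally have "s * ((1/s) * (LINT x|lborel. u (s *\<^sub>R x + b) * partial i \<phi> x)) = s * - (LINT x|lborel. wpart i u (s *\<^sub>R x + b) * \<phi> x)"
      by (simp add: mult.left_commute)
    then show ?thesis using assms(2) by (simp add: mult.assoc)
  qed
  note * = H1I[where u = "\<lambda>x. u (s *\<^sub>R x + b)" and g = "\<lambda>i x. s * wpart i u (s *\<^sub>R x + b)",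
      OF L2_affine(1)[OF H1_L2[OF assms(1)] assms(2)] L2_cmult[OF L2_affine(1)[OF wpart_L2[OF assms(1)] assms(2)]] this]
  from * show "(\<lambda>x. u (s *\<^sub>R x + b)) \<in> H1"
    "AE x in lborel. wpart i (\<lambda>x. u (s *\<^sub>R x + b)) x = s * wpart i u (s *\<^sub>R x + b)" by auto
qed

lemma wpart_borel_lborel: "u \<in> H1 \<Longrightarrow> wpart i u \<in> borel_measurable lborel"
  using wpart_borel by simp

lemma A_fun_cmult: assumes "u \<in> H1" shows "A_fun (\<lambda>x. c * u x) = c\<^sup>2 * A_fun u"
proof -
  have "nrm (wpart i (\<lambda>x. c * u x)) = nrm (\<lambda>x. c * wpart i u x)" for i
    using wpart_borel[OF assms, of i]
    by (intro nrm2_cong_AE wpart_borel_lborel H1_cmult assms) simp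
  then show ?thesis
    unfolding A_fun_eq[OF assms] A_fun_eq[OF H1_cmult(1)[OF assms]]
    by (simp add: nrm2_cmult power_mult_distrib distrib_left)
qed

lemma A_fun_affine: assumes "u \<in> H1" "s \<noteq> 0" shows "A_fun (\<lambda>x. u (s *\<^sub>R x + b)) = A_fun u"
proof -
  have "nrm (wpart i (\<lambda>x. u (s *\<^sub>R x + b))) = nrm (\<lambda>x. s * wpart i u (s *\<^sub>R x + b))" for i
    using L2_meas[OF L2_cmult[OF L2_affine(1)[OF wpart_L2[OF assms(1)] assms(2)]]]
    by (intro nrm2_cong_AE wpart_borel_lborel H1_affine assms)
  then show ?thesis
    unfolding A_fun_eq[OF assms(1)] A_fun_eq[OF H1_affine(1)[OF assms]]
    using assms(2) by (simp add: nrm2_cmult L2_affine(2)[OF wpart_L2[OF assms(1)] assms(2)])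
qed

text \<open>
  The inner product belonging to the quadratic form \<open>A_fun\<close>.
\<close>

definition dirichlet :: "(plane \<Rightarrow> real) \<Rightarrow> (plane \<Rightarrow> real) \<Rightarrow> real" where
  "dirichlet u v = (LINT x|lborel. wpart 1 u x * wpart 1 v x) + (LINT x|lborel. wpart 2 u x * wpart 2 v x)"

lemma A_fun_add:
  assumes "u \<in> H1" "v \<in> H1"
  shows "A_fun (\<lambda>x. u x + v x) = A_fun u + 2 * dirichlet u v + A_fun v"
proof -
  have "(nrm (wpart i (\<lambda>x. u x + v x)))\<^sup>2 = (nrm (wpart i u))\<^sup>2 + 2 * (LINT x|lborel. wpart i u x * wpart i v x) + (nrm (wpart i v))\<^sup>2" for i
  proof -
    have "nrm (wpart i (\<lambda>x. u x + v x)) = nrm (\<lambda>x. wpart i u x + wpart i v x)"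
      using wpart_borel[OF assms(1), of i] wpart_borel[OF assms(2), of i]
      by (intro nrm2_cong_AE wpart_borel_lborel H1_add assms) simp
    then have "(nrm (wpart i (\<lambda>x. u x + v x)))\<^sup>2 = (LINT x|lborel. (wpart i u x + wpart i v x)\<^sup>2)"
      by (simp add: nrm2_sq)
    then show ?thesis
      using L2_mult_integrable[OF wpart_L2[OF assms(1)] wpart_L2[OF assms(2)], of i i] L2_int[OF wpart_L2[OF assms(1)], of i] L2_int[OF wpart_L2[OF assms(2)], of i]
      by (simp add: nrm2_sq power2_sum mult.assoc)
  qed
  then show ?thesis
    unfolding A_fun_eq[OF assms(1)] A_fun_eq[OF assms(2)] A_fun_eq[OF H1_add(1)[OF assms]] dirichlet_def by simp
qed

lemma dirichlet_add: assumes "u \<in> H1" "v \<in> H1" "w \<in> H1"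
  shows "dirichlet u (\<lambda>x. v x + w x) = dirichlet u v + dirichlet u w"
proof -
  have "(LINT x|lborel. wpart i u x * wpart i (\<lambda>x. v x + w x) x) = (LINT x|lborel. wpart i u x * wpart i v x + wpart i u x * wpart i w x)" for i
  proof (rule integral_cong_AE)
    show "AE x in lborel. wpart i u x * wpart i (\<lambda>x. v x + w x) x = wpart i u x * wpart i v x + wpart i u x * wpart i w x"
      using H1_add(2)[OF assms(2,3), of i] by eventually_elim (simp add: distrib_left)
  qed (use wpart_borel[OF assms(1)] wpart_borel[OF assms(2)] wpart_borel[OF assms(3)] wpart_borel[OF H1_add(1)[OF assms(2,3)]] in auto)
  then show ?thesis
    using L2_mult_integrable[OF wpart_L2[OF assms(1)] wpart_L2[OF assms(2)]] L2_mult_integrable[OF wpart_L2[OF assms(1)] wpart_L2[OF assms(3)]]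
    by (simp add: dirichlet_def)
qed

lemma dirichlet_cmult: assumes "u \<in> H1" "v \<in> H1"
  shows "dirichlet u (\<lambda>x. c * v x) = c * dirichlet u v"
proof -
  have "(LINT x|lborel. wpart i u x * wpart i (\<lambda>x. c * v x) x) = (LINT x|lborel. c * (wpart i u x * wpart i v x))" for i
  proof (rule integral_cong_AE)
    show "AE x in lborel. wpart i u x * wpart i (\<lambda>x. c * v x) x = c * (wpart i u x * wpart i v x)"
      using H1_cmult(2)[OF assms(2), of i c] by eventually_elim simp
  qed (use wpart_borel[OF assms(1)] wpart_borel[OF assms(2)] wpart_borel[OF H1_cmult(1)[OF assms(2)]] in auto)
  then show ?thesis by (simp add: dirichlet_def distrib_left)
qed

lemma nrm_wpart_le: "u \<in> H1 \<Longrightarrow> nrm (wpart i u) \<le> sqrt (A_fun u)"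
  using exhaust_2[of i] by (auto intro!: real_le_rsqrt simp: A_fun_eq)

lemma A_fun_parallelogram:
  assumes "u \<in> H1" "v \<in> H1"
  shows "A_fun (\<lambda>x. u x - v x) = 2 * A_fun u + 2 * A_fun v - 4 * A_fun (\<lambda>x. (1/2) * (u x + v x))"
proof -
  have m: "(\<lambda>x. -1 * v x) \<in> H1" by (rule H1_cmult(1)[OF assms(2)])
  have "A_fun (\<lambda>x. u x - v x) = A_fun (\<lambda>x. u x + (-1) * v x)" by simp
  also have "\<dots> = A_fun u - 2 * dirichlet u v + A_fun v"
    unfolding A_fun_add[OF assms(1) m] A_fun_cmult[OF assms(2)] dirichlet_cmult[OF assms] by simp
  finally show ?thesis
    unfolding A_fun_cmult[OF H1_add(1)[OF assms]] A_fun_add[OF assms] by (simp add: power2_eq_square field_simps)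
qed

section \<open>Continuity of translations\<close>

definition L1_transl_cont :: "('a::euclidean_space \<Rightarrow> real) \<Rightarrow> bool" where
  "L1_transl_cont f \<longleftrightarrow> (\<forall>h. h \<longlonglongrightarrow> 0 \<longrightarrow> (\<lambda>n::nat. LINT x|lborel. \<bar>f (x + h n) - f x\<bar>) \<longlonglongrightarrow> 0)"

lemma lborel_integral_translate:
  fixes f :: "'a::euclidean_space \<Rightarrow> real"
  assumes "f \<in> borel_measurable borel"
  shows "(LINT x|lborel. f (x + b)) = (LINT x|lborel. f x)"
  using lborel_integral_affine[OF assms, of 1 b] by simp

lemma lborel_integrable_translate:
  fixes f :: "'a::euclidean_space \<Rightarrow> real"
  assumes "f \<in> borel_measurable borel"
  shows "integrable lborel (\<lambda>x. f (x + b)) \<longleftrightarrow> integrable lborel f"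
  using lborel_integrable_affine[OF assms, of 1 b] by simp

lemma L1_transl_cont_approx:
  fixes f :: "'a::euclidean_space \<Rightarrow> real"
  assumes f: "integrable lborel f"
    and ap: "\<And>e. e > 0 \<Longrightarrow> \<exists>g. integrable lborel g \<and> L1_transl_cont g \<and> (LINT x|lborel. \<bar>f x - g x\<bar>) < e"
  shows "L1_transl_cont f"
  unfolding L1_transl_cont_def
proof (intro allI impI)
  fix h :: "nat \<Rightarrow> 'a" assume h: "h \<longlonglongrightarrow> 0"
  show "(\<lambda>n::nat. LINT x|lborel. \<bar>f (x + h n) - f x\<bar>) \<longlonglongrightarrow> 0"
  proof (rule LIMSEQ_I)
    fix e :: real assume e: "e > 0"
    obtain g where g: "integrable lborel g" "L1_transl_cont g" "(LINT x|lborel. \<bar>f x - g x\<bar>) < e / 3"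
      using ap[of "e/3"] e by auto
    have [measurable]: "f \<in> borel_measurable borel" "g \<in> borel_measurable borel"
      using borel_measurable_integrable[OF f] borel_measurable_integrable[OF g(1)] by auto
    have fi: "integrable lborel (\<lambda>x. f (x + b))" "integrable lborel (\<lambda>x. g (x + b))" for b
      using f g(1) by (auto simp: lborel_integrable_translate)
    have "(\<lambda>n. LINT x|lborel. \<bar>g (x + h n) - g x\<bar>) \<longlonglongrightarrow> 0"
      using g(2) h by (auto simp: L1_transl_cont_def)
    then obtain N where N: "\<And>n. n \<ge> N \<Longrightarrow> norm ((LINT x|lborel. \<bar>g (x + h n) - g x\<bar>) - 0) < e / 3"
      using LIMSEQ_D[of _ 0 "e/3"] e by force
    have "norm ((LINT x|lborel. \<bar>f (x + h n) - f x\<bar>) - 0) < e" if "n \<ge> N" for n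
    proof -
      have "(LINT x|lborel. \<bar>f (x + h n) - f x\<bar>) \<le>
        (LINT x|lborel. \<bar>f (x + h n) - g (x + h n)\<bar> + \<bar>g (x + h n) - g x\<bar> + \<bar>f x - g x\<bar>)"
        using fi f g(1) by (intro integral_mono) auto
      also have "\<dots> = (LINT x|lborel. \<bar>f (x + h n) - g (x + h n)\<bar>) + (LINT x|lborel. \<bar>g (x + h n) - g x\<bar>) + (LINT x|lborel. \<bar>f x - g x\<bar>)"
        using fi f g(1) by simp
      also have "(LINT x|lborel. \<bar>f (x + h n) - g (x + h n)\<bar>) = (LINT x|lborel. \<bar>f x - g x\<bar>)"
        by (rule lborel_integral_translate[where f = "\<lambda>x. \<bar>f x - g x\<bar>"]) measurable
      finally show ?thesis using N[OF that] g(3) by simp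
    qed
    then show "\<exists>N. \<forall>n\<ge>N. norm ((LINT x|lborel. \<bar>f (x + h n) - f x\<bar>) - 0) < e" by blast
  qed
qed

text \<open>
  For \<open>x\<close> in an open set \<open>U\<close> the translates \<open>x + h\<close> finally lie in \<open>U\<close>, so the measure of
  \<open>U \<inter> (U - h)\<close> tends to that of \<open>U\<close> by dominated convergence. Since \<open>U\<close> and
  \<open>U - h\<close> have the same measure, the part of either set outside the other becomes small as well.
\<close>

lemma L1_transl_cont_open:
  fixes U :: "'a::euclidean_space set"
  assumes U: "open U" "emeasure lborel U < \<infinity>"
  shows "L1_transl_cont (indicator U)"
  unfolding L1_transl_cont_def
proof (intro allI impI)
  fix h :: "nat \<Rightarrow> 'a" assume h: "h \<longlonglongrightarrow> 0"
  have [measurable]: "U \<in> sets borel" using U(1) by simp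
  have iU: "integrable lborel (indicator U :: _ \<Rightarrow> real)" using U by (simp add: integrable_real_indicator)
  have iT: "integrable lborel (\<lambda>x. indicator U (x + b) :: real)" for b
    using iU by (subst lborel_integrable_translate) auto
  have i2: "integrable lborel (\<lambda>x. indicator U (x + b) * indicator U x :: real)" for b
    by (rule Bochner_Integration.integrable_bound[OF iU]) (auto simp: indicator_def)
  have lim: "(\<lambda>n. LINT x|lborel. indicator U (x + h n) * indicator U x :: real) \<longlonglongrightarrow> (LINT x|lborel. indicator U x)"
  proof (rule integral_dominated_convergence[OF _ _ iU])
    show "AE x in lborel. (\<lambda>n. indicator U (x + h n) * indicator U x :: real) \<longlonglongrightarrow> indicator U x"
    proof (rule AE_I2, cases)
      fix x assume x: "x \<in> U"
      have "(\<lambda>n. x + h n) \<longlonglongrightarrow> x" using tendsto_add[OF tendsto_const h, of x] by simp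
      then have "\<forall>\<^sub>F n in sequentially. x + h n \<in> U"
        using U(1) x by (simp add: tendsto_def)
      then have "\<forall>\<^sub>F n in sequentially. indicator U (x + h n) * indicator U x = (1 :: real)"
        by eventually_elim (use x in simp)
      then show "(\<lambda>n. indicator U (x + h n) * indicator U x :: real) \<longlonglongrightarrow> indicator U x"
        using x by (simp add: tendsto_eventually)
    next
      fix x assume "x \<notin> U"
      then show "(\<lambda>n. indicator U (x + h n) * indicator U x :: real) \<longlonglongrightarrow> indicator U x" by simp
    qed
  qed (auto simp: indicator_def)
  have "(LINT x|lborel. \<bar>indicator U (x + h n) - indicator U x\<bar>) =
    2 * (LINT x|lborel. indicator U x) - 2 * (LINT x|lborel. indicator U (x + h n) * indicator U x :: real)" for n
  proof -
    have "(LINT x|lborel. \<bar>indicator U (x + h n) - indicator U x :: real\<bar>) =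
      (LINT x|lborel. indicator U (x + h n) + indicator U x - 2 * (indicator U (x + h n) * indicator U x :: real))"
      by (rule Bochner_Integration.integral_cong) (auto simp: indicator_def)
    also have "\<dots> = (LINT x|lborel. indicator U (x + h n) :: real) + (LINT x|lborel. indicator U x) - 2 * (LINT x|lborel. indicator U (x + h n) * indicator U x :: real)"
      using iU iT i2 by simp
    also have "(LINT x|lborel. indicator U (x + h n) :: real) = (LINT x|lborel. indicator U x)"
      by (rule lborel_integral_translate) measurable
    finally show ?thesis by simp
  qed
  then show "(\<lambda>n::nat. LINT x|lborel. \<bar>indicator U (x + h n) - indicator U x :: real\<bar>) \<longlonglongrightarrow> 0"
    using tendsto_diff[OF tendsto_const[of "2 * (LINT x|lborel. indicator U x :: real)"] tendsto_mult[OF tendsto_const[of 2] lim]] by simp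
qed

text \<open>
  Indicators of sets of finite measure are close in \<open>L\<^sup>1\<close> to those of open sets, and every integrable
  function is close to a linear combination of indicators.
\<close>

lemma L1_transl_cont_integrable:
  fixes f :: "'a::euclidean_space \<Rightarrow> real"
  assumes "integrable lborel f"
  shows "L1_transl_cont f"
  using assms
proof (induct rule: integrable_induct)
  case (base A c)
  have [measurable]: "A \<in> sets borel" using base by simp
  have "L1_transl_cont (indicator A :: 'a \<Rightarrow> real)"
  proof (rule L1_transl_cont_approx)
    show iA: "integrable lborel (indicator A :: 'a \<Rightarrow> real)" using base by (simp add: integrable_real_indicator)
    fix e :: real assume "e > 0"
    then obtain U where U: "open U" "A \<subseteq> U" "emeasure lborel (U - A) < e"
      using outer_regular_lborel[of A e] by auto
    have [measurable]: "U \<in> sets borel" using U(1) by simp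
    have "emeasure lborel U = emeasure lborel A + emeasure lborel (U - A)"
      using U(2) by (subst plus_emeasure) (auto simp: Un_absorb1)
    also have "\<dots> < \<infinity>" using base(2) U(3) by (auto simp: less_top[symmetric])
    finally have fU: "emeasure lborel U < \<infinity>" .
    have "(LINT x|lborel. \<bar>indicator A x - indicator U x :: real\<bar>) = (LINT x|lborel. indicator (U - A) x)"
      using U(2) by (intro Bochner_Integration.integral_cong) (auto simp: indicator_def)
    also have "\<dots> = measure lborel (U - A)" by simp
    also have "\<dots> < e" using U(3) \<open>e > 0\<close>
      by (metis emeasure_eq_ennreal_measure ennreal_less_iff measure_nonneg top.not_eq_extremum less_trans ennreal_less_top)
    finally show "\<exists>g. integrable lborel g \<and> L1_transl_cont g \<and> (LINT x|lborel. \<bar>indicator A x - g x :: real\<bar>) < e"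
      using L1_transl_cont_open[OF U(1) fU] fU by (intro exI[of _ "indicator U"]) (auto simp: integrable_real_indicator)
  qed
  then have "(\<lambda>n. \<bar>c\<bar> * (LINT x|lborel. \<bar>indicator A (x + h n) - indicator A x :: real\<bar>)) \<longlonglongrightarrow> \<bar>c\<bar> * 0" if "h \<longlonglongrightarrow> 0" for h
    using that unfolding L1_transl_cont_def by (intro tendsto_mult tendsto_const) blast
  moreover have "\<bar>c\<bar> * (LINT x|lborel. \<bar>indicator A (x + b) - indicator A x :: real\<bar>) = (LINT x|lborel. \<bar>indicator A (x + b) *\<^sub>R c - indicator A x *\<^sub>R c\<bar>)" for b
    by (subst integral_mult_right_zero[symmetric]) (simp add: abs_mult[symmetric] algebra_simps)
  ultimately show ?case by (simp add: L1_transl_cont_def)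
next
  case (add f g)
  have [measurable]: "f \<in> borel_measurable borel" "g \<in> borel_measurable borel"
    using borel_measurable_integrable[OF add(1)] borel_measurable_integrable[OF add(3)] by auto
  show ?case unfolding L1_transl_cont_def
  proof (intro allI impI)
    fix h :: "nat \<Rightarrow> 'a" assume h: "h \<longlonglongrightarrow> 0"
    have fi: "integrable lborel (\<lambda>x. f (x + b))" "integrable lborel (\<lambda>x. g (x + b))" for b
      using add by (auto simp: lborel_integrable_translate)
    have "(\<lambda>n. (LINT x|lborel. \<bar>f (x + h n) - f x\<bar>) + (LINT x|lborel. \<bar>g (x + h n) - g x\<bar>)) \<longlonglongrightarrow> 0 + 0"
      using add(2,4) h unfolding L1_transl_cont_def by (intro tendsto_add) blast+
    then have l: "(\<lambda>n. (LINT x|lborel. \<bar>f (x + h n) - f x\<bar>) + (LINT x|lborel. \<bar>g (x + h n) - g x\<bar>)) \<longlonglongrightarrow> 0" by simp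
    show "(\<lambda>n. LINT x|lborel. \<bar>f (x + h n) + g (x + h n) - (f x + g x)\<bar>) \<longlonglongrightarrow> 0"
    proof (rule Lim_null_comparison[OF _ l], rule always_eventually, rule allI)
      fix n
      have "(LINT x|lborel. \<bar>f (x + h n) + g (x + h n) - (f x + g x)\<bar>) \<le> (LINT x|lborel. \<bar>f (x + h n) - f x\<bar> + \<bar>g (x + h n) - g x\<bar>)"
        using fi add by (intro integral_mono) auto
      then show "norm (LINT x|lborel. \<bar>f (x + h n) + g (x + h n) - (f x + g x)\<bar>) \<le> (LINT x|lborel. \<bar>f (x + h n) - f x\<bar>) + (LINT x|lborel. \<bar>g (x + h n) - g x\<bar>)"
        using fi add by (simp add: abs_of_nonneg)
    qed
  qed
next
  case (lim f s)
  show ?case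
  proof (rule L1_transl_cont_approx[OF lim(5)])
    fix e :: real assume e: "e > 0"
    have "(\<lambda>i. LINT x|lborel. \<bar>f x - s i x\<bar>) \<longlonglongrightarrow> (LINT x|(lborel::'a measure). (0::real))"
    proof (rule integral_dominated_convergence)
      show "integrable lborel (\<lambda>x. 3 * \<bar>f x\<bar>)" using lim(5) by simp
      show "AE x in lborel. (\<lambda>i. \<bar>f x - s i x\<bar>) \<longlonglongrightarrow> 0"
      proof (rule AE_I2)
        fix x :: 'a
        have "(\<lambda>i. s i x) \<longlonglongrightarrow> f x" by (rule lim(3)) simp
        from tendsto_rabs[OF tendsto_diff[OF tendsto_const[of "f x"] this]]
        show "(\<lambda>i. \<bar>f x - s i x\<bar>) \<longlonglongrightarrow> 0" by simp
      qed
      show "AE x in lborel. norm \<bar>f x - s i x\<bar> \<le> 3 * \<bar>f x\<bar>" for i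
      proof (rule AE_I2)
        fix x :: 'a
        have "norm (s i x) \<le> 2 * norm (f x)" by (rule lim(4)) simp
        then show "norm \<bar>f x - s i x\<bar> \<le> 3 * \<bar>f x\<bar>" by simp
      qed
    qed (use borel_measurable_integrable[OF lim(5)] borel_measurable_integrable[OF lim(1)] in auto)
    then have "\<forall>\<^sub>F i in sequentially. (LINT x|lborel. \<bar>f x - s i x\<bar>) < e"
      using e by (simp add: order_tendstoD(2))
    then obtain i where "(LINT x|lborel. \<bar>f x - s i x\<bar>) < e"
      by (meson eventually_happens trivial_limit_sequentially)
    then show "\<exists>g. integrable lborel g \<and> L1_transl_cont g \<and> (LINT x|lborel. \<bar>f x - g x\<bar>) < e"
      using lim(1,2) by blast
  qed
qed

lemma L2_translate: "f \<in> L2p \<Longrightarrow> (\<lambda>x. f (x + b)) \<in> L2p" "f \<in> L2p \<Longrightarrow> nrm (\<lambda>x. f (x + b)) = nrm f"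
  using L2_affine[of f 1 b] by auto

lemma L2_transl_cont:
  assumes u: "u \<in> L2p" and e: "e > 0"
  obtains d where "d > 0" "\<And>h. norm h < d \<Longrightarrow> nrm (\<lambda>x. u (x + h) - u x) < e"
proof -
  define f where "f = (\<lambda>x. u x * \<bar>u x\<bar>)"
  have [measurable]: "u \<in> borel_measurable borel" using L2_meas[OF u] by simp
  have fi: "integrable lborel f" unfolding f_def by (rule L2_mult_integrable[OF u L2_abs[OF u]])
  have fm[measurable]: "f \<in> borel_measurable borel" unfolding f_def by measurable
  have fi': "integrable lborel (\<lambda>x. f (x + h))" for h using fi by (subst lborel_integrable_translate[OF fm])
  have c: "L1_transl_cont f" by (rule L1_transl_cont_integrable[OF fi])
  have "\<exists>d>0. \<forall>h. norm h < d \<longrightarrow> nrm (\<lambda>x. u (x + h) - u x) < e"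
  proof (rule ccontr)
    assume "\<not> ?thesis"
    then have "\<forall>n. \<exists>h. norm h < 1 / real (Suc n) \<and> \<not> nrm (\<lambda>x. u (x + h) - u x) < e"
      by simp
    from choice[OF this] obtain h where hh: "\<forall>n. norm (h n) < 1 / real (Suc n) \<and> \<not> nrm (\<lambda>x. u (x + h n) - u x) < e"
      by blast
    have h: "\<And>n. norm (h n) < 1 / real (Suc n)" "\<And>n. e \<le> nrm (\<lambda>x. u (x + h n) - u x)"
      using hh by (auto simp: not_less)
    have h0: "h \<longlonglongrightarrow> 0"
      by (rule LIMSEQ_norm_0) (rule h(1))
    have "(\<lambda>n. 2 * (LINT x|lborel. \<bar>f (x + h n) - f x\<bar>)) \<longlonglongrightarrow> 2 * 0"
      using c h0 unfolding L1_transl_cont_def by (intro tendsto_mult tendsto_const) blast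
    then have "\<forall>\<^sub>F n in sequentially. 2 * (LINT x|lborel. \<bar>f (x + h n) - f x\<bar>) < e\<^sup>2"
      using e by (intro order_tendstoD(2)[where y = 0]) auto
    then obtain n where n: "2 * (LINT x|lborel. \<bar>f (x + h n) - f x\<bar>) < e\<^sup>2"
      by (meson eventually_happens trivial_limit_sequentially)
    have "(nrm (\<lambda>x. u (x + h n) - u x))\<^sup>2 \<le> (LINT x|lborel. 2 * \<bar>f (x + h n) - f x\<bar>)"
      unfolding nrm2_sq
    proof (rule integral_mono)
      show "integrable lborel (\<lambda>x. (u (x + h n) - u x)\<^sup>2)"
        by (rule L2_int[OF L2_diff[OF L2_translate(1)[OF u] u]])
      show "integrable lborel (\<lambda>x. 2 * \<bar>f (x + h n) - f x\<bar>)" using fi fi' by simp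
      show "(u (x + h n) - u x)\<^sup>2 \<le> 2 * \<bar>f (x + h n) - f x\<bar>" for x
        unfolding f_def by (rule sq_diff_le_signed)
    qed
    also have "\<dots> < e\<^sup>2" using n by simp
    finally show False using h(2)[of n] e by (smt (verit) power_mono)
  qed
  then show ?thesis using that by blast
qed

lemma test_function_add:
  assumes "test_function f" "test_function g" shows "test_function (\<lambda>x. f x + g x)"
proof -
  obtain K where K: "compact K" "\<And>x. x \<notin> K \<Longrightarrow> f x = 0" using test_functionE[OF assms(1)] by blast
  obtain L where L: "compact L" "\<And>x. x \<notin> L \<Longrightarrow> g x = 0" using test_functionE[OF assms(2)] by blast
  show ?thesis
    using assms K L by (intro test_functionI[OF _ compact_Un[OF K(1) L(1)]] Ck_add) (auto simp: test_function_def)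
qed

definition dirder :: "plane \<Rightarrow> (plane \<Rightarrow> real) \<Rightarrow> plane \<Rightarrow> real" where
  "dirder h f x = h $ 1 * partial 1 f x + h $ 2 * partial 2 f x"

lemma plane_basis: "(h::plane) = h $ 1 *\<^sub>R axis 1 1 + h $ 2 *\<^sub>R axis 2 1"
  by (simp add: vec_eq_iff forall_2 axis_def)

lemma has_derivative_dirder:
  assumes "f differentiable at x"
  shows "(f has_derivative (\<lambda>h. dirder h f x)) (at x)"
proof -
  have l: "linear (frechet_derivative f (at x))" by (rule linear_frechet_derivative[OF assms])
  have "frechet_derivative f (at x) h = dirder h f x" for h
  proof -
    have "frechet_derivative f (at x) h = frechet_derivative f (at x) (h $ 1 *\<^sub>R axis 1 1 + h $ 2 *\<^sub>R axis 2 1)"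
      using plane_basis[of h] by simp
    also have "\<dots> = dirder h f x"
      by (simp add: linear_add[OF l] linear_scale[OF l] dirder_def partial_def)
    finally show ?thesis .
  qed
  then have "frechet_derivative f (at x) = (\<lambda>h. dirder h f x)" by (rule ext)
  then show ?thesis using frechet_derivative_works[THEN iffD1, OF assms] by simp
qed

lemma test_function_dirder: "test_function f \<Longrightarrow> test_function (dirder h f)"
  unfolding dirder_def[abs_def]
  by (intro test_function_add test_function_cmult test_function_partial)

lemma line_deriv:
  assumes "f differentiable at (y + s *\<^sub>R h)"
  shows "((\<lambda>s. f (y + s *\<^sub>R h)) has_real_derivative dirder h f (y + s *\<^sub>R h)) (at s)"
proof -
  have "((\<lambda>s. y + s *\<^sub>R h) has_derivative (\<lambda>t. t *\<^sub>R h)) (at s)"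
    by (auto intro!: derivative_eq_intros)
  from has_derivative_compose[OF this has_derivative_dirder[OF assms]]
  have "((\<lambda>s. f (y + s *\<^sub>R h)) has_derivative (\<lambda>t. dirder (t *\<^sub>R h) f (y + s *\<^sub>R h))) (at s)" .
  then show ?thesis unfolding has_field_derivative_def
    by (rule has_derivative_eq_rhs) (auto simp: dirder_def algebra_simps)
qed

text \<open>
  Differentiation under the integral sign: for bounded \<open>s\<close> the difference quotients of \<open>\<rho>\<close> are bounded
  by a constant and vanish outside a common compact set.
\<close>

lemma shift_deriv:
  assumes r: "test_function \<rho>" and u: "locally_integrable (u :: plane \<Rightarrow> real)"
  shows "((\<lambda>s. LINT y|lborel. u y * \<rho> (y + s *\<^sub>R h)) has_real_derivative (LINT y|lborel. u y * dirder h \<rho> y)) (at 0)"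
proof -
  have um[measurable]: "u \<in> borel_measurable borel" by (rule locally_integrable_borel[OF u])
  have rm[measurable]: "\<rho> \<in> borel_measurable borel" "dirder h \<rho> \<in> borel_measurable borel"
    using test_function_borel[OF r] test_function_borel[OF test_function_dirder[OF r]] by auto
  obtain K where K: "compact K" "\<And>x. x \<notin> K \<Longrightarrow> \<rho> x = 0" using test_functionE[OF r] by blast
  obtain C where C: "C > 0" "\<And>x. \<bar>dirder h \<rho> x\<bar> \<le> C"
    using test_function_bounded[OF test_function_dirder[OF r]] by blast
  have sh: "test_function (\<lambda>y. \<rho> (y + s *\<^sub>R h))" for s
    using test_function_affine[OF r, of 1 "s *\<^sub>R h"] by simp
  have ii: "integrable lborel (\<lambda>y. u y * \<rho> (y + s *\<^sub>R h))" for s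
    by (rule locally_integrable_mult_test[OF u sh])
  have ii0: "integrable lborel (\<lambda>y. u y * \<rho> y)" using ii[of 0] by simp
  have ld: "((\<lambda>s. \<rho> (y + s *\<^sub>R h)) has_real_derivative dirder h \<rho> (y + s *\<^sub>R h)) (at s)" for y s
    by (rule line_deriv[OF test_function_differentiable[OF r]])
  have lip: "\<bar>\<rho> (y + s *\<^sub>R h) - \<rho> y\<bar> \<le> C * \<bar>s\<bar>" for y s
    using field_differentiable_bound[of UNIV "\<lambda>s. \<rho> (y + s *\<^sub>R h)" "\<lambda>s. dirder h \<rho> (y + s *\<^sub>R h)" C s 0] ld C(2)
    by simp
  show ?thesis unfolding DERIV_def tendsto_at_iff_sequentially comp_def
  proof (intro allI impI)
    fix X :: "nat \<Rightarrow> real" assume X: "\<forall>i. X i \<in> UNIV - {0}" "X \<longlonglongrightarrow> 0"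
    obtain R where R: "\<And>i. \<bar>X i\<bar> \<le> R"
      using Bseq_def convergent_imp_Bseq convergentI[OF X(2)] by (metis real_norm_def)
    \<comment> \<open>contains the support of every \<open>\<rho> (y + X i h)\<close> and of \<open>\<rho>\<close>\<close>
    define K' where "K' = (\<lambda>p. fst p - snd p *\<^sub>R h) ` (K \<times> {-R..R})"
    have cK': "compact K'" unfolding K'_def
      by (intro compact_continuous_image compact_Times K compact_Icc continuous_intros)
    have z: "u y * ((\<rho> (y + X i *\<^sub>R h) - \<rho> y) / X i) = 0" if "y \<notin> K'" for y i
    proof -
      have R0: "R \<ge> 0" using R[of 0] by linarith
      have "y \<notin> K"
      proof
        assume "y \<in> K" then have "(y, 0) \<in> K \<times> {-R..R}" using R0 by auto
        then have "fst (y, 0::real) - snd (y, 0::real) *\<^sub>R h \<in> K'" unfolding K'_def by (rule imageI)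
        then show False using that by simp
      qed
      moreover have "y + X i *\<^sub>R h \<notin> K"
      proof
        assume "y + X i *\<^sub>R h \<in> K" then have "(y + X i *\<^sub>R h, X i) \<in> K \<times> {-R..R}" using R[of i] by auto
        then have "fst (y + X i *\<^sub>R h, X i) - snd (y + X i *\<^sub>R h, X i) *\<^sub>R h \<in> K'" unfolding K'_def by (rule imageI)
        then show False using that by simp
      qed
      ultimately show ?thesis using K(2) by simp
    qed
    have "(\<lambda>i. LINT y|lborel. u y * ((\<rho> (y + X i *\<^sub>R h) - \<rho> y) / X i)) \<longlonglongrightarrow> (LINT y|lborel. u y * dirder h \<rho> y)"
    proof (rule integral_dominated_convergence)
      show "integrable lborel (\<lambda>x. C * norm (indicator K' x *\<^sub>R u x))"
        using u cK' by (intro integrable_mult_right integrable_norm) (auto simp: locally_integrable_def set_integrable_def)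
      show "AE y in lborel. (\<lambda>i. u y * ((\<rho> (y + X i *\<^sub>R h) - \<rho> y) / X i)) \<longlonglongrightarrow> u y * dirder h \<rho> y"
      proof (rule AE_I2)
        fix y :: plane
        have "(\<lambda>i. (\<rho> (y + X i *\<^sub>R h) - \<rho> y) / X i) \<longlonglongrightarrow> dirder h \<rho> y"
          using ld[of y 0] X unfolding DERIV_def tendsto_at_iff_sequentially comp_def by auto
        then show "(\<lambda>i. u y * ((\<rho> (y + X i *\<^sub>R h) - \<rho> y) / X i)) \<longlonglongrightarrow> u y * dirder h \<rho> y"
          by (intro tendsto_mult tendsto_const)
      qed
      show "AE y in lborel. norm (u y * ((\<rho> (y + X i *\<^sub>R h) - \<rho> y) / X i)) \<le> C * norm (indicator K' y *\<^sub>R u y)" for i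
      proof (rule AE_I2)
        fix y :: plane
        show "norm (u y * ((\<rho> (y + X i *\<^sub>R h) - \<rho> y) / X i)) \<le> C * norm (indicator K' y *\<^sub>R u y)"
        proof (cases "y \<in> K'")
          case True
          have "\<bar>(\<rho> (y + X i *\<^sub>R h) - \<rho> y) / X i\<bar> \<le> C"
            using lip[of y "X i"] X(1) by (simp add: pos_divide_le_eq)
          then have "\<bar>u y\<bar> * \<bar>(\<rho> (y + X i *\<^sub>R h) - \<rho> y) / X i\<bar> \<le> \<bar>u y\<bar> * C"
            by (intro mult_left_mono) auto
          then show ?thesis using True by (simp add: abs_mult mult.commute)
        next
          case False
          show ?thesis unfolding z[OF False] using False by simp
        qed
      qed
    qed auto
    moreover have "(LINT y|lborel. u y * ((\<rho> (y + X i *\<^sub>R h) - \<rho> y) / X i)) =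
       ((LINT y|lborel. u y * \<rho> (y + (0 + X i) *\<^sub>R h)) - (LINT y|lborel. u y * \<rho> (y + 0 *\<^sub>R h))) / X i" for i
    proof -
      have "(LINT y|lborel. u y * ((\<rho> (y + X i *\<^sub>R h) - \<rho> y) / X i)) = (LINT y|lborel. (u y * \<rho> (y + X i *\<^sub>R h) - u y * \<rho> y) / X i)"
        by (simp add: right_diff_distrib)
      also have "\<dots> = ((LINT y|lborel. u y * \<rho> (y + X i *\<^sub>R h)) - (LINT y|lborel. u y * \<rho> y)) / X i"
        using ii[of "X i"] ii0 by simp
      finally show ?thesis by simp
    qed
    ultimately show "(\<lambda>i. ((LINT y|lborel. u y * \<rho> (y + (0 + X i) *\<^sub>R h)) - (LINT y|lborel. u y * \<rho> (y + 0 *\<^sub>R h))) / X i)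
      \<longlonglongrightarrow> (LINT y|lborel. u y * dirder h \<rho> y)" by (simp only:)
  qed
qed

text \<open>
  The integral of a translate does not depend on the translation, so its derivative vanishes.
\<close>

lemma integral_partial_test: assumes r: "test_function \<rho>" shows "(LINT y|lborel. partial i \<rho> y) = 0"
proof -
  have l: "locally_integrable (\<lambda>_::plane. 1::real)"
    unfolding locally_integrable_def set_integrable_def
    using emeasure_compact_finite compact_imp_closed by (auto intro!: integrable_real_indicator borel_closed)
  have c: "(LINT y|lborel. 1 * \<rho> (y + s *\<^sub>R axis i 1)) = (LINT y|lborel. \<rho> y)" for s
    using lborel_integral_translate[OF test_function_borel[OF r], of "s *\<^sub>R axis i 1"] by simp
  have "((\<lambda>s. LINT y|lborel. \<rho> y) has_real_derivative (LINT y|lborel. 1 * dirder (axis i 1) \<rho> y)) (at 0)"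
    using shift_deriv[OF r l, of "axis i 1"] unfolding c .
  then have "(LINT y|lborel. dirder (axis i 1) \<rho> y) = 0"
    using DERIV_unique[OF _ DERIV_const] by fastforce
  moreover have "dirder (axis i 1) \<rho> y = partial i \<rho> y" for y
    using exhaust_2[of i] by (auto simp: dirder_def axis_def)
  ultimately show ?thesis by simp
qed

lemma test_function_H1: assumes r: "test_function \<rho>" shows "\<rho> \<in> H1"
proof (rule H1I(1)[where g = "\<lambda>i. partial i \<rho>"])
  show "\<rho> \<in> L2p" by (rule test_function_L2[OF r])
  show "partial i \<rho> \<in> L2p" for i by (rule test_function_L2[OF test_function_partial[OF r]])
  fix i \<phi> assume t: "test_function \<phi>"
  have "0 = (LINT x|lborel. partial i (\<lambda>x. \<rho> x * \<phi> x) x)"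
    by (rule integral_partial_test[OF test_function_mult[OF r t], symmetric])
  also have "\<dots> = (LINT x|lborel. \<rho> x * partial i \<phi> x + partial i \<rho> x * \<phi> x)"
    by (simp add: partial_mult test_function_differentiable r t)
  also have "\<dots> = (LINT x|lborel. \<rho> x * partial i \<phi> x) + (LINT x|lborel. partial i \<rho> x * \<phi> x)"
    by (intro Bochner_Integration.integral_add L2_mult_test_integrable test_function_L2 test_function_partial r t)
  finally show "(LINT x|lborel. \<rho> x * partial i \<phi> x) = - (LINT x|lborel. partial i \<rho> x * \<phi> x)" by simp
qed

section \<open>Mollification\<close>

text \<open>
  A bump supported in the square of half side \<open>1 / (n + 1)\<close>, not yet normalized.
\<close>

definition raw_moll :: "nat \<Rightarrow> plane \<Rightarrow> real" where
  "raw_moll n = bump 1 (\<chi> i. - (1 / real (Suc n))) (\<chi> i. 1 / real (Suc n))"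

definition moll :: "nat \<Rightarrow> plane \<Rightarrow> real" where
  "moll n z = raw_moll n z / (LINT z|lborel. raw_moll n z)"

lemma raw_moll_test: "test_function (raw_moll n)"
  unfolding raw_moll_def by (rule test_function_bump) simp

lemma raw_moll_eq_0: "raw_moll n z = 0" if "\<bar>z $ i\<bar> \<ge> 1 / real (Suc n)" for i
  unfolding raw_moll_def by (rule bump_eq_0) (use that in \<open>auto simp: mem_box_cart intro!: exI[of _ i]\<close>)

lemma test_function_integrable: assumes t: "test_function f" shows "integrable lborel f"
proof -
  obtain K where K: "compact K" "\<And>x. x \<notin> K \<Longrightarrow> f x = 0" using test_functionE[OF t] by blast
  have "(\<lambda>x. indicator K x * f x) = f" using K(2) by (intro ext) (auto simp: indicator_def)
  with L2_mult_integrable[OF indicator_L2[OF K(1)] test_function_L2[OF t]] show ?thesis by simp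
qed

lemma raw_moll_int_pos: "(LINT z|lborel. raw_moll n z) > 0"
proof -
  let ?B = "box (\<chi> i. - (1 / real (Suc n))) (\<chi> i. 1 / real (Suc n)) :: plane set"
  have i: "integrable lborel (raw_moll n)" by (rule test_function_integrable[OF raw_moll_test])
  have nn: "0 \<le> raw_moll n z" for z by (simp add: raw_moll_def bump_nonneg)
  have "(LINT z|lborel. raw_moll n z) \<noteq> 0"
  proof
    assume "(LINT z|lborel. raw_moll n z) = 0"
    then have "AE z in lborel. raw_moll n z = 0"
      using integral_nonneg_eq_0_iff_AE[OF i] nn by simp
    then have "AE z in lborel. z \<notin> ?B"
    proof eventually_elim
      case (elim z)
      then show ?case unfolding raw_moll_def using bump_pos[OF zero_less_one] by force
    qed
    then have "?B \<in> null_sets lborel" by (subst AE_iff_null_sets) auto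
    then have "negligible ?B" by (simp add: negligible_iff_null_sets null_sets_completionI)
    then have "?B = {}" using open_not_negligible[OF open_box] by blast
    moreover have "0 \<in> ?B" by (simp add: mem_box_cart)
    ultimately show False by blast
  qed
  moreover have "(LINT z|lborel. raw_moll n z) \<ge> 0" using nn by simp
  ultimately show ?thesis by linarith
qed

lemma moll_test: "test_function (moll n)"
  using test_function_cmult[OF raw_moll_test, of "1 / (LINT z|lborel. raw_moll n z)" n] by (simp add: moll_def[abs_def])

lemma moll_nonneg: "0 \<le> moll n z"
  using raw_moll_int_pos[of n] by (simp add: moll_def raw_moll_def bump_nonneg)

lemma moll_int: "(LINT z|lborel. moll n z) = 1"
  using raw_moll_int_pos[of n] by (simp add: moll_def)

lemma moll_eq_0: "moll n z = 0" if "\<bar>z $ i\<bar> \<ge> 1 / real (Suc n)" for i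
  using raw_moll_eq_0[OF that] by (simp add: moll_def)

definition moll_measure :: "nat \<Rightarrow> plane measure" where
  "moll_measure n = density lborel (\<lambda>z. ennreal (moll n z))"

lemma moll_borel[measurable]: "moll n \<in> borel_measurable borel"
  by (rule test_function_borel[OF moll_test])

lemma moll_measure_sets[simp, measurable_cong]: "sets (moll_measure n) = sets borel" "space (moll_measure n) = UNIV"
  by (simp_all add: moll_measure_def)

lemma moll_measure_space: "emeasure (moll_measure n) (space (moll_measure n)) = 1"
proof -
  have "emeasure (moll_measure n) (space (moll_measure n)) = (\<integral>\<^sup>+z. ennreal (moll n z) \<partial>lborel)"
    unfolding moll_measure_def by (subst emeasure_density) auto
  also have "\<dots> = ennreal (LINT z|lborel. moll n z)"
    by (rule nn_integral_eq_integral[OF test_function_integrable[OF moll_test]]) (simp add: moll_nonneg)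
  finally show ?thesis by (simp add: moll_int)
qed

lemma moll_measure_AE: "AE z in moll_measure n. \<forall>i. \<bar>z $ i\<bar> < 1 / real (Suc n)"
  unfolding moll_measure_def by (subst AE_density) (auto intro!: AE_I2 simp: not_le[symmetric] moll_eq_0)

definition mollify :: "nat \<Rightarrow> (plane \<Rightarrow> real) \<Rightarrow> plane \<Rightarrow> real" where
  "mollify n u x = (LINT y|lborel. u y * moll n (x - y))"

lemma moll_refl_test: "test_function (\<lambda>y. moll n (x - y))"
  using test_function_affine[OF moll_test, of "-1" n x] by (simp add: add.commute[of _ x])

lemma mollify_eq_average: assumes u: "u \<in> L2p" shows "mollify n u x = (LINT z|moll_measure n. u (x - z))"
proof -
  have [measurable]: "u \<in> borel_measurable borel" using L2_meas[OF u] by simp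
  have "(LINT z|moll_measure n. u (x - z)) = (LINT z|lborel. moll n z * u (x - z))"
    unfolding moll_measure_def by (subst integral_density) (auto simp: moll_nonneg)
  also have "\<dots> = (LINT y|lborel. moll n ((-1) *\<^sub>R y + x) * u (x - ((-1) *\<^sub>R y + x)))"
    by (subst lborel_integral_affine[where s = "-1" and b = x and f = "\<lambda>z. moll n z * u (x - z)"]) auto
  finally show ?thesis by (simp add: mollify_def mult.commute)
qed

lemma mollify_borel[measurable]: assumes u: "u \<in> L2p" shows "mollify n u \<in> borel_measurable borel"
proof -
  have [measurable]: "u \<in> borel_measurable borel" using L2_meas[OF u] by simp
  have "(\<lambda>x. LINT y|lborel. u y * moll n (x - y)) \<in> borel_measurable borel"
    by (rule lborel.borel_measurable_lebesgue_integral) measurable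
  then show ?thesis by (simp add: mollify_def[abs_def])
qed

lemma mollify_L2: assumes u: "u \<in> L2p" shows "mollify n u \<in> L2p" "nrm (mollify n u) \<le> nrm u"
proof -
  have [measurable]: "u \<in> borel_measurable borel" using L2_meas[OF u] by simp
  have "(\<integral>\<^sup>+x. ennreal ((LINT z|moll_measure n. u (x - z))\<^sup>2) \<partial>lborel) \<le> ennreal ((nrm u)\<^sup>2)"
  proof (rule nn_integral_square_average_le[OF sigma_finite_lborel moll_measure_space])
    show "(\<lambda>(x, z). u (x - z)) \<in> borel_measurable (lborel \<Otimes>\<^sub>M moll_measure n)" by measurable
    have "(\<integral>\<^sup>+x. ennreal ((u (x - z))\<^sup>2) \<partial>lborel) = ennreal ((nrm u)\<^sup>2)" for z
      using nn_integral_L2[OF L2_translate(1)[OF u, of "-z"]] L2_translate(2)[OF u, of "-z"] by simp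
    then show "AE z in moll_measure n. (\<integral>\<^sup>+x. ennreal ((u (x - z))\<^sup>2) \<partial>lborel) \<le> ennreal ((nrm u)\<^sup>2)" by simp
  qed
  then have *: "(\<integral>\<^sup>+x. ennreal ((mollify n u x)\<^sup>2) \<partial>lborel) \<le> ennreal ((nrm u)\<^sup>2)"
    by (simp add: mollify_eq_average[OF u])
  have m: "mollify n u \<in> borel_measurable lborel" using mollify_borel[OF u] by simp
  from L2_nn_integralI[OF m *] show "mollify n u \<in> L2p" "nrm (mollify n u) \<le> nrm u" by auto
qed

text \<open>
  A mollified function is an average of translates by at most \<open>1 / (n + 1)\<close> in each coordinate, so it
  is as close to \<open>u\<close> as these translates are.
\<close>

lemma mollify_diff_L2:
  assumes u: "u \<in> L2p" and B: "0 \<le> B"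
    and h: "\<And>h. (\<And>i. \<bar>h $ i\<bar> < 1 / real (Suc n)) \<Longrightarrow> nrm (\<lambda>x. u (x + h) - u x) \<le> B"
  shows "nrm (\<lambda>x. mollify n u x - u x) \<le> B"
proof -
  have [measurable]: "u \<in> borel_measurable borel" using L2_meas[OF u] by simp
  interpret F: finite_measure "moll_measure n" by (rule finite_measureI) (subst moll_measure_space, simp)
  have L: "(\<lambda>x. u (x - z) - u x) \<in> L2p" for z
    using L2_diff[OF L2_translate(1)[OF u, of "-z"] u] by simp
  have "(\<integral>\<^sup>+x. ennreal ((LINT z|moll_measure n. u (x - z) - u x)\<^sup>2) \<partial>lborel) \<le> ennreal (B\<^sup>2)"
  proof (rule nn_integral_square_average_le[OF sigma_finite_lborel moll_measure_space])
    show "(\<lambda>(x, z). u (x - z) - u x) \<in> borel_measurable (lborel \<Otimes>\<^sub>M moll_measure n)" by measurable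
    show "AE z in moll_measure n. (\<integral>\<^sup>+x. ennreal ((u (x - z) - u x)\<^sup>2) \<partial>lborel) \<le> ennreal (B\<^sup>2)"
      using moll_measure_AE
    proof eventually_elim
      case (elim z)
      then have "nrm (\<lambda>x. u (x + (- z)) - u x) \<le> B" by (intro h) auto
      then show ?case unfolding nn_integral_L2[OF L] by (simp add: ennreal_leI power_mono)
    qed
  qed
  moreover have "(LINT z|moll_measure n. u (x - z) - u x) = mollify n u x - u x" for x
  proof -
    have "integrable lborel (\<lambda>y. u y * moll n (x - y))" by (rule L2_mult_test_integrable[OF u moll_refl_test])
    then have "integrable lborel (\<lambda>y. moll n ((-1) *\<^sub>R y + x) * u (x - ((-1) *\<^sub>R y + x)))"
      by (simp add: mult.commute)
    then have "integrable lborel (\<lambda>z. moll n z * u (x - z))"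
      by (subst (asm) lborel_integrable_affine[where s = "-1" and b = x and f = "\<lambda>z. moll n z * u (x - z)"]) auto
    then have "integrable (moll_measure n) (\<lambda>z. u (x - z))"
      unfolding moll_measure_def by (subst integrable_density) (auto simp: moll_nonneg)
    moreover have "measure (moll_measure n) UNIV = 1" using moll_measure_space[of n] by (simp add: measure_def)
    ultimately show ?thesis by (simp add: mollify_eq_average[OF u])
  qed
  ultimately have *: "(\<integral>\<^sup>+x. ennreal ((mollify n u x - u x)\<^sup>2) \<partial>lborel) \<le> ennreal (B\<^sup>2)" by simp
  show ?thesis
    by (rule L2_nn_integralI(2)[OF _ * B]) (use L2_meas[OF L2_diff[OF mollify_L2(1)[OF u] u]] in simp)
qed

lemma plane_norm_lt: "(\<And>i. \<bar>(h::plane) $ i\<bar> < d) \<Longrightarrow> norm h < 2 * d"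
proof -
  assume a: "\<And>i. \<bar>h $ i\<bar> < d"
  show "norm h < 2 * d" using norm_le_l1_cart[of h] a[of 1] a[of 2] by (simp add: sum_2)
qed

lemma mollify_tendsto_L2: assumes u: "u \<in> L2p" shows "(\<lambda>n. nrm (\<lambda>x. mollify n u x - u x)) \<longlonglongrightarrow> 0"
proof (rule LIMSEQ_I)
  fix e :: real assume e: "e > 0"
  obtain d where d: "d > 0" "\<And>h. norm h < d \<Longrightarrow> nrm (\<lambda>x. u (x + h) - u x) < e / 2"
    using L2_transl_cont[OF u, of "e/2"] e by auto
  obtain N where N: "N > 0" "inverse (real N) < d / 2" using reals_Archimedean3 ex_inverse_of_nat_less[of "d/2"] d(1) by auto
  have "norm (nrm (\<lambda>x. mollify n u x - u x) - 0) < e" if n: "n \<ge> N" for n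
  proof -
    have "1 / real (Suc n) \<le> inverse (real N)" using n N by (simp add: field_simps)
    then have *: "2 * (1 / real (Suc n)) < d" using N(2) by simp
    have "nrm (\<lambda>x. mollify n u x - u x) \<le> e / 2"
    proof (rule mollify_diff_L2[OF u])
      fix h :: plane assume "\<And>i. \<bar>h $ i\<bar> < 1 / real (Suc n)"
      then have "norm h < d" using plane_norm_lt[of h "1 / real (Suc n)"] * by simp
      then show "nrm (\<lambda>x. u (x + h) - u x) \<le> e / 2" using d(2)[of h] by simp
    qed (use e in simp)
    then show ?thesis using e by simp
  qed
  then show "\<exists>N. \<forall>n\<ge>N. norm (nrm (\<lambda>x. mollify n u x - u x) - 0) < e" by blast
qed

lemma mollify_diff_bound:
  assumes u: "u \<in> L2p"
  shows "\<bar>mollify n u x' - mollify n u x\<bar> \<le> nrm u * nrm (\<lambda>z. moll n (z + (x' - x)) - moll n z)"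
proof -
  have L: "(\<lambda>y. moll n (x' - y) - moll n (x - y)) \<in> L2p"
    by (intro L2_diff test_function_L2 moll_refl_test)
  have L': "(\<lambda>z. moll n (z + (x' - x)) - moll n z) \<in> L2p"
    by (intro L2_diff L2_translate test_function_L2 moll_test)
  have "mollify n u x' - mollify n u x = (LINT y|lborel. u y * (moll n (x' - y) - moll n (x - y)))"
    unfolding mollify_def by (simp add: right_diff_distrib L2_mult_test_integrable[OF u moll_refl_test])
  then have "\<bar>mollify n u x' - mollify n u x\<bar> \<le> nrm u * nrm (\<lambda>y. moll n (x' - y) - moll n (x - y))"
    using Cauchy_Schwarz_L2[OF u L] by simp
  also have "nrm (\<lambda>y. moll n (x' - y) - moll n (x - y)) = nrm (\<lambda>z. moll n (z + (x' - x)) - moll n z)"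
    using L2_affine(2)[OF L', of "-1" x] by simp
  finally show ?thesis .
qed

lemma mollify_continuous: assumes u: "u \<in> L2p" shows "continuous_on UNIV (mollify n u)"
  unfolding continuous_on_iff
proof safe
  fix x :: plane and e :: real assume e: "e > 0"
  have "e / (nrm u + 1) > 0" using e nrm2_nonneg[of lborel u] by (intro divide_pos_pos) (linarith | simp)+
  from L2_transl_cont[OF test_function_L2[OF moll_test] this, of n]
  obtain d where d: "d > 0" "\<And>h. norm h < d \<Longrightarrow> nrm (\<lambda>x. moll n (x + h) - moll n x) < e / (nrm u + 1)"
    by blast
  have "dist (mollify n u x') (mollify n u x) < e" if "dist x' x < d" for x'
  proof -
    have "\<bar>mollify n u x' - mollify n u x\<bar> \<le> nrm u * (e / (nrm u + 1))"
      by (rule order_trans[OF mollify_diff_bound[OF u]], rule mult_left_mono)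
         (use d(2)[of "x' - x"] that in \<open>auto simp: dist_norm less_imp_le\<close>)
    also have "\<dots> < e"
    proof -
      have "nrm u + 1 > 0" using nrm2_nonneg[of lborel u] by linarith
      then show ?thesis using e by (simp add: field_simps)
    qed
    finally show ?thesis by (simp add: dist_real_def)
  qed
  then show "\<exists>d>0. \<forall>x'\<in>UNIV. dist x' x < d \<longrightarrow> dist (mollify n u x') (mollify n u x) < e" using d(1) by blast
qed

definition wdir :: "plane \<Rightarrow> (plane \<Rightarrow> real) \<Rightarrow> plane \<Rightarrow> real" where
  "wdir h u x = h $ 1 * wpart 1 u x + h $ 2 * wpart 2 u x"

lemma wdir_L2: "u \<in> H1 \<Longrightarrow> wdir h u \<in> L2p"
  unfolding wdir_def[abs_def] by (intro L2_add L2_cmult wpart_L2)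

lemma nrm_wdir: assumes "u \<in> H1" shows "nrm (wdir h u) \<le> (\<bar>h $ 1\<bar> + \<bar>h $ 2\<bar>) * sqrt (A_fun u)"
proof -
  have "nrm (wdir h u) \<le> nrm (\<lambda>x. h $ 1 * wpart 1 u x) + nrm (\<lambda>x. h $ 2 * wpart 2 u x)"
    unfolding wdir_def[abs_def] by (intro nrm2_triangle L2_cmult wpart_L2 assms)
  also have "\<dots> \<le> \<bar>h $ 1\<bar> * sqrt (A_fun u) + \<bar>h $ 2\<bar> * sqrt (A_fun u)"
    unfolding nrm2_cmult by (intro add_mono mult_left_mono nrm_wpart_le assms) auto
  finally show ?thesis by (simp add: distrib_right)
qed

text \<open>
  The derivative falls on the kernel, which is a test function of the integration variable; the
  definition of the weak gradient moves it to \<open>u\<close>.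
\<close>

lemma mollify_deriv:
  assumes u: "u \<in> H1"
  shows "((\<lambda>s. mollify n u (x + s *\<^sub>R h)) has_real_derivative mollify n (wdir h u) (x + s *\<^sub>R h)) (at s)"
proof -
  define \<rho> where "\<rho> = (\<lambda>y. moll n (x + s *\<^sub>R h - y))"
  have r: "test_function \<rho>" unfolding \<rho>_def by (rule moll_refl_test)
  have "((\<lambda>t. LINT y|lborel. u y * \<rho> (y + t *\<^sub>R (- h))) has_real_derivative (LINT y|lborel. u y * dirder (- h) \<rho> y)) (at 0)"
    by (rule shift_deriv[OF r L2_locally_integrable[OF H1_L2[OF u]]])
  moreover have "(LINT y|lborel. u y * \<rho> (y + t *\<^sub>R (- h))) = mollify n u (x + (t + s) *\<^sub>R h)" for t
    unfolding mollify_def \<rho>_def by (simp add: algebra_simps)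
  moreover have "(LINT y|lborel. u y * dirder (- h) \<rho> y) = mollify n (wdir h u) (x + s *\<^sub>R h)"
  proof -
    note i = L2_mult_test_integrable[OF H1_L2[OF u] test_function_partial[OF r]]
    note j = L2_mult_test_integrable[OF wpart_L2[OF u] r]
    have "(LINT y|lborel. u y * dirder (- h) \<rho> y) = (LINT y|lborel. - (h $ 1) * (u y * partial 1 \<rho> y) + - (h $ 2) * (u y * partial 2 \<rho> y))"
      by (rule Bochner_Integration.integral_cong) (auto simp: dirder_def algebra_simps)
    also have "\<dots> = - (h $ 1) * (LINT y|lborel. u y * partial 1 \<rho> y) + - (h $ 2) * (LINT y|lborel. u y * partial 2 \<rho> y)"
      using i[of 1] i[of 2] by simp
    also have "\<dots> = h $ 1 * (LINT y|lborel. wpart 1 u y * \<rho> y) + h $ 2 * (LINT y|lborel. wpart 2 u y * \<rho> y)"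
      unfolding wpart_test[OF u r] by simp
    also have "\<dots> = (LINT y|lborel. h $ 1 * (wpart 1 u y * \<rho> y) + h $ 2 * (wpart 2 u y * \<rho> y))"
      using j[of 1] j[of 2] by simp
    also have "\<dots> = mollify n (wdir h u) (x + s *\<^sub>R h)"
      unfolding mollify_def \<rho>_def wdir_def by (rule Bochner_Integration.integral_cong) (auto simp: algebra_simps)
    finally show ?thesis .
  qed
  ultimately have "((\<lambda>t. mollify n u (x + (t + s) *\<^sub>R h)) has_real_derivative mollify n (wdir h u) (x + s *\<^sub>R h)) (at 0)" by simp
  then show ?thesis using DERIV_shift[of "\<lambda>s. mollify n u (x + s *\<^sub>R h)" "mollify n (wdir h u) (x + s *\<^sub>R h)" 0 s] by simp
qed

lemma mollify_line_integral:
  assumes u: "u \<in> H1"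
  shows "mollify n u (x + h) - mollify n u x = (LINT t|density lborel (indicator {0..1}). mollify n (wdir h u) (x + t *\<^sub>R h))"
proof -
  have c: "continuous_on UNIV (\<lambda>t. mollify n (wdir h u) (x + t *\<^sub>R h))"
    by (rule continuous_on_compose2[OF mollify_continuous[OF wdir_L2[OF u]]]) (auto intro!: continuous_intros)
  have [measurable]: "(\<lambda>t. mollify n (wdir h u) (x + t *\<^sub>R h)) \<in> borel_measurable borel"
    by (rule borel_measurable_continuous_onI[OF c])
  have "(LINT t|lborel. indicator {0..1} t *\<^sub>R mollify n (wdir h u) (x + t *\<^sub>R h)) = mollify n u (x + 1 *\<^sub>R h) - mollify n u (x + 0 *\<^sub>R h)"
  proof (rule integral_FTC_Icc)
    show "((\<lambda>s. mollify n u (x + s *\<^sub>R h)) has_vector_derivative mollify n (wdir h u) (x + s *\<^sub>R h)) (at s within {0..1})" for s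
      using mollify_deriv[OF u] by (simp add: has_real_derivative_iff_has_vector_derivative has_vector_derivative_at_within)
    show "continuous_on {0..1} (\<lambda>t. mollify n (wdir h u) (x + t *\<^sub>R h))" by (rule continuous_on_subset[OF c]) simp
  qed simp
  moreover have "(LINT t|density lborel (indicator {0..1}). mollify n (wdir h u) (x + t *\<^sub>R h)) = (LINT t|lborel. indicator {0..1} t *\<^sub>R mollify n (wdir h u) (x + t *\<^sub>R h))"
    using integral_density[of "\<lambda>t. mollify n (wdir h u) (x + t *\<^sub>R h)" lborel "indicator {0..1}"] by (simp add: ennreal_indicator)
  ultimately show ?thesis by simp
qed

lemma nrm_mollify_translate:
  assumes u: "u \<in> H1"
  shows "nrm (\<lambda>x. mollify n u (x + h) - mollify n u x) \<le> nrm (wdir h u)"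
proof -
  let ?M = "density lborel (indicator {0..1}) :: real measure"
  have g: "wdir h u \<in> L2p" by (rule wdir_L2[OF u])
  have [measurable]: "mollify n (wdir h u) \<in> borel_measurable borel" by (rule mollify_borel[OF g])
  have "(\<integral>\<^sup>+x. ennreal ((LINT t|?M. mollify n (wdir h u) (x + t *\<^sub>R h))\<^sup>2) \<partial>lborel) \<le> ennreal ((nrm (wdir h u))\<^sup>2)"
  proof (rule nn_integral_square_average_le[OF sigma_finite_lborel])
    show "emeasure ?M (space ?M) = 1" by (simp add: emeasure_density)
    show "(\<lambda>(x, t). mollify n (wdir h u) (x + t *\<^sub>R h)) \<in> borel_measurable (lborel \<Otimes>\<^sub>M ?M)" by measurable
    have "(\<integral>\<^sup>+x. ennreal ((mollify n (wdir h u) (x + t *\<^sub>R h))\<^sup>2) \<partial>lborel) = ennreal ((nrm (mollify n (wdir h u)))\<^sup>2)" for t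
      using nn_integral_L2[OF L2_translate(1)[OF mollify_L2(1)[OF g]]] L2_translate(2)[OF mollify_L2(1)[OF g]] by simp
    then show "AE t in ?M. (\<integral>\<^sup>+x. ennreal ((mollify n (wdir h u) (x + t *\<^sub>R h))\<^sup>2) \<partial>lborel) \<le> ennreal ((nrm (wdir h u))\<^sup>2)"
      using mollify_L2(2)[OF g] by (simp add: ennreal_leI power_mono)
  qed
  then have *: "(\<integral>\<^sup>+x. ennreal ((mollify n u (x + h) - mollify n u x)\<^sup>2) \<partial>lborel) \<le> ennreal ((nrm (wdir h u))\<^sup>2)"
    by (simp add: mollify_line_integral[OF u])
  show ?thesis
    by (rule L2_nn_integralI(2)[OF _ *])
       (use L2_meas[OF L2_diff[OF L2_translate(1)[OF mollify_L2(1)[OF H1_L2[OF u]]] mollify_L2(1)[OF H1_L2[OF u]]]] in auto)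
qed

text \<open>
  For mollified functions this is the fundamental theorem of calculus along the segment from \<open>x\<close> to
  \<open>x + h\<close>; the general case follows in the limit. It is the quantitative form of compactness: it controls
  the error of mollification uniformly on sets of bounded energy.
\<close>

lemma nrm_translate:
  assumes u: "u \<in> H1"
  shows "nrm (\<lambda>x. u (x + h) - u x) \<le> (\<bar>h $ 1\<bar> + \<bar>h $ 2\<bar>) * sqrt (A_fun u)"
proof -
  note L = H1_L2[OF u]
  have lim: "(\<lambda>n. 2 * nrm (\<lambda>x. mollify n u x - u x) + nrm (wdir h u)) \<longlonglongrightarrow> 2 * 0 + nrm (wdir h u)"
    by (intro tendsto_intros mollify_tendsto_L2 L)
  have "nrm (\<lambda>x. u (x + h) - u x) \<le> 2 * nrm (\<lambda>x. mollify n u x - u x) + nrm (wdir h u)" for n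
  proof -
    note LT = mollify_L2(1)[OF L, of n]
    have "nrm (\<lambda>x. u (x + h) - u x) \<le> nrm (\<lambda>x. u (x + h) - mollify n u (x + h)) + nrm (\<lambda>x. mollify n u (x + h) - u x)"
      by (rule nrm2_triangle_diff[OF L2_translate(1)[OF L] L2_translate(1)[OF LT] L])
    also have "nrm (\<lambda>x. mollify n u (x + h) - u x) \<le> nrm (\<lambda>x. mollify n u (x + h) - mollify n u x) + nrm (\<lambda>x. mollify n u x - u x)"
      by (rule nrm2_triangle_diff[OF L2_translate(1)[OF LT] LT L])
    also have "nrm (\<lambda>x. u (x + h) - mollify n u (x + h)) = nrm (\<lambda>x. mollify n u x - u x)"
      using L2_translate(2)[OF L2_diff[OF L LT], of h] nrm2_minus_commute[of lborel u "mollify n u"] by simp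
    finally show ?thesis using nrm_mollify_translate[OF u, of n h] by simp
  qed
  then have "nrm (\<lambda>x. u (x + h) - u x) \<le> 2 * 0 + nrm (wdir h u)"
    by (intro LIMSEQ_le_const[OF lim]) blast
  then show ?thesis using nrm_wdir[OF u, of h] by simp
qed

lemma nrm_mollify_rate:
  assumes u: "u \<in> H1"
  shows "nrm (\<lambda>x. mollify n u x - u x) \<le> 2 / real (Suc n) * sqrt (A_fun u)"
proof (rule mollify_diff_L2[OF H1_L2[OF u]])
  fix h :: plane assume h: "\<And>i. \<bar>h $ i\<bar> < 1 / real (Suc n)"
  have "\<bar>h $ 1\<bar> + \<bar>h $ 2\<bar> \<le> 2 / real (Suc n)" using h[of 1] h[of 2] by simp
  then have "(\<bar>h $ 1\<bar> + \<bar>h $ 2\<bar>) * sqrt (A_fun u) \<le> 2 / real (Suc n) * sqrt (A_fun u)"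
    by (intro mult_right_mono) auto
  with nrm_translate[OF u, of h] show "nrm (\<lambda>x. u (x + h) - u x) \<le> 2 / real (Suc n) * sqrt (A_fun u)" by simp
qed simp

section \<open>The Gagliardo--Nirenberg inequality\<close>

definition pt :: "real \<Rightarrow> real \<Rightarrow> plane" where
  "pt a b = a *\<^sub>R axis 1 1 + b *\<^sub>R axis 2 1"

lemma pt_nth[simp]: "pt a b $ 1 = a" "pt a b $ 2 = b"
  by (auto simp: pt_def axis_def)

lemma pt_measurable[measurable]: "(\<lambda>(a, b). pt a b) \<in> borel_measurable (lborel \<Otimes>\<^sub>M lborel)"
  unfolding pt_def by measurable

lemma lborel_plane: "lborel = distr (lborel \<Otimes>\<^sub>M lborel) borel (\<lambda>(a, b). pt a b)"
proof (rule lborel_eqI)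
  fix l u :: plane assume lu: "\<And>b. b \<in> Basis \<Longrightarrow> l \<bullet> b \<le> u \<bullet> b"
  have le: "l $ i \<le> u $ i" for i
    using lu[of "axis i 1"] by (simp add: inner_axis)
  have "(\<lambda>(a, b). pt a b) -` box l u \<inter> space (lborel \<Otimes>\<^sub>M lborel) = {l $ 1<..<u $ 1} \<times> {l $ 2<..<u $ 2}"
    by (auto simp: mem_box_cart forall_2 space_pair_measure)
  then have "emeasure (distr (lborel \<Otimes>\<^sub>M lborel) borel (\<lambda>(a, b). pt a b)) (box l u) = emeasure (lborel \<Otimes>\<^sub>M lborel) ({l $ 1<..<u $ 1} \<times> {l $ 2<..<u $ 2})"
    by (subst emeasure_distr) auto
  also have "\<dots> = emeasure lborel {l $ 1<..<u $ 1} * emeasure lborel {l $ 2<..<u $ 2}"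
    by (rule lborel.emeasure_pair_measure_Times) auto
  also have "\<dots> = ennreal ((u - l) $ 1 * (u - l) $ 2)"
    using le by (simp add: ennreal_mult)
  also have "(u - l) $ 1 * (u - l) $ 2 = (\<Prod>i\<in>UNIV. (u - l) \<bullet> axis i 1)"
    by (simp add: UNIV_2 inner_axis)
  also have "\<dots> = (\<Prod>b\<in>range (\<lambda>i::2. axis i (1::real)). (u - l) \<bullet> b)"
    by (subst prod.reindex) (auto intro!: injI simp: axis_eq_axis)
  also have "range (\<lambda>i::2. axis i (1::real)) = Basis" by (auto simp: Basis_vec_def)
  finally show "emeasure (distr (lborel \<Otimes>\<^sub>M lborel) borel (\<lambda>(a, b). pt a b)) (box l u) = ennreal (\<Prod>b\<in>Basis. (u - l) \<bullet> b)" .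
qed simp

lemma nn_integral_plane:
  assumes [measurable]: "f \<in> borel_measurable (borel :: plane measure)"
  shows "(\<integral>\<^sup>+x. f x \<partial>lborel) = (\<integral>\<^sup>+a. \<integral>\<^sup>+b. f (pt a b) \<partial>lborel \<partial>lborel)"
    and "(\<integral>\<^sup>+x. f x \<partial>lborel) = (\<integral>\<^sup>+b. \<integral>\<^sup>+a. f (pt a b) \<partial>lborel \<partial>lborel)"
proof -
  have "(\<integral>\<^sup>+x. f x \<partial>lborel) = (\<integral>\<^sup>+p. f (case p of (a, b) \<Rightarrow> pt a b) \<partial>(lborel \<Otimes>\<^sub>M lborel))"
    by (subst lborel_plane, subst nn_integral_distr) auto
  also have "\<dots> = (\<integral>\<^sup>+a. \<integral>\<^sup>+b. f (pt a b) \<partial>lborel \<partial>lborel)"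
    by (subst lborel.nn_integral_fst[symmetric]) auto
  finally show 1: "(\<integral>\<^sup>+x. f x \<partial>lborel) = (\<integral>\<^sup>+a. \<integral>\<^sup>+b. f (pt a b) \<partial>lborel \<partial>lborel)" .
  also have "\<dots> = (\<integral>\<^sup>+b. \<integral>\<^sup>+a. f (pt a b) \<partial>lborel \<partial>lborel)"
    by (rule lborel_pair.Fubini'[symmetric]) measurable
  finally show "(\<integral>\<^sup>+x. f x \<partial>lborel) = (\<integral>\<^sup>+b. \<integral>\<^sup>+a. f (pt a b) \<partial>lborel \<partial>lborel)" .
qed

text \<open>
  If \<open>|f t|\<close> were larger than the total variation of \<open>f\<close>, then \<open>|f|\<close> would be bounded below by a
  positive constant and could not be integrable over the line.
\<close>

lemma abs_le_integral_deriv: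
  fixes f g :: "real \<Rightarrow> real"
  assumes d: "\<And>s. (f has_real_derivative g s) (at s)" and c: "continuous_on UNIV g"
    and fi: "(\<integral>\<^sup>+s. ennreal \<bar>f s\<bar> \<partial>lborel) < \<infinity>"
  shows "ennreal \<bar>f t\<bar> \<le> (\<integral>\<^sup>+s. ennreal \<bar>g s\<bar> \<partial>lborel)"
proof (cases "(\<integral>\<^sup>+s. ennreal \<bar>g s\<bar> \<partial>lborel) = \<infinity>")
  case False
  have gm[measurable]: "g \<in> borel_measurable borel" by (rule borel_measurable_continuous_onI[OF c])
  have gi: "integrable lborel g"
    using False by (intro integrableI_bounded) (auto simp: less_top)
  define I where "I = (LINT s|lborel. \<bar>g s\<bar>)"
  have eI: "(\<integral>\<^sup>+s. ennreal \<bar>g s\<bar> \<partial>lborel) = ennreal I"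
    unfolding I_def using gi by (intro nn_integral_eq_integral) auto
  have inc: "\<bar>f b - f a\<bar> \<le> I" if "a \<le> b" for a b
  proof -
    have "(LINT x|lborel. indicator {a..b} x *\<^sub>R g x) = f b - f a"
      using that d c by (intro integral_FTC_Icc)
        (auto intro: continuous_on_subset has_field_derivative_at_within simp: has_real_derivative_iff_has_vector_derivative[symmetric])
    then have "\<bar>f b - f a\<bar> \<le> (LINT x|lborel. \<bar>indicator {a..b} x *\<^sub>R g x\<bar>)"
      using integral_abs_bound[of lborel "\<lambda>x. indicator {a..b} x *\<^sub>R g x"] by simp
    also have "\<dots> \<le> I" unfolding I_def
      using integrable_mult_indicator[OF _ gi, of "{a..b}"] gi
      by (intro integral_mono integrable_abs) (auto split: split_indicator)
    finally show ?thesis .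
  qed
  show ?thesis
  proof (rule ccontr)
    assume "\<not> ?thesis"
    then have "\<bar>f t\<bar> > I" unfolding eI by (simp add: not_le ennreal_less_iff I_def)
    \<comment> \<open>a lower bound for \<open>|f|\<close> on the whole line\<close>
    define \<delta> where "\<delta> = \<bar>f t\<bar> - I"
    have dp: "\<delta> > 0" using \<open>\<bar>f t\<bar> > I\<close> by (simp add: \<delta>_def)
    have "\<delta> \<le> \<bar>f s\<bar>" for s
      using inc[of s t] inc[of t s] unfolding \<delta>_def by (cases "s \<le> t") auto
    then have "(\<integral>\<^sup>+s. ennreal \<delta> \<partial>(lborel :: real measure)) \<le> (\<integral>\<^sup>+s. ennreal \<bar>f s\<bar> \<partial>lborel)"
      by (intro nn_integral_mono ennreal_leI)
    moreover have "(\<integral>\<^sup>+s. ennreal \<delta> \<partial>(lborel :: real measure)) = \<infinity>"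
      using dp by (simp add: ennreal_mult_top)
    ultimately show False using fi by (simp add: top_unique)
  qed
qed simp

text \<open>
  Gagliardo's argument. On almost every horizontal line \<open>|w|\<close> is bounded by the integral of \<open>|g1|\<close> over
  that line, on almost every vertical line by the integral of \<open>|g2|\<close>. The product of the two bounds
  separates the variables.
\<close>

lemma slice_inequality:
  fixes w g1 g2 :: "plane \<Rightarrow> real"
  assumes w: "continuous_on UNIV w" and g1: "continuous_on UNIV g1" and g2: "continuous_on UNIV g2"
    and d1: "\<And>x s. ((\<lambda>s. w (x + s *\<^sub>R axis 1 1)) has_real_derivative g1 (x + s *\<^sub>R axis 1 1)) (at s)"
    and d2: "\<And>x s. ((\<lambda>s. w (x + s *\<^sub>R axis 2 1)) has_real_derivative g2 (x + s *\<^sub>R axis 2 1)) (at s)"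
    and wi: "(\<integral>\<^sup>+x. ennreal \<bar>w x\<bar> \<partial>lborel) < \<infinity>"
  shows "(\<integral>\<^sup>+x. ennreal ((w x)\<^sup>2) \<partial>lborel) \<le> (\<integral>\<^sup>+x. ennreal \<bar>g1 x\<bar> \<partial>lborel) * (\<integral>\<^sup>+x. ennreal \<bar>g2 x\<bar> \<partial>lborel)"
proof -
  have [measurable]: "w \<in> borel_measurable borel" "g1 \<in> borel_measurable borel" "g2 \<in> borel_measurable borel"
    using w g1 g2 by (auto intro: borel_measurable_continuous_onI)
  define G1 where "G1 = (\<lambda>b. \<integral>\<^sup>+a. ennreal \<bar>g1 (pt a b)\<bar> \<partial>lborel)"
  define G2 where "G2 = (\<lambda>a. \<integral>\<^sup>+b. ennreal \<bar>g2 (pt a b)\<bar> \<partial>lborel)"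
  have plm[measurable]: "(\<lambda>p. pt (fst p) (snd p)) \<in> borel_measurable (lborel \<Otimes>\<^sub>M lborel)"
    "(\<lambda>p. pt (snd p) (fst p)) \<in> borel_measurable (lborel \<Otimes>\<^sub>M lborel)"
    "pt a \<in> borel_measurable lborel" "(\<lambda>a. pt a b) \<in> borel_measurable lborel" for a b
    unfolding pt_def by measurable
  have [measurable]: "G1 \<in> borel_measurable lborel" "G2 \<in> borel_measurable lborel"
    unfolding G1_def G2_def pt_def by measurable
  have c1: "continuous_on UNIV (\<lambda>a. g1 (pt a b))" "continuous_on UNIV (\<lambda>b. g2 (pt a b))" for a b
    unfolding pt_def by (intro continuous_on_compose2[OF g1] continuous_on_compose2[OF g2] continuous_intros; simp)+
  have ae1: "AE b in lborel. \<forall>a. ennreal \<bar>w (pt a b)\<bar> \<le> G1 b"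
  proof -
    have "(\<integral>\<^sup>+b. \<integral>\<^sup>+a. ennreal \<bar>w (pt a b)\<bar> \<partial>lborel \<partial>lborel) \<noteq> \<infinity>"
      using wi by (subst nn_integral_plane(2)[symmetric]) auto
    then have "AE b in lborel. (\<integral>\<^sup>+a. ennreal \<bar>w (pt a b)\<bar> \<partial>lborel) \<noteq> \<infinity>"
      by (intro nn_integral_PInf_AE) (unfold pt_def, measurable)
    then show ?thesis
    proof eventually_elim
      case (elim b)
      have "((\<lambda>a. w (pt a b)) has_real_derivative g1 (pt s b)) (at s)" for s
        using d1[of "pt 0 b" s] by (simp add: pt_def add.commute)
      from abs_le_integral_deriv[OF this c1(1)] show ?case
        unfolding G1_def using elim by (simp add: less_top)
    qed
  qed
  have ae2: "AE a in lborel. \<forall>b. ennreal \<bar>w (pt a b)\<bar> \<le> G2 a"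
  proof -
    have "(\<integral>\<^sup>+a. \<integral>\<^sup>+b. ennreal \<bar>w (pt a b)\<bar> \<partial>lborel \<partial>lborel) \<noteq> \<infinity>"
      using wi by (subst nn_integral_plane(1)[symmetric]) auto
    then have "AE a in lborel. (\<integral>\<^sup>+b. ennreal \<bar>w (pt a b)\<bar> \<partial>lborel) \<noteq> \<infinity>"
      by (intro nn_integral_PInf_AE) (unfold pt_def, measurable)
    then show ?thesis
    proof eventually_elim
      case (elim a)
      have "((\<lambda>b. w (pt a b)) has_real_derivative g2 (pt a s)) (at s)" for s
        using d2[of "pt a 0" s] by (simp add: pt_def add.commute)
      from abs_le_integral_deriv[OF this c1(2)] show ?case
        unfolding G2_def using elim by (simp add: less_top)
    qed
  qed
  have "(\<integral>\<^sup>+x. ennreal ((w x)\<^sup>2) \<partial>lborel) = (\<integral>\<^sup>+b. \<integral>\<^sup>+a. ennreal ((w (pt a b))\<^sup>2) \<partial>lborel \<partial>lborel)"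
    by (rule nn_integral_plane(2)) measurable
  also have "\<dots> \<le> (\<integral>\<^sup>+b. \<integral>\<^sup>+a. G1 b * G2 a \<partial>lborel \<partial>lborel)"
    using ae1
  proof (intro nn_integral_mono_AE, eventually_elim)
    case (elim b)
    show ?case using ae2
    proof (intro nn_integral_mono_AE, eventually_elim)
      case (elim a)
      have "ennreal ((w (pt a b))\<^sup>2) = ennreal \<bar>w (pt a b)\<bar> * ennreal \<bar>w (pt a b)\<bar>"
        by (simp add: ennreal_mult[symmetric] power2_eq_square)
      also have "\<dots> \<le> G1 b * G2 a"
        using elim \<open>\<forall>a. ennreal \<bar>w (pt a b)\<bar> \<le> G1 b\<close> by (intro mult_mono) auto
      finally show ?case .
    qed
  qed
  also have "\<dots> = (\<integral>\<^sup>+b. G1 b * (\<integral>\<^sup>+a. G2 a \<partial>lborel) \<partial>lborel)"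
    by (simp add: nn_integral_cmult)
  also have "\<dots> = (\<integral>\<^sup>+b. G1 b \<partial>lborel) * (\<integral>\<^sup>+a. G2 a \<partial>lborel)"
    by (simp add: nn_integral_multc)
  also have "(\<integral>\<^sup>+b. G1 b \<partial>lborel) = (\<integral>\<^sup>+x. ennreal \<bar>g1 x\<bar> \<partial>lborel)"
    unfolding G1_def by (rule nn_integral_plane(2)[symmetric]) measurable
  also have "(\<integral>\<^sup>+a. G2 a \<partial>lborel) = (\<integral>\<^sup>+x. ennreal \<bar>g2 x\<bar> \<partial>lborel)"
    unfolding G2_def by (rule nn_integral_plane(1)[symmetric]) measurable
  finally show ?thesis .
qed

lemma wdir_axis: "wdir (axis i 1) u = wpart i u"
  using exhaust_2[of i] by (auto simp: wdir_def axis_def fun_eq_iff)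

lemma power_interpolation:
  fixes t :: real assumes "2 \<le> m"
  shows "\<bar>t\<bar> ^ m \<le> t\<^sup>2 + (t ^ (m - 1))\<^sup>2"
proof (cases "\<bar>t\<bar> \<le> 1")
  case True
  then have "\<bar>t\<bar> ^ m \<le> \<bar>t\<bar> ^ 2" using assms by (intro power_decreasing) auto
  then show ?thesis using zero_le_power2[of "t ^ (m - 1)"] by (simp only: power2_abs)
next
  case False
  then have "\<bar>t\<bar> ^ m \<le> \<bar>t\<bar> ^ ((m - 1) * 2)" using assms by (intro power_increasing) auto
  also have "\<dots> = (t ^ (m - 1))\<^sup>2" by (simp add: power_mult power_even_abs flip: power_abs)
  finally show ?thesis using zero_le_power2[of t] by linarith
qed

text \<open>
  The slice inequality for \<open>w = U\<^sup>m\<close> and the Cauchy--Schwarz inequality give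
  \<open>\<integral> U\<^sup>2\<^sup>m \<le> m\<^sup>2 A(u) \<integral> U\<^sup>2\<^sup>m\<^sup>-\<^sup>2\<close>, which is iterated.
\<close>

lemma GN_mollified:
  assumes u: "u \<in> H1"
  shows "(\<lambda>x. mollify n u x ^ Suc m) \<in> L2p \<and>
    (nrm (\<lambda>x. mollify n u x ^ Suc m))\<^sup>2 \<le> (fact (Suc m))\<^sup>2 * A_fun u ^ m * (nrm u)\<^sup>2"
proof (induction m)
  case 0
  show ?case using mollify_L2[OF H1_L2[OF u], of n] by (simp add: power_mono)
next
  case (Suc m)
  define U where "U = mollify n u"
  have UL: "U \<in> L2p" unfolding U_def by (rule mollify_L2(1)[OF H1_L2[OF u]])
  have U1: "(\<lambda>x. U x ^ Suc m) \<in> L2p" using Suc by (simp add: U_def)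
  have cU: "continuous_on UNIV U" unfolding U_def by (rule mollify_continuous[OF H1_L2[OF u]])
  have cW: "continuous_on UNIV (mollify n (wpart i u))" for i by (rule mollify_continuous[OF wpart_L2[OF u]])
  have WL: "mollify n (wpart i u) \<in> L2p" for i by (rule mollify_L2(1)[OF wpart_L2[OF u]])
  have W: "nrm (mollify n (wpart i u)) \<le> sqrt (A_fun u)" for i
    using mollify_L2(2)[OF wpart_L2[OF u, of i], of n] nrm_wpart_le[OF u, of i] by simp
  define g where "g = (\<lambda>i x. real (Suc (Suc m)) * (U x ^ Suc m * mollify n (wpart i u) x))"
  have d: "((\<lambda>s. U (x + s *\<^sub>R axis i 1) ^ Suc (Suc m)) has_real_derivative g i (x + s *\<^sub>R axis i 1)) (at s)" for i x s
    using DERIV_power[OF mollify_deriv[OF u, of n x "axis i 1" s], of "Suc (Suc m)"]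
    by (simp add: U_def g_def wdir_axis mult_ac)
  have gb: "(\<integral>\<^sup>+x. ennreal \<bar>g i x\<bar> \<partial>lborel) \<le> ennreal (real (Suc (Suc m)) * (nrm (\<lambda>x. U x ^ Suc m) * sqrt (A_fun u)))" for i
  proof -
    have "(\<integral>\<^sup>+x. ennreal \<bar>g i x\<bar> \<partial>lborel) = ennreal (LINT x|lborel. \<bar>g i x\<bar>)"
      unfolding g_def by (intro nn_integral_eq_integral integrable_abs integrable_mult_right L2_mult_integrable U1 WL) auto
    also have "(LINT x|lborel. \<bar>g i x\<bar>) = real (Suc (Suc m)) * (LINT x|lborel. \<bar>U x ^ Suc m\<bar> * \<bar>mollify n (wpart i u) x\<bar>)"
      unfolding g_def abs_mult by simp
    also have "\<dots> \<le> real (Suc (Suc m)) * (nrm (\<lambda>x. U x ^ Suc m) * sqrt (A_fun u))"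
      by (intro mult_left_mono order_trans[OF Cauchy_Schwarz_abs[OF U1 WL]] W) auto
    finally show ?thesis by (simp add: ennreal_leI)
  qed
  have "(\<integral>\<^sup>+x. ennreal ((U x ^ Suc (Suc m))\<^sup>2) \<partial>lborel) \<le> (\<integral>\<^sup>+x. ennreal \<bar>g 1 x\<bar> \<partial>lborel) * (\<integral>\<^sup>+x. ennreal \<bar>g 2 x\<bar> \<partial>lborel)"
  proof (rule slice_inequality)
    show "continuous_on UNIV (\<lambda>x. U x ^ Suc (Suc m))" "continuous_on UNIV (g 1)" "continuous_on UNIV (g 2)"
      unfolding g_def by (intro continuous_intros cU cW)+
    have i: "integrable lborel (\<lambda>x. (U x)\<^sup>2 + (U x ^ Suc m)\<^sup>2)"
      using L2_int[OF UL] L2_int[OF U1] by simp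
    have "integrable lborel (\<lambda>x. U x ^ Suc (Suc m))"
    proof (rule Bochner_Integration.integrable_bound[OF i])
      show "AE x in lborel. norm (U x ^ Suc (Suc m)) \<le> norm ((U x)\<^sup>2 + (U x ^ Suc m)\<^sup>2)"
      proof (rule AE_I2)
        fix x
        have "\<bar>U x\<bar> ^ Suc (Suc m) \<le> (U x)\<^sup>2 + (U x ^ Suc m)\<^sup>2"
          using power_interpolation[of "Suc (Suc m)" "U x"] by simp
        then show "norm (U x ^ Suc (Suc m)) \<le> norm ((U x)\<^sup>2 + (U x ^ Suc m)\<^sup>2)"
          by (simp only: real_norm_def power_abs)
      qed
    qed (use L2_meas[OF UL] in simp)
    then show "(\<integral>\<^sup>+x. ennreal \<bar>U x ^ Suc (Suc m)\<bar> \<partial>lborel) < \<infinity>"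
      by (simp only: integrable_iff_bounded real_norm_def)
  qed (use d in auto)
  also have "\<dots> \<le> ennreal (real (Suc (Suc m)) * (nrm (\<lambda>x. U x ^ Suc m) * sqrt (A_fun u))) * ennreal (real (Suc (Suc m)) * (nrm (\<lambda>x. U x ^ Suc m) * sqrt (A_fun u)))"
    by (intro mult_mono gb) auto
  also have "\<dots> = ennreal ((real (Suc (Suc m)) * (nrm (\<lambda>x. U x ^ Suc m) * sqrt (A_fun u)))\<^sup>2)"
    by (simp add: ennreal_mult[symmetric] power2_eq_square)
  finally have *: "(\<integral>\<^sup>+x. ennreal ((U x ^ Suc (Suc m))\<^sup>2) \<partial>lborel) \<le> ennreal ((real (Suc (Suc m)) * (nrm (\<lambda>x. U x ^ Suc m) * sqrt (A_fun u)))\<^sup>2)" .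
  have m: "(\<lambda>x. U x ^ Suc (Suc m)) \<in> borel_measurable lborel" using L2_meas[OF UL] by simp
  have r: "(\<lambda>x. U x ^ Suc (Suc m)) \<in> L2p" "nrm (\<lambda>x. U x ^ Suc (Suc m)) \<le> real (Suc (Suc m)) * (nrm (\<lambda>x. U x ^ Suc m) * sqrt (A_fun u))"
    by (rule L2_nn_integralI[OF m *]; simp)+
  have "(nrm (\<lambda>x. U x ^ Suc (Suc m)))\<^sup>2 \<le> (real (Suc (Suc m)) * (nrm (\<lambda>x. U x ^ Suc m) * sqrt (A_fun u)))\<^sup>2"
    using r(2) by (intro power_mono) auto
  also have "\<dots> = (real (Suc (Suc m)))\<^sup>2 * A_fun u * (nrm (\<lambda>x. U x ^ Suc m))\<^sup>2"
    by (simp add: power_mult_distrib)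
  also have "\<dots> \<le> (real (Suc (Suc m)))\<^sup>2 * A_fun u * ((fact (Suc m))\<^sup>2 * A_fun u ^ m * (nrm u)\<^sup>2)"
    using Suc by (intro mult_left_mono) (auto simp: U_def)
  also have "\<dots> = (fact (Suc (Suc m)))\<^sup>2 * A_fun u ^ Suc m * (nrm u)\<^sup>2"
    by (simp only: fact_Suc[of "Suc m"] power_mult_distrib power_Suc of_nat_mult of_nat_fact) (simp add: mult_ac)
  finally show ?case using r(1) by (simp add: U_def)
qed

lemma GN_even:
  assumes u: "u \<in> H1"
  shows "(\<lambda>x. u x ^ Suc m) \<in> L2p"
    "(nrm (\<lambda>x. u x ^ Suc m))\<^sup>2 \<le> (fact (Suc m))\<^sup>2 * A_fun u ^ m * (nrm u)\<^sup>2"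
proof -
  note L = H1_L2[OF u]
  define B where "B = sqrt ((fact (Suc m))\<^sup>2 * A_fun u ^ m * (nrm u)\<^sup>2)"
  have B: "B\<^sup>2 = (fact (Suc m))\<^sup>2 * A_fun u ^ m * (nrm u)\<^sup>2" "B \<ge> 0" unfolding B_def by auto
  obtain r where r: "strict_mono (r::nat\<Rightarrow>nat)" "AE x in lborel. (\<lambda>n. mollify (r n) u x) \<longlonglongrightarrow> u x"
    by (rule L2_AE_subseq[OF mollify_L2(1)[OF L] L mollify_tendsto_L2[OF L]])
  have g: "(\<lambda>x. mollify n u x ^ Suc m) \<in> L2p" "nrm (\<lambda>x. mollify n u x ^ Suc m) \<le> B" for n
  proof -
    show "(\<lambda>x. mollify n u x ^ Suc m) \<in> L2p" using GN_mollified[OF u] by blast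
    have "(nrm (\<lambda>x. mollify n u x ^ Suc m))\<^sup>2 \<le> B\<^sup>2" using GN_mollified[OF u] unfolding B(1) by blast
    then show "nrm (\<lambda>x. mollify n u x ^ Suc m) \<le> B" using B(2) by (rule power2_le_imp_le)
  qed
  have ae: "AE x in lborel. (\<lambda>n. mollify (r n) u x ^ Suc m) \<longlonglongrightarrow> u x ^ Suc m"
    using r(2) by eventually_elim (rule tendsto_power)
  have m: "(\<lambda>x. u x ^ Suc m) \<in> borel_measurable lborel" using L2_meas[OF L] by simp
  note F = L2_Fatou[where f = "\<lambda>n x. mollify (r n) u x ^ Suc m", OF g(1) m ae always_eventually B(2)]
  show "(\<lambda>x. u x ^ Suc m) \<in> L2p" using F(1) g(2) by blast
  have "nrm (\<lambda>x. u x ^ Suc m) \<le> B" using F(2) g(2) by blast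
  then show "(nrm (\<lambda>x. u x ^ Suc m))\<^sup>2 \<le> (fact (Suc m))\<^sup>2 * A_fun u ^ m * (nrm u)\<^sup>2"
    unfolding B(1)[symmetric] by (intro power_mono) auto
qed

lemma powr_interpolation:
  fixes t s q :: real and m :: nat
  assumes "0 \<le> t" "0 < s" "2 \<le> q" "q \<le> 2 * real m"
  shows "t powr q \<le> s powr (q - 2) * t\<^sup>2 + s powr (q - 2 * real m) * (t ^ m)\<^sup>2"
proof (cases "t = 0")
  case False
  then have t: "t > 0" using assms by simp
  have e2: "t\<^sup>2 = t powr 2" using t by (simp add: powr_numeral)
  have em: "(t ^ m)\<^sup>2 = t powr (2 * real m)" using t by (simp add: powr_realpow[symmetric] powr_powr power2_eq_square powr_add[symmetric])
  show ?thesis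
  proof (cases "t \<le> s")
    case True
    have "t powr q = t powr (q - 2) * t powr 2" by (simp add: powr_add[symmetric])
    also have "\<dots> \<le> s powr (q - 2) * t powr 2" using True t assms by (intro mult_right_mono powr_mono2) auto
    finally show ?thesis unfolding e2 by (simp add: add_increasing2)
  next
    case False
    have "t powr q = t powr (q - 2 * real m) * t powr (2 * real m)" by (simp add: powr_add[symmetric])
    also have "\<dots> \<le> s powr (q - 2 * real m) * t powr (2 * real m)"
      using False t assms by (intro mult_right_mono powr_mono2') auto
    finally show ?thesis unfolding em by (simp add: add_increasing)
  qed
qed (use assms in simp)

text \<open>
  For real exponents \<open>q\<close> the power \<open>|u|\<^sup>q\<close> is interpolated pointwise between \<open>u\<^sup>2\<close> and an even power,
  with a free parameter \<open>s\<close>. The choice \<open>s = \<parallel>\<nabla>u\<parallel>\<close> makes both terms scale in the same way.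
\<close>

lemma GN_inequality:
  assumes q: "2 < q"
  obtains K where "K \<ge> 0" "\<And>u. u \<in> H1 \<Longrightarrow> integrable lborel (\<lambda>x. \<bar>u x\<bar> powr q)"
    "\<And>u. u \<in> H1 \<Longrightarrow> (LINT x|lborel. \<bar>u x\<bar> powr q) \<le> K * sqrt (A_fun u) powr (q - 2) * (nrm u)\<^sup>2"
proof -
  obtain m where m: "q \<le> 2 * real (Suc m)" "m \<ge> 1"
  proof -
    obtain k :: nat where k: "q \<le> real k" using real_arch_simple by blast
    show ?thesis by (rule that[of "Suc k"]) (use k in auto)
  qed
  define K where "K = 1 + (fact (Suc m) :: real)\<^sup>2"
  have main: "integrable lborel (\<lambda>x. \<bar>u x\<bar> powr q) \<and> (LINT x|lborel. \<bar>u x\<bar> powr q) \<le> s powr (q - 2) * (nrm u)\<^sup>2 + s powr (q - 2 * real (Suc m)) * (nrm (\<lambda>x. u x ^ Suc m))\<^sup>2"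
    if u: "u \<in> H1" and s: "s > 0" for u s
  proof -
    note L = H1_L2[OF u]
    have i: "integrable lborel (\<lambda>x. s powr (q - 2) * (u x)\<^sup>2 + s powr (q - 2 * real (Suc m)) * (u x ^ Suc m)\<^sup>2)"
      using L2_int[OF L] L2_int[OF GN_even(1)[OF u, of m]] by simp
    have b: "\<bar>u x\<bar> powr q \<le> s powr (q - 2) * (u x)\<^sup>2 + s powr (q - 2 * real (Suc m)) * (u x ^ Suc m)\<^sup>2" for x
      using powr_interpolation[OF abs_ge_zero s less_imp_le[OF q] m(1), of "u x"] by (simp only: power_abs[symmetric] power2_abs abs_power2)
    have ii: "integrable lborel (\<lambda>x. \<bar>u x\<bar> powr q)"
    proof (rule Bochner_Integration.integrable_bound[OF i])
      show "(\<lambda>x. \<bar>u x\<bar> powr q) \<in> borel_measurable lborel" using L2_meas[OF L] by simp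
      show "AE x in lborel. norm (\<bar>u x\<bar> powr q) \<le> norm (s powr (q - 2) * (u x)\<^sup>2 + s powr (q - 2 * real (Suc m)) * (u x ^ Suc m)\<^sup>2)"
        by (rule AE_I2) (use b in \<open>simp only: real_norm_def, auto intro: order_trans[OF _ abs_ge_self]\<close>)
    qed
    have "(LINT x|lborel. \<bar>u x\<bar> powr q) \<le> (LINT x|lborel. s powr (q - 2) * (u x)\<^sup>2 + s powr (q - 2 * real (Suc m)) * (u x ^ Suc m)\<^sup>2)"
      by (rule integral_mono[OF ii i b])
    also have "\<dots> = s powr (q - 2) * (nrm u)\<^sup>2 + s powr (q - 2 * real (Suc m)) * (nrm (\<lambda>x. u x ^ Suc m))\<^sup>2"
      unfolding nrm2_sq using L2_int[OF L] L2_int[OF GN_even(1)[OF u, of m]] by simp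
    finally show ?thesis using ii by blast
  qed
  show ?thesis
  proof (rule that[of K])
    show "K \<ge> 0" by (simp add: K_def)
    fix u assume u: "u \<in> H1"
    show ii: "integrable lborel (\<lambda>x. \<bar>u x\<bar> powr q)" using main[OF u, of 1] by simp
    show "(LINT x|lborel. \<bar>u x\<bar> powr q) \<le> K * sqrt (A_fun u) powr (q - 2) * (nrm u)\<^sup>2"
    proof (cases "A_fun u = 0")
      case True
      have "(nrm (\<lambda>x. u x ^ Suc m))\<^sup>2 \<le> 0" using GN_even(2)[OF u, of m] m(2) True by (simp add: power_0_left)
      then have "(LINT x|lborel. (u x ^ Suc m)\<^sup>2) = 0" unfolding nrm2_sq by (simp add: antisym)
      then have "AE x in lborel. (u x ^ Suc m)\<^sup>2 = 0"
        by (subst (asm) integral_nonneg_eq_0_iff_AE[OF L2_int[OF GN_even(1)[OF u]]]) auto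
      then have "AE x in lborel. \<bar>u x\<bar> powr q = 0" by eventually_elim auto
      then have "(LINT x|lborel. \<bar>u x\<bar> powr q) = 0" by (rule integral_eq_zero_AE)
      then show ?thesis using True by simp
    next
      case False
      define s where "s = sqrt (A_fun u)"
      have s: "s > 0" "s\<^sup>2 = A_fun u" using False A_fun_nonneg[of u] by (auto simp: s_def order_le_less)
      have "(LINT x|lborel. \<bar>u x\<bar> powr q) \<le> s powr (q - 2) * (nrm u)\<^sup>2 + s powr (q - 2 * real (Suc m)) * (nrm (\<lambda>x. u x ^ Suc m))\<^sup>2"
        using main[OF u s(1)] by blast
      also have "\<dots> \<le> s powr (q - 2) * (nrm u)\<^sup>2 + s powr (q - 2 * real (Suc m)) * ((fact (Suc m))\<^sup>2 * A_fun u ^ m * (nrm u)\<^sup>2)"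
        by (intro add_left_mono mult_left_mono GN_even(2)[OF u]) auto
      also have "s powr (q - 2 * real (Suc m)) * ((fact (Suc m))\<^sup>2 * A_fun u ^ m * (nrm u)\<^sup>2) = (fact (Suc m))\<^sup>2 * (s powr (q - 2 * real (Suc m)) * A_fun u ^ m) * (nrm u)\<^sup>2"
        by (simp add: mult_ac)
      also have "s powr (q - 2 * real (Suc m)) * A_fun u ^ m = s powr (q - 2)"
      proof -
        have "A_fun u ^ m = s ^ (2 * m)" by (simp only: s(2)[symmetric] power_mult)
        also have "\<dots> = s powr real (2 * m)" by (rule powr_realpow[OF s(1), symmetric])
        finally have "A_fun u ^ m = s powr (2 * real m)" by simp
        then show ?thesis by (simp add: powr_add[symmetric])
      qed
      finally show ?thesis by (simp add: K_def s_def algebra_simps)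
    qed
  qed
qed

text \<open>
  The infimum defining \<open>K_GN\<close> is itself an admissible constant, because for each \<open>u\<close> the condition on
  the constant is a closed half line; the set of admissible constants is not empty by the previous lemma.
\<close>

lemma K_GN_inequality:
  assumes q: "2 < q" and u: "u \<in> H1"
  shows "C_fun q u \<le> K_GN q * sqrt (A_fun u) powr (q - 2) * (nrm u)\<^sup>2"
proof -
  let ?S = "{K. \<forall>u\<in>H1. (LINT x|lborel. \<bar>u x\<bar> powr q)
      \<le> K * sqrt (LINT x|lborel. (norm (weak_gradient u x))\<^sup>2) powr (q - 2) * (sqrt (LINT x|lborel. (u x)\<^sup>2))\<^sup>2}"
  define W where "W = sqrt (A_fun u) powr (q - 2) * (nrm u)\<^sup>2"
  obtain K where K: "K \<ge> 0" "\<And>u. u \<in> H1 \<Longrightarrow> (LINT x|lborel. \<bar>u x\<bar> powr q) \<le> K * sqrt (A_fun u) powr (q - 2) * (nrm u)\<^sup>2"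
    using GN_inequality[OF q] by metis
  have KS: "K \<in> ?S" using K(2) by (auto simp: A_fun_def nrm2_def)
  have le: "C_fun q u \<le> k * W" if "k \<in> ?S" for k
    using that u by (auto simp: A_fun_def nrm2_def C_fun_def W_def mult.assoc)
  have W0: "W \<ge> 0" by (simp add: W_def)
  have "C_fun q u \<le> Inf ?S * W"
  proof (cases "W = 0")
    case True
    then show ?thesis using le[OF KS] by simp
  next
    case False
    then have W: "W > 0" using W0 by simp
    have "C_fun q u / W \<le> Inf ?S"
    proof (rule cInf_greatest)
      show "?S \<noteq> {}" using KS by blast
      fix k assume "k \<in> ?S"
      from le[OF this] show "C_fun q u / W \<le> k" using W by (simp add: pos_divide_le_eq)
    qed
    then show ?thesis using W by (simp add: pos_divide_le_eq)
  qed
  then show ?thesis by (simp add: K_GN_def W_def mult.assoc)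
qed

section \<open>The Dirichlet energy and \<open>L\<^sup>2\<close> convergence\<close>

lemma dirichlet_Cauchy_Schwarz: assumes "u \<in> H1" "v \<in> H1" shows "\<bar>dirichlet u v\<bar> \<le> sqrt (A_fun u) * sqrt (A_fun v)"
proof -
  define n where "n = (\<lambda>i. nrm (wpart i u))"
  define m where "m = (\<lambda>i. nrm (wpart i v))"
  have b: "\<bar>LINT x|lborel. wpart i u x * wpart i v x\<bar> \<le> n i * m i" for i
    unfolding n_def m_def by (rule Cauchy_Schwarz_L2[OF wpart_L2 wpart_L2]) (use assms in auto)
  have "\<bar>dirichlet u v\<bar> \<le> n 1 * m 1 + n 2 * m 2"
    unfolding dirichlet_def using b[of 1] b[of 2] by linarith
  also have "\<dots> \<le> sqrt (((n 1)\<^sup>2 + (n 2)\<^sup>2) * ((m 1)\<^sup>2 + (m 2)\<^sup>2))"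
  proof (rule real_le_rsqrt)
    have "0 \<le> (n 1 * m 2 - n 2 * m 1)\<^sup>2" by simp
    then show "(n 1 * m 1 + n 2 * m 2)\<^sup>2 \<le> ((n 1)\<^sup>2 + (n 2)\<^sup>2) * ((m 1)\<^sup>2 + (m 2)\<^sup>2)"
      by (simp add: power2_eq_square algebra_simps)
  qed
  finally show ?thesis
    unfolding A_fun_eq[OF assms(1)] A_fun_eq[OF assms(2)] n_def m_def by (simp add: real_sqrt_mult)
qed

lemma sqrt_A_fun_triangle:
  assumes "u \<in> H1" "v \<in> H1"
  shows "sqrt (A_fun (\<lambda>x. u x + v x)) \<le> sqrt (A_fun u) + sqrt (A_fun v)"
proof (rule real_le_lsqrt)
  show "A_fun (\<lambda>x. u x + v x) \<le> (sqrt (A_fun u) + sqrt (A_fun v))\<^sup>2"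
    unfolding A_fun_add[OF assms] using dirichlet_Cauchy_Schwarz[OF assms] by (simp add: power2_sum)
qed simp_all

lemma sqrt_A_fun_diff:
  assumes "u \<in> H1" "v \<in> H1"
  shows "\<bar>sqrt (A_fun u) - sqrt (A_fun v)\<bar> \<le> sqrt (A_fun (\<lambda>x. u x - v x))"
proof -
  have "A_fun (\<lambda>x. v x - u x) = A_fun (\<lambda>x. u x - v x)"
    using A_fun_cmult[OF H1_diff(1)[OF assms], of "-1"] by simp
  then show ?thesis
    using sqrt_A_fun_triangle[OF H1_diff(1)[OF assms] assms(2)] sqrt_A_fun_triangle[OF H1_diff(1)[OF assms(2,1)] assms(1)]
    by simp
qed

lemma nrm_wpart_diff:
  assumes "u \<in> H1" "v \<in> H1"
  shows "nrm (\<lambda>x. wpart i u x - wpart i v x) = nrm (wpart i (\<lambda>x. u x - v x))"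
proof (rule nrm2_cong_AE)
  show "AE x in lborel. wpart i u x - wpart i v x = wpart i (\<lambda>x. u x - v x) x"
    using H1_diff(2)[OF assms, of i] by eventually_elim simp
qed (use wpart_borel[OF assms(1)] wpart_borel[OF assms(2)] wpart_borel[OF H1_diff(1)[OF assms]] in auto)

text \<open>
  The partial derivatives converge in \<open>L\<^sup>2\<close> by completeness, and integration against test functions
  passes to the limit.
\<close>

lemma H1_closed:
  assumes f: "\<And>n. f n \<in> H1" and u: "u \<in> L2p" and c: "(\<lambda>n. nrm (\<lambda>x. f n x - u x)) \<longlonglongrightarrow> 0"
    and C: "\<And>e. e > 0 \<Longrightarrow> \<exists>N. \<forall>i\<ge>N. \<forall>j\<ge>N. A_fun (\<lambda>x. f i x - f j x) < e"
  shows "u \<in> H1" "(\<lambda>n. A_fun (\<lambda>x. f n x - u x)) \<longlonglongrightarrow> 0"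
proof -
  have "\<exists>g. g \<in> L2p \<and> (\<lambda>n. nrm (\<lambda>x. wpart i (f n) x - g x)) \<longlonglongrightarrow> 0" for i
  proof (rule L2_complete[of "\<lambda>n. wpart i (f n)" lborel])
    show "wpart i (f n) \<in> L2p" for n by (rule wpart_L2[OF f])
    fix e :: real assume e: "e > 0"
    obtain N where N: "\<And>k l. k \<ge> N \<Longrightarrow> l \<ge> N \<Longrightarrow> A_fun (\<lambda>x. f k x - f l x) < e\<^sup>2"
      using C[of "e\<^sup>2"] e by auto
    have "nrm (\<lambda>x. wpart i (f k) x - wpart i (f l) x) < e" if "k \<ge> N" "l \<ge> N" for k l
    proof -
      have "nrm (\<lambda>x. wpart i (f k) x - wpart i (f l) x) \<le> sqrt (A_fun (\<lambda>x. f k x - f l x))"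
        unfolding nrm_wpart_diff[OF f f] by (rule nrm_wpart_le[OF H1_diff(1)[OF f f]])
      also have "\<dots> < e" using N[OF that] e by (intro real_less_lsqrt) auto
      finally show ?thesis .
    qed
    then show "\<exists>N. \<forall>k\<ge>N. \<forall>l\<ge>N. nrm (\<lambda>x. wpart i (f k) x - wpart i (f l) x) < e" by blast
  qed blast
  then have "\<forall>i. \<exists>g. g \<in> L2p \<and> (\<lambda>n. nrm (\<lambda>x. wpart i (f n) x - g x)) \<longlonglongrightarrow> 0" by blast
  from choice[OF this] obtain g where g: "\<And>i. g i \<in> L2p" "\<And>i. (\<lambda>n. nrm (\<lambda>x. wpart i (f n) x - g i x)) \<longlonglongrightarrow> 0"
    by blast
  have w: "(LINT x|lborel. u x * partial i \<phi> x) = - (LINT x|lborel. g i x * \<phi> x)" if t: "test_function \<phi>" for i \<phi>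
  proof (rule LIMSEQ_unique)
    show "(\<lambda>n. LINT x|lborel. f n x * partial i \<phi> x) \<longlonglongrightarrow> (LINT x|lborel. u x * partial i \<phi> x)"
      by (rule L2_tendsto_inner[OF H1_L2[OF f] u test_function_L2[OF test_function_partial[OF t]] c])
    have "(\<lambda>n. - (LINT x|lborel. wpart i (f n) x * \<phi> x)) \<longlonglongrightarrow> - (LINT x|lborel. g i x * \<phi> x)"
      by (intro tendsto_minus L2_tendsto_inner[OF wpart_L2[OF f] g(1) test_function_L2[OF t] g(2)])
    then show "(\<lambda>n. LINT x|lborel. f n x * partial i \<phi> x) \<longlonglongrightarrow> - (LINT x|lborel. g i x * \<phi> x)"
      by (simp add: wpart_test[OF f t])
  qed
  show uH: "u \<in> H1" by (rule H1I(1)[OF u g(1) w])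
  have ae: "AE x in lborel. wpart i u x = g i x" for i by (rule H1I(2)[OF u g(1) w])
  have e: "nrm (wpart i (\<lambda>x. f n x - u x)) = nrm (\<lambda>x. wpart i (f n) x - g i x)" for i n
    unfolding nrm_wpart_diff[OF f uH, symmetric]
  proof (rule nrm2_cong_AE)
    show "AE x in lborel. wpart i (f n) x - wpart i u x = wpart i (f n) x - g i x"
      using ae[of i] by eventually_elim simp
  qed (use wpart_borel[OF f] wpart_borel[OF uH] L2_meas[OF g(1)] in auto)
  have "(\<lambda>n. (nrm (\<lambda>x. wpart 1 (f n) x - g 1 x))\<^sup>2 + (nrm (\<lambda>x. wpart 2 (f n) x - g 2 x))\<^sup>2) \<longlonglongrightarrow> 0\<^sup>2 + 0\<^sup>2"
    by (intro tendsto_intros g)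
  then show "(\<lambda>n. A_fun (\<lambda>x. f n x - u x)) \<longlonglongrightarrow> 0"
    unfolding A_fun_eq[OF H1_diff(1)[OF f uH]] e by simp
qed

text \<open>
  Let \<open>d N\<close> be the infimum of \<open>A_fun\<close> over the functions at distance at
  most \<open>1 / (N + 1)\<close> from \<open>u\<close>. These sets are convex, so the parallelogram identity shows that almost
  minimizers \<open>v N\<close> form a Cauchy sequence for the energy. Their limit is \<open>u\<close>, and \<open>d N \<le> K\<close> because the
  set contains members of the given sequence.
\<close>

lemma A_fun_lsc:
  assumes f: "\<And>n. f n \<in> H1" and u: "u \<in> L2p" and c: "(\<lambda>n. nrm (\<lambda>x. f n x - u x)) \<longlonglongrightarrow> 0"
    and K: "\<And>n. A_fun (f n) \<le> K"
  shows "u \<in> H1" "A_fun u \<le> K"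
proof -
  define S where "S = (\<lambda>N. {v \<in> H1. nrm (\<lambda>x. v x - u x) \<le> inverse (real (Suc N))})"
  \<comment> \<open>the infima increase with \<open>N\<close> and are bounded by \<open>K\<close>, hence converge\<close>
  define d where "d = (\<lambda>N. Inf (A_fun ` S N))"
  have ne: "\<exists>n. f n \<in> S N" for N
  proof -
    have "\<forall>\<^sub>F n in sequentially. nrm (\<lambda>x. f n x - u x) < inverse (real (Suc N))"
      by (rule order_tendstoD(2)[OF c]) simp
    then obtain n where "nrm (\<lambda>x. f n x - u x) < inverse (real (Suc N))"
      by (meson eventually_happens trivial_limit_sequentially)
    then show ?thesis using f by (auto simp: S_def intro!: exI[of _ n])
  qed
  have bb: "bdd_below (A_fun ` S N)" for N by (rule bdd_belowI[of _ 0]) auto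
  have dle: "d N \<le> A_fun v" if "v \<in> S N" for v N
    unfolding d_def by (rule cInf_lower[OF _ bb]) (use that in blast)
  have dK: "d N \<le> K" for N using ne[of N] dle K order_trans by blast
  have Smono: "S M \<subseteq> S N" if "N \<le> M" for N M
  proof -
    have "inverse (real (Suc M)) \<le> inverse (real (Suc N))" using that by (intro le_imp_inverse_le) auto
    then show ?thesis by (auto simp: S_def simp del: of_nat_Suc intro: order_trans)
  qed
  have dm: "d N \<le> d M" if "N \<le> M" for N M
    unfolding d_def using ne[of M] Smono[OF that] by (intro cInf_superset_mono bb image_mono) auto
  have "\<forall>N. \<exists>v. v \<in> S N \<and> A_fun v < d N + inverse (real (Suc N))"
  proof
    fix N
    have "Inf (A_fun ` S N) < d N + inverse (real (Suc N))" by (simp add: d_def)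
    then show "\<exists>v. v \<in> S N \<and> A_fun v < d N + inverse (real (Suc N))"
      using ne[of N] by (subst (asm) cInf_less_iff[OF _ bb]) auto
  qed
  from choice[OF this] obtain v where v: "\<And>N. v N \<in> S N" "\<And>N. A_fun (v N) < d N + inverse (real (Suc N))" by blast
  have vH: "v N \<in> H1" for N using v(1) by (auto simp: S_def)
  have vu: "nrm (\<lambda>x. v N x - u x) \<le> inverse (real (Suc N))" for N using v(1) by (auto simp: S_def)
  have vc: "(\<lambda>N. nrm (\<lambda>x. v N x - u x)) \<longlonglongrightarrow> 0"
    by (rule Lim_null_comparison[OF _ LIMSEQ_inverse_real_of_nat]) (use vu in auto)
  have dconv: "Cauchy d"
  proof -
    have "incseq d" using dm by (auto simp: incseq_def)
    then obtain L where "d \<longlonglongrightarrow> L" using incseq_convergent[of d K] dK by blast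
    then show ?thesis by (rule LIMSEQ_imp_Cauchy)
  qed
  have half: "(\<lambda>x. (1/2) * (v N x + v M x)) \<in> S N" if "N \<le> M" for N M
  proof -
    have vM: "v M \<in> S N" using v(1) Smono[OF that] by blast
    have H: "(\<lambda>x. (1/2) * (v N x + v M x)) \<in> H1" by (intro H1_cmult(1) H1_add(1) vH)
    have "nrm (\<lambda>x. (1/2) * (v N x + v M x) - u x) = nrm (\<lambda>x. (1/2) * ((v N x - u x) + (v M x - u x)))"
      by (rule nrm2_cong) (simp add: field_simps)
    also have "\<dots> \<le> (1/2) * (nrm (\<lambda>x. v N x - u x) + nrm (\<lambda>x. v M x - u x))"
      unfolding nrm2_cmult using nrm2_triangle[OF L2_diff[OF H1_L2[OF vH[of N]] u] L2_diff[OF H1_L2[OF vH[of M]] u]] by simp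
    also have "\<dots> \<le> inverse (real (Suc N))" using v(1)[of N] vM by (simp add: S_def)
    finally show ?thesis using H by (simp add: S_def)
  qed
  have est: "A_fun (\<lambda>x. v N x - v M x) \<le> 2 * (d M - d N) + 4 * inverse (real (Suc N))" if "N \<le> M" for N M
  proof -
    have "inverse (real (Suc M)) \<le> inverse (real (Suc N))" using that by (intro le_imp_inverse_le) auto
    moreover have "2 * a + 2 * b - 4 * c \<le> 2 * (dM - dN) + 4 * i"
      if "j \<le> i" "dN \<le> c" "a < dN + i" "b < dM + j" for a b c dM dN i j :: real
      using that by argo
    ultimately show ?thesis
      unfolding A_fun_parallelogram[OF vH vH] using dle[OF half[OF that]] v(2)[of N] v(2)[of M] by blast
  qed
  have C: "\<exists>N. \<forall>i\<ge>N. \<forall>j\<ge>N. A_fun (\<lambda>x. v i x - v j x) < e" if e: "e > 0" for e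
  proof -
    obtain N1 where N1: "\<And>i j. i \<ge> N1 \<Longrightarrow> j \<ge> N1 \<Longrightarrow> norm (d i - d j) < e / 8"
      using CauchyD[OF dconv, of "e/8"] e by auto
    obtain N2 where N2: "inverse (real (Suc N2)) < e / 8" using reals_Archimedean[of "e/8"] e by auto
    have *: "A_fun (\<lambda>x. v i x - v j x) < e" if "i \<ge> max N1 N2" "i \<le> j" for i j
    proof -
      have "inverse (real (Suc i)) \<le> inverse (real (Suc N2))" using that by (intro le_imp_inverse_le) auto
      moreover have "d j - d i < e / 8"
        using abs_ge_self[of "d j - d i"] N1[of j i] that by (simp add: real_norm_def del: abs_ge_self)
      moreover have "a < e" if "a \<le> 2 * (dj - di) + 4 * x" "x \<le> y" "y < e / 8" "dj - di < e / 8" for a dj di x y :: real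
        using that e by argo
      ultimately show ?thesis using est[OF that(2)] N2 by blast
    qed
    have "A_fun (\<lambda>x. v i x - v j x) < e" if "i \<ge> max N1 N2" "j \<ge> max N1 N2" for i j
    proof (cases "i \<le> j")
      case False
      have "A_fun (\<lambda>x. v i x - v j x) = A_fun (\<lambda>x. v j x - v i x)"
        using A_fun_cmult[OF H1_diff(1)[OF vH vH], of "-1" j i] by simp
      then show ?thesis using *[of j i] False that by simp
    qed (use * that in auto)
    then show ?thesis by blast
  qed
  note H = H1_closed[OF vH u vc C]
  show uH: "u \<in> H1" by (rule H(1))
  have "sqrt (A_fun u) \<le> sqrt (K + inverse (real (Suc n))) + sqrt (A_fun (\<lambda>x. v n x - u x))" for n
  proof -
    have "sqrt (A_fun (v n)) \<le> sqrt (K + inverse (real (Suc n)))"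
      using v(2)[of n] dK[of n] by (intro real_sqrt_le_mono) linarith
    then show ?thesis using sqrt_A_fun_diff[OF vH uH, of n] by linarith
  qed
  moreover have "(\<lambda>n. sqrt (K + inverse (real (Suc n))) + sqrt (A_fun (\<lambda>x. v n x - u x))) \<longlonglongrightarrow> sqrt (K + 0) + sqrt 0"
    by (intro tendsto_add tendsto_real_sqrt tendsto_const LIMSEQ_inverse_real_of_nat H(2))
  ultimately have "sqrt (A_fun u) \<le> sqrt (K + 0) + sqrt 0" by (intro LIMSEQ_le_const) blast+
  then show "A_fun u \<le> K" by simp
qed

text \<open>
  By the parallelogram identity a part of \<open>A_fun (f n - u)\<close> that does not tend to \<open>0\<close> would be missing
  in the energy of the midpoints \<open>(f n + u) / 2\<close>, which also converge to \<open>u\<close>: this contradicts lower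
  semicontinuity.
\<close>

lemma A_fun_strong_convergence:
  assumes f: "\<And>n. f n \<in> H1" and u: "u \<in> H1" and c: "(\<lambda>n. nrm (\<lambda>x. f n x - u x)) \<longlonglongrightarrow> 0"
    and A: "(\<lambda>n. A_fun (f n)) \<longlonglongrightarrow> A_fun u"
  shows "(\<lambda>n. A_fun (\<lambda>x. f n x - u x)) \<longlonglongrightarrow> 0"
proof (rule LIMSEQ_I, rule ccontr)
  fix e :: real assume e: "0 < e" and n: "\<not> (\<exists>no. \<forall>n\<ge>no. norm (A_fun (\<lambda>x. f n x - u x) - 0) < e)"
  \<comment> \<open>if the claim fails, \<open>P\<close> is infinite and the midpoints along \<open>P\<close> have energy at most \<open>A_fun u - e / 8\<close>\<close>
  define P where "P = {n. A_fun (\<lambda>x. f n x - u x) \<ge> e \<and> A_fun (f n) \<le> A_fun u + e / 4}"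
  have ev: "\<forall>\<^sub>F n in sequentially. A_fun (f n) < A_fun u + e / 4"
    by (rule order_tendstoD(2)[OF A]) (use e in simp)
  then obtain N where N: "\<And>n. n \<ge> N \<Longrightarrow> A_fun (f n) < A_fun u + e / 4" by (auto simp: eventually_sequentially)
  have "infinite P"
    unfolding infinite_nat_iff_unbounded_le
  proof
    fix m
    obtain n where "n \<ge> max m N" "\<not> norm (A_fun (\<lambda>x. f n x - u x) - 0) < e" using n by blast
    then show "\<exists>n\<ge>m. n \<in> P" using N[of n] by (auto simp: P_def intro!: exI[of _ n])
  qed
  then obtain r :: "nat \<Rightarrow> nat" where r: "strict_mono r" "\<And>n. r n \<in> P"
    using infinite_enumerate by blast
  have "A_fun u \<le> A_fun u - e / 8"
  proof (rule A_fun_lsc(2)[where f = "\<lambda>n x. (1/2) * (f (r n) x + u x)"])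
    show "(\<lambda>x. (1/2) * (f (r n) x + u x)) \<in> H1" for n by (intro H1_cmult(1) H1_add(1) f u)
    show "u \<in> L2p" by (rule H1_L2[OF u])
    have "nrm (\<lambda>x. (1/2) * (f (r n) x + u x) - u x) = (1/2) * nrm (\<lambda>x. f (r n) x - u x)" for n
    proof -
      have "nrm (\<lambda>x. (1/2) * (f (r n) x + u x) - u x) = nrm (\<lambda>x. (1/2) * (f (r n) x - u x))"
        by (rule nrm2_cong) (simp add: field_simps)
      then show ?thesis by (simp only: nrm2_cmult)
    qed
    moreover have "(\<lambda>n. (1/2) * nrm (\<lambda>x. f (r n) x - u x)) \<longlonglongrightarrow> (1/2) * 0"
      using LIMSEQ_subseq_LIMSEQ[OF c r(1)] by (intro tendsto_mult tendsto_const) (simp add: comp_def)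
    ultimately show "(\<lambda>n. nrm (\<lambda>x. (1/2) * (f (r n) x + u x) - u x)) \<longlonglongrightarrow> 0" by (simp only: mult_zero_right)
    show "A_fun (\<lambda>x. (1/2) * (f (r n) x + u x)) \<le> A_fun u - e / 8" for n
      using r(2)[of n] A_fun_parallelogram[OF f u, of "r n"] by (simp add: P_def)
  qed
  then show False using e by simp
qed

section \<open>Compactness in \<open>L\<^sup>2\<close>\<close>

lemma mollify_bound: assumes u: "u \<in> L2p" shows "\<bar>mollify n u x\<bar> \<le> nrm u * nrm (moll n)"
proof -
  have "nrm (\<lambda>y. moll n (x - y)) = nrm (moll n)"
    using L2_affine(2)[OF test_function_L2[OF moll_test], of "-1" n x] by simp
  then show ?thesis unfolding mollify_def
    using Cauchy_Schwarz_L2[OF u test_function_L2[OF moll_refl_test], of n x] by simp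
qed

lemma L2_indicator_mult:
  assumes "f \<in> L2p" "B \<in> sets borel"
  shows "(\<lambda>x. indicator B x * f x) \<in> L2p" "nrm (\<lambda>x. indicator B x * f x) \<le> nrm f"
proof -
  have "(\<lambda>x. indicator B x * f x) \<in> borel_measurable lborel" using L2_meas[OF assms(1)] assms(2) by simp
  then show L: "(\<lambda>x. indicator B x * f x) \<in> L2p"
    by (rule L2_bounded_by[OF _ L2_int[OF assms(1)]]) (auto simp: indicator_def)
  show "nrm (\<lambda>x. indicator B x * f x) \<le> nrm f"
    unfolding nrm2_def by (intro real_sqrt_le_mono integral_mono L2_int L assms) (auto simp: indicator_def)
qed

text \<open>
  A diagonal argument gives convergence at the points of a countable dense set. It extends to all points
  because the mollified functions are equicontinuous: \<open>L\<^sup>2\<close> is paired with translates of a fixed kernel.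
\<close>

lemma mollified_subsequence:
  assumes u: "\<And>n::nat. u n \<in> L2p" and M: "\<And>n. nrm (u n) \<le> M"
  obtains r where "strict_mono (r::nat\<Rightarrow>nat)" "\<forall>k x. convergent (\<lambda>n. mollify k (u (r n)) x)"
proof -
  have M0: "M \<ge> 0" using M[of 0] nrm2_nonneg order_trans by blast
  obtain E :: "plane set" where E: "countable E" "\<And>X. open X \<Longrightarrow> X \<noteq> {} \<Longrightarrow> \<exists>d\<in>E. d \<in> X"
    using countable_dense_setE by blast
  define f where "f = (\<lambda>n (k, q). mollify k (u n) q / (nrm (moll k) + 1))"
  obtain r where r: "strict_mono (r::nat\<Rightarrow>nat)" "\<And>p. p \<in> (UNIV :: nat set) \<times> E \<Longrightarrow> \<exists>l. (\<lambda>n. f (r n) p) \<longlonglongrightarrow> l"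
  proof (rule function_convergent_subsequence[of "(UNIV :: nat set) \<times> E" f M])
    show "countable ((UNIV :: nat set) \<times> E)" using E(1) by simp
    fix n p assume "p \<in> (UNIV :: nat set) \<times> E"
    obtain k q where p: "p = (k, q)" by (cases p)
    have m: "0 \<le> nrm (moll k)" by simp
    have "\<bar>mollify k (u n) q\<bar> \<le> M * (nrm (moll k) + 1)"
      using order_trans[OF mollify_bound[OF u] mult_right_mono[OF M m]] M0 by (simp add: distrib_left add_increasing2)
    moreover have "nrm (moll k) + 1 > 0" using m by linarith
    ultimately show "norm (f n p) \<le> M" unfolding f_def p by (simp add: pos_divide_le_eq)
  qed blast
  have cQ: "convergent (\<lambda>n. mollify k (u (r n)) q)" if qQ: "q \<in> E" for k q
  proof -
    obtain l where "(\<lambda>n. mollify k (u (r n)) q / (nrm (moll k) + 1)) \<longlonglongrightarrow> l" using r(2)[of "(k, q)"] qQ unfolding f_def by auto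
    from tendsto_mult[OF this tendsto_const[of "nrm (moll k) + 1"]]
    have "(\<lambda>n. mollify k (u (r n)) q) \<longlonglongrightarrow> l * (nrm (moll k) + 1)"
      using nrm2_nonneg[of lborel "moll k"] by (simp add: add_nonneg_eq_0_iff)
    then show ?thesis by (auto simp: convergent_def)
  qed
  have "Cauchy (\<lambda>n. mollify k (u (r n)) x)" for k x
  proof (rule CauchyI)
    fix e :: real assume e: "e > 0"
    have "e / (3 * (M + 1)) > 0" using e M0 by simp
    from L2_transl_cont[OF test_function_L2[OF moll_test] this, of k]
    obtain d where d: "d > 0" "\<And>h. norm h < d \<Longrightarrow> nrm (\<lambda>x. moll k (x + h) - moll k x) < e / (3 * (M + 1))" by blast
    obtain q where q: "q \<in> E" "q \<in> ball x d" using E(2)[of "ball x d"] d(1) by auto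
    have close: "\<bar>mollify k (u n) x - mollify k (u n) q\<bar> < e / 3" for n
    proof -
      have "\<bar>mollify k (u n) x - mollify k (u n) q\<bar> \<le> nrm (u n) * nrm (\<lambda>z. moll k (z + (x - q)) - moll k z)"
        by (rule mollify_diff_bound[OF u])
      also have "\<dots> \<le> M * (e / (3 * (M + 1)))"
        using d(2)[of "x - q"] q(2) M0 by (intro mult_mono M) (auto simp: dist_norm)
      also have "\<dots> < e / 3" using M0 e by (simp add: field_simps)
      finally show ?thesis .
    qed
    have "Cauchy (\<lambda>n. mollify k (u (r n)) q)" using cQ[OF q(1)] by (rule convergent_Cauchy)
    from CauchyD[OF this, of "e/3"] e obtain N
      where N: "\<And>m n. m \<ge> N \<Longrightarrow> n \<ge> N \<Longrightarrow> norm (mollify k (u (r m)) q - mollify k (u (r n)) q) < e / 3"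
      by auto
    have "norm (mollify k (u (r m)) x - mollify k (u (r n)) x) < e" if "m \<ge> N" "n \<ge> N" for m n
      using N[OF that] close[of "r m"] close[of "r n"] by (simp add: abs_if split: if_splits)
    then show "\<exists>N. \<forall>m\<ge>N. \<forall>n\<ge>N. norm (mollify k (u (r m)) x - mollify k (u (r n)) x) < e" by blast
  qed
  then show ?thesis using r(1) that Cauchy_convergent_iff by blast
qed

lemma mollified_ball_convergence:
  assumes u: "\<And>n::nat. u n \<in> L2p" and M: "\<And>n. nrm (u n) \<le> M"
    and c: "\<And>x. convergent (\<lambda>n. mollify k (u n) x)" and e: "e > 0"
  shows "\<exists>N. \<forall>i\<ge>N. \<forall>j\<ge>N. nrm (\<lambda>x. indicator (cball 0 R) x * (mollify k (u i) x - mollify k (u j) x)) < e"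
proof -
  define g where "g = (\<lambda>x. lim (\<lambda>n. mollify k (u n) x))"
  define C where "C = M * nrm (moll k)"
  have m[measurable]: "mollify k (u n) \<in> borel_measurable borel" for n by (rule mollify_borel[OF u])
  have gm[measurable]: "g \<in> borel_measurable borel" unfolding g_def by (rule borel_measurable_lim_metric) auto
  have gl: "(\<lambda>n. mollify k (u n) x) \<longlonglongrightarrow> g x" for x using c[of x] by (simp add: g_def convergent_LIMSEQ_iff)
  have b: "\<bar>mollify k (u n) x\<bar> \<le> C" for n x
    unfolding C_def by (rule order_trans[OF mollify_bound[OF u]]) (intro mult_right_mono M, simp)
  have gb: "\<bar>g x\<bar> \<le> C" for x
    by (rule LIMSEQ_le_const2[OF tendsto_rabs[OF gl]]) (use b in auto)
  define B where "B = (cball 0 R :: plane set)"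
  have Bm[measurable]: "B \<in> sets borel" by (simp add: B_def)
  have iB: "integrable lborel (\<lambda>x. indicator B x * (2 * C)\<^sup>2)"
    using emeasure_compact_finite[of B] by (auto simp: B_def intro!: integrable_mult_left integrable_real_indicator)
  have sqb: "(indicator B x * (mollify k (u n) x - g x))\<^sup>2 \<le> indicator B x * (2 * C)\<^sup>2" for n x
  proof -
    have "\<bar>mollify k (u n) x - g x\<bar> \<le> 2 * C" using b[of n x] gb[of x] by linarith
    then have "(mollify k (u n) x - g x)\<^sup>2 \<le> (2 * C)\<^sup>2" by (metis abs_ge_zero power2_abs power_mono)
    then show ?thesis by (auto simp: indicator_def)
  qed
  have L: "(\<lambda>x. indicator B x * (mollify k (u n) x - g x)) \<in> L2p" for n
    by (rule L2_bounded_by[OF _ iB sqb]) measurable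
  have "(\<lambda>n. LINT x|lborel. (indicator B x * (mollify k (u n) x - g x))\<^sup>2) \<longlonglongrightarrow> (LINT x|(lborel :: plane measure). 0)"
  proof (rule integral_dominated_convergence[OF _ _ iB])
    show "AE x in lborel. (\<lambda>n. (indicator B x * (mollify k (u n) x - g x))\<^sup>2) \<longlonglongrightarrow> 0"
    proof (rule AE_I2)
      fix x :: plane
      have "(\<lambda>n. (indicator B x * (mollify k (u n) x - g x))\<^sup>2) \<longlonglongrightarrow> (indicator B x * (g x - g x))\<^sup>2"
        by (intro tendsto_intros gl)
      then show "(\<lambda>n. (indicator B x * (mollify k (u n) x - g x))\<^sup>2) \<longlonglongrightarrow> 0" by simp
    qed
    show "AE x in lborel. norm ((indicator B x * (mollify k (u n) x - g x))\<^sup>2) \<le> indicator B x * (2 * C)\<^sup>2" for n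
      using sqb by simp
  qed auto
  then have "(\<lambda>n. nrm (\<lambda>x. indicator B x * (mollify k (u n) x - g x))) \<longlonglongrightarrow> sqrt 0"
    unfolding nrm2_def by (intro tendsto_real_sqrt) simp
  then have "\<forall>\<^sub>F n in sequentially. nrm (\<lambda>x. indicator B x * (mollify k (u n) x - g x)) < e / 2"
    using e by (intro order_tendstoD(2)) auto
  then obtain N where N: "\<And>n. n \<ge> N \<Longrightarrow> nrm (\<lambda>x. indicator B x * (mollify k (u n) x - g x)) < e / 2"
    by (auto simp: eventually_sequentially)
  have "nrm (\<lambda>x. indicator B x * (mollify k (u i) x - mollify k (u j) x)) < e" if "i \<ge> N" "j \<ge> N" for i j
  proof -
    have "nrm (\<lambda>x. indicator B x * (mollify k (u i) x - mollify k (u j) x)) =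
      nrm (\<lambda>x. indicator B x * (mollify k (u i) x - g x) - indicator B x * (mollify k (u j) x - g x))"
      by (rule nrm2_cong) (simp add: algebra_simps)
    also have "\<dots> \<le> nrm (\<lambda>x. indicator B x * (mollify k (u i) x - g x)) + nrm (\<lambda>x. - (indicator B x * (mollify k (u j) x - g x)))"
      using nrm2_triangle[OF L L2_minus[OF L], of i j] by simp
    finally show ?thesis using N[OF that(1)] N[OF that(2)] by simp
  qed
  then show ?thesis unfolding B_def by blast
qed

lemma ln_weight_tail:
  assumes u: "u \<in> L2p" and i: "integrable lborel (\<lambda>x. ln (1 + norm x) * (u x)\<^sup>2)"
    and M: "(LINT x|lborel. ln (1 + norm x) * (u x)\<^sup>2) \<le> M" and R: "R > 0"
  shows "(nrm (\<lambda>x. indicator (- cball 0 R) x * u x))\<^sup>2 \<le> M / ln (1 + R)"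
proof -
  have lR: "ln (1 + R) > 0" using R by simp
  have "(nrm (\<lambda>x. indicator (- cball 0 R) x * u x))\<^sup>2 \<le> (LINT x|lborel. (ln (1 + norm x) * (u x)\<^sup>2) / ln (1 + R))"
    unfolding nrm2_sq
  proof (rule integral_mono)
    show "integrable lborel (\<lambda>x. (indicator (- cball 0 R) x * u x)\<^sup>2)"
      by (rule L2_int[OF L2_indicator_mult(1)[OF u]]) simp
    show "integrable lborel (\<lambda>x. (ln (1 + norm x) * (u x)\<^sup>2) / ln (1 + R))" using i by simp
    fix x :: plane
    show "(indicator (- cball 0 R) x * u x)\<^sup>2 \<le> (ln (1 + norm x) * (u x)\<^sup>2) / ln (1 + R)"
    proof (cases "norm x \<le> R")
      case True
      then show ?thesis using lR by (auto simp: indicator_def)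
    next
      case False
      then have "ln (1 + R) \<le> ln (1 + norm x)" using R by simp
      then have "ln (1 + R) * (u x)\<^sup>2 \<le> ln (1 + norm x) * (u x)\<^sup>2" by (intro mult_right_mono) auto
      then show ?thesis using lR False by (simp add: indicator_def pos_le_divide_eq mult.commute)
    qed
  qed
  also have "\<dots> \<le> M / ln (1 + R)" using M lR by (simp add: divide_right_mono)
  finally show ?thesis .
qed

text \<open>
  The subsequence is Cauchy in \<open>L\<^sup>2\<close>: outside a large ball the weight makes the functions uniformly
  small, mollification changes them uniformly little by the bound on the energy, and the mollified functions
  converge on the ball.
\<close>

lemma X_compact_embedding:
  assumes u: "\<And>n::nat. u n \<in> X_space" and n: "\<And>n. nrm (u n) \<le> M" and A: "\<And>n. A_fun (u n) \<le> M"
    and w: "\<And>n. (LINT x|lborel. ln (1 + norm x) * (u n x)\<^sup>2) \<le> M"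
  obtains r v where "strict_mono (r::nat\<Rightarrow>nat)" "v \<in> L2p" "(\<lambda>n. nrm (\<lambda>x. u (r n) x - v x)) \<longlonglongrightarrow> 0"
proof -
  have uH: "u n \<in> H1" for n using u by (auto simp: X_space_def)
  have uL: "u n \<in> L2p" for n by (rule H1_L2[OF uH])
  have wi: "integrable lborel (\<lambda>x. ln (1 + norm x) * (u n x)\<^sup>2)" for n using u by (auto simp: X_space_def)
  have M0: "M \<ge> 0" using n[of 0] nrm2_nonneg order_trans by blast
  obtain r where r: "strict_mono (r::nat\<Rightarrow>nat)" "\<forall>k x. convergent (\<lambda>n. mollify k (u (r n)) x)"
    by (rule mollified_subsequence[of u M, OF uL n])
  show ?thesis
  proof (rule L2_complete[of "\<lambda>n. u (r n)" lborel])
    show "u (r n) \<in> L2p" for n by (rule uL)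
    fix e :: real assume e: "e > 0"
    obtain k where k: "2 / real (Suc k) * sqrt M < e / 6"
    proof -
      have "e / (12 * (sqrt M + 1)) > 0" using e M0 by (simp add: add_nonneg_pos)
      from reals_Archimedean[OF this] obtain k where k: "inverse (real (Suc k)) < e / (12 * (sqrt M + 1))" by blast
      have "2 / real (Suc k) * sqrt M \<le> 2 * inverse (real (Suc k)) * (sqrt M + 1)"
        using M0 by (simp add: divide_inverse mult_left_mono)
      also have "\<dots> < 2 * (e / (12 * (sqrt M + 1))) * (sqrt M + 1)"
        using k M0 by (intro mult_strict_right_mono mult_strict_left_mono) (auto simp: add_nonneg_pos)
      also have "\<dots> = e / 6"
      proof -
        have "2 * (e / (12 * t)) * t = e / 6" if "t \<noteq> 0" for t using that by simp
        moreover have "sqrt M + 1 \<noteq> 0" using real_sqrt_ge_zero[OF M0] by linarith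
        ultimately show ?thesis by blast
      qed
      finally show ?thesis by (rule that)
    qed
    \<comment> \<open>chosen so that \<open>M / ln (1 + R) < (e / 6)\<^sup>2\<close>\<close>
    define R where "R = exp (36 * (M + 1) / e\<^sup>2)"
    have R: "R > 0" by (simp add: R_def)
    have tail: "nrm (\<lambda>x. indicator (- cball 0 R) x * u i x) < e / 6" for i
    proof -
      have "36 * (M + 1) / e\<^sup>2 \<le> ln (1 + R)" 
      proof -
        have "1 + R > 0" using R by linarith
        then show ?thesis by (subst ln_ge_iff) (simp_all add: R_def)
      qed
      then have "M / ln (1 + R) \<le> M / (36 * (M + 1) / e\<^sup>2)"
        using M0 e R by (intro divide_left_mono mult_pos_pos divide_pos_pos) auto
      also have "\<dots> < (e / 6)\<^sup>2" using M0 e by (simp add: field_simps power2_eq_square)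
      finally have "(nrm (\<lambda>x. indicator (- cball 0 R) x * u i x))\<^sup>2 < (e / 6)\<^sup>2"
        using ln_weight_tail[OF uL wi w R, of i] by linarith
      then show ?thesis by (rule power2_less_imp_less) (use e in simp)
    qed
    obtain N where N: "\<And>i j. i \<ge> N \<Longrightarrow> j \<ge> N \<Longrightarrow> nrm (\<lambda>x. indicator (cball 0 R) x * (mollify k (u (r i)) x - mollify k (u (r j)) x)) < e / 6"
      using mollified_ball_convergence[of "\<lambda>n. u (r n)" M k "e/6" R, OF uL n r(2)[rule_format]] e by auto
    have rate: "nrm (\<lambda>x. mollify k (u i) x - u i x) < e / 6" for i
    proof -
      have "2 / real (Suc k) * sqrt (A_fun (u i)) \<le> 2 / real (Suc k) * sqrt M" by (intro mult_left_mono real_sqrt_le_mono A) auto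
      then show ?thesis using nrm_mollify_rate[OF uH, of k i] k by linarith
    qed
    have "nrm (\<lambda>x. u (r i) x - u (r j) x) < e" if ij: "i \<ge> N" "j \<ge> N" for i j
    proof -
      let ?B = "indicator (cball 0 R) :: plane \<Rightarrow> real" and ?O = "indicator (- cball 0 R) :: plane \<Rightarrow> real"
      let ?a = "u (r i)" and ?b = "u (r j)"
      \<comment> \<open>on the ball: mollify, compare the mollified functions, undo the mollification; outside: the two tails\<close>
      let ?f1 = "\<lambda>x. ?B x * (?a x - mollify k ?a x)" and ?f2 = "\<lambda>x. ?B x * (mollify k ?a x - mollify k ?b x)"
        and ?f3 = "\<lambda>x. ?B x * (mollify k ?b x - ?b x)" and ?f4 = "\<lambda>x. ?O x * ?a x" and ?f5 = "\<lambda>x. - (?O x * ?b x)"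
      note LT = mollify_L2(1)[OF uL]
      have L: "?f1 \<in> L2p" "?f2 \<in> L2p" "?f3 \<in> L2p" "?f4 \<in> L2p" "?f5 \<in> L2p"
        by (intro L2_minus L2_indicator_mult(1) L2_diff uL LT; simp)+
      have "nrm (\<lambda>x. ?a x - ?b x) = nrm (\<lambda>x. ?f1 x + (?f2 x + (?f3 x + (?f4 x + ?f5 x))))"
        by (rule nrm2_cong) (auto simp: indicator_def)
      also have "\<dots> \<le> nrm ?f1 + (nrm ?f2 + (nrm ?f3 + (nrm ?f4 + nrm ?f5)))"
        using L by (intro order_trans[OF nrm2_triangle] add_left_mono L2_add order_refl)
      also have "nrm ?f1 \<le> nrm (\<lambda>x. mollify k ?a x - ?a x)"
        using L2_indicator_mult(2)[OF L2_diff[OF uL LT], of "cball 0 R" "r i" k "r i"] nrm2_minus_commute[of lborel ?a "mollify k ?a"] by simp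
      also have "nrm ?f3 \<le> nrm (\<lambda>x. mollify k ?b x - ?b x)"
        using L2_indicator_mult(2)[OF L2_diff[OF LT uL], of "cball 0 R"] by simp
      finally show ?thesis using rate[of "r i"] rate[of "r j"] tail[of "r i"] tail[of "r j"] N[OF ij] e by simp
    qed
    then show "\<exists>N. \<forall>i\<ge>N. \<forall>j\<ge>N. nrm (\<lambda>x. u (r i) x - u (r j) x) < e" by blast
  next
    fix g assume "g \<in> L2p" "(\<lambda>n. nrm (\<lambda>x. u (r n) x - g x)) \<longlonglongrightarrow> 0"
    then show thesis by (rule that[OF r(1)])
  qed
qed

section \<open>The space \<open>X\<close>\<close>

definition logw :: "plane \<Rightarrow> real" where "logw x = ln (1 + norm x)"

definition weighted :: "(plane \<Rightarrow> real) \<Rightarrow> plane \<Rightarrow> real" where "weighted u = (\<lambda>x. sqrt (logw x) * u x)"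

lemma logw_nonneg[simp]: "0 \<le> logw x" by (simp add: logw_def)

lemma logw_borel[measurable]: "logw \<in> borel_measurable borel"
  unfolding logw_def[abs_def] by measurable

lemma weighted_sq: "(weighted u x)\<^sup>2 = logw x * (u x)\<^sup>2"
  by (simp add: weighted_def power_mult_distrib)

lemma X_space_iff: "u \<in> X_space \<longleftrightarrow> u \<in> H1 \<and> weighted u \<in> L2p"
proof
  assume "u \<in> X_space"
  then have u: "u \<in> H1" "integrable lborel (\<lambda>x. logw x * (u x)\<^sup>2)" by (auto simp: X_space_def logw_def)
  have [measurable]: "u \<in> borel_measurable borel" using L2_meas[OF H1_L2[OF u(1)]] by simp
  have "weighted u \<in> borel_measurable lborel" unfolding weighted_def by measurable
  then show "u \<in> H1 \<and> weighted u \<in> L2p" using u by (simp add: L2_def weighted_sq)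
next
  assume "u \<in> H1 \<and> weighted u \<in> L2p"
  then show "u \<in> X_space" using L2_int[of "weighted u" lborel] by (simp add: X_space_def weighted_sq logw_def)
qed

lemma X_H1: "u \<in> X_space \<Longrightarrow> u \<in> H1" and X_weighted: "u \<in> X_space \<Longrightarrow> weighted u \<in> L2p"
  by (simp_all add: X_space_iff)

lemma X_L2: "u \<in> X_space \<Longrightarrow> u \<in> L2p" by (rule H1_L2[OF X_H1])

lemma X_borel: "u \<in> X_space \<Longrightarrow> u \<in> borel_measurable borel" using L2_meas[OF X_L2] by simp

lemma nrm_weighted_sq: "(nrm (weighted u))\<^sup>2 = (LINT x|lborel. ln (1 + norm x) * (u x)\<^sup>2)"
  by (simp add: nrm2_sq weighted_sq logw_def)

lemma X_norm_sq: assumes "u \<in> X_space"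
  shows "(X_norm u)\<^sup>2 = A_fun u + (nrm u)\<^sup>2 + (nrm (weighted u))\<^sup>2"
proof -
  have "(LINT x|lborel. (norm (weak_gradient u x))\<^sup>2 + (u x)\<^sup>2) = A_fun u + (nrm u)\<^sup>2"
    unfolding A_fun_def nrm2_sq using grad_sq_integrable[OF X_H1[OF assms]] L2_int[OF X_L2[OF assms]] by simp
  then have "X_norm u = sqrt (A_fun u + (nrm u)\<^sup>2 + (nrm (weighted u))\<^sup>2)"
    by (simp add: X_norm_def nrm_weighted_sq)
  then show ?thesis by simp
qed

lemma X_norm_nonneg: "u \<in> X_space \<Longrightarrow> 0 \<le> X_norm u"
  unfolding X_norm_def by (auto intro!: add_nonneg_nonneg Bochner_Integration.integral_nonneg)

lemma X_norm_ge:
  assumes "u \<in> X_space"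
  shows "sqrt (A_fun u) \<le> X_norm u" "nrm u \<le> X_norm u" "nrm (weighted u) \<le> X_norm u"
  using X_norm_sq[OF assms] X_norm_nonneg[OF assms] A_fun_nonneg[of u]
  by (auto intro!: real_le_lsqrt power2_le_imp_le[of _ "X_norm u"] simp: add_nonneg_nonneg)

lemma weighted_add: "weighted (\<lambda>x. u x + v x) = (\<lambda>x. weighted u x + weighted v x)" by (simp add: weighted_def distrib_left)
lemma weighted_diff: "weighted (\<lambda>x. u x - v x) = (\<lambda>x. weighted u x - weighted v x)" by (simp add: weighted_def right_diff_distrib)
lemma weighted_cmult: "weighted (\<lambda>x. c * u x) = (\<lambda>x. c * weighted u x)" by (simp add: weighted_def mult_ac)

lemma X_add: "u \<in> X_space \<Longrightarrow> v \<in> X_space \<Longrightarrow> (\<lambda>x. u x + v x) \<in> X_space"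
  unfolding X_space_iff weighted_add by (auto intro: H1_add(1))
lemma X_diff: "u \<in> X_space \<Longrightarrow> v \<in> X_space \<Longrightarrow> (\<lambda>x. u x - v x) \<in> X_space"
  unfolding X_space_iff weighted_diff by (auto intro: H1_diff(1))
lemma X_cmult: "u \<in> X_space \<Longrightarrow> (\<lambda>x. c * u x) \<in> X_space"
  unfolding X_space_iff weighted_cmult by (auto intro: H1_cmult(1))

lemma X_norm_cmult: assumes "u \<in> X_space" shows "X_norm (\<lambda>x. c * u x) = \<bar>c\<bar> * X_norm u"
proof (rule power2_eq_imp_eq)
  show "(X_norm (\<lambda>x. c * u x))\<^sup>2 = (\<bar>c\<bar> * X_norm u)\<^sup>2"
    unfolding X_norm_sq[OF X_cmult[OF assms]] power_mult_distrib X_norm_sq[OF assms] weighted_cmult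
      A_fun_cmult[OF X_H1[OF assms]] nrm2_cmult by (simp add: distrib_left)
qed (use X_norm_nonneg[OF assms] X_norm_nonneg[OF X_cmult[OF assms]] in auto)

lemma X_norm_add: assumes "u \<in> X_space" "v \<in> X_space"
  shows "X_norm (\<lambda>x. u x + v x) \<le> 2 * (X_norm u + X_norm v)"
proof (rule power2_le_imp_le)
  have sq: "(a + b)\<^sup>2 \<le> 2 * a\<^sup>2 + 2 * b\<^sup>2" for a b :: real
    using zero_le_power2[of "a - b"] by (simp add: power2_eq_square algebra_simps)
  have n: "(nrm (\<lambda>x. f x + g x))\<^sup>2 \<le> 2 * (nrm f)\<^sup>2 + 2 * (nrm g)\<^sup>2" if "f \<in> L2p" "g \<in> L2p" for f g
    using order_trans[OF power_mono[OF nrm2_triangle[OF that] nrm2_nonneg, of 2] sq] .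
  have a: "A_fun (\<lambda>x. u x + v x) \<le> 2 * A_fun u + 2 * A_fun v"
    using power_mono[OF sqrt_A_fun_triangle[OF X_H1[OF assms(1)] X_H1[OF assms(2)]], of 2] sq[of "sqrt (A_fun u)" "sqrt (A_fun v)"] by simp
  have "(X_norm (\<lambda>x. u x + v x))\<^sup>2 \<le> 2 * (X_norm u)\<^sup>2 + 2 * (X_norm v)\<^sup>2"
    unfolding X_norm_sq[OF X_add[OF assms]] X_norm_sq[OF assms(1)] X_norm_sq[OF assms(2)] weighted_add
    using a n[OF X_L2[OF assms(1)] X_L2[OF assms(2)]] n[OF X_weighted[OF assms(1)] X_weighted[OF assms(2)]] by argo
  also have "\<dots> \<le> (2 * (X_norm u + X_norm v))\<^sup>2"
  proof -
    have "0 \<le> X_norm u * X_norm v" using X_norm_nonneg assms by simp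
    then show ?thesis by (simp add: power2_eq_square algebra_simps)
  qed
  finally show "(X_norm (\<lambda>x. u x + v x))\<^sup>2 \<le> (2 * (X_norm u + X_norm v))\<^sup>2" .
qed (use X_norm_nonneg assms in simp)

section \<open>The logarithmic kernel\<close>

text \<open>
  The logarithm is split as \<open>ln r = ln (1 + r) - ln (1 + 1 / r)\<close> into two nonnegative kernels. The first
  grows at infinity but is bounded by the weights of \<open>X\<close>; the second is singular at the origin but locally
  square integrable. At \<open>r = 0\<close> all three terms are \<open>0\<close> by the conventions for \<open>ln 0\<close> and \<open>1 / 0\<close>.
\<close>

definition log_far :: "plane \<Rightarrow> real" where "log_far z = ln (1 + norm z)"
definition log_near :: "plane \<Rightarrow> real" where "log_near z = ln (1 + 1 / norm z)"

lemma log_far_nonneg[simp]: "0 \<le> log_far z" and log_near_nonneg[simp]: "0 \<le> log_near z"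
  by (auto simp: log_far_def log_near_def)

lemma log_far_near_borel[measurable]: "log_far \<in> borel_measurable borel" "log_near \<in> borel_measurable borel"
  unfolding log_far_def[abs_def] log_near_def[abs_def] by measurable

lemma ln_norm_split: "ln (norm (z::plane)) = log_far z - log_near z"
proof (cases "z = 0")
  case False
  then have n: "norm z > 0" by simp
  have "log_far z - log_near z = ln ((1 + norm z) / (1 + 1 / norm z))"
    unfolding log_far_def log_near_def using n by (subst ln_divide_pos) (auto simp: add_pos_pos)
  also have "(1 + norm z) / (1 + 1 / norm z) = norm z"
  proof -
    have "1 + 1 / norm z = (1 + norm z) / norm z" using n by (simp add: field_simps)
    moreover have "1 + norm z \<noteq> 0" using n by linarith
    ultimately show ?thesis by simp
  qed
  finally show ?thesis by simp
qed (simp add: log_far_def log_near_def)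

lemma ln_one_plus_norm_add: "ln (1 + norm (x + y)) \<le> ln (1 + norm x) + ln (1 + norm (y :: plane))"
proof -
  have "ln (1 + norm (x + y)) \<le> ln ((1 + norm x) * (1 + norm y))"
  proof (rule ln_mono)
    have "1 + norm (x + y) \<le> 1 + (norm x + norm y)" using norm_triangle_ineq[of x y] by simp
    also have "\<dots> \<le> (1 + norm x) * (1 + norm y)" by (simp add: algebra_simps)
    finally show "1 + norm (x + y) \<le> (1 + norm x) * (1 + norm y)" .
  qed (auto simp: add_pos_nonneg)
  also have "\<dots> = ln (1 + norm x) + ln (1 + norm y)" by (rule ln_mult_pos) (auto simp: add_pos_nonneg)
  finally show ?thesis .
qed

lemma log_far_le: "log_far (x - y) \<le> logw x + logw y"
  using ln_one_plus_norm_add[of x "-y"] by (simp add: log_far_def logw_def)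

lemma logw_le_log_far: "logw x \<le> log_far (x - y) + logw y"
  using ln_one_plus_norm_add[of "x - y" y] by (simp add: log_far_def logw_def)

lemma ln_one_plus_le_sqrt: assumes "0 \<le> s" shows "ln (1 + s) \<le> 2 * sqrt s"
proof -
  have "ln (1 + s) \<le> ln ((1 + sqrt s)\<^sup>2)"
    using assms by (intro ln_mono) (auto simp: power2_sum add_pos_nonneg)
  also have "\<dots> = 2 * ln (1 + sqrt s)"
    using assms by (subst ln_realpow) (auto simp: add_pos_nonneg)
  also have "\<dots> \<le> 2 * sqrt s"
    using assms by (intro mult_left_mono ln_add_one_self_le_self) auto
  finally show ?thesis .
qed

lemma ball_borel[measurable]: "ball (x::plane) r \<in> sets borel"
  by simp

definition log_near_sq :: ennreal where
  "log_near_sq = (\<integral>\<^sup>+z. ennreal (indicator (ball 0 1) z * (log_near z)\<^sup>2) \<partial>lborel)"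

lemma nn_integral_inverse_sqrt:
  "(\<integral>\<^sup>+t. ennreal (indicator {-1..1} t * \<bar>t\<bar> powr (-1/2)) \<partial>(lborel :: real measure)) < \<infinity>"
proof -
  have p: "(\<integral>\<^sup>+t. ennreal (indicator {0..1} t * t powr (-1/2)) \<partial>(lborel :: real measure)) = ennreal 2"
    using nn_integral_has_integral_lebesgue[OF _ has_integral_powr_from_0[of "-1/2" 1]] by simp
  have m: "(\<integral>\<^sup>+t. ennreal (indicator {0..1} (-t) * (-t) powr (-1/2)) \<partial>(lborel :: real measure)) = ennreal 2"
    using nn_integral_lborel_affine[of "\<lambda>t. ennreal (indicator {0..1} t * t powr (-1/2))" "-1" 0] p by simp
  have "(\<integral>\<^sup>+t. ennreal (indicator {-1..1} t * \<bar>t\<bar> powr (-1/2)) \<partial>(lborel :: real measure))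
    \<le> (\<integral>\<^sup>+t. ennreal (indicator {0..1} t * t powr (-1/2)) + ennreal (indicator {0..1} (-t) * (-t) powr (-1/2)) \<partial>lborel)"
    by (rule nn_integral_mono) (auto simp: indicator_def abs_if)
  also have "\<dots> = ennreal 2 + ennreal 2"
    by (subst nn_integral_add) (auto simp only: p m, measurable)
  also have "\<dots> < \<infinity>" by simp
  finally show ?thesis .
qed

text \<open>
  In the unit ball \<open>ln (1 + 1 / |z|)\<^sup>2 \<le> 4 / |z| \<le> 4 |z\<^sub>1|\<^sup>-\<^sup>1\<^sup>/\<^sup>2 |z\<^sub>2|\<^sup>-\<^sup>1\<^sup>/\<^sup>2\<close>, a product of integrable
  functions of one variable.
\<close>

lemma log_near_sq_finite: "log_near_sq < \<infinity>"
proof -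
  define \<phi> where "\<phi> = (\<lambda>t::real. indicator {-1..1} t * \<bar>t\<bar> powr (-1/2) :: real)"
  have [measurable]: "\<phi> \<in> borel_measurable borel" unfolding \<phi>_def by measurable
  have le: "indicator (ball 0 1) (pt a b) * (log_near (pt a b))\<^sup>2 \<le> 4 * (\<phi> a * \<phi> b)" if ab: "a \<noteq> 0" "b \<noteq> 0" for a b
  proof (cases "pt a b \<in> ball 0 1")
    case True
    let ?r = "norm (pt a b)"
    have r: "\<bar>a\<bar> \<le> ?r" "\<bar>b\<bar> \<le> ?r" using component_le_norm_cart[of "pt a b" 1] component_le_norm_cart[of "pt a b" 2] by auto
    have rp: "?r > 0" using r ab by linarith
    have "log_near (pt a b) \<le> 2 * sqrt (1 / ?r)" unfolding log_near_def by (rule ln_one_plus_le_sqrt) simp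
    then have "(log_near (pt a b))\<^sup>2 \<le> (2 * sqrt (1 / ?r))\<^sup>2" by (intro power_mono) auto
    also have "\<dots> = 4 * (1 / ?r)" by (simp add: power_mult_distrib)
    also have "1 / ?r = ?r powr (-1/2) * ?r powr (-1/2)"
      using rp by (simp add: powr_add[symmetric] powr_minus_divide)
    also have "\<dots> \<le> \<bar>a\<bar> powr (-1/2) * \<bar>b\<bar> powr (-1/2)"
      using r ab by (intro mult_mono powr_mono2') auto
    also have "\<dots> = \<phi> a * \<phi> b" using True r by (auto simp: \<phi>_def indicator_def)
    finally show ?thesis using True by simp
  qed (simp add: \<phi>_def)
  have ne: "AE a in (lborel :: real measure). a \<noteq> 0" by (rule AE_lborel_singleton)
  have [measurable]: "pt a \<in> borel_measurable borel" for a unfolding pt_def[abs_def] by measurable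
  have "log_near_sq = (\<integral>\<^sup>+a. \<integral>\<^sup>+b. ennreal (indicator (ball 0 1) (pt a b) * (log_near (pt a b))\<^sup>2) \<partial>lborel \<partial>lborel)"
    unfolding log_near_sq_def by (rule nn_integral_plane(1)) measurable
  also have "\<dots> \<le> (\<integral>\<^sup>+a. \<integral>\<^sup>+b. ennreal (4 * (\<phi> a * \<phi> b)) \<partial>lborel \<partial>lborel)"
    using ne
  proof (intro nn_integral_mono_AE, eventually_elim)
    case (elim a)
    show ?case using ne
    proof (intro nn_integral_mono_AE, eventually_elim)
      case (elim b)
      show ?case by (rule ennreal_leI, rule le) fact+
    qed
  qed
  also have "\<dots> = (\<integral>\<^sup>+a. \<integral>\<^sup>+b. 4 * (ennreal (\<phi> a) * ennreal (\<phi> b)) \<partial>lborel \<partial>lborel)"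
    by (intro nn_integral_cong) (simp add: ennreal_mult' ennreal_mult \<phi>_def)
  also have "\<dots> = 4 * ((\<integral>\<^sup>+a. ennreal (\<phi> a) \<partial>lborel) * (\<integral>\<^sup>+b. ennreal (\<phi> b) \<partial>lborel))"
    by (simp add: nn_integral_cmult nn_integral_multc)
  also have "\<dots> < \<infinity>"
    using nn_integral_inverse_sqrt unfolding \<phi>_def by (simp add: ennreal_mult_less_top)
  finally show ?thesis .
qed

text \<open>
  Where \<open>|z| < 1\<close> the product \<open>log_near z * t\<close> is at most \<open>(log_near z)\<^sup>2 + t\<^sup>2\<close>, elsewhere
  \<open>log_near \<le> ln 2 \<le> 1\<close>.
\<close>

lemma log_near_convolution_le:
  assumes f: "f \<in> L2p" and f2: "(\<lambda>x. (f x)\<^sup>2) \<in> L2p"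
  shows "(\<integral>\<^sup>+y. ennreal (log_near (x - y) * (f y)\<^sup>2) \<partial>lborel) \<le> log_near_sq + ennreal ((nrm (\<lambda>x. (f x)\<^sup>2))\<^sup>2 + (nrm f)\<^sup>2)"
proof -
  have [measurable]: "f \<in> borel_measurable borel" using L2_meas[OF f] by simp
  have b: "log_near z * t \<le> indicator (ball 0 1) z * (log_near z)\<^sup>2 + (t\<^sup>2 + t)" if t: "t \<ge> 0" for z t
  proof (cases "z \<in> ball 0 1")
    case True
    have "2 * (log_near z * t) \<le> (log_near z)\<^sup>2 + t\<^sup>2" using zero_le_power2[of "log_near z - t"] by (simp add: power2_diff)
    moreover have "0 \<le> log_near z * t" using t by simp
    ultimately have "log_near z * t \<le> (log_near z)\<^sup>2 + (t\<^sup>2 + t)" using t by linarith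
    then show ?thesis using True by simp
  next
    case False
    then have "norm z \<ge> 1" by (simp add: not_less)
    then have "1 / norm z \<le> 1" by (subst divide_le_eq_1_pos) auto
    then have "log_near z \<le> ln 2" unfolding log_near_def by (intro ln_mono) (auto simp: add_pos_nonneg)
    also have "\<dots> \<le> 1" using ln_add_one_self_le_self[of 1] by simp
    finally have "log_near z * t \<le> 1 * t" using t by (rule mult_right_mono)
    then show ?thesis using False by (simp add: add_increasing)
  qed
  have sh: "(\<integral>\<^sup>+y. ennreal (indicator (ball 0 1) (x - y) * (log_near (x - y))\<^sup>2) \<partial>lborel) = log_near_sq"
    using nn_integral_lborel_affine[of "\<lambda>z. ennreal (indicator (ball 0 1) z * (log_near z)\<^sup>2)" "-1" x] by (simp add: log_near_sq_def)
  have "(\<integral>\<^sup>+y. ennreal (log_near (x - y) * (f y)\<^sup>2) \<partial>lborel)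
    \<le> (\<integral>\<^sup>+y. ennreal (indicator (ball 0 1) (x - y) * (log_near (x - y))\<^sup>2) + (ennreal (((f y)\<^sup>2)\<^sup>2) + ennreal ((f y)\<^sup>2)) \<partial>lborel)"
    by (rule nn_integral_mono) (use b[of "(f _)\<^sup>2"] in \<open>auto simp: ennreal_plus[symmetric] simp del: ennreal_plus intro!: ennreal_leI\<close>)
  also have "\<dots> = log_near_sq + ((\<integral>\<^sup>+y. ennreal (((f y)\<^sup>2)\<^sup>2) \<partial>lborel) + (\<integral>\<^sup>+y. ennreal ((f y)\<^sup>2) \<partial>lborel))"
    by (subst nn_integral_add, measurable, subst nn_integral_add, measurable) (simp only: sh)
  also have "\<dots> = log_near_sq + ennreal ((nrm (\<lambda>x. (f x)\<^sup>2))\<^sup>2 + (nrm f)\<^sup>2)"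
    unfolding nn_integral_L2[OF f] nn_integral_L2[OF f2] by simp
  finally show ?thesis .
qed

text \<open>
  For \<open>A_fun f \<le> 1\<close> and \<open>\<parallel>f\<parallel> \<le> 1\<close> the bound of the previous lemma is at most the local integral plus
  \<open>4 + 1\<close>, where \<open>4\<close> is the constant of \<open>GN_even\<close> for the fourth power; scaling gives the general case.
\<close>

definition near_const :: real where "near_const = enn2real log_near_sq + 5"

lemma near_const_pos: "near_const > 0" by (simp add: near_const_def add_nonneg_pos)

lemma log_near_convolution_H1_scaled:
  assumes f: "f \<in> H1" and s: "s > 0" "A_fun f \<le> s\<^sup>2" "nrm f \<le> s"
  shows "(\<integral>\<^sup>+y. ennreal (log_near (x - y) * (f y)\<^sup>2) \<partial>lborel) \<le> ennreal (near_const * s\<^sup>2)"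
proof -
  have [measurable]: "f \<in> borel_measurable borel" using L2_meas[OF H1_L2[OF f]] by simp
  define g where "g = (\<lambda>x. (1/s) * f x)"
  have g: "g \<in> H1" unfolding g_def by (rule H1_cmult(1)[OF f])
  have A: "A_fun g \<le> 1" unfolding g_def A_fun_cmult[OF f] using s by (simp add: power_divide)
  have n: "nrm g \<le> 1" unfolding g_def nrm2_cmult using s by simp
  have g2: "(\<lambda>x. (g x)\<^sup>2) \<in> L2p" "(nrm (\<lambda>x. (g x)\<^sup>2))\<^sup>2 \<le> 4"
  proof -
    show "(\<lambda>x. (g x)\<^sup>2) \<in> L2p" using GN_even(1)[OF g, of 1] by (simp add: numeral_2_eq_2)
    have "(nrm (\<lambda>x. (g x)\<^sup>2))\<^sup>2 \<le> 4 * (A_fun g * (nrm g)\<^sup>2)" using GN_even(2)[OF g, of 1] by (simp add: numeral_2_eq_2)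
    also have "A_fun g * (nrm g)\<^sup>2 \<le> 1 * 1" using A n by (intro mult_mono power_le_one) auto
    finally show "(nrm (\<lambda>x. (g x)\<^sup>2))\<^sup>2 \<le> 4" by simp
  qed
  have "(nrm g)\<^sup>2 \<le> 1" using n by (intro power_le_one) auto
  then have "(nrm (\<lambda>x. (g x)\<^sup>2))\<^sup>2 + (nrm g)\<^sup>2 \<le> 5" using g2(2) by linarith
  then have "log_near_sq + ennreal ((nrm (\<lambda>x. (g x)\<^sup>2))\<^sup>2 + (nrm g)\<^sup>2) \<le> ennreal (enn2real log_near_sq) + ennreal 5"
    using log_near_sq_finite by (intro add_mono ennreal_leI) (auto simp: less_top[symmetric])
  also have "\<dots> = ennreal near_const" by (simp add: near_const_def)
  finally have *: "(\<integral>\<^sup>+y. ennreal (log_near (x - y) * (g y)\<^sup>2) \<partial>lborel) \<le> ennreal near_const"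
    using log_near_convolution_le[OF H1_L2[OF g] g2(1), of x] by (rule order_trans[rotated])
  have "(\<integral>\<^sup>+y. ennreal (log_near (x - y) * (f y)\<^sup>2) \<partial>lborel) = (\<integral>\<^sup>+y. ennreal (s\<^sup>2) * ennreal (log_near (x - y) * (g y)\<^sup>2) \<partial>lborel)"
    using s by (intro nn_integral_cong) (simp add: ennreal_mult[symmetric] g_def power_mult_distrib power_divide)
  also have "\<dots> = ennreal (s\<^sup>2) * (\<integral>\<^sup>+y. ennreal (log_near (x - y) * (g y)\<^sup>2) \<partial>lborel)"
    unfolding g_def by (intro nn_integral_cmult) measurable
  also have "\<dots> \<le> ennreal (s\<^sup>2) * ennreal near_const" by (rule mult_left_mono[OF *]) simp
  also have "\<dots> = ennreal (near_const * s\<^sup>2)" using near_const_pos by (simp add: ennreal_mult[symmetric] mult.commute)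
  finally show ?thesis .
qed

lemma log_near_convolution_H1:
  assumes f: "f \<in> H1" and s: "0 \<le> s" "A_fun f \<le> s\<^sup>2" "nrm f \<le> s"
  shows "(\<integral>\<^sup>+y. ennreal (log_near (x - y) * (f y)\<^sup>2) \<partial>lborel) \<le> ennreal (near_const * s\<^sup>2)"
proof (cases "s = 0")
  case True
  have [measurable]: "f \<in> borel_measurable borel" using L2_meas[OF H1_L2[OF f]] by simp
  have "nrm f = 0" using s True by (simp add: antisym)
  then have "(\<integral>\<^sup>+y. ennreal ((f y)\<^sup>2) \<partial>lborel) = 0" by (simp add: nn_integral_L2[OF H1_L2[OF f]])
  then have "AE y in lborel. ennreal ((f y)\<^sup>2) = 0" by (subst (asm) nn_integral_0_iff_AE) auto
  then have "AE y in lborel. ennreal (log_near (x - y) * (f y)\<^sup>2) = 0" by eventually_elim simp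
  then have "(\<integral>\<^sup>+y. ennreal (log_near (x - y) * (f y)\<^sup>2) \<partial>lborel) = 0" by (subst nn_integral_0_iff_AE) auto
  then show ?thesis by simp
qed (use assms log_near_convolution_H1_scaled in auto)

section \<open>The quartic logarithmic form\<close>

abbreviation Pm :: "(plane \<times> plane) measure" where "Pm \<equiv> lborel \<Otimes>\<^sub>M lborel"

text \<open>
  A majorant of \<open>|ln |x - y||\<close> that is adapted to the norm of \<open>X\<close>.
\<close>

definition log_major :: "plane \<times> plane \<Rightarrow> real" where
  "log_major p = logw (fst p) + logw (snd p) + log_near (fst p - snd p)"

lemma log_major_nonneg[simp]: "0 \<le> log_major p" by (simp add: log_major_def)

lemma log_major_borel[measurable]: "log_major \<in> borel_measurable Pm"
  unfolding log_major_def[abs_def] by measurable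

lemma abs_ln_le_log_major: "\<bar>ln (norm (x - y))\<bar> \<le> log_major (x, y)"
proof -
  have "\<bar>log_far (x - y) - log_near (x - y)\<bar> \<le> logw x + logw y + log_near (x - y)"
    using log_far_le[of x y] log_far_nonneg[of "x - y"] log_near_nonneg[of "x - y"] by linarith
  then show ?thesis by (simp only: ln_norm_split log_major_def fst_conv snd_conv)
qed

lemma Pm_nn_integral_product:
  assumes [measurable]: "f \<in> borel_measurable borel" "g \<in> borel_measurable borel"
  shows "(\<integral>\<^sup>+p. f (fst p) * g (snd p) \<partial>Pm) = (\<integral>\<^sup>+x. f x \<partial>lborel) * (\<integral>\<^sup>+y. g y \<partial>lborel)"
proof -
  have "(\<integral>\<^sup>+p. f (fst p) * g (snd p) \<partial>Pm) = (\<integral>\<^sup>+x. \<integral>\<^sup>+y. f x * g y \<partial>lborel \<partial>lborel)"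
    by (subst lborel.nn_integral_fst[symmetric]) auto
  then show ?thesis by (simp add: nn_integral_cmult nn_integral_multc)
qed

lemma log_major_nn_integral_le:
  assumes f: "f \<in> X_space" and g: "g \<in> X_space"
  shows "(\<integral>\<^sup>+p. ennreal (log_major p * ((f (fst p))\<^sup>2 * (g (snd p))\<^sup>2)) \<partial>Pm) \<le> ennreal ((2 + near_const) * (X_norm f)\<^sup>2 * (X_norm g)\<^sup>2)"
proof -
  note [measurable] = X_borel[OF f] X_borel[OF g]
  let ?F = "X_norm f" and ?G = "X_norm g"
  have F0: "?F \<ge> 0" "?G \<ge> 0" using X_norm_nonneg f g by auto
  have nf: "(\<integral>\<^sup>+x. ennreal ((f x)\<^sup>2) \<partial>lborel) \<le> ennreal (?F\<^sup>2)"
    unfolding nn_integral_L2[OF X_L2[OF f]] using X_norm_ge(2)[OF f] by (intro ennreal_leI power_mono) auto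
  have ng: "(\<integral>\<^sup>+x. ennreal ((g x)\<^sup>2) \<partial>lborel) \<le> ennreal (?G\<^sup>2)"
    unfolding nn_integral_L2[OF X_L2[OF g]] using X_norm_ge(2)[OF g] by (intro ennreal_leI power_mono) auto
  have wf: "(\<integral>\<^sup>+x. ennreal (logw x * (f x)\<^sup>2) \<partial>lborel) \<le> ennreal (?F\<^sup>2)"
    using nn_integral_L2[OF X_weighted[OF f]] X_norm_ge(3)[OF f] by (auto simp: weighted_sq intro!: ennreal_leI power_mono)
  have wg: "(\<integral>\<^sup>+x. ennreal (logw x * (g x)\<^sup>2) \<partial>lborel) \<le> ennreal (?G\<^sup>2)"
    using nn_integral_L2[OF X_weighted[OF g]] X_norm_ge(3)[OF g] by (auto simp: weighted_sq intro!: ennreal_leI power_mono)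
  have kg: "(\<integral>\<^sup>+y. ennreal (log_near (x - y) * (g y)\<^sup>2) \<partial>lborel) \<le> ennreal (near_const * ?G\<^sup>2)" for x
  proof (rule log_near_convolution_H1[OF X_H1[OF g] F0(2)])
    have "A_fun g = (sqrt (A_fun g))\<^sup>2" by simp
    also have "\<dots> \<le> ?G\<^sup>2" using X_norm_ge(1)[OF g] by (intro power_mono) auto
    finally show "A_fun g \<le> ?G\<^sup>2" .
  qed (rule X_norm_ge(2)[OF g])
  have "(\<integral>\<^sup>+p. ennreal (log_major p * ((f (fst p))\<^sup>2 * (g (snd p))\<^sup>2)) \<partial>Pm) =
    (\<integral>\<^sup>+p. ennreal (logw (fst p) * (f (fst p))\<^sup>2) * ennreal ((g (snd p))\<^sup>2) + (ennreal ((f (fst p))\<^sup>2) * ennreal (logw (snd p) * (g (snd p))\<^sup>2)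
      + ennreal ((f (fst p))\<^sup>2) * ennreal (log_near (fst p - snd p) * (g (snd p))\<^sup>2)) \<partial>Pm)"
    by (intro nn_integral_cong) (simp add: log_major_def ennreal_mult[symmetric] ennreal_plus[symmetric] algebra_simps del: ennreal_plus)
  also have "\<dots> = (\<integral>\<^sup>+p. ennreal (logw (fst p) * (f (fst p))\<^sup>2) * ennreal ((g (snd p))\<^sup>2) \<partial>Pm) +
    ((\<integral>\<^sup>+p. ennreal ((f (fst p))\<^sup>2) * ennreal (logw (snd p) * (g (snd p))\<^sup>2) \<partial>Pm) + (\<integral>\<^sup>+p. ennreal ((f (fst p))\<^sup>2) * ennreal (log_near (fst p - snd p) * (g (snd p))\<^sup>2) \<partial>Pm))"
    by (subst nn_integral_add, measurable, subst nn_integral_add, measurable)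
  also have "(\<integral>\<^sup>+p. ennreal (logw (fst p) * (f (fst p))\<^sup>2) * ennreal ((g (snd p))\<^sup>2) \<partial>Pm) \<le> ennreal (?F\<^sup>2) * ennreal (?G\<^sup>2)"
    by (subst Pm_nn_integral_product[of "\<lambda>x. ennreal (logw x * (f x)\<^sup>2)" "\<lambda>x. ennreal ((g x)\<^sup>2)"]) (auto intro!: mult_mono wf ng)
  also have "(\<integral>\<^sup>+p. ennreal ((f (fst p))\<^sup>2) * ennreal (logw (snd p) * (g (snd p))\<^sup>2) \<partial>Pm) \<le> ennreal (?F\<^sup>2) * ennreal (?G\<^sup>2)"
    by (subst Pm_nn_integral_product[of "\<lambda>x. ennreal ((f x)\<^sup>2)" "\<lambda>x. ennreal (logw x * (g x)\<^sup>2)"]) (auto intro!: mult_mono nf wg)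
  also have "(\<integral>\<^sup>+p. ennreal ((f (fst p))\<^sup>2) * ennreal (log_near (fst p - snd p) * (g (snd p))\<^sup>2) \<partial>Pm) \<le> ennreal (?F\<^sup>2) * ennreal (near_const * ?G\<^sup>2)"
  proof -
    have "(\<integral>\<^sup>+p. ennreal ((f (fst p))\<^sup>2) * ennreal (log_near (fst p - snd p) * (g (snd p))\<^sup>2) \<partial>Pm)
      = (\<integral>\<^sup>+x. ennreal ((f x)\<^sup>2) * (\<integral>\<^sup>+y. ennreal (log_near (x - y) * (g y)\<^sup>2) \<partial>lborel) \<partial>lborel)"
      by (subst lborel.nn_integral_fst[symmetric]) (auto simp: nn_integral_cmult)
    also have "\<dots> \<le> (\<integral>\<^sup>+x. ennreal ((f x)\<^sup>2) * ennreal (near_const * ?G\<^sup>2) \<partial>lborel)"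
      by (intro nn_integral_mono mult_left_mono kg) auto
    also have "\<dots> = (\<integral>\<^sup>+x. ennreal ((f x)\<^sup>2) \<partial>lborel) * ennreal (near_const * ?G\<^sup>2)"
      by (rule nn_integral_multc) measurable
    also have "\<dots> \<le> ennreal (?F\<^sup>2) * ennreal (near_const * ?G\<^sup>2)" by (intro mult_mono nf) auto
    finally show ?thesis .
  qed
  also have "ennreal (?F\<^sup>2) * ennreal (?G\<^sup>2) + (ennreal (?F\<^sup>2) * ennreal (?G\<^sup>2) + ennreal (?F\<^sup>2) * ennreal (near_const * ?G\<^sup>2)) = ennreal ((2 + near_const) * ?F\<^sup>2 * ?G\<^sup>2)"
    using near_const_pos by (simp add: ennreal_mult[symmetric] ennreal_plus[symmetric] algebra_simps del: ennreal_plus)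
  finally show ?thesis by (simp add: add_mono)
qed

text \<open>
  The form of which \<open>V_fun\<close> is the diagonal. By Cauchy--Schwarz with respect to the majorant it is
  bounded on \<open>X\<close> in each of its four arguments.
\<close>

definition log_form :: "(plane \<Rightarrow> real) \<Rightarrow> (plane \<Rightarrow> real) \<Rightarrow> (plane \<Rightarrow> real) \<Rightarrow> (plane \<Rightarrow> real) \<Rightarrow> real" where
  "log_form f1 f2 f3 f4 = (LINT p|Pm. ln (norm (fst p - snd p)) * (f1 (fst p) * f2 (fst p) * (f3 (snd p) * f4 (snd p))))"

lemma log_major_L2:
  assumes f: "f \<in> X_space" and g: "g \<in> X_space"
  shows "(\<lambda>p. sqrt (log_major p) * (f (fst p) * g (snd p))) \<in> L2 Pm"
    "nrm2 Pm (\<lambda>p. sqrt (log_major p) * (f (fst p) * g (snd p))) \<le> sqrt (2 + near_const) * X_norm f * X_norm g"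
proof -
  note [measurable] = X_borel[OF f] X_borel[OF g]
  have m: "(\<lambda>p. sqrt (log_major p) * (f (fst p) * g (snd p))) \<in> borel_measurable Pm" by measurable
  have B: "(sqrt (2 + near_const) * X_norm f * X_norm g)\<^sup>2 = (2 + near_const) * (X_norm f)\<^sup>2 * (X_norm g)\<^sup>2"
    using near_const_pos by (simp add: power_mult_distrib)
  have *: "(\<integral>\<^sup>+p. ennreal ((sqrt (log_major p) * (f (fst p) * g (snd p)))\<^sup>2) \<partial>Pm) \<le> ennreal ((sqrt (2 + near_const) * X_norm f * X_norm g)\<^sup>2)"
    unfolding B using log_major_nn_integral_le[OF f g] by (simp add: power_mult_distrib)
  have B0: "0 \<le> sqrt (2 + near_const) * X_norm f * X_norm g"
    using near_const_pos X_norm_nonneg[OF f] X_norm_nonneg[OF g] by simp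
  show "(\<lambda>p. sqrt (log_major p) * (f (fst p) * g (snd p))) \<in> L2 Pm"
    "nrm2 Pm (\<lambda>p. sqrt (log_major p) * (f (fst p) * g (snd p))) \<le> sqrt (2 + near_const) * X_norm f * X_norm g"
    by (rule L2_nn_integralI[OF m * B0])+
qed

lemma log_form_bound:
  assumes X: "f1 \<in> X_space" "f2 \<in> X_space" "f3 \<in> X_space" "f4 \<in> X_space"
  shows "integrable Pm (\<lambda>p. ln (norm (fst p - snd p)) * (f1 (fst p) * f2 (fst p) * (f3 (snd p) * f4 (snd p))))"
    "\<bar>log_form f1 f2 f3 f4\<bar> \<le> (2 + near_const) * (X_norm f1 * X_norm f2 * (X_norm f3 * X_norm f4))"
proof -
  note [measurable] = X_borel[OF X(1)] X_borel[OF X(2)] X_borel[OF X(3)] X_borel[OF X(4)]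
  let ?F = "\<lambda>p. sqrt (log_major p) * (f1 (fst p) * f3 (snd p))" and ?G = "\<lambda>p. sqrt (log_major p) * (f2 (fst p) * f4 (snd p))"
  let ?q = "\<lambda>p. ln (norm (fst p - snd p)) * (f1 (fst p) * f2 (fst p) * (f3 (snd p) * f4 (snd p)))"
  note LF = log_major_L2[OF X(1,3)] and LG = log_major_L2[OF X(2,4)]
  have iFG: "integrable Pm (\<lambda>p. \<bar>?F p\<bar> * \<bar>?G p\<bar>)" by (rule L2_mult_integrable[OF L2_abs[OF LF(1)] L2_abs[OF LG(1)]])
  have b: "\<bar>?q p\<bar> \<le> \<bar>?F p\<bar> * \<bar>?G p\<bar>" for p
  proof -
    have "\<bar>?F p\<bar> * \<bar>?G p\<bar> = (sqrt (log_major p) * sqrt (log_major p)) * \<bar>f1 (fst p) * f2 (fst p) * (f3 (snd p) * f4 (snd p))\<bar>"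
      by (simp add: abs_mult mult_ac)
    also have "sqrt (log_major p) * sqrt (log_major p) = log_major p" by simp
    finally have e: "\<bar>?F p\<bar> * \<bar>?G p\<bar> = log_major p * \<bar>f1 (fst p) * f2 (fst p) * (f3 (snd p) * f4 (snd p))\<bar>" .
    show ?thesis unfolding e abs_mult[of "ln _"]
      by (rule mult_right_mono) (use abs_ln_le_log_major[of "fst p" "snd p"] in auto)
  qed
  show i: "integrable Pm ?q"
    by (rule Bochner_Integration.integrable_bound[OF iFG]) (use b in auto)
  have "\<bar>log_form f1 f2 f3 f4\<bar> \<le> (LINT p|Pm. \<bar>?q p\<bar>)" unfolding log_form_def by (rule integral_abs_bound)
  also have "\<dots> \<le> (LINT p|Pm. \<bar>?F p\<bar> * \<bar>?G p\<bar>)" using i iFG b by (intro integral_mono integrable_abs) auto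
  also have "\<dots> \<le> nrm2 Pm ?F * nrm2 Pm ?G" by (rule Cauchy_Schwarz_abs[OF LF(1) LG(1)])
  also have "\<dots> \<le> (sqrt (2 + near_const) * X_norm f1 * X_norm f3) * (sqrt (2 + near_const) * X_norm f2 * X_norm f4)"
    using LF(2) LG(2) near_const_pos X_norm_nonneg X by (intro mult_mono) auto
  also have "\<dots> = (sqrt (2 + near_const) * sqrt (2 + near_const)) * (X_norm f1 * X_norm f2 * (X_norm f3 * X_norm f4))" by (simp add: mult_ac)
  also have "sqrt (2 + near_const) * sqrt (2 + near_const) = 2 + near_const" using near_const_pos by simp
  finally show "\<bar>log_form f1 f2 f3 f4\<bar> \<le> (2 + near_const) * (X_norm f1 * X_norm f2 * (X_norm f3 * X_norm f4))" .
qed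

lemma V_fun_log_form: "V_fun u = log_form u u u u"
  unfolding V_fun_def log_form_def by (simp add: case_prod_beta' power2_eq_square mult_ac)

definition V_far :: "(plane \<Rightarrow> real) \<Rightarrow> real" where
  "V_far u = (LINT p|Pm. log_far (fst p - snd p) * ((u (fst p))\<^sup>2 * (u (snd p))\<^sup>2))"
definition V_near :: "(plane \<Rightarrow> real) \<Rightarrow> real" where
  "V_near u = (LINT p|Pm. log_near (fst p - snd p) * ((u (fst p))\<^sup>2 * (u (snd p))\<^sup>2))"

lemma log_major_integrable: assumes u: "u \<in> X_space" "v \<in> X_space"
  shows "integrable Pm (\<lambda>p. log_major p * ((u (fst p))\<^sup>2 * (v (snd p))\<^sup>2))"
  using L2_int[OF log_major_L2(1)[OF u]] by (simp add: power_mult_distrib)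

lemma V_far_integrable: assumes u: "u \<in> X_space" "v \<in> X_space"
  shows "integrable Pm (\<lambda>p. log_far (fst p - snd p) * ((u (fst p))\<^sup>2 * (v (snd p))\<^sup>2))"
proof (rule Bochner_Integration.integrable_bound[OF log_major_integrable[OF u]])
  note [measurable] = X_borel[OF u(1)] X_borel[OF u(2)]
  show "(\<lambda>p. log_far (fst p - snd p) * ((u (fst p))\<^sup>2 * (v (snd p))\<^sup>2)) \<in> borel_measurable Pm" by measurable
  have "log_far (x - y) \<le> log_major (x, y)" for x y using add_mono[OF log_far_le[of x y] log_near_nonneg[of "x - y"]] by (simp add: log_major_def)
  then show "AE p in Pm. norm (log_far (fst p - snd p) * ((u (fst p))\<^sup>2 * (v (snd p))\<^sup>2)) \<le> norm (log_major p * ((u (fst p))\<^sup>2 * (v (snd p))\<^sup>2))"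
    by (intro AE_I2) (auto simp: abs_mult intro!: mult_right_mono)
qed

lemma V_near_integrable: assumes u: "u \<in> X_space" "v \<in> X_space"
  shows "integrable Pm (\<lambda>p. log_near (fst p - snd p) * ((u (fst p))\<^sup>2 * (v (snd p))\<^sup>2))"
proof (rule Bochner_Integration.integrable_bound[OF log_major_integrable[OF u]])
  note [measurable] = X_borel[OF u(1)] X_borel[OF u(2)]
  show "(\<lambda>p. log_near (fst p - snd p) * ((u (fst p))\<^sup>2 * (v (snd p))\<^sup>2)) \<in> borel_measurable Pm" by measurable
  show "AE p in Pm. norm (log_near (fst p - snd p) * ((u (fst p))\<^sup>2 * (v (snd p))\<^sup>2)) \<le> norm (log_major p * ((u (fst p))\<^sup>2 * (v (snd p))\<^sup>2))"
    by (intro AE_I2) (auto simp: abs_mult log_major_def intro!: mult_right_mono)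
qed

lemma V_fun_split: assumes u: "u \<in> X_space" shows "V_fun u = V_far u - V_near u"
proof -
  have "V_fun u = (LINT p|Pm. log_far (fst p - snd p) * ((u (fst p))\<^sup>2 * (u (snd p))\<^sup>2) - log_near (fst p - snd p) * ((u (fst p))\<^sup>2 * (u (snd p))\<^sup>2))"
    unfolding V_fun_def by (simp add: case_prod_beta' ln_norm_split algebra_simps)
  then show ?thesis unfolding V_far_def V_near_def using V_far_integrable[OF u u] V_near_integrable[OF u u] by simp
qed

lemma V_far_nonneg: "0 \<le> V_far u" unfolding V_far_def by (intro Bochner_Integration.integral_nonneg) auto

lemma nn_integral_log_near_le:
  assumes v: "v \<in> H1" and s: "0 \<le> s" "A_fun v \<le> s\<^sup>2" "nrm v \<le> s" and g[measurable]: "g \<in> borel_measurable borel" "\<And>x. 0 \<le> g x"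
  shows "(\<integral>\<^sup>+p. ennreal (log_near (fst p - snd p) * (g (fst p) * (v (snd p))\<^sup>2)) \<partial>Pm) \<le> ennreal (near_const * s\<^sup>2) * (\<integral>\<^sup>+x. ennreal (g x) \<partial>lborel)"
    "(\<integral>\<^sup>+p. ennreal (log_near (fst p - snd p) * ((v (fst p))\<^sup>2 * g (snd p))) \<partial>Pm) \<le> ennreal (near_const * s\<^sup>2) * (\<integral>\<^sup>+x. ennreal (g x) \<partial>lborel)"
proof -
  have [measurable]: "v \<in> borel_measurable borel" using L2_meas[OF H1_L2[OF v]] by simp
  have sym: "log_near (x - y) = log_near (y - x)" for x y by (simp add: log_near_def norm_minus_commute)
  have main: "(\<integral>\<^sup>+x. \<integral>\<^sup>+y. ennreal (log_near (x - y) * (g x * (v y)\<^sup>2)) \<partial>lborel \<partial>lborel) \<le> ennreal (near_const * s\<^sup>2) * (\<integral>\<^sup>+x. ennreal (g x) \<partial>lborel)"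
  proof -
    have "(\<integral>\<^sup>+x. \<integral>\<^sup>+y. ennreal (log_near (x - y) * (g x * (v y)\<^sup>2)) \<partial>lborel \<partial>lborel) = (\<integral>\<^sup>+x. ennreal (g x) * (\<integral>\<^sup>+y. ennreal (log_near (x - y) * (v y)\<^sup>2) \<partial>lborel) \<partial>lborel)"
      using g(2) by (subst nn_integral_cmult[symmetric]) (auto intro!: nn_integral_cong simp: ennreal_mult[symmetric] mult_ac)
    also have "\<dots> \<le> (\<integral>\<^sup>+x. ennreal (g x) * ennreal (near_const * s\<^sup>2) \<partial>lborel)"
      by (intro nn_integral_mono mult_left_mono log_near_convolution_H1 v s) auto
    also have "\<dots> = ennreal (near_const * s\<^sup>2) * (\<integral>\<^sup>+x. ennreal (g x) \<partial>lborel)"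
      by (subst nn_integral_multc) (auto simp: mult.commute)
    finally show ?thesis .
  qed
  have "(\<integral>\<^sup>+p. ennreal (log_near (fst p - snd p) * (g (fst p) * (v (snd p))\<^sup>2)) \<partial>Pm) = (\<integral>\<^sup>+x. \<integral>\<^sup>+y. ennreal (log_near (x - y) * (g x * (v y)\<^sup>2)) \<partial>lborel \<partial>lborel)"
    by (subst lborel.nn_integral_fst[symmetric]) auto
  with main show "(\<integral>\<^sup>+p. ennreal (log_near (fst p - snd p) * (g (fst p) * (v (snd p))\<^sup>2)) \<partial>Pm) \<le> ennreal (near_const * s\<^sup>2) * (\<integral>\<^sup>+x. ennreal (g x) \<partial>lborel)" by simp
  have "(\<integral>\<^sup>+p. ennreal (log_near (fst p - snd p) * ((v (fst p))\<^sup>2 * g (snd p))) \<partial>Pm) = (\<integral>\<^sup>+y. \<integral>\<^sup>+x. ennreal (log_near (x - y) * ((v x)\<^sup>2 * g y)) \<partial>lborel \<partial>lborel)"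
    by (subst lborel_pair.nn_integral_snd[symmetric]) auto
  also have "\<dots> = (\<integral>\<^sup>+x. \<integral>\<^sup>+y. ennreal (log_near (x - y) * (g x * (v y)\<^sup>2)) \<partial>lborel \<partial>lborel)"
    by (intro nn_integral_cong) (subst sym, simp add: mult_ac)
  finally show "(\<integral>\<^sup>+p. ennreal (log_near (fst p - snd p) * ((v (fst p))\<^sup>2 * g (snd p))) \<partial>Pm) \<le> ennreal (near_const * s\<^sup>2) * (\<integral>\<^sup>+x. ennreal (g x) \<partial>lborel)"
    using main by simp
qed

lemma V_near_le:
  assumes u: "u \<in> X_space" and s: "0 \<le> s" "A_fun u \<le> s\<^sup>2" "nrm u \<le> s"
  shows "0 \<le> V_near u" "V_near u \<le> near_const * s\<^sup>2 * s\<^sup>2"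
proof -
  note [measurable] = X_borel[OF u]
  show "0 \<le> V_near u" unfolding V_near_def by (intro Bochner_Integration.integral_nonneg) auto
  have "ennreal (V_near u) = (\<integral>\<^sup>+p. ennreal (log_near (fst p - snd p) * ((u (fst p))\<^sup>2 * (u (snd p))\<^sup>2)) \<partial>Pm)"
    unfolding V_near_def by (rule nn_integral_eq_integral[OF V_near_integrable[OF u u], symmetric]) auto
  also have "\<dots> \<le> ennreal (near_const * s\<^sup>2) * (\<integral>\<^sup>+x. ennreal ((u x)\<^sup>2) \<partial>lborel)"
    by (rule nn_integral_log_near_le(1)[OF X_H1[OF u] s]) auto
  also have "\<dots> \<le> ennreal (near_const * s\<^sup>2) * ennreal (s\<^sup>2)"
    unfolding nn_integral_L2[OF X_L2[OF u]] by (intro mult_left_mono ennreal_leI power_mono s) auto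
  also have "\<dots> = ennreal (near_const * s\<^sup>2 * s\<^sup>2)" using near_const_pos by (simp add: ennreal_mult[symmetric])
  finally show "V_near u \<le> near_const * s\<^sup>2 * s\<^sup>2" using near_const_pos by (simp add: ennreal_le_iff)
qed

text \<open>
  The convolution of \<open>log_near\<close> with the square of a function of bounded energy is bounded, so only
  the \<open>L\<^sup>1\<close> distance of \<open>u\<^sup>2\<close> and \<open>v\<^sup>2\<close> matters.
\<close>

lemma V_near_diff_le:
  assumes u: "u \<in> X_space" and v: "v \<in> X_space" and s: "0 \<le> s" "A_fun u \<le> s\<^sup>2" "nrm u \<le> s" "A_fun v \<le> s\<^sup>2" "nrm v \<le> s"
  shows "\<bar>V_near u - V_near v\<bar> \<le> 4 * near_const * s ^ 3 * nrm (\<lambda>x. u x - v x)"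
proof -
  note [measurable] = X_borel[OF u] X_borel[OF v]
  note Lu = X_L2[OF u] and Lv = X_L2[OF v]
  define g where "g = (\<lambda>x. \<bar>(u x)\<^sup>2 - (v x)\<^sup>2\<bar>)"
  have [measurable]: "g \<in> borel_measurable borel" unfolding g_def by measurable
  have gi: "integrable lborel g" unfolding g_def using L2_int[OF Lu] L2_int[OF Lv] by (intro integrable_abs Bochner_Integration.integrable_diff)
  define I where "I = (LINT x|lborel. g x)"
  have I: "(\<integral>\<^sup>+x. ennreal (g x) \<partial>lborel) = ennreal I" "I \<ge> 0"
    unfolding I_def using gi by (auto simp: nn_integral_eq_integral g_def intro!: Bochner_Integration.integral_nonneg)
  have Ile: "I \<le> nrm (\<lambda>x. u x - v x) * (2 * s)"
  proof -
    have "I = (LINT x|lborel. \<bar>u x - v x\<bar> * \<bar>u x + v x\<bar>)"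
      unfolding I_def g_def by (intro Bochner_Integration.integral_cong) (auto simp: abs_mult[symmetric] power2_eq_square algebra_simps)
    also have "\<dots> \<le> nrm (\<lambda>x. u x - v x) * nrm (\<lambda>x. u x + v x)"
      by (intro Cauchy_Schwarz_abs L2_diff L2_add Lu Lv)
    also have "\<dots> \<le> nrm (\<lambda>x. u x - v x) * (2 * s)"
      using nrm2_triangle[OF Lu Lv] s by (intro mult_left_mono) auto
    finally show ?thesis .
  qed
  let ?a = "\<lambda>p. log_near (fst p - snd p) * (g (fst p) * (u (snd p))\<^sup>2)" and ?b = "\<lambda>p. log_near (fst p - snd p) * ((v (fst p))\<^sup>2 * g (snd p))"
  have "ennreal \<bar>V_near u - V_near v\<bar> \<le> (\<integral>\<^sup>+p. ennreal \<bar>log_near (fst p - snd p) * ((u (fst p))\<^sup>2 * (u (snd p))\<^sup>2) - log_near (fst p - snd p) * ((v (fst p))\<^sup>2 * (v (snd p))\<^sup>2)\<bar> \<partial>Pm)"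
  proof -
    have i: "integrable Pm (\<lambda>p. log_near (fst p - snd p) * ((u (fst p))\<^sup>2 * (u (snd p))\<^sup>2) - log_near (fst p - snd p) * ((v (fst p))\<^sup>2 * (v (snd p))\<^sup>2))"
      by (intro Bochner_Integration.integrable_diff V_near_integrable u v)
    have "V_near u - V_near v = (LINT p|Pm. log_near (fst p - snd p) * ((u (fst p))\<^sup>2 * (u (snd p))\<^sup>2) - log_near (fst p - snd p) * ((v (fst p))\<^sup>2 * (v (snd p))\<^sup>2))"
      unfolding V_near_def using V_near_integrable[OF u u] V_near_integrable[OF v v] by simp
    then show ?thesis
      using integral_norm_bound_ennreal[OF i] by simp
  qed
  also have "\<dots> \<le> (\<integral>\<^sup>+p. ennreal (?a p) + ennreal (?b p) \<partial>Pm)"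
  proof (rule nn_integral_mono)
    fix p :: "plane \<times> plane"
    have "\<bar>U * U' - W * W'\<bar> \<le> \<bar>U - W\<bar> * U' + W * \<bar>U' - W'\<bar>" if "U' \<ge> 0" "W \<ge> 0" for U U' W W' :: real
    proof -
      have "U * U' - W * W' = (U - W) * U' + W * (U' - W')" by (simp add: algebra_simps)
      then show ?thesis using that by (metis abs_mult abs_of_nonneg abs_triangle_ineq)
    qed
    from mult_left_mono[OF this[of "(u (snd p))\<^sup>2" "(v (fst p))\<^sup>2" "(u (fst p))\<^sup>2" "(v (snd p))\<^sup>2"] log_near_nonneg[of "fst p - snd p"]]
    have "\<bar>log_near (fst p - snd p) * ((u (fst p))\<^sup>2 * (u (snd p))\<^sup>2) - log_near (fst p - snd p) * ((v (fst p))\<^sup>2 * (v (snd p))\<^sup>2)\<bar> \<le> ?a p + ?b p"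
      by (simp add: g_def right_diff_distrib[symmetric] abs_mult distrib_left)
    then show "ennreal \<bar>log_near (fst p - snd p) * ((u (fst p))\<^sup>2 * (u (snd p))\<^sup>2) - log_near (fst p - snd p) * ((v (fst p))\<^sup>2 * (v (snd p))\<^sup>2)\<bar> \<le> ennreal (?a p) + ennreal (?b p)"
      by (subst ennreal_plus[symmetric]) (auto simp: g_def simp del: ennreal_plus intro!: ennreal_leI)
  qed
  also have "\<dots> = (\<integral>\<^sup>+p. ennreal (?a p) \<partial>Pm) + (\<integral>\<^sup>+p. ennreal (?b p) \<partial>Pm)"
    by (rule nn_integral_add) measurable
  also have "\<dots> \<le> ennreal (near_const * s\<^sup>2) * ennreal I + ennreal (near_const * s\<^sup>2) * ennreal I"
    unfolding I(1)[symmetric] by (intro add_mono nn_integral_log_near_le X_H1 u v s) (auto simp: g_def)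
  also have "\<dots> = ennreal (2 * (near_const * s\<^sup>2 * I))"
    using near_const_pos I(2) by (simp add: ennreal_mult[symmetric] ennreal_plus[symmetric] del: ennreal_plus)
  finally have "\<bar>V_near u - V_near v\<bar> \<le> 2 * (near_const * s\<^sup>2 * I)" using near_const_pos I(2) by (simp add: ennreal_le_iff)
  also have "\<dots> \<le> 2 * (near_const * s\<^sup>2 * (nrm (\<lambda>x. u x - v x) * (2 * s)))"
    using near_const_pos Ile by (intro mult_left_mono) auto
  finally show ?thesis by (simp add: power3_eq_cube power2_eq_square mult_ac)
qed

section \<open>Translations and dilations\<close>

lemma logw_scale: assumes "s > 0" shows "logw x \<le> ln (1 + 1 / s) + logw ((1/s) *\<^sub>R b) + logw (s *\<^sub>R x + b)"
proof -
  have "x = (1/s) *\<^sub>R (s *\<^sub>R x + b) + (- ((1/s) *\<^sub>R b))" using assms by (simp add: algebra_simps)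
  then have "logw x \<le> logw ((1/s) *\<^sub>R (s *\<^sub>R x + b)) + logw ((1/s) *\<^sub>R b)"
    using ln_one_plus_norm_add[of "(1/s) *\<^sub>R (s *\<^sub>R x + b)" "- ((1/s) *\<^sub>R b)"] by (simp add: logw_def)
  moreover have "logw ((1/s) *\<^sub>R y) \<le> ln (1 + 1 / s) + logw y" for y
  proof -
    have "ln (1 + norm ((1/s) *\<^sub>R y)) \<le> ln ((1 + 1 / s) * (1 + norm y))"
      using assms by (intro ln_mono) (auto simp: field_simps add_pos_nonneg)
    also have "\<dots> = ln (1 + 1 / s) + ln (1 + norm y)"
      using assms by (intro ln_mult_pos) (auto simp: add_pos_nonneg)
    finally show ?thesis by (simp add: logw_def)
  qed
  ultimately show ?thesis by (smt (verit))
qed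

lemma X_affine:
  assumes u: "u \<in> X_space" and s: "s > 0"
  shows "(\<lambda>x. u (s *\<^sub>R x + b)) \<in> X_space"
  unfolding X_space_iff
proof
  note [measurable] = X_borel[OF u]
  show "(\<lambda>x. u (s *\<^sub>R x + b)) \<in> H1" using H1_affine(1)[OF X_H1[OF u]] s by simp
  define K where "K = ln (1 + 1 / s) + logw ((1/s) *\<^sub>R b)"
  define f where "f = (\<lambda>y. (K + logw y) * (u y)\<^sup>2)"
  have fm: "f \<in> borel_measurable borel" unfolding f_def by measurable
  have "integrable lborel f"
    unfolding f_def using L2_int[OF X_L2[OF u]] L2_int[OF X_weighted[OF u]] by (simp add: distrib_right weighted_sq)
  then have fi: "integrable lborel (\<lambda>x. f (s *\<^sub>R x + b))" using lborel_integrable_affine[OF fm] s by simp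
  show "weighted (\<lambda>x. u (s *\<^sub>R x + b)) \<in> L2p"
  proof (rule L2_bounded_by[OF _ fi])
    show "weighted (\<lambda>x. u (s *\<^sub>R x + b)) \<in> borel_measurable lborel" unfolding weighted_def by measurable
    show "(weighted (\<lambda>x. u (s *\<^sub>R x + b)) x)\<^sup>2 \<le> f (s *\<^sub>R x + b)" for x
      unfolding weighted_sq f_def K_def using logw_scale[OF s, of x b] by (intro mult_right_mono) auto
  qed
qed

lemma C_fun_affine:
  assumes u: "u \<in> X_space" and s: "s > 0"
  shows "C_fun p (\<lambda>x. u (s *\<^sub>R x + b)) = C_fun p u / s\<^sup>2"
proof -
  note [measurable] = X_borel[OF u]
  have "(\<lambda>x. \<bar>u x\<bar> powr p) \<in> borel_measurable borel" by measurable
  from lborel_integral_affine[OF this, of s b] s show ?thesis by (simp add: C_fun_def)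
qed

lemma Pm_lborel: "Pm = (lborel :: (plane \<times> plane) measure)" by (rule lborel_prod)

lemma L2_product:
  assumes u: "f \<in> L2p" and v: "g \<in> L2p"
  shows "integrable Pm (\<lambda>p. (f (fst p))\<^sup>2 * (g (snd p))\<^sup>2)"
    "(LINT p|Pm. (f (fst p))\<^sup>2 * (g (snd p))\<^sup>2) = (nrm f)\<^sup>2 * (nrm g)\<^sup>2"
proof -
  have [measurable]: "f \<in> borel_measurable borel" "g \<in> borel_measurable borel" using L2_meas[OF u] L2_meas[OF v] by auto
  have *: "(\<integral>\<^sup>+p. ennreal ((f (fst p))\<^sup>2 * (g (snd p))\<^sup>2) \<partial>Pm) = ennreal ((nrm f)\<^sup>2 * (nrm g)\<^sup>2)"
    using Pm_nn_integral_product[of "\<lambda>x. ennreal ((f x)\<^sup>2)" "\<lambda>x. ennreal ((g x)\<^sup>2)"]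
    by (simp add: nn_integral_L2[OF u] nn_integral_L2[OF v] ennreal_mult)
  have m: "(\<lambda>p. (f (fst p))\<^sup>2 * (g (snd p))\<^sup>2) \<in> borel_measurable Pm" by measurable
  show "integrable Pm (\<lambda>p. (f (fst p))\<^sup>2 * (g (snd p))\<^sup>2)"
    by (rule integrableI_nn_integral_finite[OF m _ *]) auto
  show "(LINT p|Pm. (f (fst p))\<^sup>2 * (g (snd p))\<^sup>2) = (nrm f)\<^sup>2 * (nrm g)\<^sup>2"
    using integral_eq_nn_integral[OF m] * by auto
qed

lemma mass_product:
  assumes u: "u \<in> X_space" and v: "v \<in> X_space"
  shows "integrable Pm (\<lambda>p. (u (fst p))\<^sup>2 * (v (snd p))\<^sup>2)"
    "(LINT p|Pm. (u (fst p))\<^sup>2 * (v (snd p))\<^sup>2) = (nrm u)\<^sup>2 * (nrm v)\<^sup>2"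
  by (rule L2_product[OF X_L2[OF u] X_L2[OF v]])+

lemma V_fun_alt: "V_fun u = (LINT p|Pm. ln (norm (fst p - snd p)) * ((u (fst p))\<^sup>2 * (u (snd p))\<^sup>2))"
  unfolding V_fun_def by (simp add: case_prod_beta' mult_ac)

lemma ln_integrable: "u \<in> X_space \<Longrightarrow> integrable Pm (\<lambda>p. ln (norm (fst p - snd p)) * ((u (fst p))\<^sup>2 * (u (snd p))\<^sup>2))"
  using log_form_bound(1)[of u u u u] by (simp add: power2_eq_square)

text \<open>
  Scaling adds the constant \<open>- ln s\<close> to the kernel off the diagonal, which is a null set.
\<close>

lemma V_fun_affine:
  assumes u: "u \<in> X_space" and s: "s > 0"
  shows "V_fun (\<lambda>x. u (s *\<^sub>R x + b)) = (V_fun u - ln s * (nrm u) ^ 4) / s ^ 4"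
proof -
  note [measurable] = X_borel[OF u]
  define f where "f = (\<lambda>p :: plane \<times> plane. ln (norm (fst p - snd p) / s) * ((u (fst p))\<^sup>2 * (u (snd p))\<^sup>2))"
  have fmP: "f \<in> borel_measurable Pm" unfolding f_def by measurable
  then have fm: "f \<in> borel_measurable borel" by (simp add: Pm_lborel)
  have dm: "AE p in Pm. fst p \<noteq> snd p"
  proof -
    have "AE x in (lborel :: plane measure). AE y in lborel. x \<noteq> y"
    proof (rule AE_I2)
      fix x :: plane
      show "AE y in lborel. x \<noteq> y" using AE_lborel_singleton[of x] by eventually_elim auto
    qed
    moreover have "{p \<in> space Pm. fst p \<noteq> snd p} \<in> sets Pm" by measurable
    ultimately show ?thesis
      by (intro lborel_pair.AE_pair_measure) auto
  qed
  have "V_fun (\<lambda>x. u (s *\<^sub>R x + b)) = (LINT p|(lborel :: (plane \<times> plane) measure). f (s *\<^sub>R p + (b, b)))"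
    unfolding V_fun_alt Pm_lborel f_def
    using s by (intro Bochner_Integration.integral_cong) (auto simp: scaleR_diff_right[symmetric])
  also have "\<dots> = (LINT p|Pm. f p) / s ^ 4"
    using lborel_integral_affine[OF fm, of s "(b, b)"] s by (simp add: Pm_lborel)
  also have "(LINT p|Pm. f p) = (LINT p|Pm. ln (norm (fst p - snd p)) * ((u (fst p))\<^sup>2 * (u (snd p))\<^sup>2) - ln s * ((u (fst p))\<^sup>2 * (u (snd p))\<^sup>2))"
  proof (rule integral_cong_AE)
    show "AE p in Pm. f p = ln (norm (fst p - snd p)) * ((u (fst p))\<^sup>2 * (u (snd p))\<^sup>2) - ln s * ((u (fst p))\<^sup>2 * (u (snd p))\<^sup>2)"
      using dm by eventually_elim (use s in \<open>simp add: f_def ln_divide_pos left_diff_distrib\<close>)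
    show "(\<lambda>p. ln (norm (fst p - snd p)) * ((u (fst p))\<^sup>2 * (u (snd p))\<^sup>2) - ln s * ((u (fst p))\<^sup>2 * (u (snd p))\<^sup>2)) \<in> borel_measurable Pm"
      by measurable
  qed (rule fmP)
  also have "\<dots> = V_fun u - ln s * (nrm u) ^ 4"
    using ln_integrable[OF u] mass_product[OF u u] by (simp add: V_fun_alt power4_eq_xxxx power2_eq_square)
  finally show ?thesis .
qed

lemma V_fun_cmult: "V_fun (\<lambda>x. c * u x) = c ^ 4 * V_fun u"
  unfolding V_fun_alt by (subst integral_mult_right_zero[symmetric]) (simp add: power_mult_distrib power4_eq_xxxx power2_eq_square mult_ac)

lemma C_fun_cmult: "C_fun p (\<lambda>x. c * u x) = \<bar>c\<bar> powr p * C_fun p u"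
  unfolding C_fun_def by (subst integral_mult_right_zero[symmetric]) (simp add: abs_mult powr_mult)

text \<open>
  The dilations that preserve the mass.
\<close>

definition dilate :: "real \<Rightarrow> (plane \<Rightarrow> real) \<Rightarrow> plane \<Rightarrow> real" where
  "dilate t u = (\<lambda>x. t * u (t *\<^sub>R x))"

lemma dilate_facts:
  assumes u: "u \<in> X_space" and t: "t > 0"
  shows "dilate t u \<in> X_space" "nrm (dilate t u) = nrm u" "A_fun (dilate t u) = t\<^sup>2 * A_fun u"
    "V_fun (dilate t u) = V_fun u - ln t * (nrm u) ^ 4" "C_fun p (dilate t u) = t powr (p - 2) * C_fun p u"
proof -
  have a: "(\<lambda>x. u (t *\<^sub>R x)) \<in> X_space" using X_affine[OF u t, of 0] by simp
  show "dilate t u \<in> X_space" unfolding dilate_def by (rule X_cmult[OF a])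
  show "nrm (dilate t u) = nrm u" unfolding dilate_def nrm2_cmult
    using L2_affine(2)[OF X_L2[OF u], of t 0] t by simp
  show "A_fun (dilate t u) = t\<^sup>2 * A_fun u" unfolding dilate_def A_fun_cmult[OF X_H1[OF a]]
    using A_fun_affine[OF X_H1[OF u], of t 0] t by simp
  show "V_fun (dilate t u) = V_fun u - ln t * (nrm u) ^ 4" unfolding dilate_def V_fun_cmult
    using V_fun_affine[OF u t, of 0] t by simp
  show "C_fun p (dilate t u) = t powr (p - 2) * C_fun p u" unfolding dilate_def C_fun_cmult
    using C_fun_affine[OF u t, of p 0] t by (simp add: powr_diff powr_numeral)
qed

lemma translate_facts:
  assumes u: "u \<in> X_space"
  shows "(\<lambda>x. u (x + b)) \<in> X_space" "nrm (\<lambda>x. u (x + b)) = nrm u" "A_fun (\<lambda>x. u (x + b)) = A_fun u"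
    "V_fun (\<lambda>x. u (x + b)) = V_fun u" "C_fun p (\<lambda>x. u (x + b)) = C_fun p u"
  using X_affine[OF u, of 1 b] L2_translate(2)[OF X_L2[OF u]] A_fun_affine[OF X_H1[OF u], of 1 b]
    V_fun_affine[OF u, of 1 b] C_fun_affine[OF u, of 1 p b] by simp_all

section \<open>Powers of the modulus\<close>

lemma abs_powr_div_tendsto_0:
  assumes "q > 1" shows "((\<lambda>h::real. \<bar>h\<bar> powr q / h) \<longlongrightarrow> 0) (at 0)"
proof (rule Lim_null_comparison)
  have "((\<lambda>h::real. \<bar>h\<bar> powr (q - 1)) \<longlongrightarrow> 0 ) (at 0)"
    by (rule tendsto_zero_powrI[where b = "q - 1"]) (use assms in \<open>auto intro!: tendsto_rabs_zero\<close>)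
  then show "((\<lambda>h::real. \<bar>h\<bar> powr (q - 1)) \<longlongrightarrow> 0) (at 0)" .
  have "norm (\<bar>h\<bar> powr q / h) \<le> \<bar>h\<bar> powr (q - 1)" for h :: real
    by (cases "h = 0") (auto simp: powr_diff)
  then show "\<forall>\<^sub>F h in at 0. norm (\<bar>h\<bar> powr q / h) \<le> \<bar>h\<bar> powr (q - 1)" by simp
qed

lemma abs_powr_mult_abs: "\<bar>z\<bar> powr (q - 2) * \<bar>z\<bar> = \<bar>z\<bar> powr (q - 1)" for z q :: real
proof (cases "z = 0")
  case False
  then have "\<bar>z\<bar> powr (q - 2) * \<bar>z\<bar> = \<bar>z\<bar> powr (q - 2) * \<bar>z\<bar> powr 1" by simp
  also have "\<dots> = \<bar>z\<bar> powr (q - 1)" by (simp only: powr_add[symmetric]) simp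
  finally show ?thesis .
qed simp

lemma DERIV_abs_powr:
  assumes q: "q > 1" shows "((\<lambda>s. \<bar>s\<bar> powr q) has_real_derivative (q * (\<bar>s\<bar> powr (q - 2) * s))) (at s)"
proof -
  consider "s > 0" | "s < 0" | "s = 0" by linarith
  then show ?thesis
  proof cases
    case 1
    have "((\<lambda>s. s powr q) has_real_derivative (q * (\<bar>s\<bar> powr (q - 2) * s))) (at s)"
      using 1 by (auto intro!: derivative_eq_intros simp: powr_diff field_simps power2_eq_square powr_numeral)
    then show ?thesis
      by (rule DERIV_cong_ev[THEN iffD1, rotated 3])
         (use 1 in \<open>auto intro!: eventually_mono[OF eventually_nhds_in_open[of "{0<..}" s]]\<close>)
  next
    case 2
    have "((\<lambda>s. (- s) powr q) has_real_derivative (q * (\<bar>s\<bar> powr (q - 2) * s))) (at s)"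
      using 2 by (auto intro!: derivative_eq_intros simp: powr_diff field_simps power2_eq_square powr_numeral)
    then show ?thesis
      by (rule DERIV_cong_ev[THEN iffD1, rotated 3])
         (use 2 in \<open>auto intro!: eventually_mono[OF eventually_nhds_in_open[of "{..<0}" s]]\<close>)
  next
    case 3
    then show ?thesis using abs_powr_div_tendsto_0[OF q] by (simp add: DERIV_def)
  qed
qed

lemma DERIV_abs_powr_mult:
  assumes r: "r > 0" shows "((\<lambda>s. \<bar>s\<bar> powr r * s) has_real_derivative ((r + 1) * \<bar>s\<bar> powr r)) (at s)"
proof -
  consider "s > 0" | "s < 0" | "s = 0" by linarith
  then show ?thesis
  proof cases
    case 1
    have "((\<lambda>s. s powr r * s) has_real_derivative ((r + 1) * \<bar>s\<bar> powr r)) (at s)"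
      using 1 by (auto intro!: derivative_eq_intros simp: powr_diff field_simps)
    then show ?thesis
      by (rule DERIV_cong_ev[THEN iffD1, rotated 3])
         (use 1 in \<open>auto intro!: eventually_mono[OF eventually_nhds_in_open[of "{0<..}" s]]\<close>)
  next
    case 2
    have "((\<lambda>s. (- s) powr r * s) has_real_derivative ((r + 1) * \<bar>s\<bar> powr r)) (at s)"
      using 2 by (auto intro!: derivative_eq_intros simp: powr_diff field_simps)
    then show ?thesis
      by (rule DERIV_cong_ev[THEN iffD1, rotated 3])
         (use 2 in \<open>auto intro!: eventually_mono[OF eventually_nhds_in_open[of "{..<0}" s]]\<close>)
  next
    case 3
    have "((\<lambda>h::real. \<bar>h\<bar> powr r) \<longlongrightarrow> 0) (at 0)"
      by (rule tendsto_zero_powrI[where b = r]) (use r in \<open>auto intro!: tendsto_rabs_zero\<close>)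
    then have "((\<lambda>h. \<bar>h\<bar> powr r * h / h) \<longlongrightarrow> 0) (at 0)"
      by (rule Lim_transform_eventually) (auto simp: eventually_at_filter)
    then show ?thesis using 3 by (simp add: DERIV_def)
  qed
qed

lemma powr_add_le:
  fixes a b r :: real assumes "0 \<le> a" "0 \<le> b" "0 \<le> r"
  shows "(a + b) powr r \<le> 2 powr r * (a powr r + b powr r)"
proof -
  have "(a + b) powr r \<le> (2 * max a b) powr r" using assms by (intro powr_mono2) auto
  also have "\<dots> = 2 powr r * max a b powr r" using assms by (simp add: powr_mult)
  also have "\<dots> \<le> 2 powr r * (a powr r + b powr r)" by (intro mult_left_mono) (auto simp: max_def)
  finally show ?thesis .
qed

text \<open>
  The second derivative of \<open>|s|\<^sup>p\<close> is \<open>p (p - 1) |s|\<^sup>p\<^sup>-\<^sup>2\<close>, and on the segment from \<open>s\<close> to \<open>s + t\<close> it is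
  at most its value at \<open>|s| + |t|\<close>. Here \<open>\<psi> s = |s|\<^sup>p\<^sup>-\<^sup>2 s\<close> is the first derivative up to the factor \<open>p\<close>.
\<close>

lemma abs_powr_taylor:
  fixes p s t :: real assumes p: "p > 2"
  shows "\<bar>\<bar>s + t\<bar> powr p - \<bar>s\<bar> powr p - p * (\<bar>s\<bar> powr (p - 2) * s) * t\<bar>
    \<le> p * (p - 1) * 2 powr (p - 2) * (\<bar>s\<bar> powr (p - 2) * t\<^sup>2 + \<bar>t\<bar> powr p)"
proof -
  define B where "B = (p - 1) * (\<bar>s\<bar> + \<bar>t\<bar>) powr (p - 2)"
  define \<psi> where "\<psi> = (\<lambda>s. \<bar>s\<bar> powr (p - 2) * s)"
  have B0: "B \<ge> 0" using p by (simp add: B_def)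
  have lip: "\<bar>\<psi> (s + \<tau> * t) - \<psi> s\<bar> \<le> B * \<bar>t\<bar>" if \<tau>: "\<tau> \<in> {0..1}" for \<tau>
  proof -
    let ?S = "{- (\<bar>s\<bar> + \<bar>t\<bar>)..\<bar>s\<bar> + \<bar>t\<bar>}"
    have "norm (\<psi> (s + \<tau> * t) - \<psi> s) \<le> B * norm (s + \<tau> * t - s)"
    proof (rule field_differentiable_bound[where f' = "\<lambda>s. (p - 1) * \<bar>s\<bar> powr (p - 2)" and S = ?S])
      show "(\<psi> has_field_derivative (p - 1) * \<bar>z\<bar> powr (p - 2)) (at z within ?S)" for z
        using DERIV_abs_powr_mult[of "p - 2" z] p unfolding \<psi>_def by (auto intro: has_field_derivative_at_within)
      show "norm ((p - 1) * \<bar>z\<bar> powr (p - 2)) \<le> B" if "z \<in> ?S" for z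
        using that p unfolding B_def by (auto simp: abs_mult intro!: mult_left_mono powr_mono2)
      have "\<bar>\<tau> * t\<bar> \<le> \<bar>t\<bar>" using \<tau> by (auto simp: abs_mult mult_left_le_one_le)
      then show "s + \<tau> * t \<in> ?S" by (auto simp: abs_le_iff)
    qed auto
    also have "\<dots> \<le> B * \<bar>t\<bar>" using \<tau> B0 by (intro mult_left_mono) (auto simp: abs_mult mult_left_le_one_le)
    finally show ?thesis by simp
  qed
  define g where "g = (\<lambda>\<tau>. \<bar>s + \<tau> * t\<bar> powr p - \<tau> * (p * \<psi> s * t))"
  have "norm (g 1 - g 0) \<le> (p * (B * \<bar>t\<bar>) * \<bar>t\<bar>) * norm (1 - 0 :: real)"
  proof (rule field_differentiable_bound[where S = "{0..1}" and f' = "\<lambda>\<tau>. p * (\<psi> (s + \<tau> * t) - \<psi> s) * t"])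
    fix \<tau> :: real assume \<tau>: "\<tau> \<in> {0..1}"
    have "((\<lambda>\<tau>. \<bar>s + \<tau> * t\<bar> powr p) has_real_derivative (p * \<psi> (s + \<tau> * t)) * t) (at \<tau>)"
      unfolding \<psi>_def
      by (rule DERIV_chain2[of "\<lambda>s. \<bar>s\<bar> powr p", OF DERIV_abs_powr]) (use p in \<open>auto intro!: derivative_eq_intros\<close>)
    from DERIV_diff[OF this DERIV_cmult_right[OF DERIV_ident, of "p * \<psi> s * t"]]
    have "(g has_real_derivative (p * (\<psi> (s + \<tau> * t) - \<psi> s) * t)) (at \<tau>)"
      unfolding g_def by (simp add: algebra_simps)
    then show "(g has_field_derivative (p * (\<psi> (s + \<tau> * t) - \<psi> s) * t)) (at \<tau> within {0..1})"
      by (rule has_field_derivative_at_within)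
    show "norm (p * (\<psi> (s + \<tau> * t) - \<psi> s) * t) \<le> p * (B * \<bar>t\<bar>) * \<bar>t\<bar>"
      using lip[OF \<tau>] p by (simp add: abs_mult mult_left_mono mult_right_mono)
  qed auto
  then have "\<bar>\<bar>s + t\<bar> powr p - \<bar>s\<bar> powr p - p * (\<bar>s\<bar> powr (p - 2) * s) * t\<bar> \<le> p * (B * \<bar>t\<bar>) * \<bar>t\<bar>"
    by (simp add: g_def \<psi>_def algebra_simps)
  also have "\<dots> = p * (p - 1) * ((\<bar>s\<bar> + \<bar>t\<bar>) powr (p - 2) * t\<^sup>2)"
    by (simp add: B_def power2_eq_square mult_ac)
  also have "\<dots> \<le> p * (p - 1) * ((2 powr (p - 2) * (\<bar>s\<bar> powr (p - 2) + \<bar>t\<bar> powr (p - 2))) * t\<^sup>2)"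
    using p by (intro mult_left_mono mult_right_mono powr_add_le) auto
  also have "\<dots> = p * (p - 1) * 2 powr (p - 2) * (\<bar>s\<bar> powr (p - 2) * t\<^sup>2 + \<bar>t\<bar> powr (p - 2) * t\<^sup>2)"
    by (simp add: algebra_simps)
  also have "\<bar>t\<bar> powr (p - 2) * t\<^sup>2 = \<bar>t\<bar> powr p"
    by (cases "t = 0") (auto simp: powr_diff powr_numeral)
  finally show ?thesis .
qed

lemma abs_powr_diff_le:
  fixes p s t :: real assumes p: "p > 1"
  shows "\<bar>\<bar>s\<bar> powr p - \<bar>t\<bar> powr p\<bar> \<le> p * (\<bar>s - t\<bar> * (\<bar>s\<bar> powr (p - 1) + \<bar>t\<bar> powr (p - 1)))"
proof -
  let ?m = "max \<bar>s\<bar> \<bar>t\<bar>"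
  have "norm (\<bar>s\<bar> powr p - \<bar>t\<bar> powr p) \<le> (p * ?m powr (p - 1)) * norm (s - t)"
  proof (rule field_differentiable_bound[where f' = "\<lambda>s. p * (\<bar>s\<bar> powr (p - 2) * s)" and S = "{- ?m..?m}"])
    show "((\<lambda>s. \<bar>s\<bar> powr p) has_field_derivative p * (\<bar>z\<bar> powr (p - 2) * z)) (at z within {- ?m..?m})" for z
      using DERIV_abs_powr[OF p, of z] by (rule has_field_derivative_at_within)
    show "norm (p * (\<bar>z\<bar> powr (p - 2) * z)) \<le> p * ?m powr (p - 1)" if "z \<in> {- ?m..?m}" for z
    proof -
      have "\<bar>z\<bar> powr (p - 2) * \<bar>z\<bar> = \<bar>z\<bar> powr (p - 1)" by (rule abs_powr_mult_abs)
      moreover have "\<bar>z\<bar> powr (p - 1) \<le> ?m powr (p - 1)" using that p by (intro powr_mono2) (auto simp: abs_le_iff)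
      ultimately show ?thesis using p by (simp add: abs_mult mult_left_mono)
    qed
  qed (auto simp: max_def)
  also have "\<dots> \<le> (p * (\<bar>s\<bar> powr (p - 1) + \<bar>t\<bar> powr (p - 1))) * norm (s - t)"
    using p by (intro mult_right_mono mult_left_mono) (auto simp: max_def)
  finally show ?thesis by (simp add: mult_ac)
qed

lemma abs_powr_L2:
  assumes u: "u \<in> H1" and r: "r > 1"
  shows "(\<lambda>x. \<bar>u x\<bar> powr r) \<in> L2p"
proof -
  have [measurable]: "u \<in> borel_measurable borel" using L2_meas[OF H1_L2[OF u]] by simp
  have e: "(\<bar>u x\<bar> powr r)\<^sup>2 = \<bar>u x\<bar> powr (2 * r)" for x by (simp add: power2_eq_square powr_add[symmetric])
  have q: "2 < 2 * r" using r by simp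
  obtain K where "integrable lborel (\<lambda>x. \<bar>u x\<bar> powr (2 * r))" using GN_inequality[OF q] u by metis
  then show ?thesis by (simp add: L2_def e)
qed

text \<open>
  The Gagliardo--Nirenberg inequality with exponent \<open>2 r\<close>.
\<close>

lemma abs_powr_nrm_bounded:
  assumes r: "r > 1"
  obtains B where "\<And>u. u \<in> H1 \<Longrightarrow> A_fun u \<le> M\<^sup>2 \<Longrightarrow> nrm u \<le> M \<Longrightarrow> nrm (\<lambda>x. \<bar>u x\<bar> powr r) \<le> B"
proof -
  have q: "2 < 2 * r" using r by simp
  obtain K where K: "K \<ge> 0" "\<And>u. u \<in> H1 \<Longrightarrow> (LINT x|lborel. \<bar>u x\<bar> powr (2 * r)) \<le> K * sqrt (A_fun u) powr (2 * r - 2) * (nrm u)\<^sup>2"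
    using GN_inequality[OF q] by metis
  show ?thesis
  proof (rule that[of "sqrt (K * \<bar>M\<bar> powr (2 * r - 2) * \<bar>M\<bar>\<^sup>2)"])
    fix u assume u: "u \<in> H1" "A_fun u \<le> M\<^sup>2" "nrm u \<le> M"
    have e: "(\<bar>u x\<bar> powr r)\<^sup>2 = \<bar>u x\<bar> powr (2 * r)" for x by (simp add: power2_eq_square powr_add[symmetric])
    have sa: "sqrt (A_fun u) \<le> \<bar>M\<bar>" using u(2) by (metis real_sqrt_abs real_sqrt_le_mono)
    have "(LINT x|lborel. \<bar>u x\<bar> powr (2 * r)) \<le> K * sqrt (A_fun u) powr (2 * r - 2) * (nrm u)\<^sup>2" by (rule K(2)[OF u(1)])
    also have "\<dots> \<le> K * \<bar>M\<bar> powr (2 * r - 2) * \<bar>M\<bar>\<^sup>2"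
      using K(1) sa u(3) r by (intro mult_mono powr_mono2 power_mono) auto
    finally show "nrm (\<lambda>x. \<bar>u x\<bar> powr r) \<le> sqrt (K * \<bar>M\<bar> powr (2 * r - 2) * \<bar>M\<bar>\<^sup>2)"
      unfolding nrm2_def e by simp
  qed
qed

lemma C_fun_diff_le:
  assumes p: "p > 2"
  shows "\<exists>B. \<forall>u\<in>H1. \<forall>v\<in>H1. A_fun u \<le> M\<^sup>2 \<and> nrm u \<le> M \<and> A_fun v \<le> M\<^sup>2 \<and> nrm v \<le> M
    \<longrightarrow> \<bar>C_fun p u - C_fun p v\<bar> \<le> B * nrm (\<lambda>x. u x - v x)"
proof -
  have r: "p - 1 > 1" using p by simp
  obtain B where B: "\<And>u. u \<in> H1 \<Longrightarrow> A_fun u \<le> M\<^sup>2 \<Longrightarrow> nrm u \<le> M \<Longrightarrow> nrm (\<lambda>x. \<bar>u x\<bar> powr (p - 1)) \<le> B"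
    using abs_powr_nrm_bounded[OF r] by metis
  show ?thesis
  proof (intro exI[of _ "p * (2 * B)"] ballI impI)
    fix u v assume uv: "u \<in> H1" "v \<in> H1" "A_fun u \<le> M\<^sup>2 \<and> nrm u \<le> M \<and> A_fun v \<le> M\<^sup>2 \<and> nrm v \<le> M"
    then have u: "u \<in> H1" "A_fun u \<le> M\<^sup>2" "nrm u \<le> M" and v: "v \<in> H1" "A_fun v \<le> M\<^sup>2" "nrm v \<le> M" by auto
    let ?d = "\<lambda>x. u x - v x" and ?s = "\<lambda>x. \<bar>u x\<bar> powr (p - 1) + \<bar>v x\<bar> powr (p - 1)"
    have L: "?d \<in> L2p" "?s \<in> L2p" by (intro L2_diff L2_add H1_L2 u v abs_powr_L2 r)+
    have i: "integrable lborel (\<lambda>x. \<bar>u x\<bar> powr p)" "integrable lborel (\<lambda>x. \<bar>v x\<bar> powr p)"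
      using GN_inequality[OF p] u(1) v(1) by metis+
    have iL: "integrable lborel (\<lambda>x. p * (\<bar>?d x\<bar> * \<bar>?s x\<bar>))"
      by (intro integrable_mult_right L2_mult_integrable L2_abs L)
    have "\<bar>C_fun p u - C_fun p v\<bar> = \<bar>LINT x|lborel. \<bar>u x\<bar> powr p - \<bar>v x\<bar> powr p\<bar>"
      unfolding C_fun_def using i by simp
    also have "\<dots> \<le> (LINT x|lborel. \<bar>\<bar>u x\<bar> powr p - \<bar>v x\<bar> powr p\<bar>)" by (rule integral_abs_bound)
    also have "\<dots> \<le> (LINT x|lborel. p * (\<bar>?d x\<bar> * \<bar>?s x\<bar>))"
    proof (rule integral_mono[OF _ iL])
      show "integrable lborel (\<lambda>x. \<bar>\<bar>u x\<bar> powr p - \<bar>v x\<bar> powr p\<bar>)" using i by simp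
      show "\<bar>\<bar>u x\<bar> powr p - \<bar>v x\<bar> powr p\<bar> \<le> p * (\<bar>?d x\<bar> * \<bar>?s x\<bar>)" for x
        using abs_powr_diff_le[of p "u x" "v x"] p by simp
    qed
    also have "\<dots> \<le> p * (nrm ?d * nrm ?s)"
      using p Cauchy_Schwarz_abs[OF L] by simp
    also have "\<dots> \<le> p * (nrm ?d * (B + B))"
      using p nrm2_triangle[OF abs_powr_L2[OF u(1) r] abs_powr_L2[OF v(1) r]] B[OF u] B[OF v]
      by (intro mult_left_mono) auto
    finally show "\<bar>C_fun p u - C_fun p v\<bar> \<le> p * (2 * B) * nrm ?d" by (simp add: mult_ac)
  qed
qed

section \<open>Differentiability\<close>

text \<open>
  Differentiability with a remainder of second order. Unlike the definition with \<open>\<epsilon>\<close> and \<open>\<delta>\<close> it passes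
  directly to linear combinations, and the remainder is what the first variation on the sphere uses.
\<close>

definition quadratic_derivative :: "((plane \<Rightarrow> real) \<Rightarrow> real) \<Rightarrow> ((plane \<Rightarrow> real) \<Rightarrow> real) \<Rightarrow> (plane \<Rightarrow> real) \<Rightarrow> bool" where
  "quadratic_derivative \<Phi> L u \<longleftrightarrow>
     (\<forall>f\<in>X_space. \<forall>g\<in>X_space. L (\<lambda>x. f x + g x) = L f + L g) \<and>
     (\<forall>r. \<forall>f\<in>X_space. L (\<lambda>x. r * f x) = r * L f) \<and>
     (\<exists>B. \<forall>f\<in>X_space. \<bar>L f\<bar> \<le> B * X_norm f) \<and>
     (\<exists>C. \<forall>h\<in>X_space. X_norm h \<le> 1 \<longrightarrow> \<bar>\<Phi> (\<lambda>x. u x + h x) - \<Phi> u - L h\<bar> \<le> C * (X_norm h)\<^sup>2)"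

lemma quadratic_derivative_imp_has_X_derivative:
  assumes "quadratic_derivative \<Phi> L u" shows "has_X_derivative \<Phi> L u"
  unfolding has_X_derivative_def
proof (intro conjI)
  obtain C where C: "\<And>h. h \<in> X_space \<Longrightarrow> X_norm h \<le> 1 \<Longrightarrow> \<bar>\<Phi> (\<lambda>x. u x + h x) - \<Phi> u - L h\<bar> \<le> C * (X_norm h)\<^sup>2"
    using assms unfolding quadratic_derivative_def by blast
  show "\<forall>\<epsilon>>0. \<exists>\<delta>>0. \<forall>h\<in>X_space. X_norm h < \<delta> \<longrightarrow> \<bar>\<Phi> (\<lambda>x. u x + h x) - \<Phi> u - L h\<bar> \<le> \<epsilon> * X_norm h"
  proof (intro allI impI)
    fix \<epsilon> :: real assume e: "\<epsilon> > 0"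
    show "\<exists>\<delta>>0. \<forall>h\<in>X_space. X_norm h < \<delta> \<longrightarrow> \<bar>\<Phi> (\<lambda>x. u x + h x) - \<Phi> u - L h\<bar> \<le> \<epsilon> * X_norm h"
    proof (intro exI conjI ballI impI)
      show "min 1 (\<epsilon> / (\<bar>C\<bar> + 1)) > 0" using e by simp
      fix h assume h: "h \<in> X_space" "X_norm h < min 1 (\<epsilon> / (\<bar>C\<bar> + 1))"
      have n: "0 \<le> X_norm h" by (rule X_norm_nonneg[OF h(1)])
      have "\<bar>\<Phi> (\<lambda>x. u x + h x) - \<Phi> u - L h\<bar> \<le> C * (X_norm h)\<^sup>2" using C[OF h(1)] h(2) by simp
      also have "\<dots> \<le> (\<bar>C\<bar> + 1) * (X_norm h)\<^sup>2" by (intro mult_right_mono) auto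
      also have "\<dots> = ((\<bar>C\<bar> + 1) * X_norm h) * X_norm h" by (simp add: power2_eq_square)
      also have "\<dots> \<le> \<epsilon> * X_norm h"
        using h(2) n by (intro mult_right_mono) (auto simp: pos_less_divide_eq mult.commute less_imp_le)
      finally show "\<bar>\<Phi> (\<lambda>x. u x + h x) - \<Phi> u - L h\<bar> \<le> \<epsilon> * X_norm h" .
    qed
  qed
qed (use assms in \<open>auto simp: quadratic_derivative_def\<close>)

lemma quadratic_derivative_lincomb:
  assumes 1: "quadratic_derivative \<Phi> L u" and 2: "quadratic_derivative \<Psi> M u"
  shows "quadratic_derivative (\<lambda>v. a * \<Phi> v + b * \<Psi> v) (\<lambda>h. a * L h + b * M h) u"
proof -
  obtain B where B: "\<And>f. f \<in> X_space \<Longrightarrow> \<bar>L f\<bar> \<le> B * X_norm f" using 1 unfolding quadratic_derivative_def by blast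
  obtain B' where B': "\<And>f. f \<in> X_space \<Longrightarrow> \<bar>M f\<bar> \<le> B' * X_norm f" using 2 unfolding quadratic_derivative_def by blast
  obtain C where C: "\<And>h. h \<in> X_space \<Longrightarrow> X_norm h \<le> 1 \<Longrightarrow> \<bar>\<Phi> (\<lambda>x. u x + h x) - \<Phi> u - L h\<bar> \<le> C * (X_norm h)\<^sup>2"
    using 1 unfolding quadratic_derivative_def by blast
  obtain C' where C': "\<And>h. h \<in> X_space \<Longrightarrow> X_norm h \<le> 1 \<Longrightarrow> \<bar>\<Psi> (\<lambda>x. u x + h x) - \<Psi> u - M h\<bar> \<le> C' * (X_norm h)\<^sup>2"
    using 2 unfolding quadratic_derivative_def by blast
  have comb: "\<bar>a * x + b * y\<bar> \<le> (\<bar>a\<bar> * c + \<bar>b\<bar> * d) * z" if "\<bar>x\<bar> \<le> c * z" "\<bar>y\<bar> \<le> d * z" for x y c d z :: real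
  proof -
    have "\<bar>a * x + b * y\<bar> \<le> \<bar>a\<bar> * \<bar>x\<bar> + \<bar>b\<bar> * \<bar>y\<bar>" by (metis abs_mult abs_triangle_ineq)
    also have "\<dots> \<le> \<bar>a\<bar> * (c * z) + \<bar>b\<bar> * (d * z)" using that by (intro add_mono mult_left_mono) auto
    finally show ?thesis by (simp add: algebra_simps)
  qed
  show ?thesis
    unfolding quadratic_derivative_def
  proof (intro conjI)
    show "\<forall>f\<in>X_space. \<forall>g\<in>X_space. a * L (\<lambda>x. f x + g x) + b * M (\<lambda>x. f x + g x) = a * L f + b * M f + (a * L g + b * M g)"
      using 1 2 unfolding quadratic_derivative_def by (simp add: distrib_left)
    show "\<forall>r. \<forall>f\<in>X_space. a * L (\<lambda>x. r * f x) + b * M (\<lambda>x. r * f x) = r * (a * L f + b * M f)"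
      using 1 2 unfolding quadratic_derivative_def by (simp add: distrib_left mult.left_commute)
    show "\<exists>B. \<forall>f\<in>X_space. \<bar>a * L f + b * M f\<bar> \<le> B * X_norm f"
      using comb[OF B B'] by blast
    show "\<exists>C. \<forall>h\<in>X_space. X_norm h \<le> 1 \<longrightarrow> \<bar>a * \<Phi> (\<lambda>x. u x + h x) + b * \<Psi> (\<lambda>x. u x + h x) - (a * \<Phi> u + b * \<Psi> u) - (a * L h + b * M h)\<bar> \<le> C * (X_norm h)\<^sup>2"
    proof (intro exI ballI impI)
      fix h assume h: "h \<in> X_space" "X_norm h \<le> 1"
      have "a * \<Phi> (\<lambda>x. u x + h x) + b * \<Psi> (\<lambda>x. u x + h x) - (a * \<Phi> u + b * \<Psi> u) - (a * L h + b * M h)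
        = a * (\<Phi> (\<lambda>x. u x + h x) - \<Phi> u - L h) + b * (\<Psi> (\<lambda>x. u x + h x) - \<Psi> u - M h)"
        by (simp add: algebra_simps)
      then show "\<bar>a * \<Phi> (\<lambda>x. u x + h x) + b * \<Psi> (\<lambda>x. u x + h x) - (a * \<Phi> u + b * \<Psi> u) - (a * L h + b * M h)\<bar> \<le> (\<bar>a\<bar> * C + \<bar>b\<bar> * C') * (X_norm h)\<^sup>2"
        using comb[OF C[OF h] C'[OF h]] by simp
    qed
  qed
qed

lemma A_fun_le_X: "h \<in> X_space \<Longrightarrow> A_fun h \<le> (X_norm h)\<^sup>2"
  using X_norm_ge(1)[of h] power_mono[of "sqrt (A_fun h)" "X_norm h" 2] by simp

lemma quadratic_derivative_A: assumes u: "u \<in> X_space" shows "quadratic_derivative A_fun (\<lambda>h. 2 * dirichlet u h) u"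
  unfolding quadratic_derivative_def
proof (intro conjI)
  show "\<forall>f\<in>X_space. \<forall>g\<in>X_space. 2 * dirichlet u (\<lambda>x. f x + g x) = 2 * dirichlet u f + 2 * dirichlet u g"
    using dirichlet_add[OF X_H1[OF u] X_H1 X_H1] by simp
  show "\<forall>r. \<forall>f\<in>X_space. 2 * dirichlet u (\<lambda>x. r * f x) = r * (2 * dirichlet u f)"
    using dirichlet_cmult[OF X_H1[OF u] X_H1] by simp
  show "\<exists>B. \<forall>f\<in>X_space. \<bar>2 * dirichlet u f\<bar> \<le> B * X_norm f"
  proof (intro exI ballI)
    fix f assume f: "f \<in> X_space"
    have "\<bar>dirichlet u f\<bar> \<le> sqrt (A_fun u) * X_norm f"
      by (rule order_trans[OF dirichlet_Cauchy_Schwarz[OF X_H1[OF u] X_H1[OF f]]]) (intro mult_left_mono X_norm_ge f; simp)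
    then show "\<bar>2 * dirichlet u f\<bar> \<le> (2 * sqrt (A_fun u)) * X_norm f" by simp
  qed
  show "\<exists>C. \<forall>h\<in>X_space. X_norm h \<le> 1 \<longrightarrow> \<bar>A_fun (\<lambda>x. u x + h x) - A_fun u - 2 * dirichlet u h\<bar> \<le> C * (X_norm h)\<^sup>2"
    using A_fun_add[OF X_H1[OF u] X_H1] A_fun_le_X by (intro exI[of _ 1]) auto
qed

text \<open>
  Expanding the quartic form at \<open>u + h\<close> leaves, after the terms of order zero and one, six terms with
  at least two factors \<open>h\<close>. The two linear terms come from varying a factor
  that depends on \<open>y\<close> and one that depends on \<open>x\<close>.
\<close>

lemma quadratic_derivative_V: assumes u: "u \<in> X_space" shows "quadratic_derivative V_fun (\<lambda>h. 2 * log_form u u u h + 2 * log_form u h u u) u"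
  unfolding quadratic_derivative_def
proof (intro conjI)
  note i = log_form_bound(1)
  show "\<forall>f\<in>X_space. \<forall>g\<in>X_space. 2 * log_form u u u (\<lambda>x. f x + g x) + 2 * log_form u (\<lambda>x. f x + g x) u u = 2 * log_form u u u f + 2 * log_form u f u u + (2 * log_form u u u g + 2 * log_form u g u u)"
  proof (intro ballI)
    fix f g assume f: "f \<in> X_space" and g: "g \<in> X_space"
    have "log_form u u u (\<lambda>x. f x + g x) = log_form u u u f + log_form u u u g"
      unfolding log_form_def by (subst Bochner_Integration.integral_add[OF i[OF u u u f] i[OF u u u g], symmetric]) (simp add: algebra_simps)
    moreover have "log_form u (\<lambda>x. f x + g x) u u = log_form u f u u + log_form u g u u"
      unfolding log_form_def by (subst Bochner_Integration.integral_add[OF i[OF u f u u] i[OF u g u u], symmetric]) (simp add: algebra_simps)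
    ultimately show "2 * log_form u u u (\<lambda>x. f x + g x) + 2 * log_form u (\<lambda>x. f x + g x) u u = 2 * log_form u u u f + 2 * log_form u f u u + (2 * log_form u u u g + 2 * log_form u g u u)"
      by simp
  qed
  show "\<forall>r. \<forall>f\<in>X_space. 2 * log_form u u u (\<lambda>x. r * f x) + 2 * log_form u (\<lambda>x. r * f x) u u = r * (2 * log_form u u u f + 2 * log_form u f u u)"
  proof (intro allI ballI)
    fix r f
    have "log_form u u u (\<lambda>x. r * f x) = r * log_form u u u f" "log_form u (\<lambda>x. r * f x) u u = r * log_form u f u u"
      unfolding log_form_def by (subst integral_mult_right_zero[symmetric], simp add: mult_ac)+
    then show "2 * log_form u u u (\<lambda>x. r * f x) + 2 * log_form u (\<lambda>x. r * f x) u u = r * (2 * log_form u u u f + 2 * log_form u f u u)"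
      by (simp add: algebra_simps)
  qed
  define a where "a = X_norm u"
  define K where "K = 2 + near_const"
  have a0: "a \<ge> 0" "K \<ge> 0" using X_norm_nonneg[OF u] near_const_pos by (auto simp: a_def K_def)
  show "\<exists>B. \<forall>f\<in>X_space. \<bar>2 * log_form u u u f + 2 * log_form u f u u\<bar> \<le> B * X_norm f"
  proof (intro exI ballI)
    fix f assume f: "f \<in> X_space"
    show "\<bar>2 * log_form u u u f + 2 * log_form u f u u\<bar> \<le> (4 * (K * (a * a * a))) * X_norm f"
    proof -
      have "\<bar>log_form u u u f\<bar> \<le> (K * (a * a * a)) * X_norm f" "\<bar>log_form u f u u\<bar> \<le> (K * (a * a * a)) * X_norm f"
        using log_form_bound(2)[OF u u u f] log_form_bound(2)[OF u f u u] by (simp_all add: a_def K_def mult_ac)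
      then show ?thesis by linarith
    qed
  qed
  show "\<exists>C. \<forall>h\<in>X_space. X_norm h \<le> 1 \<longrightarrow> \<bar>V_fun (\<lambda>x. u x + h x) - V_fun u - (2 * log_form u u u h + 2 * log_form u h u u)\<bar> \<le> C * (X_norm h)\<^sup>2"
  proof (intro exI ballI impI)
    fix h assume h: "h \<in> X_space" "X_norm h \<le> 1"
    define b where "b = X_norm h"
    have b: "0 \<le> b" "b \<le> 1" using X_norm_nonneg[OF h(1)] h(2) by (auto simp: b_def)
    note I = i[OF u u u u] i[OF u u u h(1)] i[OF u h(1) u u] i[OF u u h(1) h(1)] i[OF u h(1) u h(1)]
      i[OF u h(1) h(1) h(1)] i[OF h(1) h(1) u u] i[OF h(1) h(1) u h(1)] i[OF h(1) h(1) h(1) h(1)]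
    have "V_fun (\<lambda>x. u x + h x) = log_form u u u u + 2 * log_form u u u h + (2 * log_form u h u u + (log_form u u h h + (4 * log_form u h u h + (2 * log_form u h h h + (log_form h h u u + (2 * log_form h h u h + log_form h h h h))))))"
    proof -
      let ?q = "\<lambda>f1 f2 f3 f4 (p :: plane \<times> plane). ln (norm (fst p - snd p)) * (f1 (fst p) * f2 (fst p) * (f3 (snd p) * f4 (snd p)))"
      have "V_fun (\<lambda>x. u x + h x) = (LINT p|Pm. ?q u u u u p + 2 * ?q u u u h p + (2 * ?q u h u u p + (?q u u h h p + (4 * ?q u h u h p
          + (2 * ?q u h h h p + (?q h h u u p + (2 * ?q h h u h p + ?q h h h h p)))))))"
        unfolding V_fun_log_form log_form_def by (rule Bochner_Integration.integral_cong) (auto simp: algebra_simps)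
      also have "\<dots> = log_form u u u u + 2 * log_form u u u h + (2 * log_form u h u u + (log_form u u h h + (4 * log_form u h u h + (2 * log_form u h h h + (log_form h h u u + (2 * log_form h h u h + log_form h h h h))))))"
        unfolding log_form_def
        by (simp only: Bochner_Integration.integral_add Bochner_Integration.integrable_add integrable_mult_right I integral_mult_right_zero)
      finally show ?thesis .
    qed
    then have e: "V_fun (\<lambda>x. u x + h x) - V_fun u - (2 * log_form u u u h + 2 * log_form u h u u) = log_form u u h h + 4 * log_form u h u h + 2 * log_form u h h h + log_form h h u u + 2 * log_form h h u h + log_form h h h h"
      by (simp add: V_fun_log_form)
    have q: "\<bar>log_form u u h h\<bar> \<le> K * (a\<^sup>2 * b\<^sup>2)" "\<bar>log_form u h u h\<bar> \<le> K * (a\<^sup>2 * b\<^sup>2)" "\<bar>log_form h h u u\<bar> \<le> K * (a\<^sup>2 * b\<^sup>2)"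
      using log_form_bound(2)[OF u u h(1) h(1)] log_form_bound(2)[OF u h(1) u h(1)] log_form_bound(2)[OF h(1) h(1) u u]
      by (simp_all add: a_def b_def K_def power2_eq_square mult_ac)
    have q3: "\<bar>log_form u h h h\<bar> \<le> K * (a * b\<^sup>2)" "\<bar>log_form h h u h\<bar> \<le> K * (a * b\<^sup>2)" "\<bar>log_form h h h h\<bar> \<le> K * b\<^sup>2"
    proof -
      have b3: "a * b * b * b \<le> a * b\<^sup>2" using b a0 mult_left_le[of b "a * b * b"] by (simp add: power2_eq_square mult_ac)
      have b4: "b * b * (b * b) \<le> b\<^sup>2" using b mult_left_le[of "b * b" "b * b"] by (simp add: power2_eq_square mult_le_one)
      have "\<bar>log_form u h h h\<bar> \<le> K * (a * b * b * b)" "\<bar>log_form h h u h\<bar> \<le> K * (a * b * b * b)" "\<bar>log_form h h h h\<bar> \<le> K * (b * b * (b * b))"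
        using log_form_bound(2)[OF u h(1) h(1) h(1)] log_form_bound(2)[OF h(1) h(1) u h(1)] log_form_bound(2)[OF h(1) h(1) h(1) h(1)]
        by (simp_all add: a_def b_def K_def mult_ac)
      then show "\<bar>log_form u h h h\<bar> \<le> K * (a * b\<^sup>2)" "\<bar>log_form h h u h\<bar> \<le> K * (a * b\<^sup>2)" "\<bar>log_form h h h h\<bar> \<le> K * b\<^sup>2"
        using mult_left_mono[OF b3 a0(2)] mult_left_mono[OF b4 a0(2)] by linarith+
    qed
    have "\<bar>V_fun (\<lambda>x. u x + h x) - V_fun u - (2 * log_form u u u h + 2 * log_form u h u u)\<bar> \<le> 6 * (K * (a\<^sup>2 * b\<^sup>2)) + 4 * (K * (a * b\<^sup>2)) + K * b\<^sup>2"
      unfolding e using q q3 by linarith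
    then show "\<bar>V_fun (\<lambda>x. u x + h x) - V_fun u - (2 * log_form u u u h + 2 * log_form u h u u)\<bar> \<le> (K * (6 * a\<^sup>2 + 4 * a + 1)) * (X_norm h)\<^sup>2"
      by (simp add: b_def algebra_simps)
  qed
qed

text \<open>
  The Taylor remainder is at most a multiple of \<open>|u|\<^sup>p\<^sup>-\<^sup>2 h\<^sup>2 + |h|\<^sup>p\<close>. Both terms are of second order in
  \<open>h\<close> by Cauchy--Schwarz and the Gagliardo--Nirenberg inequality with exponents \<open>2 (p - 2)\<close>, \<open>4\<close> and \<open>p\<close>.
\<close>

lemma quadratic_derivative_C:
  assumes u: "u \<in> X_space" and p: "p > 3"
  shows "quadratic_derivative (C_fun p) (\<lambda>h. LINT x|lborel. p * (\<bar>u x\<bar> powr (p - 2) * u x) * h x) u"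
  unfolding quadratic_derivative_def
proof (intro conjI)
  note [measurable] = X_borel[OF u]
  define \<psi> where "\<psi> = (\<lambda>x. p * (\<bar>u x\<bar> powr (p - 2) * u x))"
  have L: "\<psi> \<in> L2p"
  proof -
    have "(\<lambda>x. \<bar>u x\<bar> powr (p - 1)) \<in> L2p" using abs_powr_L2[OF X_H1[OF u], of "p - 1"] p by simp
    then have "(\<lambda>x. p * \<bar>u x\<bar> powr (p - 1)) \<in> L2p" by (rule L2_cmult)
    from L2_int[OF this] have "integrable lborel (\<lambda>x. (p * \<bar>u x\<bar> powr (p - 1))\<^sup>2)" .
    moreover have "(\<psi> x)\<^sup>2 = (p * \<bar>u x\<bar> powr (p - 1))\<^sup>2" for x
    proof -
      have "\<bar>u x\<bar> powr (p - 2) * \<bar>u x\<bar> = \<bar>u x\<bar> powr (p - 1)" by (rule abs_powr_mult_abs)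
      then have "\<bar>\<psi> x\<bar> = \<bar>p * \<bar>u x\<bar> powr (p - 1)\<bar>" by (simp add: \<psi>_def abs_mult)
      then show ?thesis by (metis power2_abs)
    qed
    ultimately show ?thesis unfolding L2_def by (simp add: \<psi>_def)
  qed
  have i: "integrable lborel (\<lambda>x. \<psi> x * f x)" if "f \<in> X_space" for f by (rule L2_mult_integrable[OF L X_L2[OF that]])
  show "\<forall>f\<in>X_space. \<forall>g\<in>X_space. (LINT x|lborel. p * (\<bar>u x\<bar> powr (p - 2) * u x) * (f x + g x)) =
    (LINT x|lborel. p * (\<bar>u x\<bar> powr (p - 2) * u x) * f x) + (LINT x|lborel. p * (\<bar>u x\<bar> powr (p - 2) * u x) * g x)"
    unfolding \<psi>_def[THEN fun_cong, symmetric] using i by (simp add: distrib_left)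
  show "\<forall>r. \<forall>f\<in>X_space. (LINT x|lborel. p * (\<bar>u x\<bar> powr (p - 2) * u x) * (r * f x)) = r * (LINT x|lborel. p * (\<bar>u x\<bar> powr (p - 2) * u x) * f x)"
    unfolding \<psi>_def[THEN fun_cong, symmetric] by (simp add: mult.left_commute)
  show "\<exists>B. \<forall>f\<in>X_space. \<bar>LINT x|lborel. p * (\<bar>u x\<bar> powr (p - 2) * u x) * f x\<bar> \<le> B * X_norm f"
    unfolding \<psi>_def[THEN fun_cong, symmetric]
  proof (intro exI ballI)
    fix f assume f: "f \<in> X_space"
    show "\<bar>LINT x|lborel. \<psi> x * f x\<bar> \<le> nrm \<psi> * X_norm f"
      by (rule order_trans[OF Cauchy_Schwarz_L2[OF L X_L2[OF f]]]) (intro mult_left_mono X_norm_ge f; simp)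
  qed
  have p2: "p > 2" and pr: "p - 2 > 1" using p by auto
  obtain K where K: "K \<ge> 0" "\<And>u. u \<in> H1 \<Longrightarrow> integrable lborel (\<lambda>x. \<bar>u x\<bar> powr p)"
    "\<And>u. u \<in> H1 \<Longrightarrow> (LINT x|lborel. \<bar>u x\<bar> powr p) \<le> K * sqrt (A_fun u) powr (p - 2) * (nrm u)\<^sup>2"
    using GN_inequality[OF p2] by metis
  define c where "c = p * (p - 1) * 2 powr (p - 2)"
  have c0: "c \<ge> 0" using p by (simp add: c_def)
  have L2': "(\<lambda>x. \<bar>u x\<bar> powr (p - 2)) \<in> L2p" by (rule abs_powr_L2[OF X_H1[OF u] pr])
  show "\<exists>C. \<forall>h\<in>X_space. X_norm h \<le> 1 \<longrightarrow> \<bar>C_fun p (\<lambda>x. u x + h x) - C_fun p u - (LINT x|lborel. p * (\<bar>u x\<bar> powr (p - 2) * u x) * h x)\<bar> \<le> C * (X_norm h)\<^sup>2"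
    unfolding \<psi>_def[THEN fun_cong, symmetric]
  proof (intro exI ballI impI)
    fix h assume h: "h \<in> X_space" "X_norm h \<le> 1"
    note [measurable] = X_borel[OF h(1)]
    note n = X_norm_nonneg[OF h(1)] and ge = X_norm_ge[OF h(1)]
    have h2: "(\<lambda>x. (h x)\<^sup>2) \<in> L2p" using GN_even(1)[OF X_H1[OF h(1)], of 1] by (simp add: numeral_2_eq_2)
    have h2n: "nrm (\<lambda>x. (h x)\<^sup>2) \<le> 2 * (X_norm h)\<^sup>2"
    proof (rule power2_le_imp_le)
      have "(nrm (\<lambda>x. (h x)\<^sup>2))\<^sup>2 \<le> 4 * (A_fun h * (nrm h)\<^sup>2)" using GN_even(2)[OF X_H1[OF h(1)], of 1] by (simp add: numeral_2_eq_2)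
      also have "\<dots> \<le> 4 * ((X_norm h)\<^sup>2 * (X_norm h)\<^sup>2)"
        using ge by (intro mult_left_mono mult_mono power_mono A_fun_le_X h) auto
      finally show "(nrm (\<lambda>x. (h x)\<^sup>2))\<^sup>2 \<le> (2 * (X_norm h)\<^sup>2)\<^sup>2" by (simp add: power2_eq_square mult_ac)
    qed simp
    have iuh: "integrable lborel (\<lambda>x. \<bar>u x + h x\<bar> powr p)" by (rule K(2)[OF H1_add(1)[OF X_H1[OF u] X_H1[OF h(1)]]])
    have iu: "integrable lborel (\<lambda>x. \<bar>u x\<bar> powr p)" and ih: "integrable lborel (\<lambda>x. \<bar>h x\<bar> powr p)"
      by (rule K(2)[OF X_H1[OF u]], rule K(2)[OF X_H1[OF h(1)]])
    have iq: "integrable lborel (\<lambda>x. \<bar>u x\<bar> powr (p - 2) * (h x)\<^sup>2)" by (rule L2_mult_integrable[OF L2' h2])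
    have "\<bar>C_fun p (\<lambda>x. u x + h x) - C_fun p u - (LINT x|lborel. \<psi> x * h x)\<bar> = \<bar>LINT x|lborel. \<bar>u x + h x\<bar> powr p - \<bar>u x\<bar> powr p - \<psi> x * h x\<bar>"
      unfolding C_fun_def using iuh iu i[OF h(1)] by simp
    also have "\<dots> \<le> (LINT x|lborel. \<bar>\<bar>u x + h x\<bar> powr p - \<bar>u x\<bar> powr p - \<psi> x * h x\<bar>)" by (rule integral_abs_bound)
    also have "\<dots> \<le> (LINT x|lborel. c * (\<bar>u x\<bar> powr (p - 2) * (h x)\<^sup>2 + \<bar>h x\<bar> powr p))"
    proof (rule integral_mono)
      show "integrable lborel (\<lambda>x. \<bar>\<bar>u x + h x\<bar> powr p - \<bar>u x\<bar> powr p - \<psi> x * h x\<bar>)" using iuh iu i[OF h(1)] by simp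
      show "integrable lborel (\<lambda>x. c * (\<bar>u x\<bar> powr (p - 2) * (h x)\<^sup>2 + \<bar>h x\<bar> powr p))" using iq ih by simp
      show "\<bar>\<bar>u x + h x\<bar> powr p - \<bar>u x\<bar> powr p - \<psi> x * h x\<bar> \<le> c * (\<bar>u x\<bar> powr (p - 2) * (h x)\<^sup>2 + \<bar>h x\<bar> powr p)" for x
        unfolding \<psi>_def c_def by (rule abs_powr_taylor[OF p2])
    qed
    also have "\<dots> = c * ((LINT x|lborel. \<bar>u x\<bar> powr (p - 2) * (h x)\<^sup>2) + (LINT x|lborel. \<bar>h x\<bar> powr p))" using iq ih by simp
    also have "\<dots> \<le> c * (nrm (\<lambda>x. \<bar>u x\<bar> powr (p - 2)) * (2 * (X_norm h)\<^sup>2) + K * (X_norm h)\<^sup>2)"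
    proof (intro mult_left_mono add_mono c0)
      have "(LINT x|lborel. \<bar>u x\<bar> powr (p - 2) * (h x)\<^sup>2) \<le> nrm (\<lambda>x. \<bar>u x\<bar> powr (p - 2)) * nrm (\<lambda>x. (h x)\<^sup>2)"
        using Cauchy_Schwarz_L2[OF L2' h2] by simp
      also have "\<dots> \<le> nrm (\<lambda>x. \<bar>u x\<bar> powr (p - 2)) * (2 * (X_norm h)\<^sup>2)" by (intro mult_left_mono h2n) simp
      finally show "(LINT x|lborel. \<bar>u x\<bar> powr (p - 2) * (h x)\<^sup>2) \<le> nrm (\<lambda>x. \<bar>u x\<bar> powr (p - 2)) * (2 * (X_norm h)\<^sup>2)" .
      have "sqrt (A_fun h) \<le> 1" using ge(1) h(2) by linarith
      then have "sqrt (A_fun h) powr (p - 2) \<le> 1 powr (p - 2)"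
        using p by (intro powr_mono2[of "p - 2" "sqrt (A_fun h)" 1] real_sqrt_ge_zero A_fun_nonneg) simp_all
      then have k: "K * sqrt (A_fun h) powr (p - 2) \<le> K * 1" using K(1) by (intro mult_left_mono) auto
      have "K * sqrt (A_fun h) powr (p - 2) * (nrm h)\<^sup>2 \<le> K * 1 * (X_norm h)\<^sup>2"
        using mult_mono[OF k power_mono[OF ge(2) nrm2_nonneg, of 2]] K(1) by simp
      then show "(LINT x|lborel. \<bar>h x\<bar> powr p) \<le> K * (X_norm h)\<^sup>2" using K(3)[OF X_H1[OF h(1)]] by simp
    qed
    finally show "\<bar>C_fun p (\<lambda>x. u x + h x) - C_fun p u - (LINT x|lborel. \<psi> x * h x)\<bar> \<le> (c * (2 * nrm (\<lambda>x. \<bar>u x\<bar> powr (p - 2)) + K)) * (X_norm h)\<^sup>2"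
      by (simp add: algebra_simps)
  qed
qed

lemma F_fun_differentiable:
  assumes u: "u \<in> X_space" and p: "p > 3"
  obtains L where "quadratic_derivative (F_fun \<gamma> a p) L u"
proof -
  note 1 = quadratic_derivative_lincomb[OF quadratic_derivative_A[OF u] quadratic_derivative_V[OF u], of "1/2" "\<gamma>/4"]
  note 2 = quadratic_derivative_lincomb[OF 1 quadratic_derivative_C[OF u p], of 1 "- a/p"]
  have "(\<lambda>v. 1 * (1 / 2 * A_fun v + \<gamma> / 4 * V_fun v) + - a / p * C_fun p v) = F_fun \<gamma> a p"
    by (simp add: fun_eq_iff F_fun_def)
  from 2[unfolded this] show ?thesis by (rule that)
qed

section \<open>Convergence tools\<close>

lemma nonneg_Fatou:
  fixes f :: "nat \<Rightarrow> 'a \<Rightarrow> real"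
  assumes i: "\<And>n. integrable M (f n)" and nn: "\<And>n x. 0 \<le> f n x" and g: "g \<in> borel_measurable M"
    and ae: "AE x in M. (\<lambda>n. f n x) \<longlonglongrightarrow> g x" and gi: "integrable M g" and l: "(\<lambda>n. LINT x|M. f n x) \<longlonglongrightarrow> \<beta>"
  shows "(LINT x|M. g x) \<le> \<beta>"
proof -
  have nng: "AE x in M. 0 \<le> g x"
    using ae by eventually_elim (rule LIMSEQ_le_const, assumption, use nn in blast)
  have b0: "0 \<le> \<beta>" by (rule LIMSEQ_le_const[OF l]) (use nn in \<open>auto intro!: Bochner_Integration.integral_nonneg\<close>)
  have "ennreal (LINT x|M. g x) = (\<integral>\<^sup>+x. ennreal (g x) \<partial>M)"
    by (rule nn_integral_eq_integral[OF gi nng, symmetric])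
  also have "\<dots> = (\<integral>\<^sup>+x. liminf (\<lambda>n. ennreal (f n x)) \<partial>M)"
  proof (rule nn_integral_cong_AE)
    show "AE x in M. ennreal (g x) = liminf (\<lambda>n. ennreal (f n x))"
      using ae by eventually_elim (rule lim_imp_Liminf[OF trivial_limit_sequentially tendsto_ennrealI, symmetric])
  qed
  also have "\<dots> \<le> liminf (\<lambda>n. \<integral>\<^sup>+x. ennreal (f n x) \<partial>M)"
    by (rule nn_integral_liminf) (use i in auto)
  also have "\<dots> = liminf (\<lambda>n. ennreal (LINT x|M. f n x))"
    using nn_integral_eq_integral[OF i AE_I2[OF nn]] by simp
  also have "\<dots> = ennreal \<beta>" by (rule lim_imp_Liminf[OF trivial_limit_sequentially tendsto_ennrealI[OF l]])
  finally show ?thesis using b0 by (simp add: ennreal_le_iff)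
qed

text \<open>
  Dominated convergence with a dominating function that depends on \<open>n\<close>. By Scheffe's lemma \<open>G n\<close> tends
  to \<open>g\<close> in \<open>L\<^sup>1\<close>, so \<open>D n\<close> differs little from \<open>min (D n) |g|\<close>, to which the classical theorem applies.
\<close>

lemma Pratt_dominated_convergence:
  fixes D :: "nat \<Rightarrow> 'a \<Rightarrow> real"
  assumes D: "\<And>n. integrable M (D n)" "\<And>n x. 0 \<le> D n x" "\<And>n x. D n x \<le> G n x"
    and G: "\<And>n. integrable M (G n)" "integrable M g"
    and aeD: "AE x in M. (\<lambda>n. D n x) \<longlonglongrightarrow> 0" and aeG: "AE x in M. (\<lambda>n. G n x) \<longlonglongrightarrow> g x"
    and l: "(\<lambda>n. LINT x|M. G n x) \<longlonglongrightarrow> (LINT x|M. g x)"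
  shows "(\<lambda>n. LINT x|M. D n x) \<longlonglongrightarrow> 0"
proof -
  have G0: "0 \<le> G n x" for n x using D(2,3) order_trans by blast
  have g0: "AE x in M. 0 \<le> g x"
    using aeG by eventually_elim (rule LIMSEQ_le_const, assumption, use G0 in blast)
  have S: "(\<lambda>n. \<integral>\<^sup>+ x. norm (G n x - g x) \<partial>M) \<longlonglongrightarrow> 0"
  proof (rule Scheffe_lemma1[OF G aeG])
    have "(\<integral>\<^sup>+ x. norm (G n x) \<partial>M) = ennreal (LINT x|M. G n x)" for n
      using nn_integral_eq_integral[OF G(1) AE_I2[OF G0]] G0 by simp
    moreover have "(\<integral>\<^sup>+ x. norm (g x) \<partial>M) = ennreal (LINT x|M. g x)"
    proof -
      have "(\<integral>\<^sup>+ x. norm (g x) \<partial>M) = (\<integral>\<^sup>+ x. g x \<partial>M)"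
        by (rule nn_integral_cong_AE) (use g0 in \<open>eventually_elim, simp\<close>)
      then show ?thesis using nn_integral_eq_integral[OF G(2) g0] by simp
    qed
    ultimately show "limsup (\<lambda>n. \<integral>\<^sup>+ x. norm (G n x) \<partial>M) \<le> (\<integral>\<^sup>+ x. norm (g x) \<partial>M)"
      using lim_imp_Limsup[OF trivial_limit_sequentially tendsto_ennrealI[OF l]] by simp
  qed
  have "(\<lambda>n. LINT x|M. \<bar>G n x - g x\<bar>) \<longlonglongrightarrow> 0"
  proof (rule tendsto_ennrealD)
    have "(\<integral>\<^sup>+ x. norm (G n x - g x) \<partial>M) = ennreal (LINT x|M. \<bar>G n x - g x\<bar>)" for n
      using G by (subst nn_integral_eq_integral) auto
    then show "(\<lambda>n. ennreal (LINT x|M. \<bar>G n x - g x\<bar>)) \<longlonglongrightarrow> ennreal 0" using S by simp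
  qed auto
  moreover have "(\<lambda>n. LINT x|M. min (D n x) \<bar>g x\<bar>) \<longlonglongrightarrow> (LINT x|M. 0)"
  proof (rule integral_dominated_convergence)
    show "integrable M (\<lambda>x. \<bar>g x\<bar>)" using G by simp
    show "AE x in M. (\<lambda>n. min (D n x) \<bar>g x\<bar>) \<longlonglongrightarrow> 0"
      using aeD
    proof eventually_elim
      case (elim x)
      from tendsto_min[OF this tendsto_const[of "\<bar>g x\<bar>"]] show ?case by simp
    qed
  qed (use D G in auto)
  ultimately have "(\<lambda>n. (LINT x|M. \<bar>G n x - g x\<bar>) + (LINT x|M. min (D n x) \<bar>g x\<bar>)) \<longlonglongrightarrow> 0 + 0"
    by (intro tendsto_add) auto
  then have lim: "(\<lambda>n. (LINT x|M. \<bar>G n x - g x\<bar>) + (LINT x|M. min (D n x) \<bar>g x\<bar>)) \<longlonglongrightarrow> 0" by simp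
  show ?thesis
  proof (rule Lim_null_comparison[OF always_eventually[OF allI] lim])
    fix n
    have im: "integrable M (\<lambda>x. min (D n x) \<bar>g x\<bar>)" using D G by (intro integrable_min) auto
    have "(LINT x|M. D n x) \<le> (LINT x|M. \<bar>G n x - g x\<bar> + min (D n x) \<bar>g x\<bar>)"
    proof (rule integral_mono[OF D(1)])
      show "integrable M (\<lambda>x. \<bar>G n x - g x\<bar> + min (D n x) \<bar>g x\<bar>)" using G im by auto
      show "D n x \<le> \<bar>G n x - g x\<bar> + min (D n x) \<bar>g x\<bar>" for x using D(3)[of n x] by (auto simp: min_def)
    qed
    also have "\<dots> = (LINT x|M. \<bar>G n x - g x\<bar>) + (LINT x|M. min (D n x) \<bar>g x\<bar>)" using G im by simp
    finally show "norm (LINT x|M. D n x) \<le> (LINT x|M. \<bar>G n x - g x\<bar>) + (LINT x|M. min (D n x) \<bar>g x\<bar>)"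
      using D by (simp add: Bochner_Integration.integral_nonneg)
  qed
qed

lemma AE_Pm:
  assumes "AE x in lborel. P x"
  shows "AE p in Pm. P (fst p) \<and> P (snd p)"
proof -
  obtain N where N: "N \<in> null_sets lborel" "\<And>x. x \<notin> N \<Longrightarrow> P x"
  proof -
    from assms obtain N where "{x \<in> space lborel. \<not> P x} \<subseteq> N" "emeasure lborel N = 0" "N \<in> sets lborel"
      by (rule AE_E)
    then show ?thesis by (intro that[of N]) auto
  qed
  have NP: "\<And>x. \<not> P x \<Longrightarrow> x \<in> N" using N(2) by blast
  have s: "N \<in> sets borel" using N(1) by (auto simp: null_sets_def)
  have "N \<times> UNIV \<in> null_sets Pm" "UNIV \<times> N \<in> null_sets Pm"
    using N(1) s by (auto simp: null_sets_def lborel.emeasure_pair_measure_Times)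
  then have "(N \<times> UNIV) \<union> (UNIV \<times> N) \<in> null_sets Pm" by (rule null_sets.Un)
  then show ?thesis
    by (rule AE_I'[of "(N \<times> UNIV) \<union> (UNIV \<times> N)"]) (use NP in \<open>auto simp: mem_Times_iff\<close>)
qed

section \<open>The weight is controlled by \<open>V_far\<close>\<close>

text \<open>
  For \<open>y\<close> in the ball of radius \<open>R\<close> the weight \<open>ln (1 + |x|)\<close> is at most
  \<open>ln (1 + |x - y|) + ln (1 + R)\<close>. Integrating over such \<open>y\<close> with density \<open>u\<^sup>2\<close> bounds the weighted mass as
  soon as the ball carries some mass.
\<close>

lemma weight_le_V_far:
  assumes u: "u \<in> X_space" and R: "R > 0"
  shows "(nrm (weighted u))\<^sup>2 * (nrm (\<lambda>x. indicator (cball 0 R) x * u x))\<^sup>2 \<le> V_far u + ln (1 + R) * (nrm u) ^ 4"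
proof -
  note [measurable] = X_borel[OF u]
  have L: "(\<lambda>x. indicator (cball 0 R) x * u x) \<in> L2p" by (rule L2_indicator_mult(1)[OF X_L2[OF u]]) simp
  have "(nrm (weighted u))\<^sup>2 * (nrm (\<lambda>x. indicator (cball 0 R) x * u x))\<^sup>2 = (LINT p|Pm. (weighted u (fst p))\<^sup>2 * (indicator (cball 0 R) (snd p) * u (snd p))\<^sup>2)"
    by (rule L2_product(2)[OF X_weighted[OF u] L, symmetric])
  also have "\<dots> \<le> (LINT p|Pm. log_far (fst p - snd p) * ((u (fst p))\<^sup>2 * (u (snd p))\<^sup>2) + ln (1 + R) * ((u (fst p))\<^sup>2 * (u (snd p))\<^sup>2))"
  proof (rule integral_mono[OF L2_product(1)[OF X_weighted[OF u] L]])
    show "integrable Pm (\<lambda>p. log_far (fst p - snd p) * ((u (fst p))\<^sup>2 * (u (snd p))\<^sup>2) + ln (1 + R) * ((u (fst p))\<^sup>2 * (u (snd p))\<^sup>2))"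
      using V_far_integrable[OF u u] mass_product(1)[OF u u] by simp
    fix p :: "plane \<times> plane"
    show "(weighted u (fst p))\<^sup>2 * (indicator (cball 0 R) (snd p) * u (snd p))\<^sup>2 \<le> log_far (fst p - snd p) * ((u (fst p))\<^sup>2 * (u (snd p))\<^sup>2) + ln (1 + R) * ((u (fst p))\<^sup>2 * (u (snd p))\<^sup>2)"
    proof (cases "snd p \<in> cball 0 R")
      case True
      then have "logw (snd p) \<le> ln (1 + R)" unfolding logw_def by (intro ln_mono) (auto simp: add_pos_nonneg)
      then have "logw (fst p) \<le> log_far (fst p - snd p) + ln (1 + R)" using logw_le_log_far[of "fst p" "snd p"] by linarith
      then have "logw (fst p) * ((u (fst p))\<^sup>2 * (u (snd p))\<^sup>2) \<le> (log_far (fst p - snd p) + ln (1 + R)) * ((u (fst p))\<^sup>2 * (u (snd p))\<^sup>2)"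
        by (intro mult_right_mono) auto
      then show ?thesis using True by (simp add: weighted_sq distrib_right mult.assoc)
    next
      case False
      then show ?thesis using R by (simp add: add_nonneg_nonneg)
    qed
  qed
  also have "\<dots> = V_far u + ln (1 + R) * (nrm u) ^ 4"
    using V_far_integrable[OF u u] mass_product[OF u u] by (simp add: V_far_def power4_eq_xxxx power2_eq_square)
  finally show ?thesis .
qed

text \<open>
  Pairs of points at distance more than \<open>R\<close> contribute at least \<open>ln (1 + R)\<close> times their mass to
  \<open>V_far\<close>, hence have mass at most \<open>c\<^sup>2 / 2\<close> in the product. If every ball of radius \<open>R\<close> had mass less than
  \<open>c / 4\<close>, the remaining pairs would have mass at most \<open>c\<^sup>2 / 4\<close>, and the total \<open>c\<^sup>2\<close> would not be reached.
\<close>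

lemma mass_concentration:
  assumes u: "u \<in> X_space" and c: "(nrm u)\<^sup>2 = c" "c > 0" and R: "R > 0" "V_far u \<le> ln (1 + R) * (c\<^sup>2 / 2)"
  obtains y where "(nrm (\<lambda>x. indicator (cball 0 R) x * u (x + y)))\<^sup>2 \<ge> c / 4"
proof (rule ccontr)
  note [measurable] = X_borel[OF u]
  assume "\<not> thesis"
  then have n: "(nrm (\<lambda>x. indicator (cball 0 R) x * u (x + y)))\<^sup>2 < c / 4" for y using that by (meson not_le)
  define I where "I = (\<lambda>z :: plane. indicator (cball 0 R) z :: real)"
  have [measurable]: "I \<in> borel_measurable borel" unfolding I_def by (rule borel_measurable_indicator) simp
  have I0: "0 \<le> I z" for z by (simp add: I_def)
  have lR: "ln (1 + R) > 0" using R by simp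
  let ?q = "\<lambda>p. (u (fst p))\<^sup>2 * (u (snd p))\<^sup>2"
  have near: "(\<integral>\<^sup>+p. ennreal (I (snd p - fst p) * ?q p) \<partial>Pm) \<le> ennreal (c * (c / 4))"
  proof -
    have "(\<integral>\<^sup>+p. ennreal (I (snd p - fst p) * ?q p) \<partial>Pm) = (\<integral>\<^sup>+x. \<integral>\<^sup>+y. ennreal (I (y - x) * ((u x)\<^sup>2 * (u y)\<^sup>2)) \<partial>lborel \<partial>lborel)"
      by (subst lborel.nn_integral_fst[symmetric]) auto
    also have "\<dots> = (\<integral>\<^sup>+x. ennreal ((u x)\<^sup>2) * (\<integral>\<^sup>+y. ennreal (I (y - x) * (u y)\<^sup>2) \<partial>lborel) \<partial>lborel)"
      by (subst nn_integral_cmult[symmetric]) (auto intro!: nn_integral_cong simp: ennreal_mult[symmetric] mult_ac I0)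
    also have "\<dots> \<le> (\<integral>\<^sup>+x. ennreal ((u x)\<^sup>2) * ennreal (c / 4) \<partial>lborel)"
    proof (intro nn_integral_mono mult_left_mono)
      fix x :: plane
      have L: "(\<lambda>z. indicator (cball 0 R) z * u (z + x)) \<in> L2p"
        by (rule L2_indicator_mult(1)[OF L2_translate(1)[OF X_L2[OF u]]]) simp
      have "(\<integral>\<^sup>+y. ennreal (I (y - x) * (u y)\<^sup>2) \<partial>lborel) = (\<integral>\<^sup>+z. ennreal ((indicator (cball 0 R) z * u (z + x))\<^sup>2) \<partial>lborel)"
        using nn_integral_lborel_affine[of "\<lambda>y. ennreal (I (y - x) * (u y)\<^sup>2)" 1 x]
        by (simp add: I_def power_mult_distrib) (auto intro!: nn_integral_cong simp: indicator_def)
      also have "\<dots> \<le> ennreal (c / 4)" unfolding nn_integral_L2[OF L] using n[of x] by (intro ennreal_leI) simp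
      finally show "(\<integral>\<^sup>+y. ennreal (I (y - x) * (u y)\<^sup>2) \<partial>lborel) \<le> ennreal (c / 4)" .
    qed simp
    also have "\<dots> = ennreal c * ennreal (c / 4)"
      by (subst nn_integral_multc) (auto simp: nn_integral_L2[OF X_L2[OF u]] c)
    finally show ?thesis using c(2) by (simp add: ennreal_mult[symmetric])
  qed
  have imq: "integrable Pm ?q" by (rule mass_product(1)[OF u u])
  have iI: "integrable Pm (\<lambda>p. I (snd p - fst p) * ?q p)"
    by (rule Bochner_Integration.integrable_bound[OF imq]) (auto simp: I_def indicator_def)
  have near': "(LINT p|Pm. I (snd p - fst p) * ?q p) \<le> c * (c / 4)"
  proof -
    have "ennreal (LINT p|Pm. I (snd p - fst p) * ?q p) \<le> ennreal (c * (c / 4))"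
      using nn_integral_eq_integral[OF iI] near by (simp add: I_def)
    then show ?thesis using c(2) by (simp add: ennreal_le_iff)
  qed
  have "c\<^sup>2 = (LINT p|Pm. ?q p)" unfolding mass_product(2)[OF u u] c by (simp add: power2_eq_square)
  also have "\<dots> \<le> (LINT p|Pm. I (snd p - fst p) * ?q p + (1 / ln (1 + R)) * (log_far (fst p - snd p) * ?q p))"
  proof (rule integral_mono[OF imq])
    show "integrable Pm (\<lambda>p. I (snd p - fst p) * ?q p + (1 / ln (1 + R)) * (log_far (fst p - snd p) * ?q p))"
      using iI V_far_integrable[OF u u] by simp
    fix p :: "plane \<times> plane"
    have "1 \<le> I (snd p - fst p) + (1 / ln (1 + R)) * log_far (fst p - snd p)"
    proof (cases "snd p - fst p \<in> cball 0 R")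
      case True
      then show ?thesis using lR by (simp add: I_def)
    next
      case False
      then have "R \<le> norm (fst p - snd p)" by (simp add: norm_minus_commute)
      then have "ln (1 + R) \<le> log_far (fst p - snd p)" unfolding log_far_def using R by (intro ln_mono) auto
      then show ?thesis using False lR by (simp add: I_def pos_le_divide_eq)
    qed
    from mult_right_mono[OF this, of "?q p"]
    show "?q p \<le> I (snd p - fst p) * ?q p + (1 / ln (1 + R)) * (log_far (fst p - snd p) * ?q p)"
      by (simp add: distrib_right mult.assoc)
  qed
  also have "\<dots> = (LINT p|Pm. I (snd p - fst p) * ?q p) + (1 / ln (1 + R)) * V_far u"
    using iI V_far_integrable[OF u u] by (simp add: V_far_def)
  also have "\<dots> \<le> c * (c / 4) + c\<^sup>2 / 2"
    using near' R(2) lR by (intro add_mono) (auto simp: pos_divide_le_eq mult.commute)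
  also have "\<dots> < c\<^sup>2" using c(2) by (simp add: power2_eq_square)
  finally show False by simp
qed

text \<open>
  On the product space the square of the weighted difference, restricted to \<open>y\<close> in the ball with density
  \<open>w n (y)\<^sup>2\<close>, is dominated by a multiple of the integrand of \<open>V_far (w n)\<close> and of products whose integrals
  converge. The integrals of the dominating functions converge because those of \<open>V_far\<close> do.
\<close>

lemma weighted_convergence:
  assumes w: "\<And>n. w n \<in> X_space" and v: "v \<in> X_space"
    and ae: "AE x in lborel. (\<lambda>n. w n x) \<longlonglongrightarrow> v x"
    and V: "(\<lambda>n. V_far (w n)) \<longlonglongrightarrow> V_far v" and nn: "(\<lambda>n. nrm (w n)) \<longlonglongrightarrow> nrm v"
    and R: "R > 0" and d: "d > 0" "\<And>n. d \<le> (nrm (\<lambda>x. indicator (cball 0 R) x * w n x))\<^sup>2"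
  shows "(\<lambda>n. nrm (weighted (\<lambda>x. w n x - v x))) \<longlonglongrightarrow> 0"
proof -
  note [measurable] = X_borel[OF w] X_borel[OF v]
  define I where "I = (\<lambda>x :: plane. indicator (cball 0 R) x :: real)"
  have [measurable]: "I \<in> borel_measurable borel" unfolding I_def by (rule borel_measurable_indicator) simp
  define D where "D = (\<lambda>n p. (weighted (\<lambda>x. w n x - v x) (fst p))\<^sup>2 * (I (snd p) * w n (snd p))\<^sup>2)"
  define G where "G = (\<lambda>w p. 2 * (log_far (fst p - snd p) * ((w (fst p))\<^sup>2 * (w (snd p))\<^sup>2)) + 2 * ln (1 + R) * ((w (fst p))\<^sup>2 * (w (snd p))\<^sup>2)
      + 2 * ((weighted v (fst p))\<^sup>2 * (w (snd p))\<^sup>2))"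
  have LI: "(\<lambda>x. I x * w n x) \<in> L2p" for n unfolding I_def by (rule L2_indicator_mult(1)[OF X_L2[OF w]]) simp
  have LW: "weighted (\<lambda>x. w n x - v x) \<in> L2p" for n by (rule X_weighted[OF X_diff[OF w v]])
  have iG: "integrable Pm (G f)" if f: "f \<in> X_space" for f
    unfolding G_def using V_far_integrable[OF f f] mass_product(1)[OF f f] L2_product(1)[OF X_weighted[OF v] X_L2[OF f]] by simp
  have IG: "(LINT p|Pm. G f p) = 2 * V_far f + 2 * ln (1 + R) * ((nrm f)\<^sup>2 * (nrm f)\<^sup>2) + 2 * ((nrm (weighted v))\<^sup>2 * (nrm f)\<^sup>2)" if f: "f \<in> X_space" for f
    unfolding G_def V_far_def using V_far_integrable[OF f f] mass_product[OF f f] L2_product[OF X_weighted[OF v] X_L2[OF f]] by simp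
  have lim: "(\<lambda>n. LINT p|Pm. D n p) \<longlonglongrightarrow> 0"
  proof (rule Pratt_dominated_convergence[where G = "\<lambda>n. G (w n)" and g = "G v"])
    show "integrable Pm (D n)" for n unfolding D_def by (rule L2_product(1)[OF LW LI])
    show "0 \<le> D n p" for n p by (simp add: D_def)
    show "integrable Pm (G (w n))" for n by (rule iG[OF w])
    show "integrable Pm (G v)" by (rule iG[OF v])
    show "(\<lambda>n. LINT p|Pm. G (w n) p) \<longlonglongrightarrow> (LINT p|Pm. G v p)"
      unfolding IG[OF w] IG[OF v] by (intro tendsto_intros V nn)
    show "D n p \<le> G (w n) p" for n p
    proof (cases "snd p \<in> cball 0 R")
      case True
      let ?a = "w n (fst p)" and ?b = "v (fst p)" and ?c = "w n (snd p)"
      have "logw (snd p) \<le> ln (1 + R)" using True unfolding logw_def by (intro ln_mono) (auto simp: add_pos_nonneg)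
      then have logw: "logw (fst p) \<le> log_far (fst p - snd p) + ln (1 + R)" using logw_le_log_far[of "fst p" "snd p"] by linarith
      have "(?a - ?b)\<^sup>2 \<le> 2 * ?a\<^sup>2 + 2 * ?b\<^sup>2" using zero_le_power2[of "?a + ?b"] by (simp add: power2_eq_square algebra_simps)
      then have "logw (fst p) * (?a - ?b)\<^sup>2 \<le> logw (fst p) * (2 * ?a\<^sup>2 + 2 * ?b\<^sup>2)" by (rule mult_left_mono) simp
      also have "\<dots> = logw (fst p) * (2 * ?a\<^sup>2) + 2 * (logw (fst p) * ?b\<^sup>2)" by (simp add: algebra_simps)
      also have "\<dots> \<le> (log_far (fst p - snd p) + ln (1 + R)) * (2 * ?a\<^sup>2) + 2 * (logw (fst p) * ?b\<^sup>2)"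
        using logw by (intro add_right_mono mult_right_mono) auto
      finally have "logw (fst p) * (?a - ?b)\<^sup>2 * ?c\<^sup>2 \<le> ((log_far (fst p - snd p) + ln (1 + R)) * (2 * ?a\<^sup>2) + 2 * (logw (fst p) * ?b\<^sup>2)) * ?c\<^sup>2"
        by (rule mult_right_mono) simp
      then show ?thesis using True by (simp add: D_def G_def I_def weighted_sq algebra_simps)
    next
      case False
      have "0 \<le> ln (1 + R)" using R by simp
      then show ?thesis using False by (simp add: D_def G_def I_def)
    qed
    show "AE p in Pm. (\<lambda>n. D n p) \<longlonglongrightarrow> 0"
      using AE_Pm[OF ae]
    proof eventually_elim
      case (elim p)
      have "(\<lambda>n. (sqrt (logw (fst p)) * (w n (fst p) - v (fst p)))\<^sup>2 * (I (snd p) * w n (snd p))\<^sup>2) \<longlonglongrightarrow> (sqrt (logw (fst p)) * (v (fst p) - v (fst p)))\<^sup>2 * (I (snd p) * v (snd p))\<^sup>2"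
        using elim by (intro tendsto_intros) auto
      then show ?case by (simp add: D_def weighted_def)
    qed
    show "AE p in Pm. (\<lambda>n. G (w n) p) \<longlonglongrightarrow> G v p"
      using AE_Pm[OF ae]
    proof eventually_elim
      case (elim p)
      then show ?case unfolding G_def by (intro tendsto_intros) auto
    qed
  qed
  have ID: "(LINT p|Pm. D n p) = (nrm (weighted (\<lambda>x. w n x - v x)))\<^sup>2 * (nrm (\<lambda>x. I x * w n x))\<^sup>2" for n
    unfolding D_def by (rule L2_product(2)[OF LW LI])
  have "(\<lambda>n. (1 / d) * (LINT p|Pm. D n p)) \<longlonglongrightarrow> (1 / d) * 0" by (intro tendsto_mult tendsto_const lim)
  then have lim': "(\<lambda>n. (1 / d) * (LINT p|Pm. D n p)) \<longlonglongrightarrow> 0" by simp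
  have "(\<lambda>n. (nrm (weighted (\<lambda>x. w n x - v x)))\<^sup>2) \<longlonglongrightarrow> 0"
  proof (rule Lim_null_comparison[OF always_eventually[OF allI] lim'])
    fix n
    have "(nrm (weighted (\<lambda>x. w n x - v x)))\<^sup>2 * d \<le> (LINT p|Pm. D n p)"
      unfolding ID I_def by (intro mult_left_mono d) simp
    then show "norm ((nrm (weighted (\<lambda>x. w n x - v x)))\<^sup>2) \<le> (1 / d) * (LINT p|Pm. D n p)"
      using d(1) by (simp add: pos_le_divide_eq)
  qed
  from tendsto_real_sqrt[OF this] show ?thesis by simp
qed

section \<open>The minimization problem\<close>

locale small_mass =
  fixes \<gamma> a p c :: real
  assumes \<gamma>: "\<gamma> > 0" and a: "a > 0" and p: "p > 4" and c: "0 < c" and cc: "c < c0 \<gamma> a p"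
begin

abbreviation K where "K \<equiv> k0 \<gamma> p c"
abbreviation S where "S \<equiv> mass_sphere c \<inter> A_sublevel (k0 \<gamma> p c)"
abbreviation F where "F \<equiv> F_fun \<gamma> a p"
abbreviation m where "m \<equiv> m_l \<gamma> a p c"

lemma K_pos: "K > 0"
  unfolding k0_def using p \<gamma> c by (intro mult_pos_pos divide_pos_pos) auto

lemma S_iff: "u \<in> S \<longleftrightarrow> u \<in> X_space \<and> (nrm u)\<^sup>2 = c \<and> A_fun u \<le> K"
  by (auto simp: mass_sphere_def A_sublevel_def nrm2_sq)

lemma S_X: "u \<in> S \<Longrightarrow> u \<in> X_space" and S_nrm: "u \<in> S \<Longrightarrow> (nrm u)\<^sup>2 = c" and S_A: "u \<in> S \<Longrightarrow> A_fun u \<le> K"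
  by (simp_all only: S_iff)

lemma S_I: "u \<in> X_space \<Longrightarrow> (nrm u)\<^sup>2 = c \<Longrightarrow> A_fun u \<le> K \<Longrightarrow> u \<in> S"
  by (simp only: S_iff)

text \<open>
  A common bound for the energy and the norm on the constraint set.
\<close>

definition M where "M = sqrt (K + c)"

lemma M_pos: "M > 0" using K_pos c by (simp add: M_def)

lemma M_sq: "M\<^sup>2 = K + c" using K_pos c by (simp add: M_def)

lemma S_bounds: assumes "u \<in> S" shows "A_fun u \<le> M\<^sup>2" "nrm u \<le> M"
proof -
  note u = S_nrm[OF assms] S_A[OF assms]
  show "A_fun u \<le> M\<^sup>2" using u c by (simp add: M_sq)
  have "(nrm u)\<^sup>2 \<le> M\<^sup>2" using u K_pos by (simp add: M_sq)
  then show "nrm u \<le> M" by (rule power2_le_imp_le) (use M_pos in simp)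
qed

text \<open>
  The other two terms of \<open>F\<close> are bounded on the constraint set, so \<open>F\<close> controls \<open>V_far\<close>.
\<close>

lemma V_far_le_F:
  obtains D where "\<And>u. u \<in> S \<Longrightarrow> \<gamma> / 4 * V_far u \<le> F u + D"
proof -
  have p2: "p > 2" using p by simp
  obtain B where B': "\<forall>u\<in>H1. \<forall>v\<in>H1. A_fun u \<le> M\<^sup>2 \<and> nrm u \<le> M \<and> A_fun v \<le> M\<^sup>2 \<and> nrm v \<le> M
    \<longrightarrow> \<bar>C_fun p u - C_fun p v\<bar> \<le> B * nrm (\<lambda>x. u x - v x)"
    using C_fun_diff_le[OF p2] by (rule exE)
  note B = B'[rule_format, OF _ _ conjI[OF _ conjI[OF _ conjI]]]
  have z: "(\<lambda>x. 0 * moll 0 x) \<in> H1" by (rule H1_cmult(1)[OF test_function_H1[OF moll_test]])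
  have z0: "(\<lambda>x::plane. 0::real) \<in> H1" "A_fun (\<lambda>x. 0) = 0" "nrm (\<lambda>x. 0) = 0" "C_fun p (\<lambda>x. 0) = 0"
    using z A_fun_cmult[OF test_function_H1[OF moll_test], of 0 0] by (simp_all add: nrm2_def C_fun_def)
  have Cb: "C_fun p u \<le> \<bar>B\<bar> * M" if u: "u \<in> S" for u
  proof -
    have "\<bar>C_fun p u - C_fun p (\<lambda>x. 0)\<bar> \<le> B * nrm (\<lambda>x. u x - 0)"
      using B[OF X_H1[OF S_X[OF u]] z0(1) S_bounds[OF u]] M_pos by (simp add: z0)
    also have "\<dots> \<le> \<bar>B\<bar> * M" using S_bounds(2)[OF u] by (intro mult_mono) auto
    finally show ?thesis by (simp add: z0)
  qed
  show ?thesis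
  proof (rule that)
    fix u assume u: "u \<in> S"
    note X = S_X[OF u]
    have "V_near u \<le> near_const * M\<^sup>2 * M\<^sup>2" using V_near_le(2)[OF X _ S_bounds[OF u]] M_pos by simp
    then have "\<gamma> / 4 * V_near u \<le> \<gamma> / 4 * (near_const * M\<^sup>2 * M\<^sup>2)" using \<gamma> by (intro mult_left_mono) auto
    moreover have "a / p * C_fun p u \<le> a / p * (\<bar>B\<bar> * M)" using Cb[OF u] a p by (intro mult_left_mono) auto
    ultimately show "\<gamma> / 4 * V_far u \<le> F u + (\<gamma> / 4 * (near_const * M\<^sup>2 * M\<^sup>2) + a / p * (\<bar>B\<bar> * M))"
      unfolding F_fun_def V_fun_split[OF X] right_diff_distrib[of "\<gamma> / 4" "V_far u"] using A_fun_nonneg[of u] by linarith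
  qed
qed

lemma F_bdd_below: "bdd_below (F ` S)"
proof -
  obtain D where D: "\<And>u. u \<in> S \<Longrightarrow> \<gamma> / 4 * V_far u \<le> F u + D" using V_far_le_F by blast
  show ?thesis
  proof (rule bdd_belowI)
    fix y assume "y \<in> F ` S"
    then obtain u where u: "u \<in> S" "y = F u" by blast
    have "0 \<le> \<gamma> / 4 * V_far u" using \<gamma> V_far_nonneg[of u] by simp
    then show "- D \<le> y" using D[OF u(1)] u(2) by simp
  qed
qed

lemma m_le: "u \<in> S \<Longrightarrow> m \<le> F u"
  unfolding m_l_def by (rule cINF_lower[OF F_bdd_below])

lemma moll_X: "moll 0 \<in> X_space"
  unfolding X_space_iff
proof
  show "moll 0 \<in> H1" by (rule test_function_H1[OF moll_test])
  note L = test_function_L2[OF moll_test[of 0]]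
  have i: "integrable lborel (\<lambda>x. 2 * (moll 0 x)\<^sup>2)" using L2_int[OF L] by simp
  show "weighted (moll 0) \<in> L2p"
  proof (rule L2_bounded_by[OF _ i])
    show "weighted (moll 0) \<in> borel_measurable lborel" unfolding weighted_def by measurable
    fix x :: plane
    show "(weighted (moll 0) x)\<^sup>2 \<le> 2 * (moll 0 x)\<^sup>2"
    proof (cases "moll 0 x = 0")
      case False
      then have "\<bar>x $ i\<bar> < 1" for i using moll_eq_0[of 0 x i] by (simp add: not_le[symmetric]) (meson not_le)
      then have "norm x < 2" using plane_norm_lt[of x 1] by simp
      then have "logw x \<le> 2" unfolding logw_def using ln_add_one_self_le_self[of "norm x"] by simp
      then show ?thesis unfolding weighted_sq by (rule mult_right_mono) simp
    qed (simp add: weighted_def)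
  qed
qed

text \<open>
  A multiple of a mollifier has the right mass, and a dilation makes its energy small.
\<close>

lemma S_nonempty: "S \<noteq> {}"
proof -
  have n: "nrm (moll 0) > 0"
  proof (rule ccontr)
    assume "\<not> ?thesis"
    then have "nrm (moll 0) = 0" using nrm2_nonneg[of lborel "moll 0"] by linarith
    then have "(LINT x|lborel. (moll 0 x)\<^sup>2) = 0" using nrm2_sq[of lborel "moll 0"] by simp
    then have "AE x in lborel. (moll 0 x)\<^sup>2 = 0"
      using integral_nonneg_eq_0_iff_AE[OF L2_int[OF test_function_L2[OF moll_test]]] by simp
    then have "AE x in lborel. moll 0 x = 0" by eventually_elim simp
    then have "(LINT x|lborel. moll 0 x) = 0" by (rule integral_eq_zero_AE)
    then show False by (simp add: moll_int)
  qed
  define v where "v = (\<lambda>x. (sqrt c / nrm (moll 0)) * moll 0 x)"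
  have v: "v \<in> X_space" unfolding v_def by (rule X_cmult[OF moll_X])
  have nv: "nrm v = sqrt c" unfolding v_def nrm2_cmult using n c by simp
  define t where "t = sqrt (K / (A_fun v + 1))"
  have t: "t > 0" "t\<^sup>2 = K / (A_fun v + 1)" using K_pos A_fun_nonneg[of v] by (auto simp: t_def add_nonneg_pos)
  have "t\<^sup>2 * A_fun v \<le> K" unfolding t(2) using K_pos A_fun_nonneg[of v] by (simp add: divide_le_eq add_nonneg_pos)
  then have "dilate t v \<in> S" using dilate_facts(1,2,3)[OF v t(1)] nv c by (intro S_I) auto
  then show ?thesis by blast
qed

text \<open>
  Since \<open>\<gamma> c\<^sup>2 / 4 = (p - 4) / (p - 2) k0\<close>, the right-hand side is \<open>2 k0 / (p - 2)\<close>. With \<open>b = c / 2\<close> the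
  quotient of the two sides is \<open>b\<^sup>p\<^sup>-\<^sup>3 / R\<close>, where \<open>R\<close> is the base of the power in the definition of \<open>c0\<close>,
  and \<open>c < c0\<close> says that this is less than \<open>1\<close>.
\<close>

lemma K_GN_smallness:
  "a * ((p - 2) / p) * (K_GN p * sqrt K powr (p - 2) * c) < K - \<gamma> * c\<^sup>2 / 4"
proof -
  have p24: "p - 2 > 0" "p - 4 > 0" using p by auto
  have e: "K - \<gamma> * c\<^sup>2 / 4 = 2 * K / (p - 2)"
  proof -
    have "(p - 2) / (p - 4) * r - r = 2 * ((p - 2) / (p - 4) * r) / (p - 2)" for r
    proof -
      have "(p - 2) / (p - 4) * r - r = 2 / (p - 4) * r" using p24 by (simp add: field_simps)
      also have "\<dots> = 2 * ((p - 2) / (p - 4) * r) / (p - 2)" using p24 by simp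
      finally show ?thesis .
    qed
    then show ?thesis unfolding k0_def .
  qed
  have rp: "2 * K / (p - 2) > 0" using K_pos p24 by simp
  show ?thesis
  proof (cases "K_GN p \<le> 0")
    case True
    have "a * ((p - 2) / p) * (K_GN p * sqrt K powr (p - 2) * c) \<le> 0"
      using True a p c by (intro mult_nonneg_nonpos mult_nonpos_nonneg) auto
    then show ?thesis unfolding e using rp by linarith
  next
    case False
    define k where "k = K_GN p"
    have k: "k > 0" using False by (simp add: k_def)
    define b where "b = c / 2"
    have b: "b > 0" using c by (simp add: b_def)
    define h where "h = (p - 4) / 2"
    have h: "h > 0" using p24 by (simp add: h_def)
    define R where "R = p * (p - 4) powr h / (p - 2) powr (p / 2) * (1 / (a * \<gamma> powr h * k))"
    have R: "R > 0" unfolding R_def using p24 p a \<gamma> k by simp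
    have "b < R powr (1 / (p - 3))"
      using cc by (simp add: c0_def b_def R_def h_def k_def)
    then have "b powr (p - 3) < (R powr (1 / (p - 3))) powr (p - 3)"
      using b p by (intro powr_less_mono2) auto
    also have "\<dots> = R" using R p by (simp add: powr_powr)
    finally have bR: "b powr (p - 3) < R" .
    have K: "K = ((p - 2) / (p - 4)) * (\<gamma> * b\<^sup>2)" by (simp add: k0_def b_def power2_eq_square)
    have sK: "sqrt K powr (p - 2) = K * K powr h"
    proof -
      have "sqrt K powr (p - 2) = (K powr (1/2)) powr (p - 2)" using K_pos by (simp add: powr_half_sqrt)
      also have "\<dots> = K powr (1 + h)" by (simp add: powr_powr h_def field_simps)
      also have "\<dots> = K * K powr h" using K_pos by (simp add: powr_add)
      finally show ?thesis .
    qed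
    have Kh: "K powr h = (p - 2) powr h / (p - 4) powr h * (\<gamma> powr h * b powr (p - 4))"
    proof -
      have "b\<^sup>2 = b powr 2" using b by (simp add: powr_numeral)
      then have "(b\<^sup>2) powr h = b powr (2 * h)" by (simp only: powr_powr)
      moreover have "2 * h = p - 4" by (simp add: h_def)
      ultimately have "(b\<^sup>2) powr h = b powr (p - 4)" by (simp only:)
      then show ?thesis unfolding K using p24 \<gamma> b by (simp add: powr_mult powr_divide)
    qed
    have P2: "(p - 2) powr (p / 2) = (p - 2) powr h * (p - 2)\<^sup>2"
    proof -
      have "(p - 2) powr (p / 2) = (p - 2) powr (h + 2)" by (simp add: h_def field_simps)
      also have "\<dots> = (p - 2) powr h * (p - 2)\<^sup>2" using p24 by (simp add: powr_add powr_numeral)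
      finally show ?thesis .
    qed
    have bb: "b powr (p - 3) = b powr (p - 4) * b"
    proof -
      have "b powr (p - 3) = b powr ((p - 4) + 1)" by simp
      also have "\<dots> = b powr (p - 4) * b" using b by (simp only: powr_add) simp
      finally show ?thesis .
    qed
    have "a * ((p - 2) / p) * (k * sqrt K powr (p - 2) * c) = (2 * K / (p - 2)) * (b powr (p - 3) / R)"
    proof -
      have ne: "(p - 2) powr h \<noteq> 0" "(p - 4) powr h \<noteq> 0" "\<gamma> powr h \<noteq> 0" "p - 2 \<noteq> 0" "p \<noteq> 0" "a \<noteq> 0" "k \<noteq> 0"
        using p24 p \<gamma> a k by auto
      have gen: "a * (P / p) * (k * (K' * (A / B * (G * bq))) * (2 * b)) = (2 * K' / P) * (bq * b / (p * B / (A * P\<^sup>2) * (1 / (a * G * k))))"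
        if "A \<noteq> 0" "B \<noteq> 0" "G \<noteq> 0" "P \<noteq> 0" for A B G P bq K' :: real
        using that ne by (simp add: field_simps power2_eq_square)
      have "a * ((p - 2) / p) * (k * sqrt K powr (p - 2) * c) = a * ((p - 2) / p) * (k * sqrt K powr (p - 2) * (2 * b))"
        by (simp add: b_def)
      also have "\<dots> = (2 * K / (p - 2)) * (b powr (p - 3) / R)"
        unfolding sK Kh R_def P2 bb by (rule gen) (use ne in auto)
      finally show ?thesis .
    qed
    also have "\<dots> < (2 * K / (p - 2)) * 1"
      using rp bR R by (intro mult_strict_left_mono) auto
    finally show ?thesis unfolding e k_def by simp
  qed
qed

text \<open>
  The function \<open>g t\<close> is the value of \<open>F\<close> at the dilation by \<open>t\<close>. Its derivative at \<open>1\<close> is positive, so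
  dilations with \<open>t\<close> slightly below \<open>1\<close> decrease \<open>F\<close>, and their energy \<open>t\<^sup>2 k0\<close> is admissible.
\<close>

lemma boundary_not_minimal:
  assumes u: "u \<in> S" and A: "A_fun u = K"
  shows "\<exists>w\<in>S. F w < F u"
proof -
  note X = S_X[OF u]
  have n: "(nrm u)\<^sup>2 = c" by (rule S_nrm[OF u])
  have n4: "(nrm u) ^ 4 = c\<^sup>2" using n by (metis power_mult numeral_Bit0 mult_2 power_add power2_eq_square)
  define V where "V = V_fun u"
  define C where "C = C_fun p u"
  define g where "g = (\<lambda>t. 1/2 * (t\<^sup>2 * K) + \<gamma>/4 * (V - ln t * c\<^sup>2) - a/p * (t powr (p - 2) * C))"
  have gF: "F (dilate t u) = g t" if "t > 0" for t
    unfolding F_fun_def dilate_facts[OF X that] A n4 g_def V_def C_def by simp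
  have g1: "g 1 = F u" unfolding g_def F_fun_def A V_def C_def by simp
  have d: "(g has_real_derivative (K - \<gamma> * c\<^sup>2 / 4 - a * ((p - 2) / p) * C)) (at 1)"
    unfolding g_def using p by (auto intro!: derivative_eq_intros simp: field_simps)
  have "C \<le> K_GN p * sqrt K powr (p - 2) * c"
    using K_GN_inequality[of p u] p X_H1[OF X] by (simp add: C_def A n)
  then have "a * ((p - 2) / p) * C \<le> a * ((p - 2) / p) * (K_GN p * sqrt K powr (p - 2) * c)"
    using a p by (intro mult_left_mono) auto
  then have pos: "K - \<gamma> * c\<^sup>2 / 4 - a * ((p - 2) / p) * C > 0" using K_GN_smallness by linarith
  obtain \<delta> where \<delta>: "\<delta> > 0" "\<And>h. h > 0 \<Longrightarrow> h < \<delta> \<Longrightarrow> g (1 - h) < g 1"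
    using DERIV_pos_inc_left[OF d pos] by auto
  define h where "h = min (\<delta> / 2) (1 / 2)"
  have h: "h > 0" "h < \<delta>" "h \<le> 1/2" using \<delta>(1) by (auto simp: h_def)
  define t where "t = 1 - h"
  have t: "0 < t" "t \<le> 1" using h by (auto simp: t_def)
  have "F (dilate t u) < F u" using \<delta>(2)[OF h(1,2)] gF[OF t(1)] by (simp add: g1 t_def)
  moreover have "dilate t u \<in> S"
  proof -
    have "t\<^sup>2 * K \<le> 1 * K" using t K_pos by (intro mult_right_mono power_le_one) auto
    then show ?thesis using dilate_facts(1,2,3)[OF X t(1)] n by (intro S_I) (auto simp: A)
  qed
  ultimately show ?thesis by blast
qed

text \<open>
  The hypothesis on the ball replaces the translation. After passing to subsequences the functions
  converge in \<open>L\<^sup>2\<close> and almost everywhere, and \<open>A\<close> and \<open>V_far\<close> converge to numbers \<open>\<alpha>\<close> and \<open>\<beta>\<close>. Lower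
  semicontinuity gives \<open>A v \<le> \<alpha>\<close> and \<open>V_far v \<le> \<beta>\<close>, minimality of \<open>m\<close> gives the opposite inequality for the
  sum, so both are equalities.
\<close>

lemma compactness_core:
  assumes u: "\<And>n. u n \<in> S" and Fm: "(\<lambda>n. F (u n)) \<longlonglongrightarrow> m"
    and R: "R > 0" "\<And>n. c / 4 \<le> (nrm (\<lambda>x. indicator (cball 0 R) x * u n x))\<^sup>2"
  obtains r v where "strict_mono (r::nat\<Rightarrow>nat)" "v \<in> S" "F v = m" "(\<lambda>k. X_norm (\<lambda>x. u (r k) x - v x)) \<longlonglongrightarrow> 0"
proof -
  have X: "u n \<in> X_space" and n: "(nrm (u n))\<^sup>2 = c" for n by (rule S_X[OF u], rule S_nrm[OF u])
  have n4: "(nrm (u n)) ^ 4 = c\<^sup>2" for n using n[of n] by (metis power_mult numeral_Bit0 mult_2 power_add power2_eq_square)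
  have ns: "nrm (u n) = sqrt c" for n using n[of n] by (metis nrm2_nonneg real_sqrt_abs abs_of_nonneg)
  obtain D where D: "\<And>u. u \<in> S \<Longrightarrow> \<gamma> / 4 * V_far u \<le> F u + D" using V_far_le_F by blast
  obtain B1 where B1: "\<And>n. \<bar>F (u n)\<bar> \<le> B1"
    using convergent_imp_Bseq[OF convergentI[OF Fm]] by (auto simp: Bseq_def)
  define B where "B = 4 / \<gamma> * (B1 + D)"
  have V1B: "V_far (u n) \<le> B" for n
  proof -
    have "\<gamma> / 4 * V_far (u n) \<le> B1 + D" using D[OF u, of n] B1[of n] by linarith
    then show ?thesis unfolding B_def using \<gamma> by (simp add: field_simps)
  qed
  define W where "W = (B + ln (1 + R) * c\<^sup>2) * (4 / c)"
  have W: "(nrm (weighted (u n)))\<^sup>2 \<le> W" for n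
  proof -
    have "(nrm (weighted (u n)))\<^sup>2 * (c / 4) \<le> (nrm (weighted (u n)))\<^sup>2 * (nrm (\<lambda>x. indicator (cball 0 R) x * u n x))\<^sup>2"
      by (intro mult_left_mono R(2)) simp
    also have "\<dots> \<le> B + ln (1 + R) * c\<^sup>2" using weight_le_V_far[OF X R(1), of n] V1B[of n] by (simp add: n4)
    finally show ?thesis unfolding W_def using c by (simp add: field_simps)
  qed
  define M0 where "M0 = max (max M K) W"
  obtain r1 v where r1: "strict_mono (r1::nat\<Rightarrow>nat)" and vL: "v \<in> L2p" and c1: "(\<lambda>k. nrm (\<lambda>x. u (r1 k) x - v x)) \<longlonglongrightarrow> 0"
  proof (rule X_compact_embedding[of u M0])
    show "u n \<in> X_space" for n by (rule X)
    show "nrm (u n) \<le> M0" for n using S_bounds(2)[OF u, of n] by (simp add: M0_def)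
    show "A_fun (u n) \<le> M0" for n using S_A[OF u[of n]] by (simp add: M0_def)
    show "(LINT x|lborel. ln (1 + norm x) * (u n x)\<^sup>2) \<le> M0" for n using W[of n] by (simp add: nrm_weighted_sq M0_def)
  qed
  obtain r2 where r2: "strict_mono (r2::nat\<Rightarrow>nat)" and ae2: "AE x in lborel. (\<lambda>k. u (r1 (r2 k)) x) \<longlonglongrightarrow> v x"
    by (rule L2_AE_subseq[OF _ vL c1]) (rule X_L2[OF X])
  define f where "f = (\<lambda>k. (A_fun (u (r1 (r2 k))), V_far (u (r1 (r2 k)))))"
  have "bounded (range f)"
  proof -
    have "range f \<subseteq> {0..K} \<times> {0..B}" using S_A[OF u] V1B V_far_nonneg by (auto simp: f_def)
    then show ?thesis using bounded_Times[OF bounded_closed_interval bounded_closed_interval] bounded_subset by blast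
  qed
  from bounded_imp_convergent_subsequence[OF this] obtain l r3 where r3: "strict_mono (r3::nat\<Rightarrow>nat)" and l: "(f \<circ> r3) \<longlonglongrightarrow> l" by blast
  define r where "r = (\<lambda>k. r1 (r2 (r3 k)))"
  have r: "strict_mono r" using r1 r2 r3 by (simp add: r_def strict_mono_def)
  define w where "w = (\<lambda>k. u (r k))"
  have wS: "w k \<in> S" for k unfolding w_def by (rule u)
  have wX: "w k \<in> X_space" for k by (simp add: w_def X)
  have r23: "strict_mono (\<lambda>k. r2 (r3 k))" using r2 r3 by (simp add: strict_mono_def)
  have wc: "(\<lambda>k. nrm (\<lambda>x. w k x - v x)) \<longlonglongrightarrow> 0"
    using LIMSEQ_subseq_LIMSEQ[OF c1 r23] by (simp add: comp_def w_def r_def)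
  have ae: "AE x in lborel. (\<lambda>k. w k x) \<longlonglongrightarrow> v x"
    using ae2
  proof eventually_elim
    case (elim x)
    from LIMSEQ_subseq_LIMSEQ[OF this r3] show ?case by (simp add: comp_def w_def r_def)
  qed
  obtain \<alpha> \<beta> where ab: "l = (\<alpha>, \<beta>)" by (cases l)
  have lA: "(\<lambda>k. A_fun (w k)) \<longlonglongrightarrow> \<alpha>" and lV: "(\<lambda>k. V_far (w k)) \<longlonglongrightarrow> \<beta>"
    using tendsto_fst[OF l] tendsto_snd[OF l] by (simp_all add: ab comp_def f_def w_def r_def)
  have lF: "(\<lambda>k. F (w k)) \<longlonglongrightarrow> m" using LIMSEQ_subseq_LIMSEQ[OF Fm r] by (simp add: comp_def w_def)
  have vH: "v \<in> H1" and vK: "A_fun v \<le> K"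
    by (rule A_fun_lsc[OF X_H1[OF wX] vL wc S_A[OF wS]])+
  have vwt: "weighted v \<in> L2p"
  proof (rule L2_Fatou(1)[where f = "\<lambda>k. weighted (w k)" and B = "sqrt W"])
    show "weighted (w k) \<in> L2p" for k by (rule X_weighted[OF wX])
    have "v \<in> borel_measurable borel" using L2_meas[OF vL] by simp
    then show "weighted v \<in> borel_measurable lborel" unfolding weighted_def by measurable
    show "AE x in lborel. (\<lambda>k. weighted (w k) x) \<longlonglongrightarrow> weighted v x"
      using ae by eventually_elim (unfold weighted_def, intro tendsto_intros)
    show "\<forall>\<^sub>F k in sequentially. nrm (weighted (w k)) \<le> sqrt W"
      using W by (intro always_eventually allI real_le_rsqrt) (simp add: w_def)
    show "0 \<le> sqrt W" using order_trans[OF zero_le_power2 W[of 0]] by simp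
  qed
  have vX: "v \<in> X_space" using vH vwt by (simp add: X_space_iff)
  have nlim: "(\<lambda>k. nrm (w k)) \<longlonglongrightarrow> nrm v" by (rule L2_tendsto_nrm2[OF X_L2[OF wX] vL wc])
  have "(\<lambda>k. sqrt c) \<longlonglongrightarrow> nrm v" using nlim by (simp add: w_def ns)
  then have nv: "nrm v = sqrt c" by (simp add: LIMSEQ_const_iff)
  then have vS: "v \<in> S" using vX vK c by (intro S_I) auto
  have lC: "(\<lambda>k. C_fun p (w k)) \<longlonglongrightarrow> C_fun p v"
  proof -
    have p2: "p > 2" using p by simp
  obtain B where B': "\<forall>u\<in>H1. \<forall>v\<in>H1. A_fun u \<le> M\<^sup>2 \<and> nrm u \<le> M \<and> A_fun v \<le> M\<^sup>2 \<and> nrm v \<le> M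
    \<longrightarrow> \<bar>C_fun p u - C_fun p v\<bar> \<le> B * nrm (\<lambda>x. u x - v x)"
    using C_fun_diff_le[OF p2] by (rule exE)
  note B = B'[rule_format, OF _ _ conjI[OF _ conjI[OF _ conjI]]]
    show ?thesis
    proof (rule LIM_zero_cancel, rule Lim_null_comparison[OF always_eventually[OF allI]])
      show "(\<lambda>k. B * nrm (\<lambda>x. w k x - v x)) \<longlonglongrightarrow> 0" using tendsto_mult[OF tendsto_const wc, of B] by simp
      show "norm (C_fun p (w k) - C_fun p v) \<le> B * nrm (\<lambda>x. w k x - v x)" for k
        using B[OF X_H1[OF wX] vH S_bounds[OF wS] S_bounds[OF vS], of k] by simp
    qed
  qed
  have lV2: "(\<lambda>k. V_near (w k)) \<longlonglongrightarrow> V_near v"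
  proof (rule LIM_zero_cancel, rule Lim_null_comparison[OF always_eventually[OF allI]])
    show "(\<lambda>k. 4 * near_const * M ^ 3 * nrm (\<lambda>x. w k x - v x)) \<longlonglongrightarrow> 0" using tendsto_mult[OF tendsto_const wc, of "4 * near_const * M ^ 3"] by simp
    show "norm (V_near (w k) - V_near v) \<le> 4 * near_const * M ^ 3 * nrm (\<lambda>x. w k x - v x)" for k
      using V_near_diff_le[OF wX vX _ S_bounds[OF wS] S_bounds[OF vS], of k] M_pos by simp
  qed
  have Fw: "F (w k) = 1/2 * A_fun (w k) + \<gamma>/4 * (V_far (w k) - V_near (w k)) - a/p * C_fun p (w k)" for k
    by (simp add: F_fun_def V_fun_split[OF wX])
  have Fv: "F v = 1/2 * A_fun v + \<gamma>/4 * (V_far v - V_near v) - a/p * C_fun p v"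
    by (simp add: F_fun_def V_fun_split[OF vX])
  have "(\<lambda>k. F (w k)) \<longlonglongrightarrow> 1/2 * \<alpha> + \<gamma>/4 * (\<beta> - V_near v) - a/p * C_fun p v"
    unfolding Fw by (intro tendsto_intros lA lV lV2 lC)
  then have meq: "m = 1/2 * \<alpha> + \<gamma>/4 * (\<beta> - V_near v) - a/p * C_fun p v" by (rule LIMSEQ_unique[OF lF])
  have A\<alpha>: "A_fun v \<le> \<alpha>"
  proof (rule field_le_epsilon)
    fix e :: real assume e: "e > 0"
    have "\<forall>\<^sub>F k in sequentially. A_fun (w k) < \<alpha> + e" by (rule order_tendstoD(2)[OF lA]) (use e in simp)
    then obtain N where N: "\<And>k. k \<ge> N \<Longrightarrow> A_fun (w k) < \<alpha> + e" by (auto simp: eventually_sequentially)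
    show "A_fun v \<le> \<alpha> + e"
    proof (rule A_fun_lsc(2)[where f = "\<lambda>k. w (k + N)"])
      show "w (k + N) \<in> H1" for k by (rule X_H1[OF wX])
      show "(\<lambda>k. nrm (\<lambda>x. w (k + N) x - v x)) \<longlonglongrightarrow> 0" using LIMSEQ_ignore_initial_segment[OF wc, of N] .
      show "A_fun (w (k + N)) \<le> \<alpha> + e" for k using N[of "k + N"] by simp
    qed (rule vL)
  qed
  have V\<beta>: "V_far v \<le> \<beta>"
  proof -
    have "(LINT p|Pm. log_far (fst p - snd p) * ((v (fst p))\<^sup>2 * (v (snd p))\<^sup>2)) \<le> \<beta>"
    proof (rule nonneg_Fatou[where f = "\<lambda>k p. log_far (fst p - snd p) * ((w k (fst p))\<^sup>2 * (w k (snd p))\<^sup>2)"])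
      show "integrable Pm (\<lambda>p. log_far (fst p - snd p) * ((w k (fst p))\<^sup>2 * (w k (snd p))\<^sup>2))" for k by (rule V_far_integrable[OF wX wX])
      show i: "integrable Pm (\<lambda>p. log_far (fst p - snd p) * ((v (fst p))\<^sup>2 * (v (snd p))\<^sup>2))" by (rule V_far_integrable[OF vX vX])
      show "(\<lambda>p. log_far (fst p - snd p) * ((v (fst p))\<^sup>2 * (v (snd p))\<^sup>2)) \<in> borel_measurable Pm" by (rule borel_measurable_integrable[OF i])
      show "(\<lambda>k. LINT p|Pm. log_far (fst p - snd p) * ((w k (fst p))\<^sup>2 * (w k (snd p))\<^sup>2)) \<longlonglongrightarrow> \<beta>" using lV by (simp add: V_far_def)
      show "AE p in Pm. (\<lambda>k. log_far (fst p - snd p) * ((w k (fst p))\<^sup>2 * (w k (snd p))\<^sup>2)) \<longlonglongrightarrow> log_far (fst p - snd p) * ((v (fst p))\<^sup>2 * (v (snd p))\<^sup>2)"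
        using AE_Pm[OF ae] by eventually_elim (intro tendsto_intros, auto)
    qed auto
    then show ?thesis by (simp add: V_far_def)
  qed
  have "m \<le> F v" by (rule m_le[OF vS])
  then have le: "1/2 * \<alpha> + \<gamma>/4 * \<beta> \<le> 1/2 * A_fun v + \<gamma>/4 * V_far v" unfolding meq Fv by (simp add: right_diff_distrib)
  have g1: "\<gamma>/4 * V_far v \<le> \<gamma>/4 * \<beta>" using V\<beta> \<gamma> by (intro mult_left_mono) auto
  have A_eq: "A_fun v = \<alpha>" using le g1 A\<alpha> by linarith
  have "\<gamma>/4 * V_far v = \<gamma>/4 * \<beta>" using le g1 A_eq by linarith
  then have V_eq: "V_far v = \<beta>" using \<gamma> by simp
  have Fvm: "F v = m" unfolding meq Fv A_eq V_eq ..
  have sA: "(\<lambda>k. A_fun (\<lambda>x. w k x - v x)) \<longlonglongrightarrow> 0"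
    by (rule A_fun_strong_convergence[OF X_H1[OF wX] vH wc]) (simp add: A_eq lA)
  have sW: "(\<lambda>k. nrm (weighted (\<lambda>x. w k x - v x))) \<longlonglongrightarrow> 0"
  proof (rule weighted_convergence[OF wX vX ae _ nlim R(1)])
    show "(\<lambda>k. V_far (w k)) \<longlonglongrightarrow> V_far v" using lV by (simp add: V_eq)
    show "c / 4 > 0" using c by simp
    show "c / 4 \<le> (nrm (\<lambda>x. indicator (cball 0 R) x * w k x))\<^sup>2" for k unfolding w_def by (rule R(2))
  qed
  have "(\<lambda>k. A_fun (\<lambda>x. w k x - v x) + (nrm (\<lambda>x. w k x - v x))\<^sup>2 + (nrm (weighted (\<lambda>x. w k x - v x)))\<^sup>2) \<longlonglongrightarrow> 0 + 0\<^sup>2 + 0\<^sup>2"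
    by (intro tendsto_add tendsto_power sA wc sW)
  then have "(\<lambda>k. (X_norm (\<lambda>x. w k x - v x))\<^sup>2) \<longlonglongrightarrow> 0" by (simp add: X_norm_sq[OF X_diff[OF wX vX]])
  from tendsto_real_sqrt[OF this] have "(\<lambda>k. X_norm (\<lambda>x. w k x - v x)) \<longlonglongrightarrow> 0"
    using X_norm_nonneg[OF X_diff[OF wX vX]] by (simp add: abs_of_nonneg)
  then show ?thesis using that[OF r vS Fvm] by (simp add: w_def)
qed

lemma minimizing_sequence_compact:
  assumes u: "\<And>n. u n \<in> S" and Fm: "(\<lambda>n. F (u n)) \<longlonglongrightarrow> m"
  obtains y r v where "strict_mono (r::nat\<Rightarrow>nat)" "v \<in> S" "F v = m"
    "(\<lambda>k. X_norm (\<lambda>x. u (r k) (x + y (r k)) - v x)) \<longlonglongrightarrow> 0"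
proof -
  have X: "u n \<in> X_space" and n: "(nrm (u n))\<^sup>2 = c" and AK: "A_fun (u n) \<le> K" for n
    by (rule S_X[OF u], rule S_nrm[OF u], rule S_A[OF u])
  obtain D where D: "\<And>u. u \<in> S \<Longrightarrow> \<gamma> / 4 * V_far u \<le> F u + D" using V_far_le_F by blast
  obtain B1 where B1: "\<And>n. \<bar>F (u n)\<bar> \<le> B1"
    using convergent_imp_Bseq[OF convergentI[OF Fm]] by (auto simp: Bseq_def)
  define B where "B = 4 / \<gamma> * (B1 + D)"
  have V1B: "V_far (u n) \<le> B" for n
  proof -
    have "\<gamma> / 4 * V_far (u n) \<le> B1 + D" using D[OF u, of n] B1[of n] by linarith
    then show ?thesis unfolding B_def using \<gamma> by (simp add: field_simps)
  qed
  \<comment> \<open>chosen so that \<open>V_far \<le> B\<close> meets the hypothesis of \<open>mass_concentration\<close>\<close>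
  define R where "R = exp (2 * B / c\<^sup>2)"
  have R: "R > 0" by (simp add: R_def)
  have lR: "B \<le> ln (1 + R) * (c\<^sup>2 / 2)"
  proof -
    have "2 * B / c\<^sup>2 = ln R" by (simp add: R_def)
    also have "\<dots> \<le> ln (1 + R)" using R by (intro ln_mono) auto
    finally show ?thesis using c by (simp add: field_simps)
  qed
  have "\<exists>y. c / 4 \<le> (nrm (\<lambda>x. indicator (cball 0 R) x * u n (x + y)))\<^sup>2" for n
    using mass_concentration[OF X n c R order_trans[OF V1B lR], of n] by blast
  then have "\<forall>n. \<exists>y. c / 4 \<le> (nrm (\<lambda>x. indicator (cball 0 R) x * u n (x + y)))\<^sup>2" by blast
  from choice[OF this] obtain y where y: "\<And>n. c / 4 \<le> (nrm (\<lambda>x. indicator (cball 0 R) x * u n (x + y n)))\<^sup>2" by blast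
  define w where "w = (\<lambda>n x. u n (x + y n))"
  have wS: "w n \<in> S" for n unfolding w_def using translate_facts(1,2,3)[OF X[of n], of "y n"] n AK by (intro S_I) auto
  have Fw: "F (w n) = F (u n)" for n unfolding w_def F_fun_def using translate_facts(3,4,5)[OF X[of n], where b = "y n"] by simp
  show ?thesis
  proof (rule compactness_core[of w R])
    show "(\<lambda>n. F (w n)) \<longlonglongrightarrow> m" unfolding Fw by (rule Fm)
    show "c / 4 \<le> (nrm (\<lambda>x. indicator (cball 0 R) x * w n x))\<^sup>2" for n unfolding w_def by (rule y)
    fix r v assume "strict_mono (r::nat\<Rightarrow>nat)" "v \<in> S" "F v = m" "(\<lambda>k. X_norm (\<lambda>x. w (r k) x - v x)) \<longlonglongrightarrow> 0"
    then show thesis using that[of r v y] by (simp add: w_def)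
  qed (use wS R in auto)
qed

lemma minimizer_exists: obtains v where "v \<in> S" "F v = m"
proof -
  have "\<exists>u. u \<in> S \<and> F u < m + inverse (real (Suc n))" for n
  proof -
    have "m < m + inverse (real (Suc n))" by simp
    then show ?thesis unfolding m_l_def using cINF_less_iff[OF S_nonempty F_bdd_below] by blast
  qed
  then have "\<forall>n. \<exists>u. u \<in> S \<and> F u < m + inverse (real (Suc n))" by blast
  from choice[OF this] obtain u where u: "\<And>n. u n \<in> S" "\<And>n. F (u n) < m + inverse (real (Suc n))" by blast
  have "(\<lambda>n. F (u n)) \<longlonglongrightarrow> m"
  proof (rule LIM_zero_cancel, rule Lim_null_comparison[OF always_eventually[OF allI] LIMSEQ_inverse_real_of_nat])
    show "norm (F (u n) - m) \<le> inverse (real (Suc n))" for n using u(2)[of n] m_le[OF u(1), of n] by (simp add: abs_le_iff)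
  qed
  from u(1) this show ?thesis by (rule minimizing_sequence_compact[of u]) (rule that)
qed

lemma arg_min_iff: "is_arg_min F (\<lambda>w. w \<in> S) u \<longleftrightarrow> u \<in> S \<and> F u = m"
proof
  assume am: "is_arg_min F (\<lambda>w. w \<in> S) u"
  obtain v where v: "v \<in> S" "F v = m" using minimizer_exists by blast
  show "u \<in> S \<and> F u = m" using am v m_le[of u] by (auto simp: is_arg_min_def not_less intro: antisym)
next
  assume "u \<in> S \<and> F u = m"
  then show "is_arg_min F (\<lambda>w. w \<in> S) u" using m_le by (auto simp: is_arg_min_def not_less)
qed

lemma minimizer_interior: assumes "u \<in> S" "F u = m" shows "A_fun u < K"
proof (rule ccontr)
  assume "\<not> ?thesis"
  then have "A_fun u = K" using S_A[OF assms(1)] by simp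
  from boundary_not_minimal[OF assms(1) this] show False using m_le assms(2) by force
qed

lemma inverse_sqrt_bound: assumes "y \<ge> 0" shows "1 - 1 / sqrt (1 + y) \<le> (y :: real)"
proof -
  have s: "1 \<le> sqrt (1 + y)" using assms by simp
  have "sqrt (1 + y) \<le> sqrt (1 + y) * sqrt (1 + y)" using s mult_left_mono[OF s, of "sqrt (1 + y)"] by simp
  also have "\<dots> = 1 + y" using assms by simp
  finally have "1 / (1 + y) \<le> 1 / sqrt (1 + y)" using s assms by (intro divide_left_mono) auto
  moreover have "1 - 1 / (1 + y) \<le> y"
  proof -
    have "1 - 1 / (1 + y) = y / (1 + y)" using assms by (simp add: field_simps)
    also have "\<dots> \<le> y / 1" using assms by (intro divide_left_mono) auto
    finally show ?thesis by simp
  qed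
  ultimately show ?thesis by linarith
qed

text \<open>
  The competitors are \<open>s t * (u + t \<psi>)\<close>. The factor \<open>s t = 1 / sqrt (1 + q t\<^sup>2)\<close> restores the mass and
  differs from \<open>1\<close> only by \<open>q t\<^sup>2\<close>, because \<open>\<psi>\<close> is orthogonal to \<open>u\<close>. Since the energy of \<open>u\<close> is strictly
  below the bound, the competitors are admissible for small \<open>t\<close> of either sign.
\<close>

lemma first_variation_bound:
  assumes u: "u \<in> S" and Fu: "F u = m" and L: "quadratic_derivative F L u"
    and \<psi>: "\<psi> \<in> X_space" and o: "(LINT x|lborel. u x * \<psi> x) = 0"
  obtains E \<delta> where "\<delta> > 0" "\<And>t. \<bar>t\<bar> < \<delta> \<Longrightarrow> - E * t\<^sup>2 \<le> t * L \<psi>"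
proof -
  note X = S_X[OF u]
  have n: "(nrm u)\<^sup>2 = c" by (rule S_nrm[OF u])
  obtain C where C: "\<And>h. h \<in> X_space \<Longrightarrow> X_norm h \<le> 1 \<Longrightarrow> \<bar>F (\<lambda>x. u x + h x) - F u - L h\<bar> \<le> C * (X_norm h)\<^sup>2"
    using L unfolding quadratic_derivative_def by blast
  have Ladd: "L (\<lambda>x. f x + g x) = L f + L g" and Lmul: "L (\<lambda>x. r * f x) = r * L f" if "f \<in> X_space" "g \<in> X_space" for f g r
    using L that unfolding quadratic_derivative_def by blast+
  define q where "q = (nrm \<psi>)\<^sup>2 / c"
  have q: "q \<ge> 0" using c by (simp add: q_def)
  define s where "s = (\<lambda>t. 1 / sqrt (1 + q * t\<^sup>2))"
  have s01: "0 < s t" "s t \<le> 1" "1 - s t \<le> q * t\<^sup>2" for t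
    using q inverse_sqrt_bound[of "q * t\<^sup>2"] by (auto simp: s_def add_pos_nonneg divide_le_eq)
  define B where "B = 2 * (q * X_norm u + X_norm \<psi>)"
  have B0: "B \<ge> 0" using q X_norm_nonneg[OF X] X_norm_nonneg[OF \<psi>] by (simp add: B_def)
  have Xt: "(\<lambda>x. u x + t * \<psi> x) \<in> X_space" for t by (rule X_add[OF X X_cmult[OF \<psi>]])
  have nt: "(nrm (\<lambda>x. u x + t * \<psi> x))\<^sup>2 = c * (1 + q * t\<^sup>2)" for t
  proof -
    have i: "integrable lborel (\<lambda>x. u x * \<psi> x)" by (rule L2_mult_integrable[OF X_L2[OF X] X_L2[OF \<psi>]])
    have "(nrm (\<lambda>x. u x + t * \<psi> x))\<^sup>2 = (LINT x|lborel. (u x)\<^sup>2 + (2 * t * (u x * \<psi> x) + t\<^sup>2 * (\<psi> x)\<^sup>2))"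
      unfolding nrm2_sq by (rule Bochner_Integration.integral_cong) (auto simp: power2_eq_square algebra_simps)
    also have "\<dots> = (nrm u)\<^sup>2 + (2 * t * (LINT x|lborel. u x * \<psi> x) + t\<^sup>2 * (nrm \<psi>)\<^sup>2)"
      unfolding nrm2_sq using i L2_int[OF X_L2[OF X]] L2_int[OF X_L2[OF \<psi>]] by simp
    also have "\<dots> = c + t\<^sup>2 * (nrm \<psi>)\<^sup>2" by (simp only: n o)
    finally show ?thesis using c by (simp add: q_def field_simps)
  qed
  have sA: "sqrt (A_fun u) < sqrt K" using minimizer_interior[OF u Fu] by simp
  \<comment> \<open>for \<open>|t| < \<delta>1\<close> the triangle inequality keeps the energy of \<open>u + t \<psi>\<close> below the bound\<close>
  define \<delta>1 where "\<delta>1 = (sqrt K - sqrt (A_fun u)) / (sqrt (A_fun \<psi>) + 1)"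
  have \<delta>1: "\<delta>1 > 0" unfolding \<delta>1_def using sA by (intro divide_pos_pos) (auto simp: add_nonneg_pos)
  have wS: "(\<lambda>x. s t * (u x + t * \<psi> x)) \<in> S" if t: "\<bar>t\<bar> < \<delta>1" for t
    unfolding S_iff
  proof (intro conjI)
    show "(\<lambda>x. s t * (u x + t * \<psi> x)) \<in> X_space" by (rule X_cmult[OF Xt])
    have "(s t)\<^sup>2 * (1 + q * t\<^sup>2) = 1" using q by (simp add: s_def power_divide add_nonneg_eq_0_iff)
    then show "(nrm (\<lambda>x. s t * (u x + t * \<psi> x)))\<^sup>2 = c"
      unfolding nrm2_cmult power_mult_distrib nt by (simp add: mult.left_commute)
    have "sqrt (A_fun (\<lambda>x. u x + t * \<psi> x)) \<le> sqrt (A_fun u) + sqrt (A_fun (\<lambda>x. t * \<psi> x))"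
      by (rule sqrt_A_fun_triangle[OF X_H1[OF X] X_H1[OF X_cmult[OF \<psi>]]])
    also have "sqrt (A_fun (\<lambda>x. t * \<psi> x)) = \<bar>t\<bar> * sqrt (A_fun \<psi>)" unfolding A_fun_cmult[OF X_H1[OF \<psi>]] by (simp add: real_sqrt_mult)
    also have "\<dots> \<le> \<bar>t\<bar> * (sqrt (A_fun \<psi>) + 1)" by (intro mult_left_mono) auto
    also have "\<dots> \<le> \<delta>1 * (sqrt (A_fun \<psi>) + 1)" using t by (intro mult_right_mono) auto
    also have "\<dots> = sqrt K - sqrt (A_fun u)"
    proof -
      have "sqrt (A_fun \<psi>) + 1 \<noteq> 0" using real_sqrt_ge_zero[OF A_fun_nonneg[of \<psi>]] by linarith
      then show ?thesis by (simp add: \<delta>1_def)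
    qed
    finally have "A_fun (\<lambda>x. u x + t * \<psi> x) \<le> K" by simp
    moreover have "(s t)\<^sup>2 * A_fun (\<lambda>x. u x + t * \<psi> x) \<le> 1 * A_fun (\<lambda>x. u x + t * \<psi> x)"
      using s01[of t] by (intro mult_right_mono power_le_one) auto
    ultimately show "A_fun (\<lambda>x. s t * (u x + t * \<psi> x)) \<le> K" unfolding A_fun_cmult[OF X_H1[OF Xt]] by simp
  qed
  \<comment> \<open>the last term makes the increment \<open>h\<close> of norm at most \<open>1\<close>, as the remainder estimate requires\<close>
  define \<delta> where "\<delta> = min (min \<delta>1 1) (1 / (B + 1))"
  show ?thesis
  proof (rule that[of \<delta> "q * \<bar>L u\<bar> + \<bar>C\<bar> * B\<^sup>2 + q * \<bar>L \<psi>\<bar>"])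
    show "\<delta> > 0" using \<delta>1 B0 by (simp add: \<delta>_def)
    fix t :: real assume t: "\<bar>t\<bar> < \<delta>"
    have t1: "\<bar>t\<bar> < \<delta>1" "\<bar>t\<bar> \<le> 1" "\<bar>t\<bar> * (B + 1) \<le> 1"
      using t B0 by (auto simp: \<delta>_def pos_less_divide_eq less_imp_le)
    have t2: "t\<^sup>2 \<le> \<bar>t\<bar>" using t1(2) by (metis abs_ge_zero mult_left_le power2_abs power2_eq_square)
    define h where "h = (\<lambda>x. (s t - 1) * u x + (s t * t) * \<psi> x)"
    have hX: "h \<in> X_space" unfolding h_def by (rule X_add[OF X_cmult[OF X] X_cmult[OF \<psi>]])
    have "X_norm h \<le> 2 * (\<bar>s t - 1\<bar> * X_norm u + \<bar>s t * t\<bar> * X_norm \<psi>)"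
      unfolding h_def using X_norm_add[OF X_cmult[OF X] X_cmult[OF \<psi>]] by (simp only: X_norm_cmult[OF X] X_norm_cmult[OF \<psi>])
    also have "\<dots> \<le> 2 * ((q * \<bar>t\<bar>) * X_norm u + \<bar>t\<bar> * X_norm \<psi>)"
    proof (intro mult_left_mono add_mono mult_right_mono X_norm_nonneg X \<psi>)
      have "q * t\<^sup>2 \<le> q * \<bar>t\<bar>" using t2 q by (rule mult_left_mono)
      then show "\<bar>s t - 1\<bar> \<le> q * \<bar>t\<bar>" using s01(2,3)[of t] by linarith
      show "\<bar>s t * t\<bar> \<le> \<bar>t\<bar>" using s01[of t] by (simp add: abs_mult mult_left_le_one_le)
    qed simp
    also have "\<dots> = \<bar>t\<bar> * B" by (simp add: B_def algebra_simps)
    finally have hB: "X_norm h \<le> \<bar>t\<bar> * B" .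
    have "\<bar>t\<bar> * B \<le> \<bar>t\<bar> * (B + 1)" by (intro mult_left_mono) auto
    then have h1: "X_norm h \<le> 1" using hB t1(3) by linarith
    have "(\<lambda>x. u x + h x) = (\<lambda>x. s t * (u x + t * \<psi> x))" by (simp add: h_def fun_eq_iff algebra_simps)
    then have "F u \<le> F (\<lambda>x. u x + h x)" using m_le[OF wS[OF t1(1)]] Fu by simp
    then have "0 \<le> L h + C * (X_norm h)\<^sup>2" using C[OF hX h1] by linarith
    also have "L h = (s t - 1) * L u + (s t * t) * L \<psi>"
      unfolding h_def by (simp only: Ladd[OF X_cmult[OF X] X_cmult[OF \<psi>]] Lmul[OF X X] Lmul[OF \<psi> \<psi>])
    also have "C * (X_norm h)\<^sup>2 \<le> \<bar>C\<bar> * (\<bar>t\<bar> * B)\<^sup>2"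
      using hB X_norm_nonneg[OF hX] by (intro mult_mono power_mono) auto
    finally have 1: "0 \<le> (s t - 1) * L u + (s t * t) * L \<psi> + \<bar>C\<bar> * B\<^sup>2 * t\<^sup>2" by (simp add: power_mult_distrib mult_ac)
    have 2: "(s t - 1) * L u \<le> q * \<bar>L u\<bar> * t\<^sup>2"
    proof -
      have "(s t - 1) * L u \<le> \<bar>s t - 1\<bar> * \<bar>L u\<bar>" by (metis abs_ge_self abs_mult)
      also have "\<dots> \<le> (q * t\<^sup>2) * \<bar>L u\<bar>" using s01(2,3)[of t] by (intro mult_right_mono) auto
      finally show ?thesis by (simp add: mult_ac)
    qed
    have 3: "(s t - 1) * (t * L \<psi>) \<le> q * \<bar>L \<psi>\<bar> * t\<^sup>2"
    proof -
      have "(s t - 1) * (t * L \<psi>) \<le> \<bar>s t - 1\<bar> * (\<bar>t\<bar> * \<bar>L \<psi>\<bar>)" by (metis abs_ge_self abs_mult)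
      also have "\<dots> \<le> (q * t\<^sup>2) * (1 * \<bar>L \<psi>\<bar>)" using s01(2,3)[of t] t1(2) q by (intro mult_mono) auto
      finally show ?thesis by (simp add: mult_ac)
    qed
    have "(s t * t) * L \<psi> = t * L \<psi> + (s t - 1) * (t * L \<psi>)" by (simp add: algebra_simps)
    with 1 2 3 have "0 \<le> q * \<bar>L u\<bar> * t\<^sup>2 + (t * L \<psi> + q * \<bar>L \<psi>\<bar> * t\<^sup>2) + \<bar>C\<bar> * B\<^sup>2 * t\<^sup>2" by linarith
    then show "- (q * \<bar>L u\<bar> + \<bar>C\<bar> * B\<^sup>2 + q * \<bar>L \<psi>\<bar>) * t\<^sup>2 \<le> t * L \<psi>" by (simp add: algebra_simps)
  qed
qed

lemma minimizer_critical:
  assumes u: "u \<in> S" and Fu: "F u = m"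
  shows "critical_point_on_sphere F c u"
proof -
  note X = S_X[OF u]
  have p3: "p > 3" using p by simp
  obtain L where L: "quadratic_derivative F L u" using F_fun_differentiable[OF X p3] by blast
  have "L \<psi> = 0" if \<psi>: "\<psi> \<in> X_space" and o: "(LINT x|lborel. u x * \<psi> x) = 0" for \<psi>
  proof -
    obtain E \<delta> where E: "\<delta> > 0" "\<And>t. \<bar>t\<bar> < \<delta> \<Longrightarrow> - E * t\<^sup>2 \<le> t * L \<psi>"
      using first_variation_bound[OF u Fu L \<psi> o] by blast
    have b: "\<bar>L \<psi>\<bar> \<le> E * t" if t: "0 < t" "t < \<delta>" for t
    proof -
      have "t * (- (E * t)) \<le> t * L \<psi>" using E(2)[of t] t by (simp add: power2_eq_square mult_ac)
      then have "- (E * t) \<le> L \<psi>" using t(1) by (rule mult_left_le_imp_le)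
      moreover have "t * L \<psi> \<le> t * (E * t)" using E(2)[of "-t"] t by (simp add: power2_eq_square mult_ac)
      then have "L \<psi> \<le> E * t" using t(1) by (rule mult_left_le_imp_le)
      ultimately show ?thesis by linarith
    qed
    have "\<bar>L \<psi>\<bar> \<le> 0"
    proof (rule field_le_epsilon)
      fix e :: real assume e: "e > 0"
      define t where "t = min (\<delta> / 2) (e / (\<bar>E\<bar> + 1))"
      have t: "0 < t" "t < \<delta>" "t \<le> e / (\<bar>E\<bar> + 1)" using E(1) e by (auto simp: t_def)
      have "E * t \<le> (\<bar>E\<bar> + 1) * t" using t(1) by (intro mult_right_mono) auto
      also have "\<dots> \<le> e" using t(3) by (simp add: pos_le_divide_eq mult.commute)
      finally show "\<bar>L \<psi>\<bar> \<le> 0 + e" using b[OF t(1,2)] by simp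
    qed
    then show ?thesis by simp
  qed
  then show ?thesis
    unfolding critical_point_on_sphere_def using quadratic_derivative_imp_has_X_derivative[OF L] u by auto
qed

end

theorem theorem3p6:
  fixes \<gamma> a p c :: real
  assumes "\<gamma> > 0" and "a > 0" and "p > 4"
    and "0 < c" and "c < c0 \<gamma> a p"
  shows
    "(\<forall>u :: nat \<Rightarrow> plane \<Rightarrow> real.
        (\<forall>n. u n \<in> mass_sphere c \<inter> A_sublevel (k0 \<gamma> p c)) \<longrightarrow>
        (\<lambda>n. F_fun \<gamma> a p (u n)) \<longlonglongrightarrow> m_l \<gamma> a p c \<longrightarrow>
        (\<exists>(x :: nat \<Rightarrow> plane) (r :: nat \<Rightarrow> nat). strict_mono r \<and>
           (\<exists>v\<in>X_space. (\<lambda>k. X_norm (\<lambda>z. u (r k) (z - x (r k)) - v z)) \<longlonglongrightarrow> 0)))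
     \<and> (\<exists>u. is_arg_min (F_fun \<gamma> a p) (\<lambda>w. w \<in> mass_sphere c \<inter> A_sublevel (k0 \<gamma> p c)) u
            \<and> F_fun \<gamma> a p u = m_l \<gamma> a p c)
     \<and> (\<forall>u. is_arg_min (F_fun \<gamma> a p) (\<lambda>w. w \<in> mass_sphere c \<inter> A_sublevel (k0 \<gamma> p c)) u \<longrightarrow>
            critical_point_on_sphere (F_fun \<gamma> a p) c u)"
proof -
  interpret small_mass \<gamma> a p c by unfold_locales fact+
  show ?thesis
  proof (intro conjI allI impI)
    fix u :: "nat \<Rightarrow> plane \<Rightarrow> real"
    assume u: "\<forall>n. u n \<in> S" and Fm: "(\<lambda>n. F (u n)) \<longlonglongrightarrow> m"
    obtain y r v where *: "strict_mono (r::nat\<Rightarrow>nat)" "v \<in> S" "F v = m"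
      "(\<lambda>k. X_norm (\<lambda>x. u (r k) (x + y (r k)) - v x)) \<longlonglongrightarrow> 0"
      by (rule minimizing_sequence_compact[of u, OF u[rule_format] Fm])
    show "\<exists>(x :: nat \<Rightarrow> plane) (r :: nat \<Rightarrow> nat). strict_mono r \<and>
           (\<exists>v\<in>X_space. (\<lambda>k. X_norm (\<lambda>z. u (r k) (z - x (r k)) - v z)) \<longlonglongrightarrow> 0)"
      using * S_X by (intro exI[of _ "\<lambda>n. - y n"] exI[of _ r] conjI bexI[of _ v]) auto
  next
    obtain v where "v \<in> S" "F v = m" using minimizer_exists by blast
    then show "\<exists>u. is_arg_min F (\<lambda>w. w \<in> S) u \<and> F u = m" using arg_min_iff by blast
  next
    fix u assume "is_arg_min F (\<lambda>w. w \<in> S) u"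
    then show "critical_point_on_sphere F c u" using arg_min_iff minimizer_critical by blast
  qed
qed

end
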